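(* Let $\lambda\in\{1,-1\}$, let $u_0\in H^2(\mathbb{R}^N)$, and let $u$ be the corresponding global solution of $$i\partial_t u+\Delta^2u+\lambda|x|^{-b}|u|^\alpha u=0,\quad t\in\mathbb{R},\ x\in\mathbb{R}^N,\qquad u(0,x)=u_0(x).$$ Suppose $\sup_{t\in\mathbb{R}}\|u(t)\|_{H^2_x}\leq\eta$ for some $\eta>0$, and that one of the following holds: (a) $N\geq3$, $0<b<\min\{\frac N2,4\}$, $\frac{8-2b}{N}<\alpha<4^*$ (with $\frac{8-2b}{N}<\alpha<7-2b$ instead if $N=5$), and $\|u\|_{B(\dot H^{s_c})}<+\infty$; (b) $N=5$, $0<b\leq\frac32$, $\frac{8-2b}{5}<\alpha<8-2b$, and $\|u\|_{L^{a^*}_tL^{r^*}_x}<+\infty$, where $$a^*=\frac{8\alpha(\alpha+1-\theta)}{8-2b-\alpha(N-4)+2\varepsilon\alpha},\qquad r^*=\frac{2\alpha N(\alpha+1-\theta)}{\alpha(N+4-2b)-2\theta(4-b)-2\varepsilon\alpha},$$ with $\theta>0$ and $\varepsilon>0$ sufficiently small numbers. Then $u$ scatters in $H^2(\mathbb{R}^N)$ as $t\to\pm\infty$.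
   Context: $4^*:=\frac{8-2b}{N-4}$ if $N\geq5$ and $4^*:=+\infty$ if $1\leq N\leq4$. $s_c:=\frac N2-\frac{4-b}{\alpha}$. $e^{it\Delta^2}$ denotes the propagator of the linear equation $i\partial_tu+\Delta^2u=0$. Solutions are understood in the integral (Duhamel) sense: $u(t)=e^{it\Delta^2}u_0+i\lambda\int_0^te^{i(t-t')\Delta^2}|x|^{-b}|u(t')|^\alpha u(t')\,dt'$, for all $t\in\mathbb{R}$. "$u$ scatters in $H^2$ as $t\to\pm\infty$" means that there exist $\phi^\pm\in H^2(\mathbb{R}^N)$ with $\lim_{t\to\pm\infty}\|u(t)-e^{it\Delta^2}\phi^\pm\|_{H^2}=0$. For $s<2$, a pair $(q,r)$ is called $\dot H^s$-biharmonic admissible if $\frac4q=\frac N2-\frac Nr-s$ with $\frac{2N}{N-2s}\leq r<\frac{2N}{N-4}$ if $N\geq5$, and $2\leq r<+\infty$ if $1\leq N\leq4$ ($q=\infty$ allowed, $1/\infty=0$). Let $\mathcal B_s$ be the set of such pairs. $\|u\|_{B(\dot H^s)}=\sup_{(q,r)\in\mathcal B_s}\|u\|_{L^q_tL^r_x}$, where $\|u\|_{L^q_tL^r_x}=\big\|\|u(t,\cdot)\|_{L^r_x(\mathbb{R}^N)}\big\|_{L^q_t(\mathbb{R})}$. *)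

theory Defs
  imports "HOL-Analysis.Analysis" "HOL-Probability.Essential_Supremum"
begin

section \<open>Lebesgue norms with values in $[0,\infty]$\<close>

definition ennreal_powr :: "ennreal \<Rightarrow> real \<Rightarrow> ennreal" where
  "ennreal_powr x p = (if x = \<infinity> then \<infinity> else ennreal (enn2real x powr p))"

text \<open>Meant for exponents \<open>0 < p \<le> \<infinity>\<close> and \<open>ennreal_powr\<close> for positive powers.\<close>

definition eLp_norm :: "ereal \<Rightarrow> 'a::euclidean_space measure \<Rightarrow> ('a \<Rightarrow> ennreal) \<Rightarrow> ennreal" where
  "eLp_norm p M g =
     (if p = \<infinity> then esssup M g
      else ennreal_powr (\<integral>\<^sup>+ x. ennreal_powr (g x) (real_of_ereal p) \<partial>M) (1 / real_of_ereal p))"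

definition Lp_norm :: "ereal \<Rightarrow> ('a::euclidean_space \<Rightarrow> complex) \<Rightarrow> ennreal" where
  "Lp_norm p f = eLp_norm p lborel (\<lambda>x. ennreal (norm (f x)))"

definition mixed_norm :: "ereal \<Rightarrow> ereal \<Rightarrow> (real \<Rightarrow> 'a::euclidean_space \<Rightarrow> complex) \<Rightarrow> ennreal" where
  "mixed_norm q r u = eLp_norm q lborel (\<lambda>t. Lp_norm r (u t))"

definition L2 :: "('a::euclidean_space \<Rightarrow> complex) set" where
  "L2 = {f. f \<in> borel_measurable lborel \<and> Lp_norm 2 f < \<infinity>}"


section \<open>Fourier transform on $L^2$, the space $H^2$ and the propagator\<close>

definition fourier_cutoff :: "real \<Rightarrow> ('a::euclidean_space \<Rightarrow> complex) \<Rightarrow> 'a \<Rightarrow> complex" where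
  "fourier_cutoff R f \<xi> =
     complex_of_real ((2 * pi) powr (- real DIM('a) / 2)) *
     (LINT x:cball 0 R|lborel. cis (- (\<xi> \<bullet> x)) * f x)"

text \<open>
  The unitary Fourier transform on $L^2$ as given by Plancherel's theorem: the $L^2$ limit of the
  Fourier integrals over balls.  The limit is unique only almost everywhere; \<open>fourier_L2\<close> picks a
  representative.
\<close>

definition has_fourier_L2 :: "('a::euclidean_space \<Rightarrow> complex) \<Rightarrow> ('a \<Rightarrow> complex) \<Rightarrow> bool" where
  "has_fourier_L2 f g \<longleftrightarrow> f \<in> L2 \<and> g \<in> L2 \<and>
     ((\<lambda>R. Lp_norm 2 (\<lambda>\<xi>. g \<xi> - fourier_cutoff R f \<xi>)) \<longlongrightarrow> 0) at_top"

definition fourier_L2 :: "('a::euclidean_space \<Rightarrow> complex) \<Rightarrow> 'a \<Rightarrow> complex" where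
  "fourier_L2 f = (SOME g. has_fourier_L2 f g)"

definition H2_norm :: "('a::euclidean_space \<Rightarrow> complex) \<Rightarrow> ennreal" where
  "H2_norm f = Lp_norm 2 (\<lambda>\<xi>. complex_of_real (1 + (norm \<xi>)\<^sup>2) * fourier_L2 f \<xi>)"

definition H2 :: "('a::euclidean_space \<Rightarrow> complex) set" where
  "H2 = {f \<in> L2. H2_norm f < \<infinity>}"

text \<open>
  $\Delta^2$ has Fourier symbol $|\xi|^4$, so $i\partial_t u + \Delta^2 u = 0$ is solved by the
  multiplier $e^{it|\xi|^4}$.  The inverse transform is the reflected Fourier transform.
\<close>

definition propagator :: "real \<Rightarrow> ('a::euclidean_space \<Rightarrow> complex) \<Rightarrow> 'a \<Rightarrow> complex" where
  "propagator t f x = fourier_L2 (\<lambda>\<xi>. cis (t * norm \<xi> ^ 4) * fourier_L2 f \<xi>) (- x)"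


section \<open>Solutions\<close>

definition inls_nonlinearity ::
    "real \<Rightarrow> real \<Rightarrow> ('a::euclidean_space \<Rightarrow> complex) \<Rightarrow> 'a \<Rightarrow> complex" where
  "inls_nonlinearity b \<alpha> f x = complex_of_real (norm x powr (- b) * norm (f x) powr \<alpha>) * f x"

text \<open>
  For $u(t) \in H^2$ the nonlinearity $|x|^{-b}|u|^\alpha u$ need not be in $L^2$; it lies in
  $H^{-2} = (H^2)'$, and Duhamel's formula is an identity in $H^{-2}$.  A function is regarded as a
  functional on $H^2$ through the bilinear pairing $\int f \varphi$.  Because the symbol
  $e^{it|\xi|^4}$ is even, the propagator is symmetric for this pairing, so its extension to
  functionals is by transposition with the same sign of $t$.
\<close>

definition pairing :: "('a::euclidean_space \<Rightarrow> complex) \<Rightarrow> ('a \<Rightarrow> complex) \<Rightarrow> complex" where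
  "pairing f = (\<lambda>\<phi>. LINT x|lborel. f x * \<phi> x)"

definition dual_propagator ::
    "real \<Rightarrow> (('a::euclidean_space \<Rightarrow> complex) \<Rightarrow> complex) \<Rightarrow> ('a \<Rightarrow> complex) \<Rightarrow> complex" where
  "dual_propagator t T = (\<lambda>\<phi>. T (propagator t \<phi>))"

text \<open>
  Global $H^2$ solutions: $u \in C(\mathbb R; H^2)$ satisfying
  $u(t) = e^{it\Delta^2}u_0 + i\lambda\int_0^t e^{i(t-t')\Delta^2}|x|^{-b}|u(t')|^\alpha u(t')\,dt'$
  for all $t$, the integral being taken in $H^{-2}$.  The interval integral is oriented, so
  $t < 0$ is covered.
\<close>

definition global_H2_solution ::
    "real \<Rightarrow> real \<Rightarrow> real \<Rightarrow> ('a::euclidean_space \<Rightarrow> complex) \<Rightarrow> (real \<Rightarrow> 'a \<Rightarrow> complex) \<Rightarrow> bool" where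
  "global_H2_solution lam b \<alpha> u0 u \<longleftrightarrow>
     (\<forall>t. u t \<in> H2) \<and>
     (\<forall>t0. ((\<lambda>t. H2_norm (\<lambda>x. u t x - u t0 x)) \<longlongrightarrow> 0) (at t0)) \<and>
     (\<forall>t. \<forall>\<phi>\<in>H2. integrable lborel (\<lambda>x. inls_nonlinearity b \<alpha> (u t) x * \<phi> x)) \<and>
     (\<forall>t. \<forall>\<phi>\<in>H2.
        interval_lebesgue_integrable lborel (ereal 0) (ereal t)
          (\<lambda>t'. dual_propagator (t - t') (pairing (inls_nonlinearity b \<alpha> (u t'))) \<phi>) \<and>
        pairing (u t) \<phi> =
          pairing (propagator t u0) \<phi> +
          \<i> * complex_of_real lam *
            (LBINT t'=ereal 0..ereal t.
               dual_propagator (t - t') (pairing (inls_nonlinearity b \<alpha> (u t'))) \<phi>))"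

definition scatters_H2 :: "(real \<Rightarrow> 'a::euclidean_space \<Rightarrow> complex) \<Rightarrow> bool" where
  "scatters_H2 u \<longleftrightarrow>
     (\<exists>\<phi>p\<in>H2. ((\<lambda>t. H2_norm (\<lambda>x. u t x - propagator t \<phi>p x)) \<longlongrightarrow> 0) at_top) \<and>
     (\<exists>\<phi>m\<in>H2. ((\<lambda>t. H2_norm (\<lambda>x. u t x - propagator t \<phi>m x)) \<longlongrightarrow> 0) at_bot)"


section \<open>Admissible pairs and exponents\<close>

text \<open>In \<open>ereal\<close>, \<open>4 / \<infinity> = 0\<close>, so \<open>q = \<infinity>\<close> is covered by the scaling relation.\<close>

definition biharmonic_admissible :: "nat \<Rightarrow> real \<Rightarrow> (ereal \<times> real) set" where
  "biharmonic_admissible N s =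
     {(q, r). 0 < q \<and> 4 / q = ereal (real N / 2 - real N / r - s) \<and>
        (if N \<ge> 5
         then 2 * real N / (real N - 2 * s) \<le> r \<and> r < 2 * real N / (real N - 4)
         else 2 \<le> r)}"

definition B_norm :: "real \<Rightarrow> (real \<Rightarrow> 'a::euclidean_space \<Rightarrow> complex) \<Rightarrow> ennreal" where
  "B_norm s u = (SUP (q, r)\<in>biharmonic_admissible DIM('a) s. mixed_norm q (ereal r) u)"

definition four_star :: "nat \<Rightarrow> real \<Rightarrow> ereal" where
  "four_star N b = (if N \<ge> 5 then ereal ((8 - 2 * b) / (real N - 4)) else \<infinity>)"

definition s_crit :: "nat \<Rightarrow> real \<Rightarrow> real \<Rightarrow> real" where
  "s_crit N b \<alpha> = real N / 2 - (4 - b) / \<alpha>"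

definition a_star :: "nat \<Rightarrow> real \<Rightarrow> real \<Rightarrow> real \<Rightarrow> real \<Rightarrow> real" where
  "a_star N b \<alpha> \<theta> \<epsilon> =
     8 * \<alpha> * (\<alpha> + 1 - \<theta>) / (8 - 2 * b - \<alpha> * (real N - 4) + 2 * \<epsilon> * \<alpha>)"

definition r_star :: "nat \<Rightarrow> real \<Rightarrow> real \<Rightarrow> real \<Rightarrow> real \<Rightarrow> real" where
  "r_star N b \<alpha> \<theta> \<epsilon> =
     2 * \<alpha> * real N * (\<alpha> + 1 - \<theta>) /
     (\<alpha> * (real N + 4 - 2 * b) - 2 * \<theta> * (4 - b) - 2 * \<epsilon> * \<alpha>)"

end

(*
  Write v(t) = exp(-it Delta^2) u(t) and V = |x|^-b |u|^alpha, so that the equation reads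
  i v' = -lam exp(-it Delta^2) (V u), and scattering means that v is Cauchy in H^2.

  The kernel of exp(it Delta^2) decays like |t|^(-N/4).  Cutting space into the dyadic pieces
  {|x| ~ 2^-k, |u| ~ 2^l} and summing gives, for the operator V(t)^(1/2) exp(i(t-s) Delta^2) V(s)^(1/2),
  a norm bound kappa(|t-s|) A(s)^(1/2) A(t)^(1/2), where A is a power of the L^r norm of u(t);
  at the exponent of scale s_c the finite mixed norm makes the time integral of kappa(|t-s|) A(s)
  over s >= T small as T grows.  With the Schur test and a TT* argument (applied to a near-extremizer
  of the quadratic form, which avoids vector-valued integrals) this yields the smoothing estimate
  ||V^(1/2) exp(it Delta^2) f|| <= eps ||f|| in L^2 of {t >= T} x R^N, and by duality
  ||w(t2) - w(t1)|| <= eps ||w(t1)|| for the profile w of u and for the profile of each difference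
  u(. + h) - u, since the nonlinearity is pointwise Lipschitz with constant of the size of V;
  eps does not depend on h.

  Two derivatives are recovered from these L^2 bounds for differences through the identity
  int_0^infinity |exp(ih rho) - 1|^2 h^-2 dh = c rho with rho = |xi|^4.
*)
theory Submission
  imports Defs "HOL-Complex_Analysis.Complex_Analysis" "HOL-Probability.Characteristic_Functions" "HOL-Real_Asymp.Real_Asymp"
begin

text \<open>The obstacle is the weight |x|^-b: a spatial derivative makes it more singular.
  Increments in time leave it unchanged, and because the flow has symbol |xi|^4, half a derivative
  in time is worth two in space; hence the flow is estimated in L^2 only. Half a derivative requires
  the profile to be Hoelder continuous in time with an exponent above 1/2, which follows from the
  equation and the H^2 bound.

  At the scaling of s_c the kernel is a borderline case for the time integral, both at t = s and at
  infinity. The H^2 bound supplies weak Lebesgue norms on both sides of the exponent r0, at 2 and at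
  some R > r0. Shifting a little from r0 to R gives integrability near t = s, shifting a little to 2
  gives it for large |t - s|; the second shift is a gain because s_c > 0.\<close>

abbreviation nn_int :: "('a::euclidean_space => ennreal) => ennreal" (binder "NN " 10) where
 "nn_int f \<equiv> nn_integral lborel f"

abbreviation limseq :: "(nat => 'a::topological_space) => 'a => bool" (infixr "---->" 60) where
 "X ----> L \<equiv> (X \<longlongrightarrow> L) sequentially"

abbreviation borelm :: "('a::topological_space => 'b::topological_space) set" where
 "borelm \<equiv> borel_measurable borel"

abbreviation intg :: "('a::euclidean_space => 'b::{banach, second_countable_topology}) => bool" where
 "intg f \<equiv> integrable lborel f"

abbreviation FT :: "('a::euclidean_space => complex) => 'a => complex" where
 "FT \<equiv> fourier_L2"

section \<open>Square-integrable functions\<close>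

definition nrm :: "('a::euclidean_space => complex) => real" where
 "nrm f = sqrt (LBINT x. (cmod (f x))^2)"

definition ip :: "('a::euclidean_space => complex) => ('a => complex) => complex" where
 "ip f g = (LBINT x. f x*cnj (g x))"

lemma Lp_norm_2_eq:
 fixes f :: "'a::euclidean_space => complex"
 shows "Lp_norm 2 f = ennreal_powr (NN x. ennreal ((cmod (f x))^2)) (1/2)"
proof -
 have "real_of_ereal 2 = 2" by simp
 moreover have "(2::ereal) \<noteq> \<infinity>" by simp
 moreover have "ennreal_powr (ennreal (cmod z)) 2 = ennreal ((cmod z)^2)" for z
  by (auto simp: ennreal_powr_def)
 ultimately show ?thesis by (simp add: Lp_norm_def eLp_norm_def)
qed

lemma L2_iff: "f \<in> L2 \<longleftrightarrow> f \<in> borel_measurable lborel \<and> intg (\<lambda>x. (cmod (f x))^2)"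
proof -
 have "Lp_norm 2 f < \<infinity> \<longleftrightarrow> (NN x. ennreal ((cmod (f x))^2)) < \<infinity>"
  unfolding Lp_norm_2_eq ennreal_powr_def infinity_ennreal_def by (cases "(NN x. ennreal ((cmod (f x))^2)) = top") (simp_all add: top.not_eq_extremum)
 then show ?thesis
  by (auto simp: L2_def integrable_iff_bounded)
qed

lemma borel_measurable_cnj' [measurable (raw)]:
 "f \<in> borel_measurable M ==> (\<lambda>x. cnj (f x)) \<in> borel_measurable M"
 by (rule borel_measurable_continuous_on[OF continuous_on_cnj[OF continuous_on_id]])

lemma L2_measurable [measurable_dest]: "f \<in> L2 ==> f \<in> borelm"
 by (simp add: L2_iff)

lemma L2_integrable: "f \<in> L2 ==> intg (\<lambda>x. (cmod (f x))^2)"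
 by (simp add: L2_iff)

lemma nrm_nonneg [simp]: "0 <= nrm f"
 by (simp add: nrm_def)

lemma nrm_sq: "(nrm f)^2 = (LBINT x. (cmod (f x))^2)"
 by (simp add: nrm_def)

lemma nn_integral_nrm: "f \<in> L2 ==> (NN x. ennreal ((cmod (f x))^2)) = ennreal ((nrm f)^2)"
 by (simp add: nrm_sq nn_integral_eq_integral L2_integrable)

lemma Lp_norm_2: "f \<in> L2 ==> Lp_norm 2 f = ennreal (nrm f)"
 unfolding Lp_norm_2_eq by (simp add: nn_integral_nrm ennreal_powr_def powr_half_sqrt)

lemma L2I_nn:
 assumes "f \<in> borelm" "(NN x. ennreal ((cmod (f x))^2)) <= ennreal (c^2)" "0 <= c"
 shows "f \<in> L2" "nrm f <= c"
proof -
 show L: "f \<in> L2"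
  unfolding L2_iff integrable_iff_bounded using assms(1) le_less_trans[OF assms(2), of top] by (simp add: ennreal_less_top)
 show "nrm f <= c"
  using assms nn_integral_nrm[OF L] by (auto intro: power2_le_imp_le)
qed

lemma L2_dominated:
 assumes "g \<in> L2" "f \<in> borelm" "AE x in lborel. cmod (f x) <= cmod (g x)"
 shows "f \<in> L2" "nrm f <= nrm g"
proof -
 have *: "(NN x. ennreal ((cmod (f x))^2)) <= ennreal ((nrm g)^2)"
  unfolding nn_integral_nrm[OF assms(1), symmetric]
  by (rule nn_integral_mono_AE) (use assms(3) in "auto elim!: eventually_mono intro: power_mono")
 show "f \<in> L2" "nrm f <= nrm g" using L2I_nn[OF assms(2) *] by auto
qed

lemma nrm_cong_AE:
 assumes "AE x in lborel. f x = g x" "f \<in> borelm" "g \<in> borelm"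
 shows "nrm f = nrm g"
 unfolding nrm_def by (intro arg_cong[where f=sqrt] integral_cong_AE) (use assms in "auto elim!: eventually_mono")

lemma ip_cong_AE:
 assumes "AE x in lborel. f x = f' x" "AE x in lborel. g x = g' x"
  "f \<in> borelm" "g \<in> borelm" "f' \<in> borelm" "g' \<in> borelm"
 shows "ip f g = ip f' g'"
proof -
 note [measurable] = assms(3-6)
 show ?thesis unfolding ip_def by (rule integral_cong_AE) (use assms(1,2) in "auto")
qed

lemma L2_mult_integrable:
 assumes "f \<in> L2" "g \<in> L2"
 shows "intg (\<lambda>x. f x*g x)"
proof (rule Bochner_Integration.integrable_bound)
 show "intg (\<lambda>x. (cmod (f x))^2 + (cmod (g x))^2)"
  using assms by (simp add: L2_integrable)
 show "(\<lambda>x. f x*g x) \<in> borel_measurable lborel" using assms by measurable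
 have "norm (f x*g x) <= norm ((cmod (f x))^2 + (cmod (g x))^2)" for x
 proof -
  have "0 <= cmod (f x)*cmod (g x)" by simp
  then have "cmod (f x)*cmod (g x) <= (cmod (f x))^2 + (cmod (g x))^2"
   using sum_squares_bound[of "cmod (f x)" "cmod (g x)"] by linarith
  then show ?thesis by (simp add: norm_mult)
 qed
 then show "AE x in lborel. norm (f x*g x) <= norm ((cmod (f x))^2 + (cmod (g x))^2)" by simp
qed

lemma L2_cnj: 
 assumes [measurable]: "f \<in> L2" shows "(\<lambda>x. cnj (f x)) \<in> L2"
 using assms unfolding L2_iff by simp

lemma nrm_cnj [simp]: "nrm (\<lambda>x. cnj (f x)) = nrm f"
 by (simp add: nrm_def)

lemma L2_add: 
 assumes [measurable]: "f \<in> L2" "g \<in> L2" shows "(\<lambda>x. f x + g x) \<in> L2"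
 unfolding L2_iff
proof
 show "intg (\<lambda>x. (cmod (f x + g x))^2)"
 proof (rule Bochner_Integration.integrable_bound)
  show "intg (\<lambda>x. 2*(cmod (f x))^2 + 2*(cmod (g x))^2)"
   using assms by (simp add: L2_integrable)
  have "(cmod (f x + g x))^2 <= 2*(cmod (f x))^2 + 2*(cmod (g x))^2" for x
  proof -
   have "(cmod (f x + g x))^2 <= (cmod (f x) + cmod (g x))^2"
    by (intro power_mono norm_triangle_ineq) auto
   also have "... <= 2*(cmod (f x))^2 + 2*(cmod (g x))^2"
    using sum_squares_bound[of "cmod (f x)" "cmod (g x)"] by (simp add: power2_sum)
   finally show ?thesis .
  qed
  then show "AE x in lborel. norm ((cmod (f x + g x))^2) <= norm (2*(cmod (f x))^2 + 2*(cmod (g x))^2)" by auto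
 qed measurable
qed measurable

lemma L2_cmult: 
 assumes [measurable]: "f \<in> L2" shows "(\<lambda>x. c*f x) \<in> L2"
 using assms unfolding L2_iff by (simp add: norm_mult power_mult_distrib)

lemma nrm_cmult: "nrm (\<lambda>x. c*f x) = cmod c*nrm f"
 by (simp add: nrm_def norm_mult power_mult_distrib real_sqrt_mult)

lemma L2_minus: "f \<in> L2 ==> (\<lambda>x. - f x) \<in> L2"
 by (simp add: L2_iff)

lemma L2_diff: "f \<in> L2 ==> g \<in> L2 ==> (\<lambda>x. f x - g x) \<in> L2"
 using L2_add[OF _ L2_minus, of f g] by simp

lemma L2_zero [simp]: "(\<lambda>x. 0) \<in> L2" by (simp add: L2_iff)

lemma nrm_zero [simp]: "nrm (\<lambda>x. 0) = 0" by (simp add: nrm_def)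

lemma nrm_eq_0: "f \<in> L2 ==> nrm f = 0 \<longleftrightarrow> (AE x in lborel. f x = 0)"
 using integral_nonneg_eq_0_iff_AE[of lborel "\<lambda>x. (cmod (f x))^2"] by (simp add: nrm_def L2_integrable)

lemma L2_CS:
 assumes "f \<in> L2" "g \<in> L2"
 shows "(LBINT x. cmod (f x*g x)) <= nrm f*nrm g"
proof -
 have i: "intg (\<lambda>x. cmod (f x*g x))"
  by (intro integrable_norm L2_mult_integrable assms)
 have "(NN x. ennreal (cmod (f x))*ennreal (cmod (g x)))^2 \<le>
  (NN x. (ennreal (cmod (f x)))^2)*(NN x. (ennreal (cmod (g x)))^2)"
  by (rule Cauchy_Schwarz_nn_integral) (use assms in "auto dest!: L2_measurable")
 also have "... = ennreal ((nrm f*nrm g)^2)"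
  using nn_integral_nrm[OF assms(1)] nn_integral_nrm[OF assms(2)] by (simp add: ennreal_power ennreal_mult power_mult_distrib)
 also have "(NN x. ennreal (cmod (f x))*ennreal (cmod (g x))) = ennreal (LBINT x. cmod (f x*g x))"
  by (subst nn_integral_eq_integral[OF i, symmetric]) (auto simp: norm_mult ennreal_mult)
 finally have "(LBINT x. cmod (f x*g x))^2 <= (nrm f*nrm g)^2"
  by (simp add: ennreal_power)
 then show ?thesis by (rule power2_le_imp_le) simp
qed

lemma ip_CS: 
 assumes "f \<in> L2" "g \<in> L2" shows "cmod (ip f g) <= nrm f*nrm g"
proof -
 have "cmod (ip f g) <= (LBINT x. cmod (f x*cnj (g x)))"
  unfolding ip_def by (rule integral_norm_bound)
 also have "... <= nrm f*nrm g" using L2_CS[OF assms(1) L2_cnj[OF assms(2)]] by simp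
 finally show ?thesis .
qed

lemma ip_integrable: "f \<in> L2 ==> g \<in> L2 ==> intg (\<lambda>x. f x*cnj (g x))"
 by (intro L2_mult_integrable L2_cnj)

lemma ip_self: "ip f f = complex_of_real ((nrm f)^2)"
 unfolding ip_def nrm_sq by (simp add: complex_norm_square[symmetric] flip: integral_complex_of_real)

lemma ip_cnj: "ip g f = cnj (ip f g)"
 unfolding ip_def by (subst Bochner_Integration.integral_cnj[symmetric]) (simp add: mult.commute)

lemma ip_add_left: "f \<in> L2 ==> g \<in> L2 ==> h \<in> L2 ==> ip (\<lambda>x. f x + g x) h = ip f h + ip g h"
 unfolding ip_def by (simp add: ip_integrable distrib_right)

lemma ip_diff_left: "f \<in> L2 ==> g \<in> L2 ==> h \<in> L2 ==> ip (\<lambda>x. f x - g x) h = ip f h - ip g h"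
 unfolding ip_def by (simp add: ip_integrable left_diff_distrib)

lemma ip_cmult_left: "ip (\<lambda>x. c*f x) h = c*ip f h"
 unfolding ip_def by (simp add: mult.assoc)

lemma ip_add_right: "f \<in> L2 ==> g \<in> L2 ==> h \<in> L2 ==> ip h (\<lambda>x. f x + g x) = ip h f + ip h g"
 by (subst (1 2 3) ip_cnj) (simp add: ip_add_left)

lemma ip_diff_right: "f \<in> L2 ==> g \<in> L2 ==> h \<in> L2 ==> ip h (\<lambda>x. f x - g x) = ip h f - ip h g"
 by (subst (1 2 3) ip_cnj) (simp add: ip_diff_left)

lemma ip_cmult_right: "ip h (\<lambda>x. c*f x) = cnj c*ip h f"
 by (subst (1 2) ip_cnj) (simp add: ip_cmult_left)

lemma nrm_add_sq:
 assumes "f \<in> L2" "g \<in> L2"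
 shows "(nrm (\<lambda>x. f x + g x))^2 = (nrm f)^2 + (nrm g)^2 + 2*Re (ip f g)"
proof -
 have "complex_of_real ((nrm (\<lambda>x. f x + g x))^2) = ip (\<lambda>x. f x + g x) (\<lambda>x. f x + g x)"
  by (simp add: ip_self)
 also have "... = ip f f + ip g g + (ip f g + cnj (ip f g))"
  using assms ip_cnj[of g f] by (simp add: ip_add_left ip_add_right L2_add)
 also have "... = complex_of_real ((nrm f)^2 + (nrm g)^2 + 2*Re (ip f g))"
  by (simp add: ip_self complex_add_cnj)
 finally show ?thesis by (simp only: of_real_eq_iff)
qed

lemma nrm_triangle:
 assumes "f \<in> L2" "g \<in> L2" shows "nrm (\<lambda>x. f x + g x) <= nrm f + nrm g"
proof (rule power2_le_imp_le)
 have "Re (ip f g) <= nrm f*nrm g"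
  using ip_CS[OF assms] complex_Re_le_cmod[of "ip f g"] by linarith
 then show "(nrm (\<lambda>x. f x + g x))^2 <= (nrm f + nrm g)^2"
  by (simp add: nrm_add_sq[OF assms] power2_sum)
qed auto

lemma nrm_minus [simp]: "nrm (\<lambda>x. - f x) = nrm f" by (simp add: nrm_def)

lemma nrm_minus_commute: "nrm (\<lambda>x. f x - g x) = nrm (\<lambda>x. g x - f x)"
 by (simp add: nrm_def norm_minus_commute)

lemma nrm_diff_le:
 assumes "f \<in> L2" "g \<in> L2" shows "nrm (\<lambda>x. f x - g x) <= nrm f + nrm g"
 using nrm_triangle[OF assms(1) L2_minus[OF assms(2)]] by simp

lemma nrm_triangle_diff:
 assumes "f \<in> L2" "g \<in> L2" "h \<in> L2"
 shows "nrm (\<lambda>x. f x - h x) <= nrm (\<lambda>x. f x - g x) + nrm (\<lambda>x. g x - h x)"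
 using nrm_triangle[OF L2_diff[OF assms(1,2)] L2_diff[OF assms(2,3)]] by simp

lemma nrm_diff_ge:
 assumes "f \<in> L2" "g \<in> L2" shows "\<bar>nrm f - nrm g\<bar> <= nrm (\<lambda>x. f x - g x)"
 using nrm_triangle[OF L2_diff[OF assms] assms(2)] nrm_triangle[OF L2_diff[OF assms(2,1)] assms(1)]
 by (simp add: nrm_minus_commute[of g f])

lemma nrm_le_dual:
 assumes "f \<in> L2" "0 <= c" "cmod (ip f f) <= c*nrm f" shows "nrm f <= c"
proof (cases "nrm f = 0")
 case False
 then have "nrm f > 0" using nrm_nonneg[of f] by linarith
 moreover have "nrm f*nrm f <= c*nrm f" using assms(3) by (simp add: ip_self power2_eq_square norm_mult)
 ultimately show ?thesis by simp
qed (use assms in auto)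

lemma AE_zero_if_ip:
 assumes "f \<in> L2" "ip f f = 0" shows "AE x in lborel. f x = 0"
 using assms nrm_eq_0[of f] by (simp add: ip_self)

section \<open>Dominated convergence, Fatou's lemma and completeness in L^2\<close>

lemma L2_dct:
 fixes g :: "'a::euclidean_space => complex"
 assumes "\<And>n. f n \<in> borelm" "g \<in> L2" "h \<in> L2"
  "AE x in lborel. (\<lambda>n. f n x) ----> g x" "\<And>n. AE x in lborel. cmod (f n x) <= cmod (h x)"
 shows "(\<lambda>n. nrm (\<lambda>x. f n x - g x)) ----> 0"
proof -
 have m[measurable]: "g \<in> borelm" "h \<in> borelm" "\<And>n. f n \<in> borelm"
  using assms by (auto dest: L2_measurable)
 have 1: "(\<lambda>n. LBINT x. (cmod (f n x - g x))^2) ----> (LINT x|(lborel::'a measure). 0)"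
 proof (rule integral_dominated_convergence)
  show "intg (\<lambda>x. 2*(cmod (h x))^2 + 2*(cmod (g x))^2)"
   using assms by (simp add: L2_integrable)
  show "AE x in lborel. (\<lambda>n. (cmod (f n x - g x))^2) ----> 0"
   using assms(4)
  proof eventually_elim
   case (elim x)
   have "(\<lambda>n. (cmod (f n x - g x))^2) ----> (cmod (g x - g x))^2"
    by (intro tendsto_intros elim)
   then show ?case by simp
  qed
  show "AE x in lborel. norm ((cmod (f n x - g x))^2) <= 2*(cmod (h x))^2 + 2*(cmod (g x))^2" for n
   using assms(5)[of n]
  proof eventually_elim
   case (elim x)
   have "(cmod (f n x - g x))^2 <= (cmod (h x) + cmod (g x))^2"
    by (intro power_mono order_trans[OF norm_triangle_ineq4] add_right_mono elim) auto
   also have "... <= 2*(cmod (h x))^2 + 2*(cmod (g x))^2"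
    using sum_squares_bound[of "cmod (h x)" "cmod (g x)"] by (simp add: power2_sum)
   finally show ?case by simp
  qed
 qed auto
 have "(\<lambda>n. sqrt (LBINT x. (cmod (f n x - g x))^2)) ----> sqrt 0"
  using 1 by (intro tendsto_real_sqrt) simp
 then show ?thesis by (simp add: nrm_def)
qed

lemma L2_AE_subseq:
 assumes "\<And>n. f n \<in> L2" "g \<in> L2" "(\<lambda>n. nrm (\<lambda>x. f n x - g x)) ----> 0"
 shows "\<exists>r::nat=>nat. strict_mono r \<and> (AE x in lborel. (\<lambda>n. f (r n) x) ----> g x)"
proof -
 have "(\<lambda>n. (nrm (\<lambda>x. f n x - g x))^2) ----> 0^2" by (intro tendsto_intros assms(3))
 then have "(\<lambda>n. LBINT x. norm ((cmod (f n x - g x))^2)) ----> 0" by (simp add: nrm_sq)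
 then obtain r :: "nat=>nat" where r: "strict_mono r" "AE x in lborel. (\<lambda>n. (cmod (f (r n) x - g x))^2) ----> 0"
  using tendsto_L1_AE_subseq[of lborel "\<lambda>n x. (cmod (f n x - g x))^2"] assms(1,2) 
  by (auto simp: L2_integrable L2_diff)
 from r(2) have "AE x in lborel. (\<lambda>n. f (r n) x) ----> g x"
 proof eventually_elim
  case (elim x)
  have "(\<lambda>n. sqrt ((cmod (f (r n) x - g x))^2)) ----> sqrt 0"
   using elim by (intro tendsto_real_sqrt)
  then have "(\<lambda>n. cmod (f (r n) x - g x)) ----> 0" by simp
  then show ?case by (metis LIM_zero_cancel tendsto_norm_zero_cancel)
 qed
 with r(1) show ?thesis by auto
qed

lemma L2_fatou:
 assumes "\<And>n. f n \<in> L2" "\<And>n. nrm (f n) <= c" "AE x in lborel. (\<lambda>n. f n x) ----> g x" "g \<in> borelm" "0 <= c"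
 shows "g \<in> L2" "nrm g <= c"
proof -
 have [measurable]: "\<And>n. f n \<in> borelm" "g \<in> borelm"
  using assms by (auto dest: L2_measurable)
 have "(NN x. ennreal ((cmod (g x))^2)) = (NN x. liminf (\<lambda>n. ennreal ((cmod (f n x))^2)))"
 proof (rule nn_integral_cong_AE, use assms(3) in eventually_elim)
  case (elim x)
  have "(\<lambda>n. ennreal ((cmod (f n x))^2)) ----> ennreal ((cmod (g x))^2)"
   by (intro tendsto_intros elim)
  from lim_imp_Liminf[OF _ this] show ?case by simp
 qed
 also have "... <= liminf (\<lambda>n. NN x. ennreal ((cmod (f n x))^2))"
  by (rule nn_integral_liminf) auto
 also have "... <= ennreal (c^2)"
 proof -
  have "liminf (\<lambda>n. NN x. ennreal ((cmod (f n x))^2)) <= liminf (\<lambda>n. ennreal (c^2))"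
   by (rule Liminf_mono, rule always_eventually) (use assms(1,2) in "auto simp: nn_integral_nrm intro!: power_mono")
  then show ?thesis by (simp add: Liminf_const)
 qed
 finally show "g \<in> L2" "nrm g <= c" using L2I_nn[of g c] assms by auto
qed

text \<open>Along a subsequence with increments d_k of norm below 2^-k, the sum of 2^k |d_k|^2 has
  integral at most the sum of the 2^-k. So almost everywhere |d_k| is bounded by a multiple of
  2^(-k/2), the telescoping series converges absolutely, and Fatou's lemma turns the pointwise limit
  into an L^2 limit.\<close>

lemma L2_complete:
 assumes f: "\<And>n. f n \<in> L2" and C: "\<And>e. e > 0 ==> \<exists>M. \<forall>m\<ge>M. \<forall>n\<ge>M. nrm (\<lambda>x. f m x - f n x) < e"
 shows "\<exists>g\<in>L2. (\<lambda>n. nrm (\<lambda>x. f n x - g x)) ----> 0"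
proof -
 have [measurable]: "\<And>n. f n \<in> borelm" using f by (auto dest: L2_measurable)
 have "\<exists>r::nat=>nat. \<forall>k. (\<forall>m\<ge>r k. \<forall>n\<ge>r k. nrm (\<lambda>x. f m x - f n x) < (1/2)^k) \<and> r k < r (Suc k)"
 proof (rule dependent_nat_choice, goal_cases)
  case 1 then show ?case using C[of "(1/2)^0"] by auto
 next
  case (2 s k)
  obtain M where M: "\<forall>m\<ge>M. \<forall>n\<ge>M. nrm (\<lambda>x. f m x - f n x) < (1/2)^Suc k" using C[of "(1/2)^Suc k"] by auto
  show ?case by (rule exI[of _ "max M (Suc s)"]) (use M in auto)
 qed
 then obtain r :: "nat=>nat" where r: "\<And>k m n. m \<ge> r k ==> n \<ge> r k ==> nrm (\<lambda>x. f m x - f n x) < (1/2)^k" "\<And>k. r k < r (Suc k)"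
  by auto
 have sm: "strict_mono r" using r(2) by (simp add: strict_mono_Suc_iff)
 define d where "d k x = f (r (Suc k)) x - f (r k) x" for k x
 have dL: "d k \<in> L2" for k unfolding d_def by (intro L2_diff f)
 have dn: "nrm (d k) <= (1/2)^k" for k
  unfolding d_def using r(1)[of k "r (Suc k)" "r k"] r(2)[of k] by auto
 have [measurable]: "\<And>k. d k \<in> borelm" using dL by (auto dest: L2_measurable)
 have "(NN x. (\<Sum>k. ennreal (2^k*(cmod (d k x))^2))) = (\<Sum>k. NN x. ennreal (2^k*(cmod (d k x))^2))"
  by (rule nn_integral_suminf) auto
 also have "... <= (\<Sum>k. ennreal ((1/2)^k))"
 proof (rule suminf_le, goal_cases)
  case (1 k)
  have "(NN x. ennreal (2^k*(cmod (d k x))^2)) = ennreal (2^k)*ennreal ((nrm (d k))^2)"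
   unfolding nn_integral_nrm[OF dL, symmetric]
   by (subst nn_integral_cmult[symmetric]) (simp_all add: ennreal_mult')
  also have "... = ennreal (2^k*(nrm (d k))^2)" by (rule ennreal_mult'[symmetric]) simp
  also have "... <= ennreal (2^k*((1/2)^k)^2)"
   by (intro ennreal_leI mult_left_mono power_mono dn) auto
  also have "... = ennreal ((1/2)^k)" by (simp add: power2_eq_square power_one_over)
  finally show ?case .
 qed auto
 also have "(\<Sum>k. ennreal ((1/2)^k)) = ennreal (\<Sum>k. (1/2)^k)"
  by (rule suminf_ennreal2) (auto intro: summable_geometric)
 also have "... < \<infinity>" by simp
 finally have "AE x in lborel. (\<Sum>k. ennreal (2^k*(cmod (d k x))^2)) \<noteq> \<infinity>"
  by (intro nn_integral_PInf_AE) auto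
 then have "AE x in lborel. convergent (\<lambda>k. f (r k) x)"
 proof eventually_elim
  case (elim x)
  then have s: "summable (\<lambda>k. 2^k*(cmod (d k x))^2)"
   by (intro summable_suminf_not_top) auto
  then obtain B where B: "\<And>k. norm (2^k*(cmod (d k x))^2) <= B"
   using summable_imp_bounded[OF s] by (auto simp: bounded_iff)
  have B0: "B \<ge> 0" using B[of 0] norm_ge_zero order_trans by blast
  have le: "norm (d k x) <= sqrt B*(sqrt (1/2))^k" for k
  proof -
   have "(cmod (d k x))^2 <= B*(1/2)^k" using B[of k] by (simp add: field_simps power_one_over)
   then have "cmod (d k x) <= sqrt (B*(1/2)^k)" by (simp add: real_le_rsqrt)
   then show ?thesis by (simp add: real_sqrt_mult real_sqrt_power)
  qed
  have "summable (\<lambda>k. sqrt B*(sqrt (1/2))^k)"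
   by (intro summable_mult summable_geometric) (auto simp: real_sqrt_divide)
  then have "summable (\<lambda>k. d k x)" by (rule summable_comparison_test') (use le in auto)
  then have "convergent (\<lambda>n. \<Sum>k<n. d k x)" by (simp add: summable_iff_convergent)
  moreover have "(\<Sum>k<n. d k x) = f (r n) x - f (r 0) x" for n
   unfolding d_def by (rule sum_lessThan_telescope)
  ultimately have "convergent (\<lambda>n. f (r n) x - f (r 0) x + f (r 0) x)"
   by (intro convergent_add) (auto simp: convergent_const)
  then show ?case by simp
 qed
 then have lim: "AE x in lborel. (\<lambda>k. f (r k) x) ----> lim (\<lambda>k. f (r k) x)"
  by eventually_elim (simp add: convergent_LIMSEQ_iff)
 define g where "g x = lim (\<lambda>k. f (r k) x)" for x
 have [measurable]: "g \<in> borelm" unfolding g_def by measurable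
 have key: "(\<lambda>x. f n x - g x) \<in> L2 \<and> nrm (\<lambda>x. f n x - g x) <= (1/2)^k" if "n \<ge> r k" for n k
 proof -
  have a: "nrm (\<lambda>x. f n x - f (r (j+k)) x) <= (1/2)^k" for j
   by (rule less_imp_le[OF r(1)[of k n "r (j+k)"]]) (use that strict_mono_leD[OF sm, of k "j+k"] in simp_all)
  have b: "AE x in lborel. (\<lambda>j. f n x - f (r (j+k)) x) ----> f n x - g x"
   using lim
  proof eventually_elim
   case (elim x)
   have "(\<lambda>j. f (r (j+k)) x) ----> g x"
    using LIMSEQ_ignore_initial_segment[OF elim, of k] by (simp only: g_def)
   then show ?case by (intro tendsto_diff tendsto_const)
  qed
  have c: "(\<lambda>x. f n x - f (r (j+k)) x) \<in> L2" for j by (rule L2_diff[OF f f])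
  have m: "(\<lambda>x. f n x - g x) \<in> borelm" by simp
  show ?thesis using L2_fatou[OF c a b m] by simp
 qed
 have "g \<in> L2" using L2_diff[OF f conjunct1[OF key[of 0 "r 0"]], of "r 0"] by simp
 moreover have "(\<lambda>n. nrm (\<lambda>x. f n x - g x)) ----> 0"
 proof (rule LIMSEQ_I)
  fix e :: real assume "e > 0"
  then obtain k where "(1/2)^k < e" using real_arch_pow_inv[of e "1/2"] by auto
  then show "\<exists>no. \<forall>n\<ge>no. norm (nrm (\<lambda>x. f n x - g x) - 0) < e"
   using key[where k=k] by (intro exI[of _ "r k"]) (auto intro: le_less_trans)
 qed
 ultimately show ?thesis by auto
qed

lemma L2_indicator: 
 assumes "f \<in> L2" "A \<in> sets borel"
 shows "(\<lambda>x. f x*indicator A x) \<in> L2" "nrm (\<lambda>x. f x*indicator A x) <= nrm f"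
 using assms by (auto intro!: L2_dominated[OF assms(1)] dest: L2_measurable simp: indicator_def)

lemma L2_bounded_mult:
 assumes "f \<in> L2" "m \<in> borelm" "\<And>x. cmod (m x) <= B" 
 shows "(\<lambda>x. m x*f x) \<in> L2" "nrm (\<lambda>x. m x*f x) <= B*nrm f"
proof -
 have B: "B \<ge> 0" using assms(3)[of 0] norm_ge_zero order_trans by blast
 have a: "cmod (m x*f x) <= cmod (complex_of_real B*f x)" for x
  using assms(3)[of x] B by (simp add: norm_mult mult_right_mono)
 have [measurable]: "f \<in> borelm" "m \<in> borelm" using assms by (auto dest: L2_measurable)
 have m: "(\<lambda>x. m x*f x) \<in> borelm" by measurable
 show "(\<lambda>x. m x*f x) \<in> L2" "nrm (\<lambda>x. m x*f x) <= B*nrm f"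
  using L2_dominated[OF L2_cmult[OF assms(1), of "complex_of_real B"] m] a B by (auto simp: nrm_cmult)
qed

section \<open>Gaussian integrals\<close>

abbreviation gk :: "complex => real => real => complex" where
 "gk p ro s \<equiv> exp (- p*(of_real s)^2 - \<i> * of_real ro * of_real s)"

abbreviation ge :: "complex => 'a::euclidean_space => 'a => complex" where
 "ge w x xi \<equiv> exp (- w * of_real ((norm x)^2) - \<i> * of_real (x \<bullet> xi))"

abbreviation cvf :: "('a::euclidean_space => complex) => ('a => complex) => 'a => complex" where
 "cvf m g x \<equiv> LBINT y. cnj (g y)*(LBINT xi. cis (- (xi \<bullet> (x - y)))*m xi)"

text \<open>The integral is the characteristic function of the standard normal law at
  \<open>t = - ro/c\<close>, after the substitution y = c s with
  \<open>c = sqrt (2*p)\<close>.\<close>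

lemma gaussian_fourier_real:
 fixes p ro :: real
 assumes p: "p > 0"
 shows "intg (\<lambda>s::real. gk (of_real p) ro s)"
  "(LBINT s. gk (of_real p) ro s) =
   of_real (sqrt (pi/p)*exp (- ro\<^sup>2/(4*p)))"
proof -
 define c where "c = sqrt (2*p)"
 have c: "c > 0" "c^2 = 2*p" using p by (auto simp: c_def)
 define t where "t = - ro/c"
 define g where "g y = of_real (std_normal_density y)*exp (\<i> * of_real t * of_real y)" for y :: real
 have 1: "char std_normal_distribution t = (LBINT y. g y)"
  unfolding char_def g_def
  by (subst integral_density) (auto simp: normal_density_nonneg scaleR_conv_of_real mult.assoc)
 have gint: "intg g"
 proof -
  have "intg (\<lambda>y. std_normal_density y)" using integrable_std_normal_moment[of 0] by simp
  then show ?thesis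
  proof (rule Bochner_Integration.integrable_bound)
   show "g \<in> borel_measurable lborel" unfolding g_def by measurable
  qed (auto simp: g_def norm_mult)
 qed
 have eq: "g (0 + c * s) = of_real (1/sqrt (2*pi))*gk (of_real p) ro s" for s
 proof -
  have "t*(c * s) = - ro * s" using c by (simp add: t_def)
  moreover have "(c * s)^2/2 = p * s^2" using c by (simp add: power_mult_distrib)
  ultimately have "g (0 + c * s) = of_real (1/sqrt (2*pi))*(of_real (exp (- (p * s^2)))*exp (\<i> * of_real (- ro * s)))"
   by (simp add: g_def normal_density_def mult.assoc flip: of_real_mult)
  also have "of_real (exp (- (p * s^2)))*exp (\<i> * of_real (- ro * s)) = gk (of_real p) ro s"
   by (simp add: exp_of_real[symmetric] exp_add[symmetric] algebra_simps minus_diff_commute)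
  finally show ?thesis .
 qed
 have "intg (\<lambda>s. g (0 + c * s))"
  using gint c by (subst lborel_integrable_real_affine_iff) auto
 then have i2: "intg (\<lambda>s. of_real (sqrt (2*pi))*g (0 + c * s))" by simp
 have eq2: "of_real (sqrt (2*pi))*g (0 + c * s) = gk (of_real p) ro s" for s
  unfolding eq by (simp add: mult.assoc[symmetric] flip: of_real_mult)
 show "intg (\<lambda>s::real. gk (of_real p) ro s)"
  using i2 unfolding eq2 .
 have "(LBINT y. g y) = \<bar>c\<bar> *\<^sub>R (LBINT s. g (0 + c * s))"
  by (rule lborel_integral_real_affine) (use c in auto)
 then have "(LBINT s. g (0 + c * s)) = char std_normal_distribution t/of_real c"
  using c by (simp add: 1 scaleR_conv_of_real)
 then have "(LBINT s. of_real (sqrt (2*pi))*g (0 + c * s)) = of_real (sqrt (2*pi))*(of_real (exp (- (t^2)/2))/of_real c)"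
  by (simp add: char_std_normal_distribution)
 also have "... = of_real (sqrt (2*pi)/c*exp (- (t^2)/2))" by simp
 also have "sqrt (2*pi)/c = sqrt (pi/p)" unfolding c_def by (simp add: real_sqrt_divide[symmetric])
 also have "- (t^2)/2 = - ro\<^sup>2/(4*p)" using c by (simp add: t_def power_divide)
 finally show "(LBINT s. gk (of_real p) ro s) =
   of_real (sqrt (pi/p)*exp (- ro\<^sup>2/(4*p)))" unfolding eq2 .
qed

lemma integrable_gaussian_real: "p > 0 ==> intg (\<lambda>s::real. exp (- p * s^2))"
 using integrable_norm[OF gaussian_fourier_real(1)[of p 0]] by simp

lemma gaussian_fourier_integrable:
 fixes p :: complex and ro :: real
 assumes p: "Re p > 0"
 shows "intg (\<lambda>s::real. gk p ro s)"
proof (rule Bochner_Integration.integrable_bound[OF integrable_gaussian_real[OF p]])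
 show "(\<lambda>s::real. gk p ro s) \<in> borel_measurable lborel"
  by measurable
 show "AE s in lborel. norm (gk p ro s) <= norm (exp (- Re p * s^2))"
  by (simp flip: of_real_power)
qed

text \<open>Analytic continuation in p from the positive axis. Expanding exp (-(q - p0) s^2) in
  powers of q - p0 and integrating term by term shows that the integral is holomorphic in q on a
  disc, and both sides agree at the real points of the disc up to its centre.\<close>

lemma gaussian_fourier:
 fixes p :: complex and ro :: real
 assumes p: "Re p > 0"
 shows "(LBINT s. gk p ro s) =
   csqrt (of_real pi/p)*exp (- of_real (ro^2)/(4*p))"
proof -
 \<comment> \<open>The disc of centre and radius \<open>p0\<close> touches the imaginary axis at 0,
   so it lies in the right half-plane, and |p - p0|^2 = p0^2 - |p|^2 puts p inside it.\<close>
 define p0 where "p0 = (cmod p)^2/Re p"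
 have "p \<noteq> 0" using p by auto
 then have p0: "p0 > 0" using p by (auto simp: p0_def intro!: divide_pos_pos)
 define I where "I q = (LBINT s. gk q ro s)" for q :: complex
 define R where "R q = csqrt (of_real pi/q)*exp (- of_real (ro^2)/(4*q))" for q :: complex
 define c where "c k = (LBINT s. (- of_real (s^2)) ^ k /\<^sub>R fact k*gk (of_real p0) ro s)" for k
 have ball_Re: "Re q > 0" if "q \<in> ball (of_real p0) p0" for q
 proof -
  have "p0 - Re q <= cmod (of_real p0 - q)" using complex_Re_le_cmod[of "of_real p0 - q"] by simp
  then show ?thesis using that by (simp add: dist_norm)
 qed
 have pin: "p \<in> ball (of_real p0) p0"
 proof -
  have "(cmod (of_real p0 - p))^2 = p0^2 - 2*p0*Re p + (cmod p)^2"
   unfolding cmod_power2 by (simp add: power2_eq_square algebra_simps)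
  also have "... = p0^2 - (cmod p)\<^sup>2" using p by (simp add: p0_def)
  also have "... < p0^2" using p by auto
  finally show ?thesis using p0 by (simp add: dist_norm power_less_imp_less_base)
 qed
 have series: "(\<lambda>k. c k*(q - of_real p0) ^ k) sums I q" if q: "q \<in> ball (of_real p0) p0" for q
 proof -
  define r where "r = cmod (q - of_real p0)"
  have r: "0 <= r" "r < p0" using q by (auto simp: r_def dist_norm norm_minus_commute)
  define f where "f k s = (- of_real (s^2)) ^ k /\<^sub>R fact k*gk (of_real p0) ro s*(q - of_real p0)^k" for k and s :: real
  have nf: "norm (f k s) = (r * s^2)^k /\<^sub>R fact k*exp (- p0 * s^2)" for k s
   by (simp add: f_def norm_mult norm_power r_def power_mult_distrib norm_exp_eq_Re flip: of_real_power)
  have sums_nf: "(\<lambda>k. norm (f k s)) sums (exp (- (p0 - r) * s^2))" for s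
  proof -
   have "(\<lambda>k. (r * s^2)^k /\<^sub>R fact k*exp (- p0 * s^2)) sums (exp (r * s^2)*exp (- p0 * s^2))"
    by (intro sums_mult2 exp_converges)
   also have "exp (r * s^2)*exp (- p0 * s^2) = exp (- (p0 - r) * s^2)" by (simp add: exp_add[symmetric] algebra_simps)
   finally show ?thesis by (simp add: nf)
  qed
  \<comment> \<open>At distance r < p0 from the centre all partial sums are dominated by exp (-(p0 -
    r) s^2), which is integrable.\<close>
  have part: "(\<Sum>k<n. norm (f k s)) <= exp (- (p0 - r) * s^2)" for n s
   using sums_nf[of s] by (intro sum_le_suminf[THEN order_trans]) (auto simp: sums_iff)
  have fm: "f k \<in> borel_measurable lborel" for k
   unfolding f_def by measurable
  have gi: "intg (\<lambda>s::real. exp (- (p0 - r) * s^2))" by (rule integrable_gaussian_real) (use r in auto)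
  have fi: "intg (f k)" for k
  proof (rule Bochner_Integration.integrable_bound[OF gi fm])
   have "norm (f k s) <= exp (- (p0 - r) * s^2)" for s
    using part[where n="Suc k" and s=s] sum_nonneg[of "{..<k}" "\<lambda>k. norm (f k s)"] by simp
   then show "AE s in lborel. norm (f k s) <= norm (exp (- (p0 - r) * s^2))" by simp
  qed
  have sb: "summable (\<lambda>k. LBINT s. norm (f k s))"
  proof (rule bounded_imp_summable)
   show "(\<Sum>k\<le>n. LBINT s. norm (f k s)) <= (LBINT s. exp (- (p0 - r) * s^2))" for n
   proof (subst Bochner_Integration.integral_sum[symmetric], intro integrable_norm fi, rule integral_mono[OF _ gi])
    show "intg (\<lambda>s. \<Sum>k\<le>n. norm (f k s))" by (intro Bochner_Integration.integrable_sum integrable_norm fi)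
    show "(\<Sum>k\<le>n. norm (f k s)) <= exp (- (p0 - r) * s^2)" for s
     using part[of s "Suc n"] by (simp add: lessThan_Suc_atMost)
   qed
  qed auto
  have "(\<lambda>k. integral\<^sup>L lborel (f k)) sums (LBINT s. (\<Sum>k. f k s))"
   by (rule sums_integral) (use fi sums_nf sb in "auto simp: sums_iff")
  moreover have "integral\<^sup>L lborel (f k) = c k*(q - of_real p0) ^ k" for k
   unfolding f_def c_def by simp
  moreover have "(\<Sum>k. f k s) = gk q ro s" for s
  proof -
   have "(\<lambda>k. (- of_real (s^2)*(q - of_real p0))^k /\<^sub>R fact k*gk (of_real p0) ro s) sums
    (exp (- of_real (s^2)*(q - of_real p0))*gk (of_real p0) ro s)"
    by (intro sums_mult2 exp_converges)
   moreover have "(- of_real (s^2)*(q - of_real p0))^k /\<^sub>R fact k*gk (of_real p0) ro s = f k s" for k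
    unfolding f_def power_mult_distrib by (simp add: mult_ac)
   ultimately show ?thesis by (simp add: sums_iff exp_add[symmetric] algebra_simps)
  qed
  ultimately show ?thesis by (simp add: I_def)
 qed
 have holI: "I holomorphic_on ball (of_real p0) p0"
  by (rule power_series_holomorphic[OF series])
 have holR: "R holomorphic_on ball (of_real p0) p0"
 proof -
  have "complex_of_real pi/q \<notin> \<real>\<^sub>\<le>\<^sub>0 \<and> q \<noteq> 0" if "q \<in> ball (of_real p0) p0" for q :: complex
  proof -
   have "Re q > 0" using ball_Re[OF that] .
   then have "Re (of_real pi/q) > 0" by (auto simp: Re_divide intro!: divide_pos_pos add_pos_nonneg) 
   then show ?thesis using \<open>Re q > 0\<close> by (auto simp: complex_nonpos_Reals_iff)
  qed
  then show ?thesis unfolding R_def by (intro holomorphic_intros) auto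
 qed
 have "I p - R p = 0"
 proof (rule analytic_continuation[where f="\<lambda>q. I q - R q" and S="ball (of_real p0) p0" and U="of_real ` {0<..<p0}" and \<xi>="of_real (p0/2)"])
  show "(\<lambda>q. I q - R q) holomorphic_on ball (of_real p0) p0" by (intro holomorphic_intros holI holR)
  show "of_real ` {0<..<p0} \<subseteq> ball (complex_of_real p0) p0"
   using p0 by (auto simp: dist_norm simp flip: of_real_diff)
  show "complex_of_real (p0/2) \<in> ball (complex_of_real p0) p0"
   using p0 by (auto simp: dist_norm simp flip: of_real_diff)
  show "complex_of_real (p0/2) islimpt of_real ` {0<..<p0}"
  proof (rule islimpt_approachable[THEN iffD2], intro allI impI)
   fix e :: real assume e: "e > 0"
   define x where "x = p0/2 + min (e/2) (p0/4)"
   have "x \<in> {0<..<p0}" "x \<noteq> p0/2" "\<bar>x - p0/2\<bar> < e" using p0 e by (auto simp: x_def min_def)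
   then show "\<exists>x'\<in>complex_of_real ` {0<..<p0}. x' \<noteq> complex_of_real (p0/2) \<and> dist x' (complex_of_real (p0/2)) < e"
    by (intro bexI[of _ "of_real x"]) (simp_all add: dist_of_real dist_real_def del: of_real_divide)
  qed
  fix z assume "z \<in> complex_of_real ` {0<..<p0}"
  then obtain x where x: "z = of_real x" "x > 0" by auto
  have "R z = csqrt (of_real (pi/x)) * of_real (exp (- ro\<^sup>2/(4*x)))"
   unfolding R_def x(1) by (simp add: exp_of_real[symmetric])
  also have "csqrt (of_real (pi/x)) = of_real (sqrt (pi/x))" using x by (subst of_real_sqrt) auto
  finally show "I z - R z = 0" using gaussian_fourier_real(2)[OF x(2), of ro] by (simp add: I_def x)
 qed (use pin in auto)
 then show ?thesis by (simp add: I_def R_def)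
qed

text \<open>Lebesgue measure is the image of a product of one-dimensional ones under the
  coordinates, so a product of functions of single coordinates integrates factor by factor.\<close>

lemma lborel_prod_integral:
 fixes f :: "'a::euclidean_space => real => complex"
 assumes f: "\<And>b. b \<in> Basis ==> intg (f b)"
 shows "intg (\<lambda>x::'a. \<Prod>b\<in>Basis. f b (x \<bullet> b))"
  "(LBINT x. (\<Prod>b\<in>Basis. f b (x \<bullet> b))) = (\<Prod>b\<in>Basis. LBINT s. f b s)"
proof -
 interpret product_sigma_finite "\<lambda>b::'a. lborel :: real measure" by standard
 have [measurable]: "b \<in> Basis ==> f b \<in> borelm" for b using f[of b] by auto
 let ?T = "\<lambda>g. \<Sum>b\<in>Basis. g b *\<^sub>R (b::'a)"
 have T[measurable]: "?T \<in> measurable (\<Pi>\<^sub>M b\<in>Basis. lborel) borel" by measurable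
 have inner: "?T g \<bullet> b = g b" if "b \<in> Basis" for g b
  using that by (simp add: inner_sum_left inner_Basis if_distrib cong: if_cong)
 have eq: "(\<Prod>b\<in>Basis. f b (?T g \<bullet> b)) = (\<Prod>b\<in>Basis. f b (g b))" for g
  by (rule prod.cong) (auto simp: inner)
 have m: "(\<lambda>x::'a. \<Prod>b\<in>Basis. f b (x \<bullet> b)) \<in> borelm" by measurable
 show "intg (\<lambda>x::'a. \<Prod>b\<in>Basis. f b (x \<bullet> b))"
  unfolding lborel_eq[where 'a='a]
  by (subst integrable_distr_eq[OF T m]) (use f in "simp add: eq product_integrable_prod")
 have "(LBINT x. (\<Prod>b\<in>Basis. f b (x \<bullet> b))) = (LINT g|(\<Pi>\<^sub>M b\<in>Basis. lborel). (\<Prod>b\<in>Basis. f b (?T g \<bullet> b)))"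
  unfolding lborel_eq[where 'a='a] by (rule integral_distr[OF T m])
 also have "... = (\<Prod>b\<in>Basis. LBINT s. f b s)"
  unfolding eq by (rule product_integral_prod) (use f in auto)
 finally show "(LBINT x. (\<Prod>b\<in>Basis. f b (x \<bullet> b))) = (\<Prod>b\<in>Basis. LBINT s. f b s)" .
qed

lemma gaussian_fourier_eucl:
 fixes w :: complex and xi :: "'a::euclidean_space"
 assumes w: "Re w > 0"
 shows "intg (\<lambda>x::'a. ge w x xi)"
  "(LBINT x. exp (- w * of_real ((norm (x::'a))^2) - \<i> * of_real (x \<bullet> xi))) =
   csqrt (of_real pi/w) ^ DIM('a)*exp (- of_real ((norm xi)^2)/(4*w))"
proof -
 have ns: "complex_of_real ((norm x)^2) = (\<Sum>b\<in>Basis. (of_real (x \<bullet> b))^2)" for x :: 'a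
  by (subst power2_norm_eq_inner, subst euclidean_inner) (simp add: power2_eq_square)
 have eq: "ge w x xi =
  (\<Prod>b\<in>Basis. exp (- w*(of_real (x \<bullet> b))^2 - \<i> * of_real (xi \<bullet> b) * of_real (x \<bullet> b)))" for x :: 'a
  unfolding ns by (subst exp_sum[symmetric], simp, subst (1) euclidean_inner) 
   (simp add: sum_subtractf sum_distrib_left mult_ac sum_negf)
 show "intg (\<lambda>x::'a. ge w x xi)"
  unfolding eq by (rule lborel_prod_integral(1), rule gaussian_fourier_integrable[OF w])
 have "(LBINT x. exp (- w * of_real ((norm (x::'a))^2) - \<i> * of_real (x \<bullet> xi))) =
  (\<Prod>b\<in>(Basis::'a set). csqrt (of_real pi/w)*exp (- of_real ((xi \<bullet> b)^2)/(4*w)))"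
  unfolding eq by (subst lborel_prod_integral(2), rule gaussian_fourier_integrable[OF w])
   (rule prod.cong, simp, rule gaussian_fourier[OF w])
 also have "... = csqrt (of_real pi/w) ^ DIM('a)*exp (\<Sum>b\<in>Basis. - of_real ((xi \<bullet> b)^2)/(4*w))"
  by (simp add: prod.distrib exp_sum)
 also have "(\<Sum>b\<in>Basis. - of_real ((xi \<bullet> b)^2)/(4*w)) = - of_real ((norm xi)^2)/(4*w)"
  unfolding ns by (simp add: sum_divide_distrib sum_negf)
 finally show "(LBINT x. exp (- w * of_real ((norm (x::'a))^2) - \<i> * of_real (x \<bullet> xi))) =
   csqrt (of_real pi/w) ^ DIM('a)*exp (- of_real ((norm xi)^2)/(4*w))" .
qed

text \<open>The factor exp (-|xi|^2/(4 w)) has modulus at most 1 since Re (1/w) > 0. What remains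
  depends on |w| alone, which lets the bound survive Re w -> 0.\<close>

lemma gaussian_fourier_eucl_le:
 fixes w :: complex and xi :: "'a::euclidean_space"
 assumes w: "Re w > 0"
 shows "cmod (LBINT x. exp (- w * of_real ((norm (x::'a))^2) - \<i> * of_real (x \<bullet> xi))) <= sqrt (pi/cmod w) ^ DIM('a)"
proof -
 have "Re (- of_real ((norm xi)^2)/(4*w)) <= 0"
  using w by (simp add: Re_divide divide_nonneg_nonneg mult_nonneg_nonneg)
 then show ?thesis
  unfolding gaussian_fourier_eucl(2)[OF w]
  by (simp add: norm_mult norm_power norm_csqrt norm_divide mult_left_le)
qed

section \<open>Affine changes of variables, translations and reflections\<close>

lemma nn_integral_lborel_affine:
 fixes f :: "'a::euclidean_space => ennreal"
 assumes [measurable]: "f \<in> borelm" and c: "c \<noteq> 0"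
 shows "(NN x. f x) = ennreal (\<bar>c\<bar> ^ DIM('a))*(NN x. f (t + c *\<^sub>R x))"
 by (subst lborel_affine[OF c, of t])
  (simp add: nn_integral_density nn_integral_distr nn_integral_cmult)

lemma integrable_lborel_affine:
 fixes f :: "'a::euclidean_space => 'b :: {banach, second_countable_topology}"
 assumes f: "intg f" and c: "c \<noteq> 0"
 shows "intg (\<lambda>x. f (t + c *\<^sub>R x))"
proof -
 have [measurable]: "f \<in> borelm" using f by auto
 have "(NN x. norm (f x)) = ennreal (\<bar>c\<bar> ^ DIM('a))*(NN x. norm (f (t + c *\<^sub>R x)))"
  by (rule nn_integral_lborel_affine[OF _ c]) simp
 moreover have "(NN x. norm (f x)) < \<infinity>" using f by (simp add: integrable_iff_bounded)
 ultimately show ?thesis using c by (auto simp: integrable_iff_bounded ennreal_mult_less_top)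
qed

lemma integral_lborel_affine:
 fixes f :: "'a::euclidean_space => 'b :: {banach, second_countable_topology}"
 assumes f[measurable]: "f \<in> borelm" and c: "c \<noteq> 0"
 shows "(LBINT x. f x) = \<bar>c\<bar> ^ DIM('a) *\<^sub>R (LBINT x. f (t + c *\<^sub>R x))"
 by (subst lborel_affine[OF c, of t]) (simp add: integral_density integral_distr c)

lemma AE_lborel_affine:
 fixes P :: "'a::euclidean_space => bool"
 assumes c: "c \<noteq> 0" and P: "AE x in lborel. P x"
 shows "AE x in lborel. P (t + c *\<^sub>R x)"
proof -
 obtain N where N: "{x \<in> space lborel. \<not> P x} \<subseteq> N" "emeasure lborel N = 0" "N \<in> sets lborel"
  by (rule AE_E[OF P])
 have [measurable]: "N \<in> sets borel" using N(3) by simp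
 have "0 = (NN x. indicator N x)" using N by simp
 also have "... = ennreal (\<bar>c\<bar> ^ DIM('a))*(NN x. indicator N (t + c *\<^sub>R x))"
  by (rule nn_integral_lborel_affine[OF _ c]) simp
 finally have "(NN x. indicator N (t + c *\<^sub>R x)) = (0::ennreal)" using c by simp
 then have "AE x in lborel. indicator N (t + c *\<^sub>R x) = (0::ennreal)"
  by (subst (asm) nn_integral_0_iff_AE) simp_all
 then show ?thesis
 proof eventually_elim
  case (elim x)
  then have "t + c *\<^sub>R x \<notin> N" by (simp add: indicator_eq_0_iff)
  then show ?case using N(1) by auto
 qed
qed

lemma AE_lborel_minus: "AE x in (lborel::'a::euclidean_space measure). P x ==> AE x in lborel. P (- x)"
 using AE_lborel_affine[of "-1" P 0] by simp

lemma integral_lborel_minus: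
 fixes f :: "'a::euclidean_space => 'b :: {banach, second_countable_topology}"
 assumes "f \<in> borelm"
 shows "(LBINT x. f (- x)) = (LBINT x. f x)"
 using integral_lborel_affine[OF assms, of "-1" 0] by simp

lemma integral_lborel_shift:
 fixes f :: "'a::euclidean_space => 'b :: {banach, second_countable_topology}"
 assumes "f \<in> borelm"
 shows "(LBINT x. f (x - z)) = (LBINT x. f x)"
 using integral_lborel_affine[OF assms, of 1 "-z"] by simp

lemma L2_affine:
 fixes f :: "'a::euclidean_space => complex"
 assumes f: "f \<in> L2" and c: "c \<noteq> 0"
 shows "(\<lambda>x. f (t + c *\<^sub>R x)) \<in> L2"
proof -
 have [measurable]: "f \<in> borelm" using f by (rule L2_measurable)
 show ?thesis using integrable_lborel_affine[OF L2_integrable[OF f] c] by (simp add: L2_iff)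
qed

lemma L2_shift: "f \<in> L2 ==> (\<lambda>x. f (x - z)) \<in> L2"
 using L2_affine[of f 1 "-z"] by simp

lemma nrm_shift: "f \<in> L2 ==> nrm (\<lambda>x. f (x - z)) = nrm f"
 unfolding nrm_def by (subst integral_lborel_shift[where f="\<lambda>x. (cmod (f x))^2"]) auto

lemma L2_reflect: "f \<in> L2 ==> (\<lambda>x. f (- x)) \<in> L2"
 using L2_affine[of f "-1" 0] by simp

lemma nrm_reflect: "f \<in> L2 ==> nrm (\<lambda>x. f (- x)) = nrm f"
 unfolding nrm_def by (subst integral_lborel_minus[where f="\<lambda>x. (cmod (f x))^2"]) auto

section \<open>Continuity of translations in L^2\<close>

definition shift_cont :: "('a::euclidean_space => complex) => bool" where
 "shift_cont f \<longleftrightarrow> f \<in> L2 \<and> (\<forall>z. z ----> 0 --> (\<lambda>n. nrm (\<lambda>x. f (x - z n) - f x)) ----> 0)"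

lemma shift_cont_add: "shift_cont f ==> shift_cont g ==> shift_cont (\<lambda>x. f x + g x)"
 unfolding shift_cont_def
proof (intro conjI allI impI)
 assume f: "f \<in> L2 \<and> (\<forall>z. z ----> 0 --> (\<lambda>n. nrm (\<lambda>x. f (x - z n) - f x)) ----> 0)"
  and g: "g \<in> L2 \<and> (\<forall>z. z ----> 0 --> (\<lambda>n. nrm (\<lambda>x. g (x - z n) - g x)) ----> 0)"
 then show "(\<lambda>x. f x + g x) \<in> L2" by (simp add: L2_add)
 fix z :: "nat => 'a" assume "z ----> 0"
 then have l: "(\<lambda>n. nrm (\<lambda>x. f (x - z n) - f x) + nrm (\<lambda>x. g (x - z n) - g x)) ----> 0"
  using f g by (auto intro!: tendsto_add_zero)
 show "(\<lambda>n. nrm (\<lambda>x. f (x - z n) + g (x - z n) - (f x + g x))) ----> 0"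
 proof (rule tendsto_sandwich[OF _ _ tendsto_const l])
  have "nrm (\<lambda>x. f (x - z n) + g (x - z n) - (f x + g x)) <= nrm (\<lambda>x. f (x - z n) - f x) + nrm (\<lambda>x. g (x - z n) - g x)" for n
   using nrm_triangle[of "\<lambda>x. f (x - z n) - f x" "\<lambda>x. g (x - z n) - g x"] f g
   by (simp add: L2_diff L2_shift algebra_simps)
  then show "\<forall>\<^sub>F n in sequentially. nrm (\<lambda>x. f (x - z n) + g (x - z n) - (f x + g x)) <= nrm (\<lambda>x. f (x - z n) - f x) + nrm (\<lambda>x. g (x - z n) - g x)" by simp
 qed simp
qed

lemma shift_cont_cmult: "shift_cont f ==> shift_cont (\<lambda>x. c*f x)"
 unfolding shift_cont_def by (auto simp: L2_cmult right_diff_distrib[symmetric] nrm_cmult intro!: tendsto_mult_right_zero)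

lemma shift_cont_limit:
 assumes f: "f \<in> L2" and g: "\<And>e. e > 0 ==> \<exists>g. shift_cont g \<and> nrm (\<lambda>x. f x - g x) < e"
 shows "shift_cont f"
 unfolding shift_cont_def
proof (intro conjI allI impI f LIMSEQ_I)
 fix z :: "nat => 'a" and e :: real assume z: "z ----> 0" and e: "0 < e"
 from g[of "e/3"] e obtain g where g: "shift_cont g" and gn: "nrm (\<lambda>x. f x - g x) < e/3" by auto
 have gL: "g \<in> L2" using g by (simp add: shift_cont_def)
 from g z have "(\<lambda>n. nrm (\<lambda>x. g (x - z n) - g x)) ----> 0" by (simp add: shift_cont_def)
 from LIMSEQ_D[OF this, of "e/3"] e obtain M where M: "\<And>n. n \<ge> M ==> nrm (\<lambda>x. g (x - z n) - g x) < e/3" by auto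
 show "\<exists>no. \<forall>n\<ge>no. norm (nrm (\<lambda>x. f (x - z n) - f x) - 0) < e"
 proof (intro exI allI impI)
  fix n assume n: "M <= n"
  have a: "nrm (\<lambda>x. f (x - z n) - g (x - z n)) < e/3"
   using nrm_shift[OF L2_diff[OF f gL], of "z n"] gn by simp
  have b: "nrm (\<lambda>x. f (x - z n) - f x) <= nrm (\<lambda>x. f (x - z n) - g x) + nrm (\<lambda>x. g x - f x)"
   by (rule nrm_triangle_diff) (intro f gL L2_shift)+
  have c: "nrm (\<lambda>x. f (x - z n) - g x) <= nrm (\<lambda>x. f (x - z n) - g (x - z n)) + nrm (\<lambda>x. g (x - z n) - g x)"
   by (rule nrm_triangle_diff) (intro f gL L2_shift)+
  show "norm (nrm (\<lambda>x. f (x - z n) - f x) - 0) < e"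
   using a b c gn M[OF n] nrm_minus_commute[of g f] by simp
 qed
qed

lemma L2_indicator_set:
 assumes "B \<in> sets borel" "emeasure lborel B < \<infinity>"
 shows "(\<lambda>x. indicator B x) \<in> L2" "(nrm (\<lambda>x. indicator B x))^2 = measure lborel B"
proof -
 have eq: "(cmod (indicator B x))^2 = indicat_real B x" for x by (auto simp: indicator_def)
 show "(\<lambda>x. indicator B x) \<in> L2" using assms unfolding L2_iff eq by (auto intro!: integrable_real_indicator)
 show "(nrm (\<lambda>x. indicator B x))^2 = measure lborel B" unfolding nrm_sq eq using assms by simp
qed

text \<open>The squared norm is 2|U| minus twice the measure of the overlap of U with its translate.
  Openness makes x - z_n fall into U eventually for each x in U, so the overlap tends to |U| by
  dominated convergence.\<close>

lemma shift_cont_open: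
 fixes U :: "'a::euclidean_space set"
 assumes U: "open U" "emeasure lborel U < \<infinity>"
 shows "shift_cont (\<lambda>x. indicator U x)"
 unfolding shift_cont_def
proof (intro conjI allI impI)
 have [measurable]: "U \<in> sets borel" using U by auto
 show L: "(\<lambda>x. indicator U x) \<in> L2" by (rule L2_indicator_set) (use U in auto)
 fix z :: "nat => 'a" assume z: "z ----> 0"
 let ?h = "\<lambda>n x. indicat_real U (x - z n)*indicat_real U x"
 have hi: "intg (?h n)" for n
  by (rule Bochner_Integration.integrable_bound[where f="indicat_real U"])
   (use U in "auto intro!: integrable_real_indicator simp: indicator_def")
 have lim: "(\<lambda>n. LBINT x. ?h n x) ----> (LBINT x. indicat_real U x)"
 proof (rule integral_dominated_convergence[where w="indicat_real U"])
  show "AE x in lborel. (\<lambda>n. ?h n x) ----> indicat_real U x"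
  proof (rule AE_I2, goal_cases)
   case (1 x)
   show ?case
   proof (cases "x \<in> U")
    case True
    have "(\<lambda>n. x - z n) ----> x - 0" by (intro tendsto_intros z)
    then have "\<forall>\<^sub>F n in sequentially. x - z n \<in> U" using U(1) True topological_tendstoD by fastforce
    then have "\<forall>\<^sub>F n in sequentially. ?h n x = 1" by eventually_elim (use True in auto)
    then show ?thesis using True by (simp add: tendsto_eventually)
   qed simp
  qed
 qed (use U in "auto intro!: integrable_real_indicator simp: indicator_def")
 have "(nrm (\<lambda>x. indicator U (x - z n) - indicator U x))^2 = 2*measure lborel U - 2*(LBINT x. ?h n x)" for n
 proof -
  have "(cmod (indicator U (x - z n) - indicator U x))^2 = indicat_real U (x - z n) + indicat_real U x - 2*?h n x" for x
   by (auto simp: indicator_def)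
  moreover have i: "intg (indicat_real U)" using U by (auto intro!: integrable_real_indicator)
  moreover have "intg (\<lambda>x. indicat_real U (x - z n))" 
   using integrable_lborel_affine[OF i, of 1 "- z n"] by simp
  moreover have "(LBINT x. indicat_real U (x - z n)) = measure lborel U"
   using U by (subst integral_lborel_shift) auto
  ultimately show ?thesis unfolding nrm_sq using hi[of n] U by simp
 qed
 moreover have "(\<lambda>n. 2*measure lborel U - 2*(LBINT x. ?h n x)) ----> 2*measure lborel U - 2*(LBINT x. indicat_real U x)"
  by (intro tendsto_intros lim)
 ultimately have "(\<lambda>n. (nrm (\<lambda>x. indicator U (x - z n) - indicator U x))^2) ----> 0" using U by simp
 then have "(\<lambda>n. sqrt ((nrm (\<lambda>x. indicator U (x - z n) - indicator U x))^2)) ----> sqrt 0" by (intro tendsto_real_sqrt)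
 then show "(\<lambda>n. nrm (\<lambda>x. indicator U (x - z n) - indicator U x)) ----> 0" by simp
qed

text \<open>Outer regularity approximates a set of finite measure by an open one.\<close>

lemma shift_cont_indicator:
 fixes B :: "'a::euclidean_space set"
 assumes B: "B \<in> sets borel" "emeasure lborel B < \<infinity>"
 shows "shift_cont (\<lambda>x. indicator B x)"
proof (rule shift_cont_limit)
 show "(\<lambda>x. indicator B x) \<in> L2" by (rule L2_indicator_set) (use B in auto)
 fix e :: real assume e: "e > 0"
 then have "e^2 > 0" by simp
 from outer_regular_lborel[OF B(1) this] obtain U where U: "open U" "B \<subseteq> U" "emeasure lborel (U - B) < ennreal (e^2)" .
 have Us: "U \<in> sets borel" "U - B \<in> sets borel" using U B by auto
 have fin: "emeasure lborel (U - B) < \<infinity>" using U(3) by (metis infinity_ennreal_def less_top order_less_imp_not_less top.not_eq_extremum)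
 have "emeasure lborel U <= emeasure lborel B + emeasure lborel (U - B)"
  using emeasure_subadditive[of B lborel "U - B"] B Us U(2) by (simp add: Un_absorb1)
 also have "... < \<infinity>" using B fin by simp
 finally have Uf: "emeasure lborel U < \<infinity>" .
 have eq: "cmod (indicator B x - indicator U x) = cmod (indicator (U - B) x)" for x
  using U(2) by (auto simp: indicator_def)
 have "(nrm (\<lambda>x. indicator B x - indicator U x))^2 = (nrm (\<lambda>x. indicator (U - B) x))^2"
  unfolding nrm_sq eq ..
 also have "... = measure lborel (U - B)" by (rule L2_indicator_set(2)) (use Us fin in auto)
 also have "... < e^2" using U(3) e fin by (simp add: measure_def enn2real_less_iff less_top)
 finally have "nrm (\<lambda>x. indicator B x - indicator U x) < e" using e by (simp add: power_less_imp_less_base)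
 then show "\<exists>g. shift_cont g \<and> nrm (\<lambda>x. indicator B x - g x) < e"
  using shift_cont_open[OF U(1) Uf] by blast
qed

lemma shift_cont_sum: "finite A ==> (\<And>i. i \<in> A ==> shift_cont (f i)) ==> shift_cont (\<lambda>x. \<Sum>i\<in>A. f i x)"
proof (induction A rule: finite_induct)
 case empty then show ?case by (simp add: shift_cont_def)
next
 case (insert a A) then show ?case by (auto intro: shift_cont_add)
qed

lemma L2_shift_continuous:
 fixes f :: "'a::euclidean_space => complex"
 assumes f: "f \<in> L2"
 shows "shift_cont f"
proof (rule shift_cont_limit[OF f])
 fix e :: real assume e: "e > 0"
 have fm[measurable]: "f \<in> borelm" using f by (rule L2_measurable)
 obtain s where s: "\<And>i. simple_function lborel (s i)" "\<And>x. (\<lambda>i. s i x) ----> f x" "\<And>i x. dist (s i x) 0 <= 2*dist (f x) 0"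
  using borel_measurable_implies_sequence_metric[of f lborel 0] by auto
 have sm[measurable]: "s i \<in> borelm" for i using borel_measurable_simple_function[OF s(1)] by simp
 have dom: "cmod (s i x) <= cmod (2*f x)" for i x using s(3)[of i x] by (simp add: norm_mult)
 have sL: "s i \<in> L2" for i by (rule L2_dominated[OF L2_cmult[OF f, of 2] sm]) (use dom in auto)
 have "(\<lambda>n. nrm (\<lambda>x. s n x - f x)) ----> 0"
  by (rule L2_dct[OF sm f L2_cmult[OF f, of 2]]) (use s(2) dom in auto)
 from LIMSEQ_D[OF this e] obtain n where n: "nrm (\<lambda>x. s n x - f x) < e" by auto
 have fin: "finite (range (s n))" using s(1)[of n] by (simp add: simple_function_def)
 have rep: "s n x = (\<Sum>y\<in>range (s n) - {0}. y*indicator (s n -` {y}) x)" for x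
 proof (cases "s n x = 0")
  case False
  have "(\<Sum>y\<in>range (s n) - {0}. y*indicator (s n -` {y}) x) = (\<Sum>y\<in>range (s n) - {0}. if y = s n x then y else 0)"
   by (rule sum.cong) (auto simp: indicator_def)
  also have "... = s n x" using fin False by (subst sum.delta) auto
  finally show ?thesis ..
 next
  case True
  then show ?thesis by (subst sum.neutral) (auto simp: indicator_def)
 qed
 have "shift_cont (\<lambda>x. y*indicator (s n -` {y}) x)" if y: "y \<noteq> 0" for y
 proof (intro shift_cont_cmult shift_cont_indicator)
  show m[measurable]: "s n -` {y} \<in> sets borel" using measurable_sets[OF sm[of n], of "{y}"] by simp
  have "ennreal ((cmod y)^2)*emeasure lborel (s n -` {y}) = (NN x. ennreal ((cmod y)^2)*indicator (s n -` {y}) x)"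
   by (simp add: nn_integral_cmult_indicator)
  also have "... <= (NN x. ennreal ((cmod (s n x))^2))"
   by (intro nn_integral_mono) (auto simp: indicator_def)
  also have "... < \<infinity>" by (simp add: nn_integral_nrm[OF sL])
  finally show "emeasure lborel (s n -` {y}) < \<infinity>" using y by (auto simp: ennreal_mult_less_top)
 qed
 then have "shift_cont (\<lambda>x. \<Sum>y\<in>range (s n) - {0}. y*indicator (s n -` {y}) x)"
  using fin by (intro shift_cont_sum) auto
 moreover have "(\<lambda>x. \<Sum>y\<in>range (s n) - {0}. y*indicator (s n -` {y}) x) = s n"
  by (rule ext) (rule rep[symmetric])
 ultimately have "shift_cont (s n)" by (simp only:)
 moreover have "nrm (\<lambda>x. f x - s n x) < e" using n by (subst nrm_minus_commute)
 ultimately show "\<exists>g. shift_cont g \<and> nrm (\<lambda>x. f x - g x) < e" by blast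
qed

section \<open>The Fourier transform on square-integrable functions\<close>

lemma measurable_cis [measurable (raw)]: "f \<in> borel_measurable M ==> (\<lambda>x. cis (f x)) \<in> borel_measurable M"
 unfolding cis_conv_exp by measurable

definition ft :: "('a::euclidean_space => complex) => 'a => complex" where
 "ft f xi = complex_of_real ((2*pi) powr (- real DIM('a)/2))*(LBINT x. cis (- (xi \<bullet> x))*f x)"

abbreviation (input) cN :: "'a::euclidean_space itself => complex" where
 "cN _ \<equiv> complex_of_real ((2*pi) powr (- real DIM('a)/2))"

lemma cN_sq: "(cN TYPE('a::euclidean_space))^2 = of_real (1/(2*pi) ^ DIM('a))"
proof -
 have "((2*pi) powr (- real DIM('a)/2))^2 = (2*pi) powr (- real DIM('a))"
  by (simp add: power2_eq_square powr_add[symmetric])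
 also have "... = 1/(2*pi) ^ DIM('a)" by (simp add: powr_minus powr_realpow divide_inverse)
 finally show ?thesis by (simp flip: of_real_power)
qed

lemma fourier_cutoff_eq: "fourier_cutoff R f = ft (\<lambda>x. f x*indicator (cball 0 R) x)"
 unfolding fourier_cutoff_def ft_def set_lebesgue_integral_def
 by (intro ext arg_cong2[where f=times] refl Bochner_Integration.integral_cong) (auto simp: indicator_def)

lemma ft_measurable [measurable]: 
 assumes [measurable]: "f \<in> borelm" shows "ft f \<in> borelm"
proof -
 have "(\<lambda>xi. LBINT x. cis (- (xi \<bullet> x))*f x) \<in> borelm" by measurable
 then show ?thesis unfolding ft_def[abs_def] by measurable
qed

lemma ft_bound:
 fixes f :: "'a::euclidean_space => complex"
 shows "cmod (ft f xi) <= (2*pi) powr (- real DIM('a)/2)*(LBINT x. cmod (f x))"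
proof -
 have "cmod (LBINT x. cis (- (xi \<bullet> x))*f x) <= (LBINT x. cmod (cis (- (xi \<bullet> x))*f x))"
  by (rule integral_norm_bound)
 then show ?thesis by (simp add: ft_def norm_mult)
qed

lemma integrable_cis_mult:
 fixes f :: "'a::euclidean_space => complex" and g :: "'a => real"
 assumes "intg f" "g \<in> borelm"
 shows "intg (\<lambda>x. cis (g x)*f x)"
proof -
 have [measurable]: "f \<in> borelm" "g \<in> borelm" using assms by auto
 show ?thesis by (rule Bochner_Integration.integrable_bound[OF assms(1)]) (auto simp: norm_mult)
qed

lemma fubini_kernel:
 fixes a :: "'a::euclidean_space => complex" and b :: "'b::euclidean_space => complex"
 assumes a: "intg a" and b: "intg b"
  and k[measurable]: "(\<lambda>(x, y). k x y) \<in> borel_measurable (lborel \<Otimes>\<^sub>M lborel)"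
  and B: "\<And>x y. cmod (k x y) <= B"
 shows "(LBINT x. a x*(LBINT y. k x y*b y)) = (LBINT y. b y*(LBINT x. k x y*a x))"
proof -
 have [measurable]: "a \<in> borelm" "b \<in> borelm" using a b by auto
 have B0: "0 <= B" using B norm_ge_zero order_trans by blast
 have 1: "integrable (lborel \<Otimes>\<^sub>M lborel) (\<lambda>p. complex_of_real B*(a (fst p)*b (snd p)))"
 proof (intro integrable_mult_right impI lborel_pair.Fubini_integrable)
  show "(\<lambda>p. a (fst p)*b (snd p)) \<in> borel_measurable (lborel \<Otimes>\<^sub>M lborel)" by measurable
  have "intg (\<lambda>x. cmod (a x)*(LBINT y. cmod (b y)))" using a by simp
  then show "intg (\<lambda>x. LBINT y. cmod (a (fst (x, y))*b (snd (x, y))))"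
   by (simp add: norm_mult)
  show "AE x in lborel. intg (\<lambda>y. a (fst (x, y))*b (snd (x, y)))" using b by simp
 qed
 have int: "integrable (lborel \<Otimes>\<^sub>M lborel) (\<lambda>(x, y). k x y*a x*b y)"
 proof (rule Bochner_Integration.integrable_bound[OF 1])
  show "(\<lambda>(x, y). k x y*a x*b y) \<in> borel_measurable (lborel \<Otimes>\<^sub>M lborel)" by measurable
  have "norm (k x y*a x*b y) <= norm (complex_of_real B*(a x*b y))" for x y
   unfolding norm_mult mult.assoc using B[of x y] B0 by (auto intro!: mult_right_mono)
  then show "AE p in lborel \<Otimes>\<^sub>M lborel. norm (case p of (x, y) => k x y*a x*b y) <= norm (complex_of_real B*(a (fst p)*b (snd p)))"
   by (auto simp: split_beta)
 qed
 have "(LBINT x. a x*(LBINT y. k x y*b y)) = (LBINT x. LBINT y. k x y*a x*b y)"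
  by (rule Bochner_Integration.integral_cong[OF refl], subst integral_mult_right_zero[symmetric]) (simp add: mult_ac)
 also have "... = (LBINT y. LBINT x. k x y*a x*b y)"
  by (rule lborel_pair.Fubini_integral[OF int, symmetric])
 also have "... = (LBINT y. b y*(LBINT x. k x y*a x))"
  by (rule Bochner_Integration.integral_cong[OF refl], subst integral_mult_right_zero[symmetric]) (simp add: mult_ac)
 finally show ?thesis .
qed

lemma ft_mult_formula:
 fixes f g :: "'a::euclidean_space => complex"
 assumes f: "intg f" and g: "intg g"
 shows "(LBINT x. f x*ft g x) = (LBINT x. g x*ft f x)"
proof -
 have "(LBINT x. f x*(LBINT y. cis (- (x \<bullet> y))*g y)) = (LBINT y. g y*(LBINT x. cis (- (x \<bullet> y))*f x))"
  by (rule fubini_kernel[OF f g, where B=1]) auto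
 then have "cN TYPE('a)*(LBINT x. f x*(LBINT y. cis (- (x \<bullet> y))*g y)) = cN TYPE('a)*(LBINT y. g y*(LBINT x. cis (- (y \<bullet> x))*f x))"
  by (simp add: inner_commute)
 then show ?thesis unfolding ft_def integral_mult_right_zero[symmetric] by (simp only: mult.left_commute)
qed

text \<open>The form of a multiplier with integrable symbol m has an explicit kernel, the Fourier
  integral of m at x - y. It is used twice with Gaussian m: with a real exponent for Plancherel's
  theorem and with a complex one for the decay estimate.\<close>

lemma ft_sesquilinear:
 fixes m f g :: "'a::euclidean_space => complex"
 assumes m: "intg m" and f: "intg f" and g: "intg g"
 shows "(LBINT xi. m xi*(ft f xi*cnj (ft g xi))) =
  (cN TYPE('a))^2*(LBINT x. f x*(cvf m g x))"
proof -
 define c where "c = cN TYPE('a)"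
 have [measurable]: "m \<in> borelm" "f \<in> borelm" "g \<in> borelm" using m f g by auto
 obtain B where B: "\<And>xi. cmod (ft g xi) <= B" using ft_bound[of g] by blast
 have B0: "0 <= B" using B norm_ge_zero order_trans by blast
 have i1: "intg (\<lambda>xi. m xi*cnj (ft g xi))"
 proof (rule Bochner_Integration.integrable_bound)
  show "intg (\<lambda>xi. complex_of_real B*m xi)" using m by simp
  have "norm (m xi*cnj (ft g xi)) <= norm (complex_of_real B*m xi)" for xi
   using B[of xi] B0 mult_right_mono[OF B[of xi] norm_ge_zero[of "m xi"]] by (simp add: norm_mult mult.commute)
  then show "AE xi in lborel. norm (m xi*cnj (ft g xi)) <= norm (complex_of_real B*m xi)" by simp
 qed measurable
 have cg: "cnj (ft g xi) = c*(LBINT y. cis (xi \<bullet> y)*cnj (g y))" for xi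
  unfolding ft_def c_def by (simp flip: Bochner_Integration.integral_cnj add: cis_cnj)
 have "(LBINT xi. m xi*(ft f xi*cnj (ft g xi))) = c*(LBINT xi. (m xi*cnj (ft g xi))*(LBINT x. cis (- (xi \<bullet> x))*f x))"
  unfolding ft_def[of f] c_def[symmetric] by (subst integral_mult_right_zero[symmetric]) (simp add: mult_ac)
 also have "(LBINT xi. (m xi*cnj (ft g xi))*(LBINT x. cis (- (xi \<bullet> x))*f x)) =
  (LBINT x. f x*(LBINT xi. cis (- (xi \<bullet> x))*(m xi*cnj (ft g xi))))"
  by (rule fubini_kernel[OF i1 f, where B=1]) auto
 also have "(\<lambda>x. LBINT xi. cis (- (xi \<bullet> x))*(m xi*cnj (ft g xi))) = (\<lambda>x. c*(cvf m g x))"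
 proof
  fix x
  have i2: "intg (\<lambda>xi. cis (- (xi \<bullet> x))*m xi)" by (rule integrable_cis_mult[OF m]) simp
  have i3: "intg (\<lambda>y. cnj (g y))" using g by simp
  have "(LBINT xi. cis (- (xi \<bullet> x))*(m xi*cnj (ft g xi))) = c*(LBINT xi. (cis (- (xi \<bullet> x))*m xi)*(LBINT y. cis (xi \<bullet> y)*cnj (g y)))"
   unfolding cg by (subst integral_mult_right_zero[symmetric]) (simp add: mult_ac)
  also have "(LBINT xi. (cis (- (xi \<bullet> x))*m xi)*(LBINT y. cis (xi \<bullet> y)*cnj (g y))) =
   (LBINT y. cnj (g y)*(LBINT xi. cis (xi \<bullet> y)*(cis (- (xi \<bullet> x))*m xi)))"
   by (rule fubini_kernel[OF i2 i3, where B=1]) auto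
  also have "(\<lambda>y xi. cis (xi \<bullet> y)*(cis (- (xi \<bullet> x))*m xi)) = (\<lambda>y xi. cis (- (xi \<bullet> (x - y)))*m xi)"
   unfolding mult.assoc[symmetric] cis_mult by (simp add: inner_diff_right)
  finally show "(LBINT xi. cis (- (xi \<bullet> x))*(m xi*cnj (ft g xi))) = c*(cvf m g x)" .
 qed
 also have "(LBINT x. f x*(c*(cvf m g x))) =
  c*(LBINT x. f x*(cvf m g x))"
  by (subst integral_mult_right_zero[symmetric]) (simp add: mult_ac)
 finally show ?thesis by (simp add: c_def power2_eq_square mult.assoc)
qed

section \<open>Plancherel's identity by Gaussian damping\<close>

lemma heat_limit:
 fixes f :: "'a::euclidean_space => complex"
 assumes f: "f \<in> L2" and eta: "eta ----> 0" and G: "intg G" "(LBINT z. G z) = 1"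
 shows "(\<lambda>n. LBINT z. G z*ip f (\<lambda>x. f (x - eta n *\<^sub>R z))) ----> of_real ((nrm f)^2)"
proof -
 have fm[measurable]: "f \<in> borelm" using f by (rule L2_measurable)
 have [measurable]: "G \<in> borelm" using G by auto
 have "(\<lambda>n. LBINT z. G z*ip f (\<lambda>x. f (x - eta n *\<^sub>R z))) ----> (LBINT z. G z*ip f f)"
 proof (rule integral_dominated_convergence[where w="\<lambda>z. cmod (G z)*(nrm f)^2"])
  show "(\<lambda>z. G z*ip f f) \<in> borel_measurable lborel" by measurable
  show "(\<lambda>z. G z*ip f (\<lambda>x. f (x - eta n *\<^sub>R z))) \<in> borel_measurable lborel" for n unfolding ip_def by measurable
  show "intg (\<lambda>z. cmod (G z)*(nrm f)^2)" using G by simp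
  show "AE z in lborel. (\<lambda>n. G z*ip f (\<lambda>x. f (x - eta n *\<^sub>R z))) ----> G z*ip f f"
  proof (rule AE_I2, rule tendsto_mult[OF tendsto_const], goal_cases)
   case (1 z)
   have "(\<lambda>n. eta n *\<^sub>R z) ----> 0 *\<^sub>R z" by (intro tendsto_intros eta)
   then have *: "(\<lambda>n. nrm (\<lambda>x. f (x - eta n *\<^sub>R z) - f x)) ----> 0" 
    using L2_shift_continuous[OF f] unfolding shift_cont_def by simp
   have "(\<lambda>n. ip f (\<lambda>x. f (x - eta n *\<^sub>R z)) - ip f f) ----> 0"
   proof (rule Lim_null_comparison)
    show "(\<lambda>n. nrm f*nrm (\<lambda>x. f (x - eta n *\<^sub>R z) - f x)) ----> 0" by (rule tendsto_mult_right_zero[OF *])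
    have "ip f (\<lambda>x. f (x - eta n *\<^sub>R z)) - ip f f = ip f (\<lambda>x. f (x - eta n *\<^sub>R z) - f x)" for n
     by (rule ip_diff_right[symmetric]) (intro f L2_shift)+
    then show "\<forall>\<^sub>F n in sequentially. norm (ip f (\<lambda>x. f (x - eta n *\<^sub>R z)) - ip f f) <= nrm f*nrm (\<lambda>x. f (x - eta n *\<^sub>R z) - f x)"
     by (simp add: ip_CS f L2_diff L2_shift)
   qed
   then show ?case by (rule LIM_zero_cancel)
  qed
  show "AE z in lborel. norm (G z*ip f (\<lambda>x. f (x - eta n *\<^sub>R z))) <= cmod (G z)*(nrm f)^2" for n
  proof (rule AE_I2, goal_cases)
   case (1 z)
   have "cmod (ip f (\<lambda>x. f (x - eta n *\<^sub>R z))) <= nrm f*nrm f"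
    using ip_CS[OF f L2_shift[OF f]] nrm_shift[OF f] by simp
   then show ?case
    by (simp add: norm_mult power2_eq_square mult_left_mono)
  qed
 qed
 then show ?thesis by (simp add: G ip_self)
qed

text \<open>The Gaussian weight makes the form absolutely convergent, and its kernel rescaled by eta
  is \<open>G\<close>. The three factors of \<open>G\<close> multiply to (4 pi)^(-N/2) exp
  (-|z|^2/4), the heat kernel at time 1.\<close>

lemma plancherel_regularized:
 fixes f :: "'a::euclidean_space => complex"
 assumes f: "f \<in> L2" "intg f" and eta: "eta > 0"
 defines "G \<equiv> \<lambda>z::'a. of_real (1/(4*pi) ^ DIM('a)) * of_real (sqrt (4*pi) ^ DIM('a))*(of_real (exp (- (norm z)\<^sup>2/4)) :: complex)"
 shows "(LBINT xi. of_real (exp (- eta\<^sup>2*(norm xi)^2))*(ft f xi*cnj (ft f xi))) = (LBINT z. G z*ip f (\<lambda>x. f (x - eta *\<^sub>R z)))"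
  and "intg G" "(LBINT z. G z) = 1"
proof -
 have [measurable]: "f \<in> borelm" using f(1) by (rule L2_measurable)
 have gm: "complex_of_real (exp (- p*(norm x)^2))*cis (- (x \<bullet> y)) = exp (- complex_of_real p * of_real ((norm x)^2) - \<i> * of_real (x \<bullet> y))" for p and x y :: 'a
  by (simp add: cis_conv_exp exp_of_real[symmetric] exp_add[symmetric])
 have q4: "exp (- complex_of_real (1/4) * of_real ((norm x)^2) - \<i> * of_real (x \<bullet> 0)) = of_real (exp (- (norm x)\<^sup>2/4))" for x :: 'a
  by (simp add: exp_of_real[symmetric])
 have ig: "intg (\<lambda>z::'a. complex_of_real (exp (- (norm z)\<^sup>2/4)))"
  using gaussian_fourier_eucl(1)[of "of_real (1/4)" "0::'a"] unfolding q4 by simp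
 show Gi: "intg G" unfolding G_def using ig by simp
 have "(LBINT z. complex_of_real (exp (- (norm (z::'a))\<^sup>2/4))) = csqrt (of_real pi/of_real (1/4)) ^ DIM('a)"
  using gaussian_fourier_eucl(2)[of "of_real (1/4)" "0::'a"] unfolding q4 by simp
 also have "csqrt (of_real pi/of_real (1/4)) = of_real (sqrt (4*pi))" by (subst of_real_sqrt) (auto simp: mult.commute)
 finally have "(LBINT z. G z) = of_real (1/(4*pi) ^ DIM('a))*(of_real (sqrt (4*pi)) ^ DIM('a) * of_real (sqrt (4*pi)) ^ DIM('a))"
  unfolding G_def by simp
 also have "of_real (sqrt (4*pi)) ^ DIM('a) * of_real (sqrt (4*pi)) ^ DIM('a) = (of_real ((4*pi) ^ DIM('a)) :: complex)"
 proof -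
  have "sqrt (4*pi) ^ DIM('a) * sqrt (4*pi) ^ DIM('a) = (4*pi) ^ DIM('a)"
   by (subst power_mult_distrib[symmetric]) (simp add: abs_of_pos)
  then have "complex_of_real (sqrt (4*pi) ^ DIM('a) * sqrt (4*pi) ^ DIM('a)) = of_real ((4*pi) ^ DIM('a))" by (simp only:)
  then show ?thesis by (simp only: of_real_mult of_real_power)
 qed
 also have "complex_of_real (1/(4*pi) ^ DIM('a)) * of_real ((4*pi) ^ DIM('a)) = 1"
  by (subst of_real_mult[symmetric]) simp
 finally show "(LBINT z. G z) = 1" .
 define m where "m xi = complex_of_real (exp (- eta\<^sup>2*(norm xi)^2))" for xi :: 'a
 have mi: "intg m"
  using gaussian_fourier_eucl(1)[of "of_real (eta^2)" "0::'a"] eta unfolding m_def gm[symmetric] by simp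
 define K where "K z = (cN TYPE('a))^2*(LBINT xi. cis (- (xi \<bullet> z))*m xi)" for z
 have K: "of_real (eta ^ DIM('a))*K (eta *\<^sub>R z) = G z" for z
 proof -
  have "(LBINT xi. cis (- (xi \<bullet> (eta *\<^sub>R z)))*m xi) = (LBINT xi. exp (- complex_of_real (eta^2) * of_real ((norm xi)^2) - \<i> * of_real (xi \<bullet> (eta *\<^sub>R z))))"
   unfolding m_def gm[symmetric] by (simp add: mult.commute)
  also have "... = csqrt (of_real pi/of_real (eta^2)) ^ DIM('a)*exp (- of_real ((norm (eta *\<^sub>R z))^2)/(4 * of_real (eta^2)))"
   by (rule gaussian_fourier_eucl(2)) (use eta in simp)
  also have "csqrt (of_real pi/of_real (eta^2)) = of_real (sqrt (pi/eta^2))" by (subst of_real_sqrt) auto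
  also have "exp (- of_real ((norm (eta *\<^sub>R z))^2)/(4 * of_real (eta^2))) = complex_of_real (exp (- (norm z)\<^sup>2/4))"
   using eta by (simp add: exp_of_real[symmetric] power_mult_distrib)
  also have "sqrt (pi/eta^2) = sqrt pi/eta" using eta by (simp add: real_sqrt_divide)
  finally have "of_real (eta ^ DIM('a))*K (eta *\<^sub>R z) = of_real (eta ^ DIM('a)*(1/(2*pi) ^ DIM('a))*(sqrt pi/eta) ^ DIM('a)) * of_real (exp (- (norm z)\<^sup>2/4))"
   unfolding K_def cN_sq by (simp only: of_real_power of_real_mult mult.assoc)
  also have "eta ^ DIM('a)*(1/(2*pi) ^ DIM('a))*(sqrt pi/eta) ^ DIM('a) = (sqrt pi/(2*pi)) ^ DIM('a)"
   using eta by (simp add: power_divide)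
  also have "sqrt pi/(2*pi) = sqrt (4*pi)/(4*pi)" by (simp add: real_sqrt_mult)
  finally show ?thesis by (simp add: G_def power_divide)
 qed
 obtain B where B: "\<And>z. cmod (K z) <= B"
 proof
  fix z
  have "cmod (LBINT xi. cis (- (xi \<bullet> z))*m xi) <= (LBINT xi. cmod (cis (- (xi \<bullet> z))*m xi))" by (rule integral_norm_bound)
  then show "cmod (K z) <= cmod ((cN TYPE('a))^2)*(LBINT xi. cmod (m xi))"
   unfolding K_def norm_mult[of "(cN TYPE('a))^2"] by (intro mult_left_mono) (auto simp: norm_mult)
 qed
 have Km[measurable]: "K \<in> borelm" unfolding K_def[abs_def] m_def by measurable
 have Ki: "intg K"
 proof -
  have "K z = G ((1/eta) *\<^sub>R z)/of_real (eta ^ DIM('a))" for z using K[of "(1/eta) *\<^sub>R z"] eta by (simp add: field_simps)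
  moreover have "intg (\<lambda>z. G (0 + (1/eta) *\<^sub>R z))" by (rule integrable_lborel_affine[OF Gi]) (use eta in auto)
  ultimately have "intg (\<lambda>z. G (0 + (1/eta) *\<^sub>R z)/of_real (eta ^ DIM('a)))" by (intro integrable_divide) 
  moreover have "(\<lambda>z. G (0 + (1/eta) *\<^sub>R z)/of_real (eta ^ DIM('a))) = K"
   by (rule ext) (simp only: add_0_left \<open>\<And>z. K z = G ((1/eta) *\<^sub>R z) / of_real (eta ^ DIM('a))\<close>)
  ultimately show ?thesis by (simp only:)
 qed
 have int: "integrable (lborel \<Otimes>\<^sub>M lborel) (\<lambda>(x, z). f x*(cnj (f (x - z))*K z))"
 proof (rule lborel_pair.Fubini_integrable)
  show "(\<lambda>(x, z). f x*(cnj (f (x - z))*K z)) \<in> borel_measurable (lborel \<Otimes>\<^sub>M lborel)" by measurable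
  have B0: "0 <= B" using B norm_ge_zero order_trans by blast
  have i4: "intg (\<lambda>z. f (x - z))" for x using integrable_lborel_affine[OF f(2), of "-1" x] by simp
  have i5: "intg (\<lambda>z. cnj (f (x - z))*K z)" for x
  proof (rule Bochner_Integration.integrable_bound)
   show "intg (\<lambda>z. complex_of_real B*f (x - z))" using i4 by simp
   show "AE z in lborel. norm (cnj (f (x - z))*K z) <= norm (complex_of_real B*f (x - z))"
    using B B0 by (auto simp: norm_mult mult.commute intro!: mult_right_mono)
  qed measurable
  show "AE x in lborel. intg (\<lambda>y. case (x, y) of (x, z) => f x*(cnj (f (x - z))*K z))" using i5 by simp
  have bd: "(LBINT z. cmod (cnj (f (x - z))*K z)) <= B*(LBINT y. cmod (f y))" for x
  proof -
   have "(LBINT z. cmod (cnj (f (x - z))*K z)) <= (LBINT z. B*cmod (f (x - z)))"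
   proof (rule integral_mono[OF integrable_norm[OF i5]])
    show "intg (\<lambda>z. B*cmod (f (x - z)))" using integrable_norm[OF i4] by simp
    show "cmod (cnj (f (x - z))*K z) <= B*cmod (f (x - z))" for z
     using mult_right_mono[OF B[of z] norm_ge_zero[of "f (x - z)"]] by (simp add: norm_mult mult.commute)
   qed
   also have "... = B*(LBINT z. cmod (f (x - z)))" by simp
   also have "(LBINT z. cmod (f (x - z))) = (LBINT y. cmod (f y))"
    using integral_lborel_affine[of "\<lambda>y. cmod (f y)" "-1" x] by simp
   finally show ?thesis by simp
  qed
  show "intg (\<lambda>x. LBINT y. norm (case (x, y) of (x, z) => f x*(cnj (f (x - z))*K z)))"
  proof (rule Bochner_Integration.integrable_bound)
   show "intg (\<lambda>x. cmod (f x)*(B*(LBINT y. cmod (f y))))" using f(2) by simp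
   show "AE x in lborel. norm (LBINT y. norm (case (x, y) of (x, z) => f x*(cnj (f (x - z))*K z))) <= norm (cmod (f x)*(B*(LBINT y. cmod (f y))))"
    using bd B0 by (auto simp: norm_mult[of "f _"] intro!: mult_left_mono)
  qed measurable
 qed
 have "(LBINT xi. m xi*(ft f xi*cnj (ft f xi))) = (LBINT x. f x*(LBINT y. cnj (f y)*K (x - y)))"
  unfolding ft_sesquilinear[OF mi f(2) f(2)] K_def
  by (subst integral_mult_right_zero[symmetric], subst mult.left_commute, subst integral_mult_right_zero[symmetric]) (simp add: mult_ac)
 also have "(\<lambda>x. LBINT y. cnj (f y)*K (x - y)) = (\<lambda>x. LBINT z. cnj (f (x - z))*K z)"
 proof
  fix x show "(LBINT y. cnj (f y)*K (x - y)) = (LBINT z. cnj (f (x - z))*K z)"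
   using integral_lborel_affine[of "\<lambda>y. cnj (f y)*K (x - y)" "-1" x] by simp
 qed
 also have "(LBINT x. f x*(LBINT z. cnj (f (x - z))*K z)) = (LBINT x. LBINT z. f x*(cnj (f (x - z))*K z))"
  by simp
 also have "... = (LBINT z. LBINT x. f x*(cnj (f (x - z))*K z))"
  by (rule lborel_pair.Fubini_integral[OF int, symmetric])
 also have "... = (LBINT z. K z*ip f (\<lambda>x. f (x - z)))"
  unfolding ip_def by (subst integral_mult_right_zero[symmetric]) (simp add: mult_ac)
 also have "... = \<bar>eta\<bar> ^ DIM('a) *\<^sub>R (LBINT z. K (0 + eta *\<^sub>R z)*ip f (\<lambda>x. f (x - (0 + eta *\<^sub>R z))))"
  by (rule integral_lborel_affine) (use eta in "auto simp: ip_def")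
 also have "... = (LBINT z. G z*ip f (\<lambda>x. f (x - eta *\<^sub>R z)))"
  unfolding scaleR_conv_of_real using eta 
  by (subst integral_mult_right_zero[symmetric]) (simp add: K[symmetric] mult.assoc)
 finally show "(LBINT xi. of_real (exp (- eta\<^sup>2*(norm xi)^2))*(ft f xi*cnj (ft f xi))) = (LBINT z. G z*ip f (\<lambda>x. f (x - eta *\<^sub>R z)))"
  unfolding m_def .
qed

text \<open>Let eta decrease to 0. The damped integrals of |ft f|^2 increase to the full one; in
  their other representation they average the autocorrelation of f over translations by eta z, and
  these tend to the identity.\<close>

lemma plancherel_L1_L2:
 fixes f :: "'a::euclidean_space => complex"
 assumes f: "f \<in> L2" "intg f"
 shows "ft f \<in> L2" "nrm (ft f) = nrm f"
proof -
 have [measurable]: "f \<in> borelm" using f(1) by (rule L2_measurable)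
 define eta where "eta n = 1/real (Suc n)" for n
 have eta0: "eta n > 0" for n by (simp add: eta_def)
 have etal: "eta ----> 0" unfolding eta_def by (rule LIMSEQ_Suc[OF lim_1_over_n])
 define e where "e n xi = exp (- (eta n)\<^sup>2*(norm xi)^2)*(cmod (ft f xi))^2" for n and xi :: 'a
 obtain B where B: "\<And>xi. cmod (ft f xi) <= B" using ft_bound[of f] by blast
 have ei: "intg (e n)" for n
 proof (rule Bochner_Integration.integrable_bound)
  have "intg (\<lambda>xi::'a. exp (- complex_of_real ((eta n)^2) * of_real ((norm xi)^2) - \<i> * of_real (xi \<bullet> 0)))"
   by (rule gaussian_fourier_eucl(1)) (use eta0[of n] in simp)
  from integrable_norm[OF this] have "intg (\<lambda>xi::'a. exp (- (eta n)\<^sup>2*(norm xi)^2))" by (simp add: norm_exp_eq_Re)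
  then show "intg (\<lambda>xi::'a. exp (- (eta n)\<^sup>2*(norm xi)^2)*B^2)" by simp
  show "e n \<in> borel_measurable lborel" unfolding e_def by measurable
  show "AE xi in lborel. norm (e n xi) <= norm (exp (- (eta n)\<^sup>2*(norm xi)^2)*B^2)"
   unfolding e_def using B by (auto simp: abs_mult intro!: mult_left_mono power_mono)
 qed
 have ev: "complex_of_real (LBINT xi. e n xi) = (LBINT xi. of_real (exp (- (eta n)\<^sup>2*(norm xi)^2))*(ft f xi*cnj (ft f xi)))" for n
  unfolding integral_complex_of_real[symmetric] e_def by (simp add: complex_norm_square[symmetric])
 define G where "G z = of_real (1/(4*pi) ^ DIM('a)) * of_real (sqrt (4*pi) ^ DIM('a))*(of_real (exp (- (norm z)\<^sup>2/4)) :: complex)" for z :: 'a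
 note pr = plancherel_regularized[OF f, folded G_def[abs_def]]
 have G: "intg G" "(LBINT z. G z) = 1"
  using pr(2,3)[OF eta0[of 0]] by (auto simp: G_def[abs_def])
 have "(\<lambda>n. complex_of_real (LBINT xi. e n xi)) ----> of_real ((nrm f)^2)"
  unfolding ev pr(1)[OF eta0] using heat_limit[OF f(1) etal G] by (simp add: G_def[abs_def])
 then have "(\<lambda>n. LBINT xi. e n xi) ----> (nrm f)^2" using tendsto_of_real_iff by blast
 then have l1: "(\<lambda>n. ennreal (LBINT xi. e n xi)) ----> ennreal ((nrm f)^2)" by (rule tendsto_ennrealI)
 have inc: "incseq (\<lambda>n xi. ennreal (e n xi))"
 proof (rule incseq_SucI, rule le_funI)
  fix n xi
  have "eta (Suc n) <= eta n" by (simp add: eta_def frac_le)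
  then have "(eta (Suc n))^2 <= (eta n)^2" using eta0[of "Suc n"] by (intro power_mono) auto
  then show "ennreal (e n xi) <= ennreal (e (Suc n) xi)"
   unfolding e_def by (intro ennreal_leI mult_right_mono) (auto intro: mult_right_mono)
 qed
 have l2: "(\<lambda>n. NN xi. ennreal (e n xi)) ----> (NN xi. ennreal ((cmod (ft f xi))^2))"
 proof (rule nn_integral_LIMSEQ[OF inc])
  show "(\<lambda>xi. ennreal (e n xi)) \<in> borel_measurable lborel" for n unfolding e_def by measurable
  fix xi
  have "(\<lambda>n. e n xi) ----> exp (- 0\<^sup>2*(norm xi)^2)*(cmod (ft f xi))^2" unfolding e_def by (intro tendsto_intros etal)
  then show "(\<lambda>n. ennreal (e n xi)) ----> ennreal ((cmod (ft f xi))^2)" by (intro tendsto_ennrealI) simp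
 qed
 have "(NN xi. ennreal (e n xi)) = ennreal (LBINT xi. e n xi)" for n
  by (rule nn_integral_eq_integral[OF ei]) (simp add: e_def)
 with l2 have "(\<lambda>n. ennreal (LBINT xi. e n xi)) ----> (NN xi. ennreal ((cmod (ft f xi))^2))" by simp
 from LIMSEQ_unique[OF this l1] have eq: "(NN xi. ennreal ((cmod (ft f xi))^2)) = ennreal ((nrm f)^2)" .
 have m: "ft f \<in> borelm" by measurable
 show L: "ft f \<in> L2" using L2I_nn[OF m _ nrm_nonneg[of f]] eq by simp
 have "ennreal ((nrm (ft f))^2) = ennreal ((nrm f)^2)" using eq nn_integral_nrm[OF L] by simp
 then have "(nrm (ft f))^2 = (nrm f)^2" by (subst (asm) ennreal_inj) auto
 then show "nrm (ft f) = nrm f" by (simp add: power2_eq_iff_nonneg)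
qed

lemma ft_add: "intg f ==> intg g ==> ft (\<lambda>x. f x + g x) xi = ft f xi + ft g xi"
 unfolding ft_def by (simp add: distrib_left integrable_cis_mult)

lemma ft_diff: "intg f ==> intg g ==> ft (\<lambda>x. f x - g x) xi = ft f xi - ft g xi"
 unfolding ft_def by (simp add: right_diff_distrib integrable_cis_mult)

lemma ft_cmult: "ft (\<lambda>x. c*f x) xi = c*ft f xi"
 unfolding ft_def by (simp add: mult.left_commute[of _ c])

lemma ft_cnj: "ft (\<lambda>x. cnj (f x)) xi = cnj (ft f (- xi))"
 unfolding ft_def by (simp flip: Bochner_Integration.integral_cnj add: cis_cnj)

lemma ft_reflect:
 assumes [measurable]: "f \<in> borelm"
 shows "ft (\<lambda>x. f (- x)) xi = ft f (- xi)"
 unfolding ft_def using integral_lborel_minus[of "\<lambda>x. cis (- (xi \<bullet> (- x)))*f x"] by simp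

section \<open>Extension of the transform from cutoffs to all of L^2\<close>

definition cutoff :: "('a::euclidean_space => complex) => real => 'a => complex" where
 "cutoff f R x = f x*indicator (cball 0 R) x"

lemma cutoff_L2: "f \<in> L2 ==> cutoff f R \<in> L2"
 unfolding cutoff_def[abs_def] by (rule L2_indicator) auto

lemma cutoff_integrable:
 fixes f :: "'a::euclidean_space => complex"
 assumes "f \<in> L2" shows "intg (cutoff f R)"
proof -
 have "(\<lambda>x. indicator (cball (0::'a) R) x) \<in> L2"
  by (rule L2_indicator_set) (use emeasure_bounded_finite[OF bounded_cball[of "0::'a" R]] in auto)
 from L2_mult_integrable[OF assms this] show ?thesis by (simp add: cutoff_def[abs_def])
qed

lemma cutoff_tendsto:
 fixes f :: "'a::euclidean_space => complex"
 assumes f: "f \<in> L2" shows "((\<lambda>R. nrm (\<lambda>x. f x - cutoff f R x)) \<longlongrightarrow> 0) at_top"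
proof (rule tendsto_at_topI_sequentially)
 fix X :: "nat => real" assume X: "filterlim X at_top sequentially"
 have [measurable]: "f \<in> borelm" using f by (rule L2_measurable)
 have "(\<lambda>n. nrm (\<lambda>x. cutoff f (X n) x - f x)) ----> 0"
 proof (rule L2_dct[OF _ f f])
  show "cutoff f (X n) \<in> borelm" for n by (rule L2_measurable[OF cutoff_L2[OF f]])
  show "AE x in lborel. cmod (cutoff f (X n) x) <= cmod (f x)" for n by (auto simp: cutoff_def indicator_def)
  show "AE x in lborel. (\<lambda>n. cutoff f (X n) x) ----> f x"
  proof (rule AE_I2, rule tendsto_eventually, goal_cases)
   case (1 x)
   have "\<forall>\<^sub>F n in sequentially. norm x <= X n" using X by (simp add: filterlim_at_top)
   then show ?case
    by eventually_elim (simp add: cutoff_def indicator_def)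
  qed
 qed
 then show "(\<lambda>n. nrm (\<lambda>x. f x - cutoff f (X n) x)) ----> 0" by (subst nrm_minus_commute)
qed

lemma has_fourier_L2_iff:
 "has_fourier_L2 f g \<longleftrightarrow> f \<in> L2 \<and> g \<in> L2 \<and> ((\<lambda>R. nrm (\<lambda>xi. g xi - ft (cutoff f R) xi)) \<longlongrightarrow> 0) at_top"
proof (cases "f \<in> L2 \<and> g \<in> L2")
 case True
 have "(\<lambda>xi. g xi - ft (cutoff f R) xi) \<in> L2" for R
  using True by (intro L2_diff plancherel_L1_L2 cutoff_L2 cutoff_integrable) auto
 then have "Lp_norm 2 (\<lambda>xi. g xi - fourier_cutoff R f xi) = ennreal (nrm (\<lambda>xi. g xi - ft (cutoff f R) xi))" for R
  unfolding fourier_cutoff_eq by (simp only: Lp_norm_2[symmetric]) (simp only: cutoff_def[abs_def])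
 then have "((\<lambda>R. Lp_norm 2 (\<lambda>xi. g xi - fourier_cutoff R f xi)) \<longlongrightarrow> 0) at_top \<longleftrightarrow> ((\<lambda>R. ennreal (nrm (\<lambda>xi. g xi - ft (cutoff f R) xi))) \<longlongrightarrow> ennreal 0) at_top"
  by simp
 also have "... \<longleftrightarrow> ((\<lambda>R. nrm (\<lambda>xi. g xi - ft (cutoff f R) xi)) \<longlongrightarrow> 0) at_top"
  by (rule tendsto_ennreal_iff) auto
 finally show ?thesis using True by (simp add: has_fourier_L2_def)
qed (auto simp: has_fourier_L2_def)

lemma nrm_ft_cut_diff:
 assumes "f \<in> L2" "g \<in> L2" "intg f" "intg g"
 shows "nrm (\<lambda>xi. ft f xi - ft g xi) = nrm (\<lambda>x. f x - g x)"
proof -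
 have "(\<lambda>xi. ft f xi - ft g xi) = ft (\<lambda>x. f x - g x)" by (rule ext) (simp add: ft_diff assms)
 then show ?thesis using plancherel_L1_L2(2)[of "\<lambda>x. f x - g x"] assms by (simp add: L2_diff)
qed

text \<open>Plancherel's identity for the difference of two cutoffs makes their transforms a Cauchy
  family. The same inequality, passed to the limit in one of the radii, bounds the error at radius R
  by the L^2 norm of f outside the ball.\<close>

lemma has_fourier_L2_exists:
 fixes f :: "'a::euclidean_space => complex"
 assumes f: "f \<in> L2" shows "\<exists>g. has_fourier_L2 f g"
proof -
 have cL: "cutoff f R \<in> L2" and ci: "intg (cutoff f R)" for R by (auto intro: cutoff_L2 cutoff_integrable f)
 have FL: "ft (cutoff f R) \<in> L2" for R by (intro plancherel_L1_L2 cL ci)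
 have tri: "nrm (\<lambda>xi. ft (cutoff f R) xi - ft (cutoff f S) xi) <= nrm (\<lambda>x. f x - cutoff f R x) + nrm (\<lambda>x. f x - cutoff f S x)" for R S
  using nrm_triangle_diff[OF cL f cL, of R S] by (simp add: nrm_ft_cut_diff cL ci nrm_minus_commute[of "cutoff f R" f])
 have lim: "(\<lambda>n. nrm (\<lambda>x. f x - cutoff f (real n) x)) ----> 0"
  by (rule filterlim_compose[OF cutoff_tendsto[OF f] filterlim_real_sequentially])
 have "\<exists>g\<in>L2. (\<lambda>n. nrm (\<lambda>x. ft (cutoff f (real n)) x - g x)) ----> 0"
 proof (rule L2_complete[OF FL])
  fix e :: real assume "e > 0"
  with LIMSEQ_D[OF lim, of "e/2"] obtain M where M: "\<And>n. n \<ge> M ==> nrm (\<lambda>x. f x - cutoff f (real n) x) < e/2" by auto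
  show "\<exists>M. \<forall>m\<ge>M. \<forall>n\<ge>M. nrm (\<lambda>x. ft (cutoff f (real m)) x - ft (cutoff f (real n)) x) < e"
  proof (intro exI allI impI)
   fix m n assume "M <= m" "M <= n"
   with M[of m] M[of n] tri[of "real m" "real n"] show "nrm (\<lambda>x. ft (cutoff f (real m)) x - ft (cutoff f (real n)) x) < e" by linarith
  qed
 qed
 then obtain g where g: "g \<in> L2" "(\<lambda>n. nrm (\<lambda>x. ft (cutoff f (real n)) x - g x)) ----> 0" by auto
 have le: "nrm (\<lambda>xi. g xi - ft (cutoff f R) xi) <= nrm (\<lambda>x. f x - cutoff f R x)" for R
 proof (rule LIMSEQ_le_const)
  have "(\<lambda>n. nrm (\<lambda>x. ft (cutoff f (real n)) x - g x) + (nrm (\<lambda>x. f x - cutoff f (real n) x) + nrm (\<lambda>x. f x - cutoff f R x))) ----> 0 + (0 + nrm (\<lambda>x. f x - cutoff f R x))"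
   by (intro tendsto_intros g lim)
  then show "(\<lambda>n. nrm (\<lambda>x. ft (cutoff f (real n)) x - g x) + (nrm (\<lambda>x. f x - cutoff f (real n) x) + nrm (\<lambda>x. f x - cutoff f R x))) ----> nrm (\<lambda>x. f x - cutoff f R x)" by simp
  show "\<exists>N. \<forall>n\<ge>N. nrm (\<lambda>xi. g xi - ft (cutoff f R) xi) <= nrm (\<lambda>x. ft (cutoff f (real n)) x - g x) + (nrm (\<lambda>x. f x - cutoff f (real n) x) + nrm (\<lambda>x. f x - cutoff f R x))"
  proof (intro exI allI impI)
   fix n :: nat
   show "nrm (\<lambda>xi. g xi - ft (cutoff f R) xi) <= nrm (\<lambda>x. ft (cutoff f (real n)) x - g x) + (nrm (\<lambda>x. f x - cutoff f (real n) x) + nrm (\<lambda>x. f x - cutoff f R x))"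
    using nrm_triangle_diff[OF g(1) FL[of "real n"] FL[of R]] tri[of "real n" R] nrm_minus_commute[of g "ft (cutoff f (real n))"] by linarith
  qed
 qed
 have "((\<lambda>R. nrm (\<lambda>xi. g xi - ft (cutoff f R) xi)) \<longlongrightarrow> 0) at_top"
  by (rule tendsto_sandwich[OF _ _ tendsto_const cutoff_tendsto[OF f]]) (auto simp: le)
 with f g(1) show ?thesis by (auto simp: has_fourier_L2_iff)
qed

lemma has_fourier_L2: "f \<in> L2 ==> has_fourier_L2 f (FT f)"
 unfolding fourier_L2_def by (rule someI_ex[OF has_fourier_L2_exists])

lemma fourier_L2_L2: "f \<in> L2 ==> FT f \<in> L2"
 using has_fourier_L2 by (auto simp: has_fourier_L2_def)

lemma has_fourier_L2_unique:
 assumes "has_fourier_L2 f g" "has_fourier_L2 f h" shows "AE x in lborel. g x = h x"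
proof -
 have L: "f \<in> L2" "g \<in> L2" "h \<in> L2" using assms by (auto simp: has_fourier_L2_def)
 have FL: "ft (cutoff f R) \<in> L2" for R by (intro plancherel_L1_L2 cutoff_L2 cutoff_integrable L)
 have "((\<lambda>R. nrm (\<lambda>xi. g xi - ft (cutoff f R) xi) + nrm (\<lambda>xi. h xi - ft (cutoff f R) xi)) \<longlongrightarrow> 0 + 0) at_top"
  using assms by (intro tendsto_intros) (auto simp: has_fourier_L2_iff)
 moreover have "nrm (\<lambda>xi. g xi - h xi) <= nrm (\<lambda>xi. g xi - ft (cutoff f R) xi) + nrm (\<lambda>xi. h xi - ft (cutoff f R) xi)" for R
  using nrm_triangle_diff[OF L(2) FL L(3), of R] by (simp add: nrm_minus_commute[of h])
 ultimately have "nrm (\<lambda>xi. g xi - h xi) <= 0"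
  by (intro tendsto_lowerbound[where F="at_top :: real filter"]) (auto simp: trivial_limit_at_top_linorder)
 then have "nrm (\<lambda>xi. g xi - h xi) = 0" using nrm_nonneg[of "\<lambda>xi. g xi - h xi"] by linarith
 then show ?thesis using nrm_eq_0[OF L2_diff[OF L(2,3)]] by simp
qed

lemma fourier_L2_eqI: "has_fourier_L2 f g ==> AE x in lborel. FT f x = g x"
 using has_fourier_L2_unique[OF has_fourier_L2, of f g] by (auto simp: has_fourier_L2_def)

text \<open>The conclusion is equality everywhere, although f and g agree only almost everywhere:
  their cutoffs have the same Fourier integrals, so the choice in \<open>fourier_L2\<close> is made
  from the same predicate for both.\<close>

lemma fourier_L2_cong:
 fixes f g :: "'a::euclidean_space => complex"
 assumes f: "f \<in> L2" "g \<in> L2" "AE x in lborel. f x = g x" shows "FT f = FT g"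
proof -
 have [measurable]: "f \<in> borelm" "g \<in> borelm" using f by (auto intro: L2_measurable)
 have "ft (cutoff f R) = ft (cutoff g R)" for R
  unfolding ft_def[abs_def] cutoff_def
 proof (intro ext arg_cong2[where f=times] refl integral_cong_AE)
  fix xi :: 'a
  show "(\<lambda>x. cis (- (xi \<bullet> x))*(f x*indicator (cball 0 R) x)) \<in> borel_measurable lborel"
   "(\<lambda>x. cis (- (xi \<bullet> x))*(g x*indicator (cball 0 R) x)) \<in> borel_measurable lborel"
   using borel_measurable_indicator[of "cball (0::'a) R" borel] by measurable
  show "AE x in lborel. cis (- (xi \<bullet> x))*(f x*indicator (cball 0 R) x) = cis (- (xi \<bullet> x))*(g x*indicator (cball 0 R) x)"
   using f(3) by eventually_elim simp
 qed
 then have "has_fourier_L2 f = has_fourier_L2 g" using f by (intro ext) (simp add: has_fourier_L2_iff)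
 then show ?thesis by (simp add: fourier_L2_def)
qed

lemma nrm_fourier_L2: 
 assumes f: "f \<in> L2" shows "nrm (FT f) = nrm f"
proof -
 have FL: "ft (cutoff f R) \<in> L2" "nrm (ft (cutoff f R)) = nrm (cutoff f R)" for R by (intro plancherel_L1_L2 cutoff_L2 cutoff_integrable f)+
 have hf: "((\<lambda>R. nrm (\<lambda>xi. FT f xi - ft (cutoff f R) xi)) \<longlongrightarrow> 0) at_top"
  using has_fourier_L2[OF f] by (simp add: has_fourier_L2_iff)
 have "((\<lambda>R. nrm (\<lambda>xi. FT f xi - ft (cutoff f R) xi) + nrm (\<lambda>x. f x - cutoff f R x)) \<longlongrightarrow> 0 + 0) at_top"
  by (intro tendsto_add hf cutoff_tendsto f)
 moreover have "\<bar>nrm (FT f) - nrm f\<bar> <= nrm (\<lambda>xi. FT f xi - ft (cutoff f R) xi) + nrm (\<lambda>x. f x - cutoff f R x)" for R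
  using nrm_diff_ge[OF fourier_L2_L2[OF f] FL(1), of R] nrm_diff_ge[OF f cutoff_L2[OF f], of R] FL(2)[of R] by linarith
 ultimately have "\<bar>nrm (FT f) - nrm f\<bar> <= 0"
  by (intro tendsto_lowerbound[where F="at_top :: real filter"]) (auto simp: trivial_limit_at_top_linorder)
 then show ?thesis by simp
qed

lemma fourier_L2_add:
 assumes f: "f \<in> L2" and g: "g \<in> L2"
 shows "AE x in lborel. FT (\<lambda>x. f x + g x) x = FT f x + FT g x"
proof (rule fourier_L2_eqI, unfold has_fourier_L2_iff, intro conjI L2_add f g fourier_L2_L2)
 have FL: "ft (cutoff f R) \<in> L2" "ft (cutoff g R) \<in> L2" for R by (intro plancherel_L1_L2 cutoff_L2 cutoff_integrable f g)+
 have e: "ft (cutoff (\<lambda>x. f x + g x) R) = (\<lambda>xi. ft (cutoff f R) xi + ft (cutoff g R) xi)" for R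
  by (subst ft_add[OF cutoff_integrable[OF f] cutoff_integrable[OF g], symmetric]) (simp add: cutoff_def[abs_def] distrib_right)
 have "((\<lambda>R. nrm (\<lambda>xi. FT f xi - ft (cutoff f R) xi) + nrm (\<lambda>xi. FT g xi - ft (cutoff g R) xi)) \<longlongrightarrow> 0 + 0) at_top"
  using has_fourier_L2[OF f] has_fourier_L2[OF g] by (intro tendsto_add) (auto simp: has_fourier_L2_iff)
 then have l: "((\<lambda>R. nrm (\<lambda>xi. FT f xi - ft (cutoff f R) xi) + nrm (\<lambda>xi. FT g xi - ft (cutoff g R) xi)) \<longlongrightarrow> 0) at_top" by simp
 have "nrm (\<lambda>xi. FT f xi + FT g xi - ft (cutoff (\<lambda>x. f x + g x) R) xi) <= nrm (\<lambda>xi. FT f xi - ft (cutoff f R) xi) + nrm (\<lambda>xi. FT g xi - ft (cutoff g R) xi)" for R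
  using nrm_triangle[OF L2_diff[OF fourier_L2_L2[OF f] FL(1)[of R]] L2_diff[OF fourier_L2_L2[OF g] FL(2)[of R]]]
  by (simp add: e algebra_simps)
 then show "((\<lambda>R. nrm (\<lambda>xi. FT f xi + FT g xi - ft (cutoff (\<lambda>x. f x + g x) R) xi)) \<longlongrightarrow> 0) at_top"
  by (intro tendsto_sandwich[OF _ _ tendsto_const l]) auto
qed

lemma fourier_L2_cmult:
 assumes f: "f \<in> L2"
 shows "AE x in lborel. FT (\<lambda>x. c*f x) x = c*FT f x"
proof (rule fourier_L2_eqI, unfold has_fourier_L2_iff, intro conjI L2_cmult f fourier_L2_L2)
 have e: "ft (cutoff (\<lambda>x. c*f x) R) = (\<lambda>xi. c*ft (cutoff f R) xi)" for R
  by (subst ft_cmult[symmetric]) (simp add: cutoff_def[abs_def] mult.assoc)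
 have "((\<lambda>R. cmod c*nrm (\<lambda>xi. FT f xi - ft (cutoff f R) xi)) \<longlongrightarrow> 0) at_top"
  using has_fourier_L2[OF f] by (intro tendsto_mult_right_zero) (auto simp: has_fourier_L2_iff)
 then show "((\<lambda>R. nrm (\<lambda>xi. c*FT f xi - ft (cutoff (\<lambda>x. c*f x) R) xi)) \<longlongrightarrow> 0) at_top"
  by (simp add: e right_diff_distrib[symmetric] nrm_cmult)
qed

lemma fourier_L2_diff:
 assumes f: "f \<in> L2" and g: "g \<in> L2"
 shows "AE x in lborel. FT (\<lambda>x. f x - g x) x = FT f x - FT g x"
 using fourier_L2_add[OF f L2_cmult[OF g, of "-1"]] fourier_L2_cmult[OF g, of "-1"]
 by eventually_elim simp

lemma fourier_L2_integrable:
 assumes f: "f \<in> L2" "intg f"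
 shows "AE x in lborel. FT f x = ft f x"
proof (rule fourier_L2_eqI, unfold has_fourier_L2_iff, intro conjI f plancherel_L1_L2)
 show "((\<lambda>R. nrm (\<lambda>xi. ft f xi - ft (cutoff f R) xi)) \<longlongrightarrow> 0) at_top"
  by (subst nrm_ft_cut_diff) (intro f cutoff_L2 cutoff_integrable cutoff_tendsto)+
qed

lemma fourier_L2_cnj:
 assumes f: "f \<in> L2"
 shows "AE x in lborel. FT (\<lambda>x. cnj (f x)) x = cnj (FT f (- x))"
proof (rule fourier_L2_eqI, unfold has_fourier_L2_iff, intro conjI L2_cnj f)
 show "(\<lambda>x. FT f (- x)) \<in> L2" by (intro L2_reflect fourier_L2_L2 f)
 have FL: "ft (cutoff f R) \<in> L2" for R by (intro plancherel_L1_L2 cutoff_L2 cutoff_integrable f)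
 have e: "ft (cutoff (\<lambda>x. cnj (f x)) R) xi = cnj (ft (cutoff f R) (- xi))" for R xi
  unfolding ft_cnj[symmetric] by (rule arg_cong[where f="\<lambda>h. ft h xi"]) (auto simp: cutoff_def indicator_def)
 have "nrm (\<lambda>xi. cnj (FT f (- xi)) - ft (cutoff (\<lambda>x. cnj (f x)) R) xi) = nrm (\<lambda>xi. FT f xi - ft (cutoff f R) xi)" for R
  unfolding e complex_cnj_diff[symmetric] nrm_cnj
  by (rule nrm_reflect[where f="\<lambda>xi. FT f xi - ft (cutoff f R) xi"]) (intro L2_diff fourier_L2_L2 f FL)
 then show "((\<lambda>R. nrm (\<lambda>xi. cnj (FT f (- xi)) - ft (cutoff (\<lambda>x. cnj (f x)) R) xi)) \<longlongrightarrow> 0) at_top"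
  using has_fourier_L2[OF f] by (simp add: has_fourier_L2_iff)
qed

lemma fourier_L2_reflect:
 assumes f: "f \<in> L2"
 shows "AE x in lborel. FT (\<lambda>x. f (- x)) x = FT f (- x)"
proof (rule fourier_L2_eqI, unfold has_fourier_L2_iff, intro conjI L2_reflect f fourier_L2_L2)
 have FL: "ft (cutoff f R) \<in> L2" for R by (intro plancherel_L1_L2 cutoff_L2 cutoff_integrable f)
 have e: "ft (cutoff (\<lambda>x. f (- x)) R) xi = ft (cutoff f R) (- xi)" for R xi
  unfolding ft_reflect[OF L2_measurable[OF cutoff_L2[OF f]], symmetric] by (rule arg_cong[where f="\<lambda>h. ft h xi"]) (auto simp: cutoff_def indicator_def)
 have "nrm (\<lambda>xi. FT f (- xi) - ft (cutoff (\<lambda>x. f (- x)) R) xi) = nrm (\<lambda>xi. FT f xi - ft (cutoff f R) xi)" for R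
  unfolding e
  by (rule nrm_reflect[where f="\<lambda>xi. FT f xi - ft (cutoff f R) xi"]) (intro L2_diff fourier_L2_L2 f FL)
 then show "((\<lambda>R. nrm (\<lambda>xi. FT f (- xi) - ft (cutoff (\<lambda>x. f (- x)) R) xi)) \<longlongrightarrow> 0) at_top"
  using has_fourier_L2[OF f] by (simp add: has_fourier_L2_iff)
qed

lemma ip_tendsto:
 assumes "\<And>i. a i \<in> L2" "\<And>i. b i \<in> L2" "f \<in> L2" "g \<in> L2"
  "((\<lambda>i. nrm (\<lambda>x. f x - a i x)) \<longlongrightarrow> 0) F" "((\<lambda>i. nrm (\<lambda>x. g x - b i x)) \<longlongrightarrow> 0) F"
 shows "((\<lambda>i. ip (a i) (b i)) \<longlongrightarrow> ip f g) F"
proof -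
 have l: "((\<lambda>i. nrm (\<lambda>x. f x - a i x)*(nrm g + nrm (\<lambda>x. g x - b i x)) + nrm f*nrm (\<lambda>x. g x - b i x)) \<longlongrightarrow> 0*(nrm g + 0) + nrm f*0) F"
  by (intro tendsto_intros assms)
 have "((\<lambda>i. ip f g - ip (a i) (b i)) \<longlongrightarrow> 0) F"
 proof (rule Lim_null_comparison)
  show "((\<lambda>i. nrm (\<lambda>x. f x - a i x)*(nrm g + nrm (\<lambda>x. g x - b i x)) + nrm f*nrm (\<lambda>x. g x - b i x)) \<longlongrightarrow> 0) F" using l by simp
  show "\<forall>\<^sub>F i in F. norm (ip f g - ip (a i) (b i)) <= nrm (\<lambda>x. f x - a i x)*(nrm g + nrm (\<lambda>x. g x - b i x)) + nrm f*nrm (\<lambda>x. g x - b i x)"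
  proof (rule always_eventually, rule allI, goal_cases)
   case (1 i)
   have "ip f g - ip (a i) (b i) = ip (\<lambda>x. f x - a i x) (b i) + ip f (\<lambda>x. g x - b i x)"
    by (simp add: ip_diff_left ip_diff_right assms)
   moreover have "cmod (ip (\<lambda>x. f x - a i x) (b i)) <= nrm (\<lambda>x. f x - a i x)*nrm (b i)" by (intro ip_CS L2_diff assms)
   moreover have "cmod (ip f (\<lambda>x. g x - b i x)) <= nrm f*nrm (\<lambda>x. g x - b i x)" by (intro ip_CS L2_diff assms)
   moreover have "nrm (b i) <= nrm g + nrm (\<lambda>x. g x - b i x)" using nrm_diff_ge[OF assms(4) assms(2), of i] by linarith
   then have "nrm (\<lambda>x. f x - a i x)*nrm (b i) <= nrm (\<lambda>x. f x - a i x)*(nrm g + nrm (\<lambda>x. g x - b i x))" by (rule mult_left_mono) simp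
   ultimately show ?case
    using norm_triangle_ineq[of "ip (\<lambda>x. f x - a i x) (b i)" "ip f (\<lambda>x. g x - b i x)"] by simp
  qed
 qed
 then have "((\<lambda>i. ip f g - (ip f g - ip (a i) (b i))) \<longlongrightarrow> ip f g - 0) F" by (intro tendsto_intros)
 then show ?thesis by simp
qed

lemma fourier_L2_mult_formula:
 assumes f: "f \<in> L2" and g: "g \<in> L2"
 shows "(LBINT x. FT f x*g x) = (LBINT x. f x*FT g x)"
proof -
 have ipc: "(LBINT x. a x*b x) = ip a (\<lambda>x. cnj (b x))" for a b :: "'a => complex" by (simp add: ip_def)
 have FL: "ft (cutoff f R) \<in> L2" "ft (cutoff g R) \<in> L2" for R by (intro plancherel_L1_L2 cutoff_L2 cutoff_integrable f g)+
 have hf: "((\<lambda>R. nrm (\<lambda>xi. FT f xi - ft (cutoff f R) xi)) \<longlongrightarrow> 0) at_top" "((\<lambda>R. nrm (\<lambda>xi. FT g xi - ft (cutoff g R) xi)) \<longlongrightarrow> 0) at_top"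
  using has_fourier_L2[OF f] has_fourier_L2[OF g] by (simp_all add: has_fourier_L2_iff)
 have cd: "((\<lambda>R. nrm (\<lambda>x. cnj (h x) - cnj (k R x))) \<longlongrightarrow> 0) at_top" if "((\<lambda>R. nrm (\<lambda>x. h x - k R x)) \<longlongrightarrow> 0) at_top" for h :: "'a => complex" and k :: "real => _"
  using that unfolding complex_cnj_diff[symmetric] nrm_cnj .
 have "((\<lambda>R. ip (ft (cutoff f R)) (\<lambda>x. cnj (cutoff g R x))) \<longlongrightarrow> ip (FT f) (\<lambda>x. cnj (g x))) at_top"
  by (rule ip_tendsto) (intro FL L2_cnj cutoff_L2 f g fourier_L2_L2 hf cd cutoff_tendsto)+
 moreover have "((\<lambda>R. ip (cutoff f R) (\<lambda>x. cnj (ft (cutoff g R) x))) \<longlongrightarrow> ip f (\<lambda>x. cnj (FT g x))) at_top"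
  by (rule ip_tendsto) (intro FL L2_cnj cutoff_L2 f g fourier_L2_L2 hf cd cutoff_tendsto)+
 moreover have "ip (ft (cutoff f R)) (\<lambda>x. cnj (cutoff g R x)) = ip (cutoff f R) (\<lambda>x. cnj (ft (cutoff g R) x))" for R
  using ft_mult_formula[OF cutoff_integrable[OF f] cutoff_integrable[OF g], of R R] unfolding ip_def by (simp add: mult.commute)
 ultimately show ?thesis unfolding ipc
  by (simp add: tendsto_unique[OF trivial_limit_at_top_linorder])
qed

text \<open>Polarisation: equality of norms for sums gives the real parts, and replacing g by i g
  gives the imaginary parts.\<close>

lemma ip_fourier_L2:
 assumes f: "f \<in> L2" and g: "g \<in> L2"
 shows "ip (FT f) (FT g) = ip f g"
proof -
 have re: "Re (ip (FT f) (FT g)) = Re (ip f g)" if f: "f \<in> L2" and g: "g \<in> L2" for f g :: "'a => complex"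
 proof -
  have "nrm (\<lambda>x. FT f x + FT g x) = nrm (FT (\<lambda>x. f x + g x))"
   by (rule nrm_cong_AE) (use fourier_L2_add[OF f g] in "auto simp: eq_commute intro!: L2_measurable L2_add fourier_L2_L2 f g")
  also have "... = nrm (\<lambda>x. f x + g x)" by (intro nrm_fourier_L2 L2_add f g)
  finally have "(nrm (\<lambda>x. FT f x + FT g x))^2 = (nrm (\<lambda>x. f x + g x))^2" by simp
  then show ?thesis by (simp add: nrm_add_sq f g fourier_L2_L2 nrm_fourier_L2)
 qed
 have "ip (FT f) (FT (\<lambda>x. \<i>*g x)) = ip (FT f) (\<lambda>x. \<i>*FT g x)"
  by (rule ip_cong_AE) (use fourier_L2_cmult[OF g, of \<i>] in "auto intro!: L2_measurable L2_cmult fourier_L2_L2 f g")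
 then have "Im (ip (FT f) (FT g)) = Im (ip f g)"
  using re[OF f L2_cmult[OF g, of \<i>]] by (simp add: ip_cmult_right)
 with re[OF f g] show ?thesis by (simp add: complex_eq_iff)
qed

text \<open>By duality: the multiplication formula moves one transform onto the conjugate of a test
  function h, conjugation turns that into the transform of the reflected h, and unitarity removes
  the remaining pair of transforms.\<close>

lemma fourier_L2_inversion:
 assumes f: "f \<in> L2"
 shows "AE x in lborel. FT (FT f) x = f (- x)"
proof -
 have FF: "FT (FT f) \<in> L2" by (intro fourier_L2_L2 f)
 have rf: "(\<lambda>x. f (- x)) \<in> L2" by (intro L2_reflect f)
 have key: "ip (FT (FT f)) h = ip (\<lambda>x. f (- x)) h" if h: "h \<in> L2" for h
 proof -
  have [measurable]: "h \<in> borelm" "f \<in> borelm" using h f by (auto intro: L2_measurable)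
  have "ip (FT (FT f)) h = (LBINT x. FT f x*FT (\<lambda>x. cnj (h x)) x)"
   unfolding ip_def by (rule fourier_L2_mult_formula[OF fourier_L2_L2[OF f] L2_cnj[OF h]])
  also have "... = ip (FT f) (\<lambda>x. cnj (FT (\<lambda>x. cnj (h x)) x))" by (simp add: ip_def)
  also have "... = ip (FT f) (FT (\<lambda>x. h (- x)))"
  proof (rule ip_cong_AE)
   show "AE x in lborel. cnj (FT (\<lambda>x. cnj (h x)) x) = FT (\<lambda>x. h (- x)) x"
    using fourier_L2_cnj[OF h] fourier_L2_reflect[OF h] by eventually_elim simp
  qed (auto intro!: L2_measurable L2_cnj L2_reflect fourier_L2_L2 f h)
  also have "... = ip f (\<lambda>x. h (- x))" by (intro ip_fourier_L2 f L2_reflect h)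
  also have "... = ip (\<lambda>x. f (- x)) h"
   unfolding ip_def using integral_lborel_minus[of "\<lambda>x. f x*cnj (h (- x))"] by simp
  finally show ?thesis .
 qed
 have d: "(\<lambda>x. FT (FT f) x - f (- x)) \<in> L2" by (intro L2_diff FF rf)
 have "ip (\<lambda>x. FT (FT f) x - f (- x)) (\<lambda>x. FT (FT f) x - f (- x)) = 0"
  by (subst ip_diff_left[OF FF rf d]) (simp add: key[OF d])
 from AE_zero_if_ip[OF d this] show ?thesis by simp
qed

section \<open>Fourier multipliers\<close>

definition fmul :: "('a::euclidean_space => complex) => ('a => complex) => 'a => complex" where
 "fmul m f x = FT (\<lambda>xi. m xi*FT f xi) (- x)"

definition bmeas :: "('a::euclidean_space => complex) => bool" where
 "bmeas m \<longleftrightarrow> m \<in> borelm \<and> (\<exists>B. \<forall>xi. cmod (m xi) <= B)"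

lemma bmeasI: "m \<in> borelm ==> (\<And>xi. cmod (m xi) <= B) ==> bmeas m"
 by (auto simp: bmeas_def)

lemma bmeas_times: 
 assumes "bmeas m" "bmeas n" shows "bmeas (\<lambda>xi. m xi*n xi)"
proof -
 obtain B C where B: "\<And>xi. cmod (m xi) <= B" "\<And>xi. cmod (n xi) <= C" using assms by (auto simp: bmeas_def)
 have [measurable]: "m \<in> borelm" "n \<in> borelm" using assms by (auto simp: bmeas_def)
 have "cmod (m xi*n xi) <= B*C" for xi
  unfolding norm_mult by (intro mult_mono B) (use B(1)[of xi] norm_ge_zero[of "m xi"] in "linarith, simp")
 then show ?thesis by (intro bmeasI) measurable
qed

lemma bmeas_L2: "bmeas m ==> f \<in> L2 ==> (\<lambda>xi. m xi*f xi) \<in> L2"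
 by (auto simp: bmeas_def intro: L2_bounded_mult)

lemma fmul_L2: "bmeas m ==> f \<in> L2 ==> fmul m f \<in> L2"
 unfolding fmul_def[abs_def] by (intro L2_reflect fourier_L2_L2 bmeas_L2)

lemma fourier_fmul:
 assumes m: "bmeas m" and f: "f \<in> L2"
 shows "AE xi in lborel. FT (fmul m f) xi = m xi*FT f xi"
proof -
 have L: "(\<lambda>xi. m xi*FT f xi) \<in> L2" by (intro bmeas_L2 fourier_L2_L2 f m)
 have "AE xi in lborel. FT (fmul m f) xi = FT (FT (\<lambda>xi. m xi*FT f xi)) (- xi)"
  unfolding fmul_def[abs_def] by (rule fourier_L2_reflect) (intro fourier_L2_L2 L)
 moreover have "AE xi in lborel. FT (FT (\<lambda>xi. m xi*FT f xi)) (- xi) = m (- (- xi))*FT f (- (- xi))"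
  by (rule AE_lborel_minus[OF fourier_L2_inversion[OF L]])
 ultimately show ?thesis by eventually_elim simp
qed

lemma fmul_cong:
 assumes "f \<in> L2" "g \<in> L2" "AE x in lborel. f x = g x" shows "fmul m f = fmul m g"
 unfolding fmul_def[abs_def] by (simp add: fourier_L2_cong[OF assms])

lemma nrm_fmul: "bmeas m ==> f \<in> L2 ==> nrm (fmul m f) = nrm (\<lambda>xi. m xi*FT f xi)"
 unfolding fmul_def[abs_def] by (subst nrm_reflect) (auto intro: fourier_L2_L2 bmeas_L2 nrm_fourier_L2)

lemma nrm_fmul_le: 
 assumes m: "m \<in> borelm" "\<And>xi. cmod (m xi) <= B" and f: "f \<in> L2"
 shows "nrm (fmul m f) <= B*nrm f"
 using L2_bounded_mult(2)[OF fourier_L2_L2[OF f] m] by (simp add: nrm_fmul[OF bmeasI[OF m] f] nrm_fourier_L2 f)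

lemma ip_fmul:
 assumes m: "bmeas m" and f: "f \<in> L2" and g: "g \<in> L2"
 shows "ip (fmul m f) g = ip (\<lambda>xi. m xi*FT f xi) (FT g)"
proof -
 have "ip (fmul m f) g = ip (FT (fmul m f)) (FT g)" by (rule ip_fourier_L2[symmetric]) (intro fmul_L2 m f g)+
 also have "... = ip (\<lambda>xi. m xi*FT f xi) (FT g)"
  by (rule ip_cong_AE) (auto intro!: fourier_fmul m f g L2_measurable fourier_L2_L2 fmul_L2 bmeas_L2)
 finally show ?thesis .
qed

lemma L2_eq_if_fourier:
 assumes f: "f \<in> L2" and g: "g \<in> L2" and e: "AE xi in lborel. FT f xi = FT g xi"
 shows "AE x in lborel. f x = g x"
proof -
 have "AE xi in lborel. FT (\<lambda>x. f x - g x) xi = 0" using fourier_L2_diff[OF f g] e by eventually_elim simp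
 then have "nrm (FT (\<lambda>x. f x - g x)) = 0" by (subst nrm_eq_0) (intro fourier_L2_L2 L2_diff f g)
 then have "nrm (\<lambda>x. f x - g x) = 0" by (simp add: nrm_fourier_L2 L2_diff f g)
 then show ?thesis by (subst (asm) nrm_eq_0) (intro L2_diff f g, simp)
qed

lemma fmul_fmul:
 assumes m: "bmeas m" and n: "bmeas n" and f: "f \<in> L2"
 shows "fmul m (fmul n f) = fmul (\<lambda>xi. m xi*n xi) f"
proof -
 have "FT (\<lambda>xi. m xi*FT (fmul n f) xi) = FT (\<lambda>xi. m xi*n xi*FT f xi)"
 proof (rule fourier_L2_cong)
  show "AE xi in lborel. m xi*FT (fmul n f) xi = m xi*n xi*FT f xi"
   using fourier_fmul[OF n f] by eventually_elim simp
 qed (intro bmeas_L2 fourier_L2_L2 fmul_L2 m n f bmeas_times)+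
 then show ?thesis by (intro ext) (simp only: fmul_def[of m] fmul_def[of "\<lambda>xi. m xi*n xi"])
qed

lemma fmul_one: "f \<in> L2 ==> AE x in lborel. fmul (\<lambda>xi. 1) f x = f x"
 using AE_lborel_minus[OF fourier_L2_inversion[of f]] by (simp add: fmul_def)

lemma fmul_diff:
 assumes m: "bmeas m" and f: "f \<in> L2" and g: "g \<in> L2"
 shows "AE x in lborel. fmul m (\<lambda>x. f x - g x) x = fmul m f x - fmul m g x"
proof (rule L2_eq_if_fourier)
 show "AE xi in lborel. FT (fmul m (\<lambda>x. f x - g x)) xi = FT (\<lambda>x. fmul m f x - fmul m g x) xi"
  using fourier_fmul[OF m L2_diff[OF f g]] fourier_L2_diff[OF f g] fourier_L2_diff[OF fmul_L2[OF m f] fmul_L2[OF m g]] fourier_fmul[OF m f] fourier_fmul[OF m g]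
  by eventually_elim (simp add: right_diff_distrib)
qed (intro fmul_L2 L2_diff m f g)+

lemma fmul_add:
 assumes m: "bmeas m" and f: "f \<in> L2" and g: "g \<in> L2"
 shows "AE x in lborel. fmul m (\<lambda>x. f x + g x) x = fmul m f x + fmul m g x"
proof (rule L2_eq_if_fourier)
 show "AE xi in lborel. FT (fmul m (\<lambda>x. f x + g x)) xi = FT (\<lambda>x. fmul m f x + fmul m g x) xi"
  using fourier_fmul[OF m L2_add[OF f g]] fourier_L2_add[OF f g] fourier_L2_add[OF fmul_L2[OF m f] fmul_L2[OF m g]] fourier_fmul[OF m f] fourier_fmul[OF m g]
  by eventually_elim (simp add: distrib_left)
qed (intro fmul_L2 L2_add m f g)+

lemma fmul_cmult:
 assumes m: "bmeas m" and f: "f \<in> L2"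
 shows "AE x in lborel. fmul m (\<lambda>x. c*f x) x = c*fmul m f x"
proof (rule L2_eq_if_fourier)
 show "AE xi in lborel. FT (fmul m (\<lambda>x. c*f x)) xi = FT (\<lambda>x. c*fmul m f x) xi"
  using fourier_fmul[OF m L2_cmult[OF f, of c]] fourier_L2_cmult[OF f, of c] fourier_L2_cmult[OF fmul_L2[OF m f], of c] fourier_fmul[OF m f]
  by eventually_elim simp
qed (intro fmul_L2 L2_cmult m f)+

lemma fmul_diff_fmul:
 assumes m: "bmeas m" and n: "bmeas n" and f: "f \<in> L2"
 shows "AE x in lborel. fmul (\<lambda>xi. m xi - n xi) f x = fmul m f x - fmul n f x"
proof -
 have mn: "bmeas (\<lambda>xi. m xi - n xi)"
 proof -
  obtain B C where B: "\<And>xi. cmod (m xi) <= B" "\<And>xi. cmod (n xi) <= C" using m n by (auto simp: bmeas_def)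
  have "cmod (m xi - n xi) <= B + C" for xi using norm_triangle_ineq4[of "m xi" "n xi"] B(1)[of xi] B(2)[of xi] by linarith
  then show ?thesis using m n by (intro bmeasI) (auto simp: bmeas_def)
 qed
 show ?thesis
 proof (rule L2_eq_if_fourier)
  show "AE xi in lborel. FT (fmul (\<lambda>xi. m xi - n xi) f) xi = FT (\<lambda>x. fmul m f x - fmul n f x) xi"
   using fourier_fmul[OF mn f] fourier_L2_diff[OF fmul_L2[OF m f] fmul_L2[OF n f]] fourier_fmul[OF m f] fourier_fmul[OF n f]
   by eventually_elim (simp add: left_diff_distrib)
 qed (intro fmul_L2 L2_diff m n mn f)+
qed

lemma fmul_cnj:
 assumes m: "bmeas m" and f: "f \<in> L2"
 shows "AE x in lborel. cnj (fmul m f x) = fmul (\<lambda>xi. cnj (m (- xi))) (\<lambda>x. cnj (f x)) x"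
proof -
 have m': "bmeas (\<lambda>xi. cnj (m (- xi)))" using m by (auto simp: bmeas_def)
 show ?thesis
 proof (rule L2_eq_if_fourier)
  show "AE xi in lborel. FT (\<lambda>x. cnj (fmul m f x)) xi = FT (fmul (\<lambda>xi. cnj (m (- xi))) (\<lambda>x. cnj (f x))) xi"
   using fourier_L2_cnj[OF fmul_L2[OF m f]] AE_lborel_minus[OF fourier_fmul[OF m f]] fourier_fmul[OF m' L2_cnj[OF f]] fourier_L2_cnj[OF f]
   by eventually_elim simp
 qed (intro fmul_L2 L2_cnj m m' f)+
qed

text \<open>Dominated convergence on the Fourier side. It yields the continuity of the propagator in
  time as well as the removal of the damping factors introduced below.\<close>

lemma fmul_tendsto:
 assumes m: "\<And>n. m n \<in> borelm" "\<And>n xi. cmod (m n xi) <= B" "k \<in> borelm" 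
  and l: "\<And>xi. (\<lambda>n. m n xi) ----> k xi" and f: "f \<in> L2"
 shows "(\<lambda>n. nrm (\<lambda>x. fmul (m n) f x - fmul k f x)) ----> 0"
proof -
 have k: "cmod (k xi) <= B" for xi by (rule LIMSEQ_le_const2[OF tendsto_norm[OF l]]) (use m in auto)
 have bm: "bmeas (m n)" "bmeas k" for n using m k by (auto intro: bmeasI[where B=B])
 have B: "0 <= B" using k norm_ge_zero order_trans by blast
 note [measurable] = m(1) m(3) L2_measurable[OF fourier_L2_L2[OF f]]
 have "(\<lambda>n. nrm (\<lambda>xi. m n xi*FT f xi - k xi*FT f xi)) ----> 0"
 proof (rule L2_dct[where h="\<lambda>xi. of_real B*FT f xi"])
  show "AE xi in lborel. (\<lambda>n. m n xi*FT f xi) ----> k xi*FT f xi" by (intro AE_I2 tendsto_intros l)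
  show "AE xi in lborel. cmod (m n xi*FT f xi) <= cmod (of_real B*FT f xi)" for n
   using m(2) B by (auto simp: norm_mult intro!: mult_right_mono)
 qed (auto intro!: bmeas_L2 bm fourier_L2_L2 f L2_cmult)
 moreover have "nrm (\<lambda>xi. m n xi*FT f xi - k xi*FT f xi) = nrm (\<lambda>x. fmul (m n) f x - fmul k f x)" for n
 proof -
  have "nrm (\<lambda>x. fmul (m n) f x - fmul k f x) = nrm (FT (\<lambda>x. fmul (m n) f x - fmul k f x))"
   by (rule nrm_fourier_L2[symmetric]) (intro L2_diff fmul_L2 bm f)
  also have "... = nrm (\<lambda>xi. m n xi*FT f xi - k xi*FT f xi)"
  proof (rule nrm_cong_AE)
   show "AE xi in lborel. FT (\<lambda>x. fmul (m n) f x - fmul k f x) xi = m n xi*FT f xi - k xi*FT f xi"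
    using fourier_L2_diff[OF fmul_L2[OF bm(1)[of n] f] fmul_L2[OF bm(2) f]] fourier_fmul[OF bm(1)[of n] f] fourier_fmul[OF bm(2) f] by eventually_elim simp
  qed (auto intro!: L2_measurable fourier_L2_L2 L2_diff fmul_L2 bm f)
  finally show ?thesis ..
 qed
 ultimately show ?thesis by simp
qed

lemma bmeas_cis [simp]: "g \<in> borelm ==> bmeas (\<lambda>xi. cis (g xi))"
 by (rule bmeasI[of _ 1]) auto

section \<open>The propagator as a unitary multiplier\<close>

lemma propagator_eq: "propagator t = fmul (\<lambda>xi. cis (t*norm xi ^ 4))"
 by (intro ext) (simp add: propagator_def fmul_def)

lemma bmeas_prop: "bmeas (\<lambda>xi::'a::euclidean_space. cis (t*norm xi ^ 4))"
 by (rule bmeas_cis) measurable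

lemma propagator_L2: "f \<in> L2 ==> propagator t f \<in> L2"
 unfolding propagator_eq by (intro fmul_L2 bmeas_prop)

lemma fourier_propagator: "f \<in> L2 ==> AE xi in lborel. FT (propagator t f) xi = cis (t*norm xi ^ 4)*FT f xi"
 unfolding propagator_eq by (intro fourier_fmul bmeas_prop)

lemma nrm_propagator: assumes "f \<in> L2" shows "nrm (propagator t f) = nrm f"
proof -
 have "nrm (propagator t f) = nrm (\<lambda>xi. cis (t*norm xi ^ 4)*FT f xi)"
  unfolding propagator_eq by (rule nrm_fmul[OF bmeas_prop assms])
 also have "... = nrm (FT f)" by (simp add: nrm_def norm_mult)
 finally show ?thesis using nrm_fourier_L2[OF assms] by simp
qed

lemma propagator_propagator: "f \<in> L2 ==> propagator s (propagator t f) = propagator (s + t) f"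
 unfolding propagator_eq by (subst fmul_fmul) (auto intro!: bmeas_prop simp: cis_mult distrib_right)

lemma propagator_0: "f \<in> L2 ==> AE x in lborel. propagator 0 f x = f x"
 unfolding propagator_eq using fmul_one[of f] by simp

lemma propagator_cong: "f \<in> L2 ==> g \<in> L2 ==> AE x in lborel. f x = g x ==> propagator t f = propagator t g"
 unfolding propagator_eq by (rule fmul_cong)

lemma propagator_diff: "f \<in> L2 ==> g \<in> L2 ==> AE x in lborel. propagator t (\<lambda>x. f x - g x) x = propagator t f x - propagator t g x"
 unfolding propagator_eq by (intro fmul_diff bmeas_prop)

lemma propagator_add: "f \<in> L2 ==> g \<in> L2 ==> AE x in lborel. propagator t (\<lambda>x. f x + g x) x = propagator t f x + propagator t g x"
 unfolding propagator_eq by (intro fmul_add bmeas_prop)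

lemma propagator_cmult: "f \<in> L2 ==> AE x in lborel. propagator t (\<lambda>x. c*f x) x = c*propagator t f x"
 unfolding propagator_eq by (intro fmul_cmult bmeas_prop)

lemma propagator_cnj: "f \<in> L2 ==> AE x in lborel. cnj (propagator t f x) = propagator (- t) (\<lambda>x. cnj (f x)) x"
 unfolding propagator_eq using fmul_cnj[OF bmeas_prop[of t]] by (simp add: cis_cnj)

lemma ip_propagator:
 assumes f: "f \<in> L2" and g: "g \<in> L2"
 shows "ip (propagator t f) g = ip f (propagator (- t) g)"
proof -
 have "ip (propagator t f) g = ip (\<lambda>xi. cis (t*norm xi ^ 4)*FT f xi) (FT g)"
  unfolding propagator_eq by (rule ip_fmul[OF bmeas_prop f g])
 also have "... = ip (FT f) (\<lambda>xi. cis (- t*norm xi ^ 4)*FT g xi)"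
  unfolding ip_def by (simp add: cis_cnj mult_ac)
 also have "... = cnj (ip (\<lambda>xi. cis (- t*norm xi ^ 4)*FT g xi) (FT f))" by (rule ip_cnj)
 also have "... = cnj (ip (propagator (- t) g) f)"
  unfolding propagator_eq by (subst ip_fmul[OF bmeas_prop g f]) simp
 also have "... = ip f (propagator (- t) g)" by (rule ip_cnj[symmetric])
 finally show ?thesis .
qed

lemma propagator_tendsto:
 assumes f: "f \<in> L2" and t: "t ----> t0"
 shows "(\<lambda>n. nrm (\<lambda>x. propagator (t n) f x - propagator t0 f x)) ----> 0"
 unfolding propagator_eq
proof (rule fmul_tendsto[OF _ _ _ _ f, where B=1])
 show "(\<lambda>n. cis (t n*norm xi ^ 4)) ----> cis (t0*norm xi ^ 4)" for xi :: 'a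
  unfolding cis_conv_exp by (intro tendsto_intros t)
qed auto

section \<open>The H^2 norm as a weighted L^2 norm on the Fourier side\<close>

definition w2 :: "'a::euclidean_space => complex" where "w2 xi = complex_of_real (1 + (norm xi)^2)"

definition h2 :: "('a::euclidean_space => complex) => real" where "h2 f = nrm (\<lambda>xi. w2 xi*FT f xi)"

lemma w2_measurable [measurable]: "w2 \<in> borelm" unfolding w2_def[abs_def] by measurable

lemma cmod_w2: "cmod (w2 xi) = 1 + (norm xi)^2" unfolding w2_def norm_of_real by simp

lemma H2_iff: "f \<in> H2 \<longleftrightarrow> f \<in> L2 \<and> (\<lambda>xi. w2 xi*FT f xi) \<in> L2"
proof (cases "f \<in> L2")
 case True
 have [measurable]: "FT f \<in> borelm" by (rule L2_measurable[OF fourier_L2_L2[OF True]])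
 have "(\<lambda>xi. w2 xi*FT f xi) \<in> borel_measurable lborel" by measurable
 then show ?thesis using True unfolding H2_def H2_norm_def w2_def[symmetric] L2_def by simp
qed (simp add: H2_def)

lemma H2_L2: "f \<in> H2 ==> f \<in> L2" by (simp add: H2_def)

lemma H2_norm_eq: "f \<in> H2 ==> H2_norm f = ennreal (h2 f)"
 unfolding H2_norm_def w2_def[symmetric] h2_def by (rule Lp_norm_2) (simp add: H2_iff)

lemma h2_nonneg [simp]: "0 <= h2 f" by (simp add: h2_def)

lemma nrm_le_h2: assumes "f \<in> H2" shows "nrm f <= h2 f"
proof -
 have "nrm (FT f) <= nrm (\<lambda>xi. w2 xi*FT f xi)"
 proof (rule L2_dominated)
  show "(\<lambda>xi. w2 xi*FT f xi) \<in> L2" using assms by (simp add: H2_iff)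
  show "FT f \<in> borelm" by (rule L2_measurable[OF fourier_L2_L2[OF H2_L2[OF assms]]])
  show "AE xi in lborel. cmod (FT f xi) <= cmod (w2 xi*FT f xi)"
   by (rule AE_I2) (simp add: norm_mult cmod_w2 distrib_right)
 qed
 then show ?thesis using nrm_fourier_L2[OF H2_L2[OF assms]] by (simp add: h2_def)
qed

lemma H2_fourierI:
 assumes f: "f \<in> L2" and g: "g \<in> L2" "AE xi in lborel. w2 xi*FT f xi = g xi"
 shows "f \<in> H2" "h2 f = nrm g"
proof -
 have [measurable]: "FT f \<in> borelm" "g \<in> borelm"
  by (auto intro!: L2_measurable fourier_L2_L2 f g)
 have m: "(\<lambda>xi. w2 xi*FT f xi) \<in> borelm" by measurable
 have "(\<lambda>xi. w2 xi*FT f xi) \<in> L2"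
  by (rule L2_dominated[OF g(1) m]) (use g(2) in "auto elim!: eventually_mono")
 then show "f \<in> H2" using f by (simp add: H2_iff)
 show "h2 f = nrm g" unfolding h2_def by (rule nrm_cong_AE) (use g in auto)
qed

lemma H2_cong:
 assumes f: "f \<in> H2" and g: "g \<in> L2" "AE x in lborel. f x = g x"
 shows "g \<in> H2" "h2 g = h2 f"
 using f g fourier_L2_cong[OF H2_L2[OF f] g] by (auto simp: H2_iff h2_def)

lemma H2_diff:
 assumes f: "f \<in> H2" and g: "g \<in> H2" shows "(\<lambda>x. f x - g x) \<in> H2" 
  "h2 (\<lambda>x. f x - g x) = nrm (\<lambda>xi. w2 xi*FT f xi - w2 xi*FT g xi)"
proof -
 have L: "(\<lambda>x. f x - g x) \<in> L2" by (intro L2_diff H2_L2 f g)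
 have L': "(\<lambda>xi. w2 xi*FT f xi - w2 xi*FT g xi) \<in> L2" using f g by (intro L2_diff) (auto simp: H2_iff)
 have "AE xi in lborel. w2 xi*FT (\<lambda>x. f x - g x) xi = w2 xi*FT f xi - w2 xi*FT g xi"
  using fourier_L2_diff[OF H2_L2[OF f] H2_L2[OF g]] by eventually_elim (simp add: right_diff_distrib)
 from H2_fourierI[OF L L' this] show "(\<lambda>x. f x - g x) \<in> H2" 
  "h2 (\<lambda>x. f x - g x) = nrm (\<lambda>xi. w2 xi*FT f xi - w2 xi*FT g xi)" .
qed

lemma H2_cnj: 
 assumes f: "f \<in> H2" shows "(\<lambda>x. cnj (f x)) \<in> H2"
proof (rule H2_fourierI)
 have "(\<lambda>xi. w2 xi*FT f xi) \<in> L2" using f by (simp add: H2_iff)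
 from L2_cnj[OF L2_reflect[OF this]] show "(\<lambda>xi. cnj (w2 (- xi)*FT f (- xi))) \<in> L2" .
 show "AE xi in lborel. w2 xi*FT (\<lambda>x. cnj (f x)) xi = cnj (w2 (- xi)*FT f (- xi))"
  using fourier_L2_cnj[OF H2_L2[OF f]] by eventually_elim (simp add: w2_def)
qed (intro L2_cnj H2_L2 f)

lemma H2_propagator:
 assumes f: "f \<in> H2" shows "propagator t f \<in> H2" "h2 (propagator t f) = h2 f"
proof -
 let ?g = "\<lambda>xi. cis (t*norm xi ^ 4)*(w2 xi*FT f xi)"
 have g: "?g \<in> L2" by (rule bmeas_L2[OF bmeas_prop]) (use f in "auto simp: H2_iff")
 have e: "AE xi in lborel. w2 xi*FT (propagator t f) xi = ?g xi"
  using fourier_propagator[OF H2_L2[OF f], of t] by eventually_elim simp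
 show "propagator t f \<in> H2" by (rule H2_fourierI(1)[OF _ g e]) (intro propagator_L2 H2_L2 f)
 have "h2 (propagator t f) = nrm ?g" by (rule H2_fourierI(2)[OF _ g e]) (intro propagator_L2 H2_L2 f)
 also have "... = h2 f" by (simp add: h2_def nrm_def norm_mult)
 finally show "h2 (propagator t f) = h2 f" .
qed

text \<open>A symbol that decays at least as fast as \<open>w2\<close> grows maps L^2 into H^2; this
  is the source of test functions for the weak equation.\<close>

lemma H2_fmul_decay:
 assumes m: "bmeas m" "bmeas (\<lambda>xi. w2 xi*m xi)" and f: "f \<in> L2"
 shows "fmul m f \<in> H2"
proof (rule H2_fourierI)
 show "(\<lambda>xi. (w2 xi*m xi)*FT f xi) \<in> L2" by (intro bmeas_L2 m fourier_L2_L2 f)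
 show "AE xi in lborel. w2 xi*FT (fmul m f) xi = (w2 xi*m xi)*FT f xi"
  using fourier_fmul[OF m(1) f] by eventually_elim simp
qed (intro fmul_L2 m f)

section \<open>Dispersive decay\<close>

definition n1 :: "('a::euclidean_space => complex) => real" where "n1 f = (LBINT x. cmod (f x))"

lemma n1_nonneg [simp]: "0 <= n1 f" by (simp add: n1_def)

text \<open>If \<open>f\<close> is not integrable, its integral is 0 by convention, while that of
  \<open>g\<close> is non-negative.\<close>

lemma norm_integral_le:
 fixes f :: "'a => 'b :: {banach, second_countable_topology}"
 assumes g: "integrable M g" "AE x in M. norm (f x) <= g x"
 shows "norm (integral\<^sup>L M f) <= integral\<^sup>L M g"
proof (cases "integrable M f")
 case True
 have "norm (integral\<^sup>L M f) <= (\<integral>x. norm (f x) \<partial>M)" by (rule integral_norm_bound)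
 also have "... <= integral\<^sup>L M g" by (rule integral_mono_AE[OF integrable_norm[OF True] g])
 finally show ?thesis .
next
 case False
 have "AE x in M. 0 <= g x" using g(2) by eventually_elim (rule order_trans[OF norm_ge_zero])
 then show ?thesis using False by (simp add: not_integrable_integral_eq integral_nonneg_AE)
qed

text \<open>This is (4 pi)^(-N/2), the maximum of the heat kernel at time 1.\<close>

definition heatC :: "'a::euclidean_space itself => real" where
 "heatC _ = sqrt pi ^ DIM('a)/(2*pi) ^ DIM('a)"

lemma heatC_nonneg: "0 <= heatC TYPE('a::euclidean_space)" by (simp add: heatC_def)

text \<open>The kernel of exp (-w |xi|^2) is a complex Gaussian, bounded everywhere by
  \<open>heatC\<close> times |w|^(-N/2); the form is therefore bounded by the product of the L^1
  norms.\<close>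

lemma heat_form_bound_pos:
 fixes f g :: "'a::euclidean_space => complex"
 assumes f: "f \<in> L2" "intg f" and g: "g \<in> L2" "intg g" and w: "Re w > 0"
 shows "cmod (LBINT xi. exp (- w * of_real ((norm xi)^2))*(FT f xi*cnj (FT g xi))) \<le>
  heatC TYPE('a)*cmod w powr (- real DIM('a)/2)*n1 f*n1 g"
proof -
 define m where "m xi = exp (- w * of_real ((norm xi)^2))" for xi :: 'a
 have mi: "intg m"
  using gaussian_fourier_eucl(1)[OF w, of "0::'a"] unfolding m_def by simp
 note [measurable] = L2_measurable[OF fourier_L2_L2[OF f(1)]] L2_measurable[OF fourier_L2_L2[OF g(1)]] L2_measurable[OF f(1)] L2_measurable[OF g(1)]
 define B where "B = sqrt (pi/cmod w) ^ DIM('a)"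
 have B: "cmod (LBINT xi. cis (- (xi \<bullet> z))*m xi) <= B" for z
 proof -
  have "cis (- (xi \<bullet> z))*m xi = exp (- w * of_real ((norm xi)^2) - \<i> * of_real (xi \<bullet> z))" for xi
   unfolding m_def cis_conv_exp exp_add[symmetric] by (simp add: minus_diff_commute)
  then show ?thesis using gaussian_fourier_eucl_le[OF w, of z] by (simp add: B_def)
 qed
 have B0: "0 <= B" using B norm_ge_zero order_trans by blast
 have inner: "cmod (cvf m g x) <= n1 g*B" for x
 proof -
  have "cmod (cvf m g x) <= (LBINT y. cmod (g y)*B)"
   by (rule norm_integral_le) (use g in "auto simp: norm_mult intro!: mult_left_mono B")
  then show ?thesis by (simp add: n1_def)
 qed
 have "(LBINT xi. m xi*(FT f xi*cnj (FT g xi))) = (LBINT xi. m xi*(ft f xi*cnj (ft g xi)))"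
 proof (rule integral_cong_AE)
  show "AE xi in lborel. m xi*(FT f xi*cnj (FT g xi)) = m xi*(ft f xi*cnj (ft g xi))"
   using fourier_L2_integrable[OF f] fourier_L2_integrable[OF g] by eventually_elim simp
 qed (unfold m_def, measurable)
 also have "... = (cN TYPE('a))^2*(LBINT x. f x*(cvf m g x))"
  by (rule ft_sesquilinear[OF mi f(2) g(2)])
 finally have "cmod (LBINT xi. m xi*(FT f xi*cnj (FT g xi))) = 
  1/(2*pi) ^ DIM('a)*cmod (LBINT x. f x*(cvf m g x))"
  unfolding cN_sq by (simp add: norm_mult norm_divide norm_power)
 also have "... <= 1/(2*pi) ^ DIM('a)*(n1 f*(n1 g*B))"
 proof (rule mult_left_mono)
  have "cmod (LBINT x. f x*(cvf m g x)) <= (LBINT x. cmod (f x)*(n1 g*B))"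
   by (rule norm_integral_le) (use f inner in "auto simp: norm_mult intro!: mult_left_mono")
  then show "cmod (LBINT x. f x*(cvf m g x)) <= n1 f*(n1 g*B)"
   by (simp add: n1_def)
 qed simp
 also have "B = sqrt pi ^ DIM('a)*cmod w powr (- real DIM('a)/2)"
 proof -
  have w0: "cmod w > 0" using w by auto
  have "sqrt (pi/cmod w) = sqrt pi*cmod w powr (- 1/2)"
   using w0 by (simp add: real_sqrt_divide powr_minus_divide powr_half_sqrt)
  then have "B = sqrt pi ^ DIM('a)*(cmod w powr (- 1/2)) ^ DIM('a)" by (simp add: B_def power_mult_distrib)
  also have "(cmod w powr (- 1/2)) ^ DIM('a) = cmod w powr (- real DIM('a)/2)"
   using w0 by (simp add: powr_realpow[symmetric] powr_powr)
  finally show ?thesis .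
 qed
 finally show ?thesis by (simp add: m_def heatC_def mult_ac)
qed

lemma fourier_prod_integrable: "f \<in> L2 ==> g \<in> L2 ==> intg (\<lambda>xi. FT f xi*cnj (FT g xi))"
 by (intro L2_mult_integrable L2_cnj fourier_L2_L2)

text \<open>The bound involves only |w|, so w can be approached by w + 1/(n+1) from the open
  half-plane. On the imaginary axis this is the decay of the Schroedinger group.\<close>

lemma heat_form_bound:
 fixes f g :: "'a::euclidean_space => complex"
 assumes f: "f \<in> L2" "intg f" and g: "g \<in> L2" "intg g" and w: "Re w \<ge> 0" "w \<noteq> 0"
 shows "cmod (LBINT xi. exp (- w * of_real ((norm xi)^2))*(FT f xi*cnj (FT g xi))) \<le>
  heatC TYPE('a)*cmod w powr (- real DIM('a)/2)*n1 f*n1 g"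
proof -
 note [measurable] = L2_measurable[OF fourier_L2_L2[OF f(1)]] L2_measurable[OF fourier_L2_L2[OF g(1)]]
 define h where "h xi = FT f xi*cnj (FT g xi)" for xi
 have [measurable]: "h \<in> borelm" unfolding h_def[abs_def] by measurable
 have hi: "intg h" unfolding h_def[abs_def] by (rule fourier_prod_integrable[OF f(1) g(1)])
 define v where "v n = w + of_real (1/real (Suc n))" for n
 have vl: "v ----> w + of_real 0" unfolding v_def by (intro tendsto_intros LIMSEQ_Suc[OF lim_1_over_n])
 have vR: "Re (v n) > 0" for n using w by (simp add: v_def add_nonneg_pos)
 have vc: "cmod w <= cmod (v n)" for n
  unfolding cmod_def v_def using w by (intro real_sqrt_le_mono) (auto intro!: power_mono)
 have lim: "(\<lambda>n. LBINT xi. exp (- v n * of_real ((norm xi)^2))*h xi) ----> (LBINT xi. exp (- w * of_real ((norm xi)^2))*h xi)"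
 proof (rule integral_dominated_convergence[where w="\<lambda>xi. cmod (h xi)"])
  show "intg (\<lambda>xi. cmod (h xi))" using hi by simp
  show "AE xi in lborel. (\<lambda>n. exp (- v n * of_real ((norm xi)^2))*h xi) ----> exp (- w * of_real ((norm xi)^2))*h xi"
   using vl by (intro AE_I2 tendsto_intros) simp
  show "AE xi in lborel. norm (exp (- v n * of_real ((norm xi)^2))*h xi) <= cmod (h xi)" for n
   using vR[of n] by (intro AE_I2) (simp add: norm_mult mult_left_le_one_le)
 qed measurable
 show ?thesis unfolding h_def[symmetric]
 proof (rule LIMSEQ_le_const2[OF tendsto_norm[OF lim]], intro exI allI impI)
  fix n :: nat
  have "cmod (LBINT xi. exp (- v n * of_real ((norm xi)^2))*h xi) <= heatC TYPE('a)*cmod (v n) powr (- real DIM('a)/2)*n1 f*n1 g"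
   unfolding h_def by (rule heat_form_bound_pos[OF f g vR])
  also have "... <= heatC TYPE('a)*cmod w powr (- real DIM('a)/2)*n1 f*n1 g"
   using vc[of n] w by (intro mult_right_mono mult_left_mono heatC_nonneg powr_mono2') auto
  finally show "cmod (LBINT xi. exp (- v n * of_real ((norm xi)^2))*h xi) <= heatC TYPE('a)*cmod w powr (- real DIM('a)/2)*n1 f*n1 g" .
 qed
qed

lemma tail_powr:
 fixes a r :: real
 assumes a: "a > 1" and r: "r > 0"
 shows "intg (\<lambda>s. indicator {r..} s * s powr (- a))" "(LBINT s. indicator {r..} s * s powr (- a)) = r powr (1 - a)/(a - 1)"
proof -
 have "((\<lambda>x. x powr (- a)) has_integral -(r powr (- a + 1))/(- a + 1)) {r..}"
  by (rule has_integral_powr_to_inf) (use a r in auto)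
 moreover have "-(r powr (- a + 1))/(- a + 1) = r powr (1 - a)/(a - 1)" using a by (simp add: field_simps)
 ultimately have "((\<lambda>x. x powr (- a)) has_integral r powr (1 - a)/(a - 1)) {r..}" by simp
 from nn_integral_has_integral_lebesgue[OF _ this] 
 have n: "(NN s. ennreal (indicator {r..} s * s powr (- a))) = ennreal (r powr (1 - a)/(a - 1))" by simp
 show i: "intg (\<lambda>s. indicator {r..} s * s powr (- a))"
  by (rule integrableI_nonneg) (use n in auto)
 show "(LBINT s. indicator {r..} s * s powr (- a)) = r powr (1 - a)/(a - 1)"
  using n nn_integral_eq_integral[OF i] a by simp
qed

lemma near_powr:
 fixes a r :: real
 assumes a: "a < 1" and r: "r \<ge> 0"
 shows "intg (\<lambda>s. indicator {0..r} s * s powr (- a))" "(LBINT s. indicator {0..r} s * s powr (- a)) = r powr (1 - a)/(1 - a)"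
proof -
 have "((\<lambda>x. x powr (- a)) has_integral (r powr (- a + 1))/(- a + 1)) {0..r}"
  by (rule has_integral_powr_from_0) (use a r in auto)
 moreover have "(r powr (- a + 1))/(- a + 1) = r powr (1 - a)/(1 - a)" by (simp add: add.commute)
 ultimately have "((\<lambda>x. x powr (- a)) has_integral r powr (1 - a)/(1 - a)) {0..r}" by simp
 from nn_integral_has_integral_lebesgue[OF _ this] 
 have n: "(NN s. ennreal (indicator {0..r} s * s powr (- a))) = ennreal (r powr (1 - a)/(1 - a))" by simp
 show i: "intg (\<lambda>s. indicator {0..r} s * s powr (- a))"
  by (rule integrableI_nonneg) (use n in auto)
 show "(LBINT s. indicator {0..r} s * s powr (- a)) = r powr (1 - a)/(1 - a)"
  using n nn_integral_eq_integral[OF i] a by simp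
qed

text \<open>The piece \<open>-r <= s <= r\<close> of the path \<open>w = i s\<close> is pushed to the half circle of radius \<open>r\<close> in
 the right half-plane, away from the singularity at \<open>w = 0\<close> of the heat kernel.\<close>

lemma gaussian_shift:
 fixes p :: complex and r ro :: real
 assumes r: "r > 0"
 shows "(LBINT s. indicator {-r..r} s *\<^sub>R gk p ro s) =
  (LBINT phi. indicator {-(pi/2)..pi/2} phi *\<^sub>R (exp (p*(of_real r*cis phi)^2 - of_real r*cis phi * of_real ro)*(of_real r*cis phi)))"
proof -
 define E where "E w = exp (p*w^2 - w * of_real ro)" for w :: complex
 have "E holomorphic_on UNIV" unfolding E_def by (intro holomorphic_intros)
 \<comment> \<open>\<open>E\<close> is entire, so both integrals are differences of one primitive
   between -i r and i r. The factor i from the straight path cancels the i in the derivative of r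
   e^(i phi).\<close>
 then obtain F where F: "\<And>w. (F has_field_derivative E w) (at w)"
  using holomorphic_convex_primitive'[of UNIV E] by auto
 have cE: "continuous_on S E" for S unfolding E_def by (intro continuous_intros)
 have "has_bochner_integral lborel (\<lambda>s. indicator {-r..r} s *\<^sub>R (\<i>*E (\<i> * of_real s))) (F (\<i> * of_real r) - F (\<i> * of_real (-r)))"
 proof (rule has_bochner_integral_FTC_Icc)
  show "- r <= r" using r by simp
  fix s :: real
  have "((\<lambda>z. F (\<i>*z)) has_field_derivative E (\<i> * of_real s)*\<i>) (at (of_real s))"
   by (rule DERIV_chain2[OF F]) (auto intro!: derivative_eq_intros)
  then have "((\<lambda>s. F (\<i> * of_real s)) has_vector_derivative (\<i>*E (\<i> * of_real s))) (at s)"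
   by (intro has_vector_derivative_real_field[where f="\<lambda>z. F (\<i>*z)"]) (simp add: mult.commute)
  then show "((\<lambda>s. F (\<i> * of_real s)) has_vector_derivative (\<i>*E (\<i> * of_real s))) (at s within {- r..r})"
   by (rule has_vector_derivative_at_within)
 next
  show "continuous_on {- r..r} (\<lambda>s. \<i>*E (\<i> * of_real s))" unfolding E_def by (intro continuous_intros)
 qed
 then have 1: "(LBINT s. indicator {-r..r} s *\<^sub>R (\<i>*E (\<i> * of_real s))) = F (\<i> * of_real r) - F (\<i> * of_real (-r))"
  by (rule has_bochner_integral_integral_eq)
 have "has_bochner_integral lborel (\<lambda>phi. indicator {-(pi/2)..pi/2} phi *\<^sub>R (of_real r*\<i>*cis phi*E (of_real r*cis phi))) (F (of_real r*cis (pi/2)) - F (of_real r*cis (-(pi/2))))"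
 proof (rule has_bochner_integral_FTC_Icc)
  fix phi :: real
  have c: "((\<lambda>phi. of_real r*cis phi) has_vector_derivative (of_real r*\<i>*cis phi)) (at phi)"
   unfolding cis_conv_exp 
   by (rule has_vector_derivative_real_field[where f="\<lambda>z. of_real r*exp (\<i>*z)"]) (auto intro!: derivative_eq_intros)
  have "((\<lambda>phi. F (of_real r*cis phi)) has_vector_derivative (of_real r*\<i>*cis phi*E (of_real r*cis phi))) (at phi)"
   using field_vector_diff_chain_at[OF c F] by (simp add: o_def)
  then show "((\<lambda>phi. F (of_real r*cis phi)) has_vector_derivative (of_real r*\<i>*cis phi*E (of_real r*cis phi))) (at phi within {-(pi/2)..pi/2})"
   by (rule has_vector_derivative_at_within)
 next
  show "continuous_on {-(pi/2)..pi/2} (\<lambda>phi. of_real r*\<i>*cis phi*E (of_real r*cis phi))" unfolding E_def by (intro continuous_intros)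
 qed simp
 then have 2: "(LBINT phi. indicator {-(pi/2)..pi/2} phi *\<^sub>R (of_real r*\<i>*cis phi*E (of_real r*cis phi))) = F (of_real r*cis (pi/2)) - F (of_real r*cis (-(pi/2)))"
  by (rule has_bochner_integral_integral_eq)
 have ends: "of_real r*cis (pi/2) = \<i> * of_real r" "of_real r*cis (-(pi/2)) = \<i> * of_real (-r)"
  by (simp_all add: cis.ctr complex_eq_iff)
 have Es: "E (\<i> * of_real s) = gk p ro s" for s
  by (simp add: E_def power_mult_distrib mult_ac)
 have "\<i>*(LBINT s. indicator {-r..r} s *\<^sub>R E (\<i> * of_real s)) = (LBINT s. indicator {-r..r} s *\<^sub>R (\<i>*E (\<i> * of_real s)))"
  by (subst integral_mult_right_zero[symmetric]) simp
 also have "... = (LBINT phi. indicator {-(pi/2)..pi/2} phi *\<^sub>R (of_real r*\<i>*cis phi*E (of_real r*cis phi)))"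
  unfolding 1 2 ends ..
 also have "... = \<i>*(LBINT phi. indicator {-(pi/2)..pi/2} phi *\<^sub>R (E (of_real r*cis phi)*(of_real r*cis phi)))"
  by (subst integral_mult_right_zero[symmetric]) (simp add: mult_ac)
 finally show ?thesis unfolding Es by (simp add: E_def)
qed

text \<open>Symbol of the propagator at time \<open>tau\<close> with the damping exp (-eta |xi|^4).
  The damping puts eta - i tau into the right half-plane, where the Gaussian formula
  applies.\<close>

definition sm :: "real => real => 'a::euclidean_space => complex" where
 "sm eta tau xi = exp (- (of_real eta - \<i> * of_real tau) * of_real (norm xi ^ 4))"

lemma sm_measurable [measurable]: "sm eta tau \<in> borelm" unfolding sm_def[abs_def] by measurable

lemma cmod_sm: "cmod (sm eta tau xi) = exp (- eta*norm xi ^ 4)" by (simp add: sm_def flip: of_real_power)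

lemma cmod_sm_le: "eta \<ge> 0 ==> cmod (sm eta tau xi) <= 1" by (simp add: cmod_sm)

text \<open>The first summand comes from the two tails |s| > r, the second from the half circle, and
  \<open>sqrt (4*pi)\<close> from the normalisation of the Gaussian integral.\<close>

definition dispC :: "'a::euclidean_space itself => real" where
 "dispC _ = heatC TYPE('a)*(2/(real DIM('a)/2 - 1) + pi*exp (1/4))/sqrt (4*pi)"

text \<open>Subordination: with rho = |xi|^2 and z = eta - i tau, the Gaussian formula writes exp
  (-z rho^2) as an average of exp (-i s rho) over real s, that is, of Schroedinger evolutions, whose
  forms decay like |s|^(-N/2). This is integrable at infinity as N > 2 but not at 0, so the middle
  piece is taken over the half circle of radius r. Both pieces contribute r^(1 - N/2), and the
  normalisation divides by r.\<close>

lemma dispersive_form: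
 fixes f g :: "'a::euclidean_space => complex"
 assumes N: "DIM('a) \<ge> 3" and f: "f \<in> L2" "intg f" and g: "g \<in> L2" "intg g"
  and eta: "eta > 0" and tau: "tau \<noteq> 0"
 shows "cmod (LBINT xi. sm eta tau xi*(FT f xi*cnj (FT g xi))) \<le>
  dispC TYPE('a)*\<bar>tau\<bar> powr (- real DIM('a)/4)*n1 f*n1 g"
proof -
 note [measurable] = L2_measurable[OF fourier_L2_L2[OF f(1)]] L2_measurable[OF fourier_L2_L2[OF g(1)]]
 define h where "h xi = FT f xi*cnj (FT g xi)" for xi
 have [measurable]: "h \<in> borelm" unfolding h_def[abs_def] by measurable
 have hi: "intg h" unfolding h_def[abs_def] by (rule fourier_prod_integrable[OF f(1) g(1)])
 define z where "z = complex_of_real eta - \<i> * of_real tau"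
 define p where "p = 1/(4*z)"
 \<comment> \<open>With r^2 = |tau| the product |p| r^2 is at most 1/4, so the Gaussian factor stays
   below exp (1/4) on the half circle.\<close>
 define r where "r = sqrt \<bar>tau\<bar>"
 define a where "a = real DIM('a)/2"
 define H where "H = heatC TYPE('a)*n1 f*n1 g"
 define I where "I = {- (pi/2)..pi/2}"
 have a1: "a > 1" using N by (simp add: a_def)
 have r0: "r > 0" using tau by (simp add: r_def)
 have H0: "H \<ge> 0" by (simp add: H_def heatC_nonneg)
 have z0: "z \<noteq> 0" "\<bar>tau\<bar> <= cmod z" "cmod z > 0"
 proof -
  show "z \<noteq> 0" using eta by (auto simp: z_def complex_eq_iff)
  then show "cmod z > 0" by simp
  show "\<bar>tau\<bar> <= cmod z" using abs_Im_le_cmod[of z] by (simp add: z_def)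
 qed
 have Rp: "Re p > 0"
  using z0(1) eta unfolding p_def by (simp add: Re_divide z_def) (auto intro!: divide_pos_pos add_pos_nonneg)
 have pr: "cmod p*r^2 <= 1/4"
  using z0 by (simp add: p_def r_def norm_divide norm_mult field_simps)
 have J: "cmod (LBINT xi. exp (- w * of_real ((norm xi)^2))*h xi) <= H*cmod w powr (- a)" if "Re w \<ge> 0" "w \<noteq> 0" for w
  using heat_form_bound[OF f g that] by (simp add: h_def H_def a_def mult_ac)
 define k1 where "k1 xi s = exp (- (\<i> * of_real s) * of_real ((norm xi)^2))" for xi :: 'a and s :: real
 define b1 where "b1 s = indicator (- {-r..r}) s *\<^sub>R exp (- p*(of_real s)^2)" for s :: real
 define w where "w phi = of_real r*cis phi" for phi
 define k2 where "k2 xi phi = indicator I phi *\<^sub>R exp (- w phi * of_real ((norm xi)^2))" for xi :: 'a and phi :: real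
 define b2 where "b2 phi = indicator I phi *\<^sub>R (exp (p*(w phi)^2)*w phi)" for phi :: real
 have [measurable]: "b1 \<in> borelm" unfolding b1_def[abs_def] by measurable
 have [measurable]: "w \<in> borelm" unfolding w_def[abs_def] by measurable
 have [measurable]: "b2 \<in> borelm" unfolding b2_def[abs_def] I_def by measurable
 have k1m[measurable]: "(\<lambda>(xi, s). k1 xi s) \<in> borel_measurable (lborel \<Otimes>\<^sub>M lborel)" unfolding k1_def by measurable
 have k2m[measurable]: "(\<lambda>(xi, s). k2 xi s) \<in> borel_measurable (lborel \<Otimes>\<^sub>M lborel)" unfolding k2_def I_def by measurable
 have gi: "intg (\<lambda>s::real. exp (- p*(of_real s)^2))"
  using gaussian_fourier_integrable[OF Rp, of 0] by simp
 have b1i: "intg b1"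
  by (rule Bochner_Integration.integrable_bound[OF gi]) (auto simp: b1_def indicator_def)
 have wn: "cmod (w phi) = r" for phi using r0 by (simp add: w_def norm_mult)
 have wR: "Re (w phi) \<ge> 0" if "phi \<in> I" for phi using that r0 by (auto simp: w_def I_def intro!: mult_nonneg_nonneg cos_ge_zero)
 have k1b: "cmod (k1 xi s) <= 1" for xi s by (simp add: k1_def)
 have k2b: "cmod (k2 xi phi) <= 1" for xi phi
  using wR[of phi] by (auto simp: k2_def indicator_def mult_nonneg_nonneg simp del: of_real_power)
 have b2b: "cmod (b2 phi) <= indicator I phi*(exp (1/4)*r)" for phi
 proof -
  have "Re (p*(w phi)^2) <= cmod (p*(w phi)^2)" by (rule complex_Re_le_cmod)
  also have "... <= 1/4" using pr by (simp add: norm_mult norm_power wn)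
  finally have "exp (Re (p*(w phi)^2))*r <= exp (1/4)*r" using r0 by (intro mult_right_mono) auto
  then show ?thesis by (simp add: b2_def norm_mult wn indicator_def)
 qed
 have Ii: "intg (\<lambda>phi. indicator I phi*c)" for c :: real
  by (intro integrable_mult_left integrable_real_indicator) (auto simp: I_def)
 have b2i: "intg b2"
  by (rule Bochner_Integration.integrable_bound[OF Ii[of "exp (1/4)*r"]]) (use b2b r0 in auto)
 \<comment> \<open>The integral over the real line gives the damped symbol up to the factor csqrt (4
   pi z). It is split at |s| = r, and the inner part is replaced by the integral over the half
   circle.\<close>
 have id: "csqrt (of_real (4*pi)*z) * sm eta tau xi = (LBINT s. k1 xi s*b1 s) + (LBINT phi. k2 xi phi*b2 phi)" for xi :: 'a
 proof -
  define ro where "ro = (norm xi)^2"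
  let ?e = "\<lambda>s::real. gk p ro s"
  have ei: "intg ?e" by (rule gaussian_fourier_integrable[OF Rp])
  have "(LBINT s. ?e s) = csqrt (of_real pi/p)*exp (- of_real (ro^2)/(4*p))" by (rule gaussian_fourier[OF Rp])
  moreover have "of_real pi/p = of_real (4*pi)*z" using z0 by (simp add: p_def)
  moreover have "exp (- of_real (ro^2)/(4*p)) = sm eta tau xi" using z0 by (simp add: p_def sm_def z_def[symmetric] ro_def mult.commute)
  moreover have "(LBINT s. ?e s) = (LBINT s. indicator (- {-r..r}) s *\<^sub>R ?e s) + (LBINT s. indicator {-r..r} s *\<^sub>R ?e s)"
  proof -
   have "(LBINT s. ?e s) = (LBINT s. indicator (- {-r..r}) s *\<^sub>R ?e s + indicator {-r..r} s *\<^sub>R ?e s)"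
    by (rule Bochner_Integration.integral_cong) (auto simp: indicator_def)
   also have "... = (LBINT s. indicator (- {-r..r}) s *\<^sub>R ?e s) + (LBINT s. indicator {-r..r} s *\<^sub>R ?e s)"
    by (intro Bochner_Integration.integral_add integrable_mult_indicator ei) auto
   finally show ?thesis .
  qed
  moreover have "indicator (- {-r..r}) s *\<^sub>R ?e s = k1 xi s*b1 s" for s
  proof -
   have "?e s = k1 xi s*exp (- p*(of_real s)^2)" unfolding k1_def ro_def exp_add[symmetric] by (rule arg_cong[where f=exp]) (simp add: mult_ac)
   then show ?thesis by (simp add: b1_def)
  qed
  moreover have "(LBINT s. indicator {-r..r} s *\<^sub>R ?e s) = (LBINT phi. k2 xi phi*b2 phi)"
  proof -
   have "indicator I phi *\<^sub>R (exp (p*(of_real r*cis phi)^2 - of_real r*cis phi * of_real ro)*(of_real r*cis phi)) = k2 xi phi*b2 phi" for phi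
   proof -
    have "exp (p*(w phi)^2 - w phi * of_real ro) = exp (- w phi * of_real ro)*exp (p*(w phi)^2)"
     unfolding exp_add[symmetric] by simp
    then show ?thesis by (simp add: k2_def b2_def w_def[symmetric] ro_def indicator_def)
   qed
   then show ?thesis unfolding gaussian_shift[OF r0] I_def by (simp only:)
  qed
  ultimately show ?thesis by simp
 qed
 have L1b: "cmod (LBINT s. k1 xi s*b1 s) <= (LBINT s. cmod (b1 s))" for xi
  by (rule norm_integral_le) (use b1i k1b in "auto simp: norm_mult intro!: mult_left_le_one_le")
 have L2b: "cmod (LBINT s. k2 xi s*b2 s) <= (LBINT s. cmod (b2 s))" for xi
  by (rule norm_integral_le) (use b2i k2b in "auto simp: norm_mult intro!: mult_left_le_one_le")
 have hL1: "intg (\<lambda>xi. h xi*(LBINT s. k1 xi s*b1 s))"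
  by (rule Bochner_Integration.integrable_bound[where f="\<lambda>xi. h xi * of_real (LBINT s. cmod (b1 s))"])
   (use hi L1b in "auto simp: norm_mult intro!: mult_left_mono order_trans[OF L1b abs_ge_self]")
 have hL2: "intg (\<lambda>xi. h xi*(LBINT s. k2 xi s*b2 s))"
  by (rule Bochner_Integration.integrable_bound[where f="\<lambda>xi. h xi * of_real (LBINT s. cmod (b2 s))"])
   (use hi L2b in "auto simp: norm_mult intro!: mult_left_mono order_trans[OF L2b abs_ge_self]")
 have "csqrt (of_real (4*pi)*z)*(LBINT xi. sm eta tau xi*h xi) = (LBINT xi. h xi*(csqrt (of_real (4*pi)*z) * sm eta tau xi))"
  by (subst integral_mult_right_zero[symmetric]) (simp add: mult_ac)
 also have "... = (LBINT xi. h xi*(LBINT s. k1 xi s*b1 s)) + (LBINT xi. h xi*(LBINT phi. k2 xi phi*b2 phi))"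
  unfolding id distrib_left by (rule Bochner_Integration.integral_add[OF hL1 hL2])
 also have "(LBINT xi. h xi*(LBINT s. k1 xi s*b1 s)) = (LBINT s. b1 s*(LBINT xi. k1 xi s*h xi))"
  by (rule fubini_kernel[OF hi b1i k1m k1b])
 also have "(LBINT xi. h xi*(LBINT s. k2 xi s*b2 s)) = (LBINT s. b2 s*(LBINT xi. k2 xi s*h xi))"
  by (rule fubini_kernel[OF hi b2i k2m k2b])
 finally have eq: "csqrt (of_real (4*pi)*z)*(LBINT xi. sm eta tau xi*h xi) =
  (LBINT s. b1 s*(LBINT xi. k1 xi s*h xi)) + (LBINT s. b2 s*(LBINT xi. k2 xi s*h xi))" .
 define t1 where "t1 s = indicator {r..} s * s powr (- a)" for s :: real
 have t1i: "intg t1" "integral\<^sup>L lborel t1 = r powr (1 - a)/(a - 1)"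
  unfolding t1_def[abs_def] by (intro tail_powr a1 r0)+
 have t1i': "intg (\<lambda>s. t1 (- s))" using integrable_lborel_affine[OF t1i(1), of "-1" 0] by simp
 have "(LBINT s. t1 (- s)) = integral\<^sup>L lborel t1" by (rule integral_lborel_minus) (use t1i in auto)
 then have tt: "intg (\<lambda>s. H*(t1 s + t1 (- s)))" "(LBINT s. H*(t1 s + t1 (- s))) = H*(2*(r powr (1 - a)/(a - 1)))"
  using t1i t1i' by auto
 have 1: "cmod (LBINT s. b1 s*(LBINT xi. k1 xi s*h xi)) <= H*(2*(r powr (1 - a)/(a - 1)))"
  unfolding tt(2)[symmetric]
 proof (rule norm_integral_le[OF tt(1)], rule AE_I2)
  fix s :: real
  show "cmod (b1 s*(LBINT xi. k1 xi s*h xi)) <= H*(t1 s + t1 (- s))"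
  proof (cases "s \<in> {-r..r}")
   case True
   then have "b1 s = 0" by (simp add: b1_def)
   moreover have "0 <= t1 s" "0 <= t1 (- s)" by (auto simp: t1_def)
   ultimately show ?thesis using H0 by simp
  next
   case False
   then have s: "\<bar>s\<bar> > r" by auto
   have "cmod (LBINT xi. k1 xi s*h xi) <= H*cmod (\<i> * of_real s) powr (- a)"
    unfolding k1_def by (rule J) (use s r0 in auto)
   then have j: "cmod (LBINT xi. k1 xi s*h xi) <= H*\<bar>s\<bar> powr (- a)" by (simp add: norm_mult)
   have "cmod (b1 s) <= 1" using Rp by (simp add: b1_def indicator_def flip: of_real_power)
   then have "cmod (b1 s*(LBINT xi. k1 xi s*h xi)) <= 1*(H*\<bar>s\<bar> powr (- a))"
    unfolding norm_mult by (intro mult_mono j) auto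
   also have "\<bar>s\<bar> powr (- a) = t1 s + t1 (- s)" using s r0 by (auto simp: t1_def indicator_def abs_if)
   finally show ?thesis by simp
  qed
 qed
 have c2: "(LBINT phi. indicator I phi*(exp (1/4)*r*(H*r powr (- a)))) = pi*(exp (1/4)*r*(H*r powr (- a)))"
  by (simp add: I_def)
 have 2: "cmod (LBINT phi. b2 phi*(LBINT xi. k2 xi phi*h xi)) <= pi*(exp (1/4)*r*(H*r powr (- a)))"
  unfolding c2[symmetric]
 proof (rule norm_integral_le[OF Ii], rule AE_I2)
  fix phi :: real
  show "cmod (b2 phi*(LBINT xi. k2 xi phi*h xi)) <= indicator I phi*(exp (1/4)*r*(H*r powr (- a)))"
  proof (cases "phi \<in> I")
   case False then show ?thesis by (simp add: b2_def)
  next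
   case True
   have "w phi \<noteq> 0" using wn[of phi] r0 by auto
   then have j: "cmod (LBINT xi. k2 xi phi*h xi) <= H*r powr (- a)"
    using J[OF wR[OF True]] True by (simp add: k2_def wn)
   have "cmod (b2 phi) <= exp (1/4)*r" using b2b[of phi] True by simp
   then show ?thesis using True r0 unfolding norm_mult by (simp add: mult_mono j)
  qed
 qed
 have rr: "r*r powr (- a) = r powr (1 - a)" using r0 by (simp add: powr_add[symmetric] powr_mult_base)
 have "cmod (csqrt (of_real (4*pi)*z))*cmod (LBINT xi. sm eta tau xi*h xi) <= H*(2*(r powr (1 - a)/(a - 1))) + pi*(exp (1/4)*r*(H*r powr (- a)))"
  unfolding norm_mult[symmetric] eq by (rule order_trans[OF norm_triangle_ineq add_mono[OF 1 2]])
 also have "... = H*(2/(a - 1) + pi*exp (1/4))*(r*r powr (- a))"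
  unfolding rr[symmetric] using a1 by (simp add: field_simps)
 finally have le: "cmod (csqrt (of_real (4*pi)*z))*cmod (LBINT xi. sm eta tau xi*h xi) <= H*(2/(a - 1) + pi*exp (1/4))*(r*r powr (- a))" .
 \<comment> \<open>As |z| >= |tau|, the normalising factor has modulus at least sqrt (4 pi) r; this
   supplies the missing power of r.\<close>
 have sq: "sqrt (4*pi)*r <= cmod (csqrt (of_real (4*pi)*z))"
 proof -
  have "sqrt (4*pi)*r = sqrt (4*pi*\<bar>tau\<bar>)" by (simp add: r_def real_sqrt_mult)
  also have "... <= sqrt (cmod (of_real (4*pi)*z))" using z0 by (intro real_sqrt_le_mono) (simp add: norm_mult)
  finally show ?thesis by (simp add: norm_csqrt)
 qed
 have "sqrt (4*pi)*r*cmod (LBINT xi. sm eta tau xi*h xi) <= H*(2/(a - 1) + pi*exp (1/4))*(r*r powr (- a))"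
  by (rule order_trans[OF mult_right_mono[OF sq] le]) simp
 then have "r*(sqrt (4*pi)*cmod (LBINT xi. sm eta tau xi*h xi)) <= r*(H*(2/(a - 1) + pi*exp (1/4))*r powr (- a))"
  by (simp only: mult_ac)
 then have "sqrt (4*pi)*cmod (LBINT xi. sm eta tau xi*h xi) <= H*(2/(a - 1) + pi*exp (1/4))*r powr (- a)"
  using r0 by (simp only: mult_le_cancel_left_pos)
 then have "cmod (LBINT xi. sm eta tau xi*h xi) <= H*(2/(a - 1) + pi*exp (1/4))*r powr (- a)/sqrt (4*pi)"
  by (subst pos_le_divide_eq) (simp_all add: mult.commute)
 also have "r powr (- a) = \<bar>tau\<bar> powr (- real DIM('a)/4)"
  unfolding r_def powr_half_sqrt[symmetric, OF abs_ge_zero] powr_powr by (simp add: a_def)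
 finally show ?thesis by (simp add: h_def H_def dispC_def a_def mult_ac)
qed

lemma n1_indicator_le:
 fixes f :: "'a::euclidean_space => complex"
 assumes f: "f \<in> L2" and A: "A \<in> sets borel" "emeasure lborel A < \<infinity>" and s: "\<And>x. x \<notin> A ==> f x = 0"
 shows "intg f" "n1 f <= sqrt (measure lborel A)*nrm f"
proof -
 note I = L2_indicator_set[OF A]
 have eq: "f x*indicator A x = f x" for x using s by (auto simp: indicator_def)
 show "intg f" using L2_mult_integrable[OF f I(1)] by (simp add: eq)
 have "n1 f = (LBINT x. cmod (f x*indicator A x))" by (simp add: n1_def eq)
 also have "... <= nrm f*nrm (\<lambda>x. indicator A x)" by (rule L2_CS[OF f I(1)])
 also have "nrm (\<lambda>x. indicator A x) = sqrt (measure lborel A)"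
  using I(2) by (metis nrm_nonneg real_sqrt_abs abs_of_nonneg)
 finally show "n1 f <= sqrt (measure lborel A)*nrm f" by (simp add: mult.commute)
qed

lemma sm_bmeas: "eta \<ge> 0 ==> bmeas (sm eta tau)"
 by (rule bmeasI[OF sm_measurable cmod_sm_le])

lemma dispC_nonneg: "DIM('a::euclidean_space) \<ge> 3 ==> 0 <= dispC TYPE('a)"
 unfolding dispC_def by (intro divide_nonneg_nonneg mult_nonneg_nonneg add_nonneg_nonneg heatC_nonneg) auto

text \<open>On supports of finite measure the L^1 norms are bounded by L^2 norms, so the decay
  estimate gives a bound P times the product of the norms, while the damped flow, a contraction,
  gives the bound 1. The elementary inequality min P 1 <= P powr th takes the place of
  interpolation.\<close>

lemma restricted_bound:
 fixes f g :: "'a::euclidean_space => complex"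
 assumes N: "DIM('a) \<ge> 3" and f: "f \<in> L2" "\<And>x. x \<notin> A ==> f x = 0" and g: "g \<in> L2" "\<And>x. x \<notin> B ==> g x = 0"
  and A: "A \<in> sets borel" "emeasure lborel A < \<infinity>" and B: "B \<in> sets borel" "emeasure lborel B < \<infinity>"
  and eta: "eta > 0" and tau: "tau \<noteq> 0" and th: "0 <= th" "th <= 1"
 shows "cmod (ip (fmul (sm eta tau) f) g) \<le>
  (dispC TYPE('a)*\<bar>tau\<bar> powr (- real DIM('a)/4) * sqrt (measure lborel A) * sqrt (measure lborel B)) powr th*(nrm f*nrm g)"
proof -
 define K where "K = dispC TYPE('a)*\<bar>tau\<bar> powr (- real DIM('a)/4)"
 define P where "P = K * sqrt (measure lborel A) * sqrt (measure lborel B)"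
 have K0: "K \<ge> 0" using dispC_nonneg[OF N] by (simp add: K_def)
 have P0: "P \<ge> 0" using K0 by (simp add: P_def)
 note fi = n1_indicator_le[OF f(1) A f(2)] and gi = n1_indicator_le[OF g(1) B g(2)]
 have "ip (fmul (sm eta tau) f) g = (LBINT xi. sm eta tau xi*(FT f xi*cnj (FT g xi)))"
  using eta by (subst ip_fmul[OF sm_bmeas f(1) g(1)]) (auto simp: ip_def mult.assoc)
 also have "cmod ... <= K*n1 f*n1 g" unfolding K_def by (rule dispersive_form[OF N f(1) fi(1) g(1) gi(1) eta tau])
 also have "... <= K*(sqrt (measure lborel A)*nrm f)*(sqrt (measure lborel B)*nrm g)"
  using K0 by (intro mult_mono fi gi) (auto intro!: mult_nonneg_nonneg)
 finally have 1: "cmod (ip (fmul (sm eta tau) f) g) <= P*(nrm f*nrm g)" by (simp add: P_def mult_ac)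
 have "cmod (ip (fmul (sm eta tau) f) g) <= nrm (fmul (sm eta tau) f)*nrm g"
  using eta by (intro ip_CS fmul_L2 sm_bmeas f g) auto
 also have "... <= (1*nrm f)*nrm g" using eta by (intro mult_right_mono nrm_fmul_le f) (auto simp: cmod_sm_le)
 finally have 2: "cmod (ip (fmul (sm eta tau) f) g) <= 1*(nrm f*nrm g)" by simp
 have "min P 1 <= P powr th" if "P > 0"
 proof (cases "P <= 1")
  case True
  then have "P powr 1 <= P powr th" using that th by (intro powr_mono') auto
  then show ?thesis using True that by simp
 next
  case False
  then have "1 <= P powr th" using th by (intro ge_one_powr_ge_zero) auto
  then show ?thesis by simp
 qed
 moreover have "cmod (ip (fmul (sm eta tau) f) g) <= min P 1*(nrm f*nrm g)" using 1 2 by (auto simp: min_def)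
 ultimately have "cmod (ip (fmul (sm eta tau) f) g) <= P powr th*(nrm f*nrm g)"
 proof (cases "P > 0")
  case True
  with \<open>P > 0 ==> min P 1 <= P powr th\<close> have "min P 1*(nrm f*nrm g) <= P powr th*(nrm f*nrm g)" by (intro mult_right_mono) auto
  with \<open>cmod (ip (fmul (sm eta tau) f) g) <= min P 1 * (nrm f * nrm g)\<close> show ?thesis by linarith
 next
  case False
  then have "P = 0" using P0 by simp
  then show ?thesis using 1 by simp
 qed
 then show ?thesis by (simp add: P_def K_def mult.assoc)
qed

section \<open>Dyadic cells in |x| and in the density\<close>

definition shell :: "int => 'a::euclidean_space set" where
 "shell k = {x. 2 powr (- real_of_int k) <= norm x \<and> norm x < 2 powr (- real_of_int k + 1)}"

text \<open>In \<open>shell k\<close> the weight |x|^-b is of size 2^(b k), hence the sign of the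
  exponent there. A cell fixes both |x| and the density \<open>ro\<close> up to a factor 2, so the
  potential is comparable to a constant on it.\<close>

definition cell :: "('a::euclidean_space => real) => int \<times> int => 'a set" where
 "cell ro i = {x \<in> shell (fst i). 2 powr real_of_int (snd i) <= ro x \<and> ro x < 2 powr (real_of_int (snd i) + 1)}"

text \<open>The inequalities are strict so that the indicator is lower semicontinuous in the value
  of \<open>ro\<close>; measurability in time rests on this.\<close>

definition trunc :: "('a::euclidean_space => real) => nat => 'a set" where
 "trunc ro n = {x. 2 powr (- real n) < norm x \<and> norm x < 2 powr real n \<and> 2 powr (- real n) < ro x \<and> ro x < 2 powr real n}"

definition KK :: "nat => (int \<times> int) set" where "KK n = {- int n..int n} \<times> {- int n..int n}"

lemma finite_KK [simp]: "finite (KK n)" by (simp add: KK_def)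

lemma powr_floor_log:
 fixes x :: real assumes "x > 0"
 shows "2 powr real_of_int \<lfloor>log 2 x\<rfloor> <= x" "x < 2 powr (real_of_int \<lfloor>log 2 x\<rfloor> + 1)"
proof -
 have "real_of_int \<lfloor>log 2 x\<rfloor> <= log 2 x" "log 2 x < real_of_int \<lfloor>log 2 x\<rfloor> + 1" by linarith+
 then show "2 powr real_of_int \<lfloor>log 2 x\<rfloor> <= x" "x < 2 powr (real_of_int \<lfloor>log 2 x\<rfloor> + 1)"
  using assms by (simp_all only: le_log_iff[symmetric] log_less_iff[symmetric] one_less_numeral_iff semiring_norm)
qed

lemma dyadic_unique:
 assumes "2 powr real_of_int k <= (x::real)" "x < 2 powr (real_of_int k + 1)" "2 powr real_of_int l <= x" "x < 2 powr (real_of_int l + 1)"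
 shows "k = l"
proof -
 have "2 powr real_of_int k < 2 powr (real_of_int l + 1)" "2 powr real_of_int l < 2 powr (real_of_int k + 1)" using assms by linarith+
 then show ?thesis by simp
qed

lemma cell_unique: "x \<in> cell ro i ==> x \<in> cell ro j ==> i = j"
 using dyadic_unique[of "- fst i" "norm x" "- fst j"] dyadic_unique[of "snd i" "ro x" "snd j"]
 by (auto simp: cell_def shell_def prod_eq_iff)

lemma trunc_cell: 
 assumes "x \<in> trunc ro n" shows "\<exists>i\<in>KK n. x \<in> cell ro i"
proof -
 have x: "2 powr (- real n) < norm x" "norm x < 2 powr real n" "2 powr (- real n) < ro x" "ro x < 2 powr real n" using assms by (auto simp: trunc_def)
 have pos: "norm x > 0" "ro x > 0" using x(1,3) powr_gt_zero[of 2 "- real n"] by linarith+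
 define k l where "k = \<lfloor>log 2 (norm x)\<rfloor>" "l = \<lfloor>log 2 (ro x)\<rfloor>"
 have "- real n < log 2 (norm x)" "log 2 (norm x) < real n" "- real n < log 2 (ro x)" "log 2 (ro x) < real n"
  using x pos by (auto simp: less_log_iff log_less_iff)
 then have "- int n <= k" "k <= int n" "- int n <= l" "l <= int n" unfolding k_l_def by linarith+
 moreover have "x \<in> cell ro (-k, l)"
  using powr_floor_log[OF pos(1)] powr_floor_log[OF pos(2)] by (simp add: cell_def shell_def k_l_def)
 ultimately show ?thesis by (intro bexI[of _ "(-k, l)"]) (auto simp: KK_def)
qed

lemma sum_trunc_cells:
 "indicat_real (trunc ro n) x = (\<Sum>i\<in>KK n. indicat_real (trunc ro n \<inter> cell ro i) x)"
proof (cases "x \<in> trunc ro n")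
 case True
 then obtain i where i: "i \<in> KK n" "x \<in> cell ro i" using trunc_cell by blast
 have "(\<Sum>j\<in>KK n. indicat_real (trunc ro n \<inter> cell ro j) x) = (\<Sum>j\<in>KK n. if j = i then 1 else 0)"
 proof (rule sum.cong[OF refl])
  fix j
  show "indicat_real (trunc ro n \<inter> cell ro j) x = (if j = i then 1 else 0)"
  proof (cases "x \<in> cell ro j")
   case True': True
   then have "j = i" using i(2) by (rule cell_unique)
   then show ?thesis using True True' by simp
  next
   case False
   then have "j \<noteq> i" using i(2) by auto
   then show ?thesis using False by simp
  qed
 qed
 then show ?thesis using True i by simp
qed simp

lemma shell_sets [measurable]: "shell k \<in> sets borel" unfolding shell_def by measurable

lemma cell_sets [measurable]: assumes [measurable]: "ro \<in> borelm" shows "cell ro i \<in> sets borel" unfolding cell_def by measurable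

lemma trunc_sets [measurable]: assumes [measurable]: "ro \<in> borelm" shows "trunc ro n \<in> sets borel" unfolding trunc_def by measurable

text \<open>The summand 1 makes the constant at least 1, so that its powers increase with the
  exponent.\<close>

definition shC :: "'a::euclidean_space itself => real" where "shC _ = 2 ^ DIM('a)*measure lborel (ball (0::'a) 1) + 1"

lemma shell_measure:
 shows "emeasure lborel (shell k :: 'a::euclidean_space set) < \<infinity>" "measure lborel (shell k :: 'a set) <= shC TYPE('a)*2 powr (- real DIM('a)*real_of_int k)"
proof -
 let ?r = "2 powr (- real_of_int k + 1) :: real"
 have sub: "shell k \<subseteq> ball (0::'a) ?r" by (auto simp: shell_def)
 have fin: "emeasure lborel (ball (0::'a) ?r) < \<infinity>" using emeasure_bounded_finite[OF bounded_ball[of "0::'a" ?r]] by simp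
 show "emeasure lborel (shell k :: 'a set) < \<infinity>" using emeasure_mono[OF sub, of lborel] fin by (simp add: le_less_trans)
 have "measure lborel (shell k :: 'a set) <= measure lborel (ball (0::'a) ?r)"
  using sub fin by (intro measure_mono_fmeasurable) (auto simp: fmeasurable_def)
 also have "... = ?r ^ DIM('a)*measure lborel (ball (0::'a) 1)"
 proof -
  have "(LBINT x. indicat_real (ball (0::'a) ?r) x) = \<bar>?r\<bar> ^ DIM('a) *\<^sub>R (LBINT x. indicat_real (ball (0::'a) ?r) (0 + ?r *\<^sub>R x))"
   by (rule integral_lborel_affine) (auto intro!: borel_measurable_indicator)
  also have "(\<lambda>x::'a. indicat_real (ball (0::'a) ?r) (0 + ?r *\<^sub>R x)) = indicat_real (ball 0 1)"
   by (auto simp: indicator_def fun_eq_iff)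
  finally show ?thesis using fin emeasure_bounded_finite[OF bounded_ball[of "0::'a" 1]] by simp
 qed
 also have "?r ^ DIM('a) = 2 ^ DIM('a)*2 powr (- real DIM('a)*real_of_int k)"
 proof -
  have "?r ^ DIM('a) = ?r powr real DIM('a)" by (simp add: powr_realpow)
  also have "... = 2 powr (real DIM('a) + (- real DIM('a)*real_of_int k))" by (simp add: powr_powr algebra_simps)
  also have "... = 2 ^ DIM('a)*2 powr (- real DIM('a)*real_of_int k)" by (simp only: powr_add) (simp add: powr_realpow)
  finally show ?thesis .
 qed
 also have "2 ^ DIM('a)*2 powr (- real DIM('a)*real_of_int k)*measure lborel (ball (0::'a) 1) <= shC TYPE('a)*2 powr (- real DIM('a)*real_of_int k)"
  by (simp add: shC_def algebra_simps)
 finally show "measure lborel (shell k :: 'a set) <= shC TYPE('a)*2 powr (- real DIM('a)*real_of_int k)" .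
qed

lemma shC_ge_1: "1 <= shC TYPE('a::euclidean_space)" by (simp add: shC_def)

definition wV :: "real => real => ('a::euclidean_space => real) => 'a => real" where
 "wV b al ro x = norm x powr (- b)*ro x powr al"

lemma wV_nonneg [simp]: "0 <= wV b al ro x" by (simp add: wV_def)

lemma wV_measurable [measurable]: assumes [measurable]: "ro \<in> borelm" shows "wV b al ro \<in> borelm"
 unfolding wV_def[abs_def] by measurable

abbreviation wt :: "real => real => int \<times> int => real" where
 "wt b be i \<equiv> 2 powr (b*real_of_int (fst i) + be*real_of_int (snd i))"

abbreviation cut :: "real => real => ('a::euclidean_space => real) => nat => ('a => complex) => 'a => complex" where
 "cut b al ro n f \<equiv> \<lambda>x. of_real (sqrt (wV b al ro x)*indicator (trunc ro n) x)*f x"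

abbreviation nsum :: "('a => complex) => ('a => complex) => 'a => real" where
 "nsum f g \<equiv> \<lambda>x. cmod (f x) + cmod (g x)"

lemma wV_cell:
 assumes x: "x \<in> cell ro i" and b: "0 <= b" "0 <= al"
 shows "wV b al ro x <= wt b al i*2 powr al"
proof -
 have x: "2 powr (- real_of_int (fst i)) <= norm x" "2 powr real_of_int (snd i) <= ro x" "ro x < 2 powr (real_of_int (snd i) + 1)"
  using x by (auto simp: cell_def shell_def)
 have "0 <= ro x" using x(2) powr_ge_zero[of 2 "real_of_int (snd i)"] by linarith
 have "norm x powr (- b) <= (2 powr (- real_of_int (fst i))) powr (- b)" using b x(1) by (intro powr_mono2') auto
 moreover have "ro x powr al <= (2 powr (real_of_int (snd i) + 1)) powr al" using b x(3) \<open>0 <= ro x\<close> by (intro powr_mono2) auto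
 ultimately have "wV b al ro x <= (2 powr (- real_of_int (fst i))) powr (- b)*(2 powr (real_of_int (snd i) + 1)) powr al"
  unfolding wV_def by (intro mult_mono) auto
 also have "... = wt b al i*2 powr al"
  by (simp add: powr_powr powr_add[symmetric] algebra_simps)
 finally show ?thesis .
qed

lemma geometric_int_sum:
 fixes q :: real assumes q: "0 <= q" "q < 1"
 shows "(\<Sum>k\<in>{- int n..int n}. q ^ nat \<bar>k\<bar>) <= 2/(1 - q)"
proof -
 have "(\<Sum>k\<in>{- int n..int n}. q ^ nat \<bar>k\<bar>) <= 2*(\<Sum>j<Suc n. q ^ j)"
 proof (induction n)
  case (Suc n)
  have "{- int (Suc n)..int (Suc n)} = insert (- int (Suc n)) (insert (int (Suc n)) {- int n..int n})" by auto
  then have "(\<Sum>k\<in>{- int (Suc n)..int (Suc n)}. q ^ nat \<bar>k\<bar>) = 2*q ^ Suc n + (\<Sum>k\<in>{- int n..int n}. q ^ nat \<bar>k\<bar>)"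
   by (simp add: nat_add_distrib)
  then show ?case using Suc by simp
 qed simp
 also have "(\<Sum>j<Suc n. q ^ j) <= 1/(1 - q)"
  using sum_le_suminf[of "\<lambda>j. q ^ j" "{..<Suc n}"] q by (simp add: suminf_geometric summable_geometric)
 finally show ?thesis by simp
qed

definition decay :: "real => int \<times> int => real" where
 "decay e i = 2 powr (- e*(\<bar>real_of_int (fst i)\<bar> + \<bar>real_of_int (snd i)\<bar>))"

lemma decay_sum: 
 assumes e: "e > 0" shows "(\<Sum>i\<in>KK n. decay e i) <= (2/(1 - 2 powr (- e)))^2"
proof -
 define q where "q = 2 powr (- e)"
 have q: "0 <= q" "q < 1" using e by (auto simp: q_def powr_minus_divide intro!: ge_one_powr_ge_zero)
 have "2 powr (- e*\<bar>real_of_int k\<bar>) = q ^ nat \<bar>k\<bar>" for k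
 proof -
  have "q > 0" by (simp add: q_def)
  then have "q ^ nat \<bar>k\<bar> = q powr real (nat \<bar>k\<bar>)" by (rule powr_realpow[symmetric])
  also have "... = 2 powr (- e*\<bar>real_of_int k\<bar>)" by (simp add: q_def powr_powr)
  finally show ?thesis ..
 qed
 then have d: "decay e i = q ^ nat \<bar>fst i\<bar>*q ^ nat \<bar>snd i\<bar>" for i
  unfolding decay_def distrib_left powr_add by (simp only:)
 have "(\<Sum>i\<in>KK n. decay e i) = (\<Sum>k\<in>{- int n..int n}. q ^ nat \<bar>k\<bar>)*(\<Sum>k\<in>{- int n..int n}. q ^ nat \<bar>k\<bar>)"
  unfolding d KK_def sum_product sum.cartesian_product by (rule sum.cong) auto
 also have "... <= (2/(1 - q))*(2/(1 - q))"
  by (intro mult_mono geometric_int_sum q sum_nonneg) (use q in auto)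
 finally show ?thesis by (simp add: q_def power2_eq_square)
qed

section \<open>Dyadic bounds for the potential\<close>

text \<open>Weak L^R and weak L^2 bounds on the distribution function, which is all that a sum over
  dyadic levels consumes.\<close>

definition tame :: "real => real => ('a::euclidean_space => real) => bool" where
 "tame B R ro \<longleftrightarrow> ro \<in> borelm \<and> (\<forall>x. 0 <= ro x) \<and>
  (\<forall>s>0. emeasure lborel {x. s <= ro x} < \<infinity> \<and> measure lborel {x. s <= ro x} <= B * s powr (- R) \<and>
    measure lborel {x. s <= ro x} <= B * s powr (- 2))"

text \<open>\<open>U\<close> bounds the r-th power of the weak L^r norm. It is kept apart from the
  constants because it will depend on time.\<close>

definition levelU :: "real => real => ('a::euclidean_space => real) => bool" where
 "levelU r U ro \<longleftrightarrow> 0 <= U \<and> (\<forall>s>0. measure lborel {x. s <= ro x} <= U * s powr (- r))"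

lemma tame_measurable [measurable_dest]: "tame B R ro ==> ro \<in> borelm" by (simp add: tame_def)

lemma cell_measure_le_level:
 assumes "tame B R ro"
 shows "measure lborel (cell ro i) <= measure lborel {x. 2 powr real_of_int (snd i) <= ro x}"
proof (rule measure_mono_fmeasurable)
 have [measurable]: "ro \<in> borelm" using assms by (rule tame_measurable)
 show "cell ro i \<subseteq> {x. 2 powr real_of_int (snd i) <= ro x}" by (auto simp: cell_def)
 show "cell ro i \<in> sets lborel" by simp
 show "{x. 2 powr real_of_int (snd i) <= ro x} \<in> fmeasurable lborel"
  using assms by (intro fmeasurableI) (auto simp: tame_def)
qed

lemma cell_measure_le_shell:
 fixes ro :: "'a::euclidean_space => real"
 assumes [measurable]: "ro \<in> borelm"
 shows "emeasure lborel (cell ro i) < \<infinity>" "measure lborel (cell ro i) <= shC TYPE('a)*2 powr (- real DIM('a)*real_of_int (fst i))"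
proof -
 have sub: "cell ro i \<subseteq> shell (fst i)" by (auto simp: cell_def)
 note s = shell_measure[where k="fst i" and 'a='a]
 show "emeasure lborel (cell ro i) < \<infinity>" using emeasure_mono[OF sub, of lborel] s(1) by (simp add: le_less_trans)
 have "measure lborel (cell ro i) <= measure lborel (shell (fst i) :: 'a set)"
  using sub s(1) by (intro measure_mono_fmeasurable) (auto intro: fmeasurableI)
 with s(2) show "measure lborel (cell ro i) <= shC TYPE('a)*2 powr (- real DIM('a)*real_of_int (fst i))" by linarith
qed

lemma powr_le_factor:
 fixes m c s t :: real
 assumes "0 < m" "m <= c*2 powr s" "0 < c" "0 <= t"
 shows "m powr t <= c powr t*2 powr (s*t)"
proof -
 have "m powr t <= (c*2 powr s) powr t" using assms by (intro powr_mono2) auto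
 also have "... = c powr t*2 powr (s*t)" using assms by (simp add: powr_mult powr_powr)
 finally show ?thesis .
qed

text \<open>The power of the measure m of a cell is split as m^th = m^x m^y m^z m^w, and the four
  factors are bounded by the volume of the shell and by the levels r0, R and 2. For x = b/N and the
  given y, z0, w0 the conditions \<open>s1\<close> and \<open>s2\<close> balance the weight exactly.
  Shifting the exponents a little according to the signs of k and l leaves geometric decay in both
  indices. The alternative y = 0, U = 1 is the version without the level r0.\<close>

lemma cell_bound:
 fixes b be th y z0 w0 B R r0 :: real
 assumes b: "b > 0" and B: "B \<ge> 1" and R: "R > 2" and y: "y \<ge> 0" and z0: "z0 > 0" and w0: "w0 > 0"
  and s1: "r0*y + R*z0 + 2*w0 = be" and s2: "b/real DIM('a) + y + z0 + w0 = th"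
 shows "\<exists>e>0. \<exists>C>0. \<forall>(ro::'a::euclidean_space => real) U i. tame B R ro --> (y = 0 \<and> U = 1 \<or> levelU r0 U ro) -->
  wt b be i*measure lborel (cell ro i) powr th <= C*decay e i*U powr y"
proof -
 define N where "N = real DIM('a)"
 have N: "N \<ge> 1" by (simp add: N_def Suc_leI)
 \<comment> \<open>\<open>D\<close> bounds how far each of the exponents x, z and w moves per unit
   of \<open>e\<close>, so that all of them stay non-negative.\<close>
 define D where "D = 1 + 3/(R - 2)"
 have D: "D > 1" using R by (simp add: D_def)
 define e where "e = min (b/N) (min z0 w0)/D"
 have e0: "e > 0" using b N z0 w0 D by (simp add: e_def)
 have "e*D = min (b/N) (min z0 w0)" using D by (simp add: e_def)
 then have "e*D <= b/N \<and> e*D <= z0 \<and> e*D <= w0" by (simp add: min_le_iff_disj)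
 moreover have "e <= e*D" "e*(3/(R - 2)) <= e*D" "e + e*(3/(R - 2)) = e*D" using e0 D R by (auto simp: D_def algebra_simps)
 ultimately have eb: "e <= b/N" "e*(3/(R - 2)) <= z0" "e + e*(3/(R - 2)) <= w0" by linarith+
 define Cs where "Cs = shC TYPE('a)"
 have Cs: "Cs \<ge> 1" by (simp add: Cs_def shC_ge_1)
 have th0: "th > 0" using s2 b y z0 w0 N by (metis N_def add_pos_nonneg add_pos_pos divide_pos_pos less_le_trans zero_less_one)
 define C where "C = Cs powr th*B powr th"
 have C0: "C > 0" using Cs B by (simp add: C_def)
 have main: "2 powr (b*real_of_int k + be*real_of_int l)*measure lborel (cell ro (k, l)) powr th <= C*decay e (k, l)*U powr y"
  if t: "tame B R ro" and U: "y = 0 \<and> U = 1 \<or> levelU r0 U ro" for ro :: "'a => real" and U k l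
 proof (cases "measure lborel (cell ro (k, l)) = 0")
  case True
  have "0 <= C*decay e (k, l)*U powr y" using C0 by (simp add: decay_def)
  then show ?thesis using True by simp
 next
  case False
  define m where "m = measure lborel (cell ro (k, l))"
  have m: "m > 0" using False by (simp add: m_def zero_less_measure_iff)
  define sk sl :: real where "sk = (if k \<ge> 0 then 1 else -1)" "sl = (if l \<ge> 0 then 1 else -1)"
  have sk: "sk = 1 \<or> sk = -1" "sk*real_of_int k = \<bar>real_of_int k\<bar>" by (auto simp: sk_sl_def)
  have sl: "sl = 1 \<or> sl = -1" "sl*real_of_int l = \<bar>real_of_int l\<bar>" by (auto simp: sk_sl_def)
  define dz where "dz = (sl*e + 2 * sk*e)/(R - 2)"
  have "\<bar>sl*e + 2 * sk*e\<bar> <= 3*e" using sk(1) sl(1) e0 by auto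
  then have "\<bar>sl*e + 2 * sk*e\<bar>/(R - 2) <= 3*e/(R - 2)" using R by (intro divide_right_mono) auto
  then have dz: "\<bar>dz\<bar> <= e*(3/(R - 2))" using R by (simp add: dz_def abs_divide mult.commute)
  have dzR: "(R - 2)*dz = sl*e + 2 * sk*e" using R by (simp add: dz_def)
  \<comment> \<open>The sum x + z + w is unchanged. N x exceeds b by \<open>N * sk * e\<close>, and
    R z + 2 w exceeds R z0 + 2 w0 by \<open>sl * e\<close>; multiplied by -k and -l these excesses
    become the decay.\<close>
  define x z w where "x = b/N + sk*e" "z = z0 + dz" "w = w0 - sk*e - dz"
  have x: "x \<ge> 0" using eb(1) sk(1) e0 by (auto simp: x_z_w_def)
  have z: "z \<ge> 0" using eb(2) dz by (simp add: x_z_w_def)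
  have "\<bar>sk*e\<bar> = e" using sk(1) e0 by auto
  then have w: "w \<ge> 0" using eb(3) dz by (simp add: x_z_w_def)
  have sum: "x + y + (z + w) = th" using s2 by (simp add: x_z_w_def N_def)
  have mx: "m powr x <= Cs powr x*2 powr (- N*k*x)"
   using powr_le_factor[OF m _ _ x, of Cs "- N*k"] cell_measure_le_shell(2)[OF tame_measurable[OF t], of "(k, l)"] Cs
   by (simp add: m_def Cs_def N_def)
  have lev: "m <= measure lborel {x. 2 powr real_of_int l <= ro x}" using cell_measure_le_level[OF t, of "(k, l)"] by (simp add: m_def)
  have t': "measure lborel {x. 2 powr real_of_int l <= ro x} <= B*(2 powr real_of_int l) powr (- R)"
   "measure lborel {x. 2 powr real_of_int l <= ro x} <= B*(2 powr real_of_int l) powr (- 2)" using t by (auto simp: tame_def)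
  have mz: "m powr z <= B powr z*2 powr ((- R*l)*z)"
   by (rule powr_le_factor[OF m _ _ z]) (use lev t'(1) B in "simp_all add: powr_powr mult.commute")
  have mw: "m powr w <= B powr w*2 powr ((- 2*l)*w)"
   by (rule powr_le_factor[OF m _ _ w]) (use lev t'(2) B in "simp_all add: powr_powr mult.commute")
  have my: "m powr y <= U powr y*2 powr ((- r0*l)*y)"
  proof (cases "y = 0 \<and> U = 1")
   case True then show ?thesis using m by simp
  next
   case False
   then have "levelU r0 U ro" using U by blast
   then have u: "measure lborel {x. 2 powr real_of_int l <= ro x} <= U*(2 powr real_of_int l) powr (- r0)" "0 <= U" by (auto simp: levelU_def)
   then have "U > 0" using lev m by (cases "U = 0") auto
   then show ?thesis by (intro powr_le_factor[OF m _ _ y]) (use lev u in "simp_all add: powr_powr mult.commute")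
  qed
  have "m powr th = m powr x*m powr y*(m powr z*m powr w)" unfolding sum[symmetric] by (simp only: powr_add)
  also have "... <= (Cs powr x*2 powr (- N*k*x))*(U powr y*2 powr ((- r0*l)*y))*((B powr z*2 powr ((- R*l)*z))*(B powr w*2 powr ((- 2*l)*w)))"
   by (intro mult_mono mx my mz mw) auto
  also have "... = (Cs powr x*B powr (z + w))*U powr y*2 powr (- N*k*x + ((- r0*l)*y + ((- R*l)*z + (- 2*l)*w)))"
   by (simp only: powr_add mult_ac)
  also have "... <= C*U powr y*2 powr (- N*k*x + ((- r0*l)*y + ((- R*l)*z + (- 2*l)*w)))"
  proof -
   have "Cs powr x <= Cs powr th" using Cs y z w sum by (intro powr_mono) auto
   moreover have "B powr (z + w) <= B powr th" using B x y sum by (intro powr_mono) auto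
   ultimately have "Cs powr x*B powr (z + w) <= C" unfolding C_def by (rule mult_mono) auto
   then show ?thesis by (rule mult_right_mono[OF mult_right_mono]) auto
  qed
  finally have "2 powr (b*real_of_int k + be*real_of_int l)*m powr th <= 2 powr (b*real_of_int k + be*real_of_int l)*(C*U powr y*2 powr (- N*k*x + ((- r0*l)*y + ((- R*l)*z + (- 2*l)*w))))"
   by (intro mult_left_mono) auto
  also have "... = C*U powr y*2 powr ((b*real_of_int k + be*real_of_int l) + (- N*k*x + ((- r0*l)*y + ((- R*l)*z + (- 2*l)*w))))"
   by (simp only: powr_add mult_ac)
  also have "(b*real_of_int k + be*real_of_int l) + (- N*k*x + ((- r0*l)*y + ((- R*l)*z + (- 2*l)*w))) = - N*e*\<bar>real_of_int k\<bar> - e*\<bar>real_of_int l\<bar>"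
  proof -
   have "N*x = b + N*(sk*e)" using N by (simp add: x_z_w_def distrib_left)
   have "- N*k*x = - (N*x)*k" by simp
   also have "... = - b*k - N*e*(sk*k)" unfolding \<open>N * x = b + N * (sk * e)\<close> by (simp add: algebra_simps)
   finally have a: "- N*k*x = - b*k - N*e*(sk*k)" .
   have "r0*y + R*z + 2*w = be + sl*e" using s1 dzR by (simp add: x_z_w_def algebra_simps)
   then have "- real_of_int l*(r0*y + R*z + 2*w) = - be*l - e*(sl*l)" by (simp add: algebra_simps)
   then have c: "(- r0*l)*y + ((- R*l)*z + (- 2*l)*w) = - be*l - e*(sl*l)" by (simp add: algebra_simps)
   show ?thesis unfolding a c sk(2) sl(2) by simp
  qed
  also have "C*U powr y*2 powr (- N*e*\<bar>real_of_int k\<bar> - e*\<bar>real_of_int l\<bar>) <= C*U powr y*2 powr (- e*(\<bar>real_of_int k\<bar> + \<bar>real_of_int l\<bar>))"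
  proof (intro mult_left_mono powr_mono)
   have "e*\<bar>real_of_int k\<bar> <= N*(e*\<bar>real_of_int k\<bar>)" using mult_right_mono[OF N, of "e*\<bar>real_of_int k\<bar>"] e0 by simp
   then show "- N*e*\<bar>real_of_int k\<bar> - e*\<bar>real_of_int l\<bar> <= - e*(\<bar>real_of_int k\<bar> + \<bar>real_of_int l\<bar>)" by (simp add: algebra_simps)
  qed (use C0 in auto)
  finally show ?thesis by (simp add: m_def decay_def mult_ac)
 qed
 show ?thesis
 proof (rule exI[of _ e], intro conjI e0, rule exI[of _ C], intro conjI C0 allI impI)
  fix ro :: "'a => real" and U and i :: "int \<times> int"
  assume t: "tame B R ro" and U: "y = 0 \<and> U = 1 \<or> levelU r0 U ro"
  obtain k l where i: "i = (k, l)" by (cases i)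
  show "wt b be i*measure lborel (cell ro i) powr th <= C*decay e i*U powr y"
   using main[OF t U, of k l] by (simp only: i fst_conv snd_conv)
 qed
qed

lemma ip_fmul_sum:
 fixes m :: "'a::euclidean_space => complex"
 assumes m: "bmeas m" and "finite I" "\<And>i. i \<in> I ==> F i \<in> L2" and G: "G \<in> L2"
 shows "(\<lambda>x. \<Sum>i\<in>I. F i x) \<in> L2 \<and> ip (fmul m (\<lambda>x. \<Sum>i\<in>I. F i x)) G = (\<Sum>i\<in>I. ip (fmul m (F i)) G)"
 using assms(2,3)
proof (induction I rule: finite_induct)
 case empty
 obtain B where B: "\<And>xi. cmod (m xi) <= B" "m \<in> borelm" using m by (auto simp: bmeas_def)
 have "nrm (fmul m (\<lambda>x. 0)) <= B*nrm (\<lambda>x::'a. 0)" by (rule nrm_fmul_le) (use B in auto)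
 then have "cmod (ip (fmul m (\<lambda>x. 0)) G) <= 0"
  using ip_CS[OF fmul_L2[OF m L2_zero] G] nrm_nonneg[of "fmul m (\<lambda>x. 0)"] by simp
 then show ?case by simp
next
 case (insert i I)
 have S: "(\<lambda>x. \<Sum>i\<in>I. F i x) \<in> L2" and IH: "ip (fmul m (\<lambda>x. \<Sum>i\<in>I. F i x)) G = (\<Sum>i\<in>I. ip (fmul m (F i)) G)" using insert by auto
 have Fi: "F i \<in> L2" using insert by auto
 have "ip (fmul m (\<lambda>x. F i x + (\<Sum>i\<in>I. F i x))) G = ip (\<lambda>x. fmul m (F i) x + fmul m (\<lambda>x. \<Sum>i\<in>I. F i x) x) G"
  by (rule ip_cong_AE[OF fmul_add[OF m Fi S]]) (auto intro!: L2_measurable fmul_L2 m L2_add Fi S G)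
 also have "... = ip (fmul m (F i)) G + ip (fmul m (\<lambda>x. \<Sum>i\<in>I. F i x)) G"
  by (intro ip_add_left fmul_L2 m Fi S G)
 finally show ?case using insert IH by (simp add: L2_add Fi S)
qed

lemma ip_sum_right:
 assumes "finite I" "\<And>i. i \<in> I ==> F i \<in> L2" and G: "G \<in> L2"
 shows "(\<lambda>x. \<Sum>i\<in>I. F i x) \<in> L2 \<and> ip G (\<lambda>x. \<Sum>i\<in>I. F i x) = (\<Sum>i\<in>I. ip G (F i))"
 using assms(1,2)
proof (induction I rule: finite_induct)
 case empty then show ?case by (simp add: ip_def)
next
 case (insert i I)
 then have "(\<lambda>x. \<Sum>i\<in>I. F i x) \<in> L2" "F i \<in> L2" by auto
 then show ?case using insert by (simp add: L2_add ip_add_right G)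
qed

lemma cell_piece:
 fixes f :: "'a::euclidean_space => complex" and i :: "int \<times> int" and n :: nat
 assumes f: "f \<in> L2" and ro[measurable]: "ro \<in> borelm" and b: "0 <= b" "0 <= al"
 defines "F \<equiv> \<lambda>x. of_real (sqrt (wV b al ro x)*indicator (trunc ro n \<inter> cell ro i) x)*f x"
 shows "F \<in> L2" "nrm F <= sqrt (wt b al i*2 powr al)*nrm f"
proof -
 define c where "c = sqrt (wt b al i*2 powr al)"
 have le: "cmod (complex_of_real (sqrt (wV b al ro x)*indicator (trunc ro n \<inter> cell ro i) x)) <= c" for x
 proof (cases "x \<in> trunc ro n \<inter> cell ro i")
  case True
  then show ?thesis using wV_cell[of x ro i b al] b unfolding norm_of_real c_def by (simp add: real_sqrt_le_mono del: real_sqrt_mult)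
 next
  case False then show ?thesis by (simp add: c_def)
 qed
 have m: "(\<lambda>x. complex_of_real (sqrt (wV b al ro x)*indicator (trunc ro n \<inter> cell ro i) x)) \<in> borelm" by measurable
 show "F \<in> L2" "nrm F <= c*nrm f" unfolding F_def using L2_bounded_mult[OF f m le] by auto
qed

text \<open>Both arguments are split over the dyadic cells of their own densities, which may belong
  to different times. On a pair of cells the potentials are bounded, the restricted bound applies
  with exponent th, and each cell contributes the square root of its cell estimate, so the double
  sum converges. The constant is independent of the damping \<open>eta\<close> and of the
  truncations \<open>n1\<close> and \<open>n2\<close>.\<close>

lemma kernel_bound:
 fixes b al th y z0 w0 B R r0 :: real
 assumes N: "DIM('a::euclidean_space) \<ge> 3" and b: "b > 0" and al: "al > 0" and B: "B \<ge> 1" and R: "R > 2" and y: "y \<ge> 0" and z0: "z0 > 0" and w0: "w0 > 0"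
  and s1: "r0*y + R*z0 + 2*w0 = al" and s2: "b/real DIM('a) + y + z0 + w0 = th" and th: "th <= 1"
 shows "\<exists>C>0. \<forall>(eta::real) (tau::real) (ro1::'a => real) (ro2::'a => real) U1 U2 n1 n2 (f::'a => complex) (g::'a => complex). eta > 0 --> tau \<noteq> 0 --> tame B R ro1 --> tame B R ro2 -->
  (y = 0 \<and> U1 = 1 \<or> levelU r0 U1 ro1) --> (y = 0 \<and> U2 = 1 \<or> levelU r0 U2 ro2) --> f \<in> L2 --> g \<in> L2 -->
  cmod (ip (fmul (sm eta tau) (cut b al ro1 n1 f))
       (cut b al ro2 n2 g))
   <= C*\<bar>tau\<bar> powr (- real DIM('a)*th/4)*(U1 powr (y/2)*U2 powr (y/2))*(nrm f*nrm g)"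
proof -
 obtain e Cc where e: "e > 0" and Cc: "Cc > 0" and cb: "\<And>(ro::'a => real) U i. tame B R ro ==> (y = 0 \<and> U = 1 \<or> levelU r0 U ro) ==>
  wt b al i*measure lborel (cell ro i) powr th <= Cc*decay e i*U powr y"
  using cell_bound[where 'a='a, OF b B R y z0 w0 s1 s2] by blast
 have th0: "th \<ge> 0" using s2 b y z0 w0 by (metis add_nonneg_nonneg divide_nonneg_nonneg less_imp_le of_nat_0_le_iff)
 define S where "S = (2/(1 - 2 powr (- (e/2))))^2"
 define K where "K = dispC TYPE('a)"
 define C where "C = (K powr th + 1)*(2 powr al*Cc)*(S*S + 1)"
 have K0: "K \<ge> 0" unfolding K_def by (rule dispC_nonneg[OF N])
 have S0: "S \<ge> 0" by (simp add: S_def)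
 have C0: "C > 0" using Cc K0 S0 unfolding C_def by (intro mult_pos_pos add_nonneg_pos) auto
 show ?thesis
 proof (rule exI[of _ C], intro conjI C0 allI impI)
  fix eta tau :: real and ro1 ro2 :: "'a => real" and U1 U2 n1 n2 and f g :: "'a => complex"
  assume eta: "eta > 0" and tau: "tau \<noteq> 0" and t1: "tame B R ro1" and t2: "tame B R ro2" and U1: "y = 0 \<and> U1 = 1 \<or> levelU r0 U1 ro1" and U2: "y = 0 \<and> U2 = 1 \<or> levelU r0 U2 ro2"
   and f: "f \<in> L2" and g: "g \<in> L2"
  note m1[measurable] = tame_measurable[OF t1] and m2[measurable] = tame_measurable[OF t2]
  define F where "F i x = of_real (sqrt (wV b al ro1 x)*indicator (trunc ro1 n1 \<inter> cell ro1 i) x)*f x" for i x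
  define G where "G i x = of_real (sqrt (wV b al ro2 x)*indicator (trunc ro2 n2 \<inter> cell ro2 i) x)*g x" for i x
  have b0: "0 <= b" "0 <= al" using b al by auto
  note Fp = cell_piece[OF f m1 b0, where n=n1, folded F_def] and Gp = cell_piece[OF g m2 b0, where n=n2, folded G_def]
  have Fs: "(cut b al ro1 n1 f) = (\<lambda>x. \<Sum>i\<in>KK n1. F i x)"
   unfolding F_def by (simp only: sum_trunc_cells[of ro1 n1] sum_distrib_left sum_distrib_right of_real_sum)
  have Gs: "(cut b al ro2 n2 g) = (\<lambda>x. \<Sum>i\<in>KK n2. G i x)"
   unfolding G_def by (simp only: sum_trunc_cells[of ro2 n2] sum_distrib_left sum_distrib_right of_real_sum)
  have GL: "(\<lambda>x. \<Sum>i\<in>KK n2. G i x) \<in> L2" using ip_sum_right[of "KK n2" G f] Gp(1) f by simp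
  have bm: "bmeas (sm eta tau :: 'a => complex)" using eta by (intro sm_bmeas) auto
  define T where "T = K powr th*\<bar>tau\<bar> powr (- real DIM('a)*th/4)"
  define c where "c i = wt b al i" for i
  \<comment> \<open>Square root of the cell estimate: the form contains the square roots of the two
    potentials and, through \<open>restricted_bound\<close>, the measures of the cells to the power
    th/2.\<close>
  have half: "sqrt (c i*2 powr al)*measure lborel (cell ro i) powr (th/2) <= sqrt (2 powr al*Cc)*decay (e/2) i*U powr (y/2)"
   if t: "tame B R ro" and U: "y = 0 \<and> U = 1 \<or> levelU r0 U ro" for ro :: "'a => real" and U i
  proof -
   have U0: "0 <= U" using U by (auto simp: levelU_def)
   have h1: "measure lborel (cell ro i) powr (th/2) = sqrt (measure lborel (cell ro i) powr th)" by (simp add: powr_half_sqrt[symmetric] powr_powr)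
   have h2: "decay (e/2) i = sqrt (decay e i)" by (simp add: decay_def powr_half_sqrt[symmetric] powr_powr)
   have h3: "U powr (y/2) = sqrt (U powr y)" by (simp add: powr_half_sqrt[symmetric] powr_powr)
   have "c i*2 powr al*measure lborel (cell ro i) powr th <= 2 powr al*(Cc*decay e i*U powr y)"
    using mult_left_mono[OF cb[OF t U, of i], of "2 powr al"] by (simp add: c_def mult_ac)
   then show ?thesis unfolding h1 h2 h3 real_sqrt_mult[symmetric] by (intro real_sqrt_le_mono) (simp add: mult_ac)
  qed
  have term_le: "cmod (ip (fmul (sm eta tau) (F i)) (G j)) <= T*(2 powr al*Cc)*(U1 powr (y/2)*U2 powr (y/2))*(nrm f*nrm g)*(decay (e/2) i*decay (e/2) j)" for i j
  proof -
   let ?m1 = "measure lborel (cell ro1 i)" and ?m2 = "measure lborel (cell ro2 j)"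
   have "cmod (ip (fmul (sm eta tau) (F i)) (G j)) <= (K*\<bar>tau\<bar> powr (- real DIM('a)/4) * sqrt ?m1 * sqrt ?m2) powr th*(nrm (F i)*nrm (G j))"
    unfolding K_def by (rule restricted_bound[OF N Fp(1) _ Gp(1)])
     (use eta tau th th0 cell_measure_le_shell(1)[OF m1] cell_measure_le_shell(1)[OF m2] in "auto simp: F_def G_def")
   also have "(K*\<bar>tau\<bar> powr (- real DIM('a)/4) * sqrt ?m1 * sqrt ?m2) powr th = T*?m1 powr (th/2)*?m2 powr (th/2)"
    using K0 by (simp add: powr_mult T_def powr_powr powr_half_sqrt[symmetric])
   also have "...*(nrm (F i)*nrm (G j)) <= (T*?m1 powr (th/2)*?m2 powr (th/2))*((sqrt (c i*2 powr al)*nrm f)*(sqrt (c j*2 powr al)*nrm g))"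
   proof (rule mult_left_mono[OF mult_mono])
    show "nrm (F i) <= sqrt (c i*2 powr al)*nrm f" unfolding c_def by (rule Fp(2))
    show "nrm (G j) <= sqrt (c j*2 powr al)*nrm g" unfolding c_def by (rule Gp(2))
   qed (simp_all add: T_def c_def)
   also have "... = T*(nrm f*nrm g)*((sqrt (c i*2 powr al)*?m1 powr (th/2))*(sqrt (c j*2 powr al)*?m2 powr (th/2)))"
    by (simp only: mult_ac)
   also have "... <= T*(nrm f*nrm g)*((sqrt (2 powr al*Cc)*decay (e/2) i*U1 powr (y/2))*(sqrt (2 powr al*Cc)*decay (e/2) j*U2 powr (y/2)))"
    by (rule mult_left_mono[OF mult_mono[OF half[OF t1 U1] half[OF t2 U2]]]) (use Cc in "simp_all add: T_def c_def decay_def")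
   also have "... = T*(sqrt (2 powr al*Cc) * sqrt (2 powr al*Cc))*(U1 powr (y/2)*U2 powr (y/2))*(nrm f*nrm g)*(decay (e/2) i*decay (e/2) j)"
    by (simp only: mult_ac)
   also have "sqrt (2 powr al*Cc) * sqrt (2 powr al*Cc) = 2 powr al*Cc" using Cc by (intro real_sqrt_mult_self[THEN trans]) (auto simp: abs_of_pos)
   finally show ?thesis .
  qed
  have e1: "ip (fmul (sm eta tau) (\<lambda>x. \<Sum>i\<in>KK n1. F i x)) (\<lambda>x. \<Sum>i\<in>KK n2. G i x) = (\<Sum>i\<in>KK n1. ip (fmul (sm eta tau) (F i)) (\<lambda>x. \<Sum>i\<in>KK n2. G i x))"
   using ip_fmul_sum[of "sm eta tau" "KK n1" F] bm Fp(1) GL by simp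
  have e2: "(\<Sum>i\<in>KK n1. ip (fmul (sm eta tau) (F i)) (\<lambda>x. \<Sum>i\<in>KK n2. G i x)) = (\<Sum>i\<in>KK n1. \<Sum>j\<in>KK n2. ip (fmul (sm eta tau) (F i)) (G j))"
  proof (rule sum.cong[OF refl], goal_cases)
   case (1 i)
   show ?case
    using ip_sum_right[of "KK n2" G "fmul (sm eta tau) (F i)"] Gp(1) fmul_L2[OF bm Fp(1)] by simp
  qed
  define Q where "Q = (U1 powr (y/2)*U2 powr (y/2))*(nrm f*nrm g)"
  have Q0: "Q \<ge> 0" by (simp add: Q_def)
  define M where "M = T*(2 powr al*Cc)*Q"
  have M0: "M \<ge> 0" using Cc Q0 by (simp add: M_def T_def)
  have tl: "cmod (ip (fmul (sm eta tau) (F i)) (G j)) <= M*(decay (e/2) i*decay (e/2) j)" for i j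
   using term_le[of i j] by (simp only: M_def Q_def mult.assoc)
  have "cmod (ip (fmul (sm eta tau) (\<lambda>x. \<Sum>i\<in>KK n1. F i x)) (\<lambda>x. \<Sum>i\<in>KK n2. G i x)) <= (\<Sum>i\<in>KK n1. \<Sum>j\<in>KK n2. M*(decay (e/2) i*decay (e/2) j))"
   unfolding e1 e2 by (rule sum_norm_le, rule sum_norm_le, rule tl)
  moreover have "(\<Sum>i\<in>KK n1. \<Sum>j\<in>KK n2. M*(decay (e/2) i*decay (e/2) j)) = M*((\<Sum>i\<in>KK n1. decay (e/2) i)*(\<Sum>j\<in>KK n2. decay (e/2) j))"
   unfolding sum_product by (simp only: sum_distrib_left)
  moreover have "M*((\<Sum>i\<in>KK n1. decay (e/2) i)*(\<Sum>j\<in>KK n2. decay (e/2) j)) <= M*(S*S)"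
  proof (rule mult_left_mono[OF mult_mono])
   show "(\<Sum>i\<in>KK n1. decay (e/2) i) <= S" "(\<Sum>i\<in>KK n2. decay (e/2) i) <= S" unfolding S_def using e by (simp_all add: decay_sum)
   show "0 <= (\<Sum>i\<in>KK n2. decay (e/2) i)" by (rule sum_nonneg) (simp add: decay_def)
  qed (use S0 M0 in simp_all)
  moreover have "M*(S*S) = (K powr th*(2 powr al*Cc)*(S*S))*(\<bar>tau\<bar> powr (- real DIM('a)*th/4)*Q)"
   unfolding T_def M_def by (simp only: mult_ac)
  moreover have "(K powr th*(2 powr al*Cc)*(S*S))*(\<bar>tau\<bar> powr (- real DIM('a)*th/4)*Q) <= C*(\<bar>tau\<bar> powr (- real DIM('a)*th/4)*Q)"
  proof (rule mult_right_mono)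
   have "K powr th*(2 powr al*Cc) <= (K powr th + 1)*(2 powr al*Cc)" using Cc by (intro mult_right_mono) auto
   then show "K powr th*(2 powr al*Cc)*(S*S) <= C" unfolding C_def by (rule mult_mono) (use S0 Cc in auto)
  qed (use Q0 in simp)
  ultimately have "cmod (ip (fmul (sm eta tau) (\<lambda>x. \<Sum>i\<in>KK n1. F i x)) (\<lambda>x. \<Sum>i\<in>KK n2. G i x)) <= C*(\<bar>tau\<bar> powr (- real DIM('a)*th/4)*Q)" by linarith
  then show "cmod (ip (fmul (sm eta tau) (cut b al ro1 n1 f))
       (cut b al ro2 n2 g))
   <= C*\<bar>tau\<bar> powr (- real DIM('a)*th/4)*(U1 powr (y/2)*U2 powr (y/2))*(nrm f*nrm g)"
   unfolding Fs Gs Q_def by (simp only: mult.assoc)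
 qed
qed

section \<open>Exhaustion by truncations and integrability of the potential\<close>

lemma trunc_mono: "m <= n ==> trunc ro m \<subseteq> trunc ro n"
proof
 fix x assume mn: "m <= n" and "x \<in> trunc ro m"
 moreover have "2 powr (- real n) <= 2 powr (- real m)" "2 powr real m <= 2 powr real n" using mn by auto
 ultimately show "x \<in> trunc ro n" unfolding trunc_def mem_Collect_eq by linarith
qed

lemma trunc_eventually:
 assumes "x \<noteq> 0" "ro x > 0" shows "\<exists>n0. \<forall>n\<ge>n0. x \<in> trunc ro n"
proof -
 have l: "(\<lambda>n. 2 powr (- real n)) ----> 0" by real_asymp
 have u: "filterlim (\<lambda>n. 2 powr real n) at_top sequentially" by real_asymp
 have "\<forall>\<^sub>F n in sequentially. 2 powr (- real n) < norm x" using order_tendstoD(2)[OF l, of "norm x"] assms by simp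
 moreover have "\<forall>\<^sub>F n in sequentially. 2 powr (- real n) < ro x" using order_tendstoD(2)[OF l, of "ro x"] assms by simp
 moreover have "\<forall>\<^sub>F n in sequentially. norm x < 2 powr real n" using u by (simp add: filterlim_at_top_dense)
 moreover have "\<forall>\<^sub>F n in sequentially. ro x < 2 powr real n" using u by (simp add: filterlim_at_top_dense)
 ultimately have "\<forall>\<^sub>F n in sequentially. x \<in> trunc ro n" by eventually_elim (simp add: trunc_def)
 then show ?thesis by (simp add: eventually_sequentially)
qed

lemma wV_zero_outside: "x = 0 \<or> ro x = 0 ==> wV b al ro x = 0" by (auto simp: wV_def)

lemma wV_trunc_SUP:
 assumes ro: "\<And>x. 0 <= ro x" and c: "0 <= c"
 shows "(SUP n. ennreal (wV b al ro x*indicator (trunc ro n) x*c)) = ennreal (wV b al ro x*c)"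
proof (cases "x = 0 \<or> ro x = 0")
 case True then show ?thesis by (simp add: wV_zero_outside)
next
 case False
 then obtain n0 where n0: "\<forall>n\<ge>n0. x \<in> trunc ro n" using trunc_eventually[of x ro] ro[of x] by force
 show ?thesis
 proof (rule antisym)
  show "(SUP n. ennreal (wV b al ro x*indicator (trunc ro n) x*c)) <= ennreal (wV b al ro x*c)"
   using c by (intro SUP_least ennreal_leI) (auto simp: indicator_def)
  show "ennreal (wV b al ro x*c) <= (SUP n. ennreal (wV b al ro x*indicator (trunc ro n) x*c))"
   by (rule SUP_upper2[of n0]) (use n0 in auto)
 qed
qed

lemma nn_integral_wV_trunc:
 assumes ro[measurable]: "ro \<in> borelm" "\<And>x. 0 <= ro x" and g[measurable]: "g \<in> borelm" "\<And>x. 0 <= g x"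
 shows "(NN x. ennreal (wV b al ro x*g x)) = (SUP n. NN x. ennreal (wV b al ro x*indicator (trunc ro n) x*g x))"
proof -
 have "(NN x. ennreal (wV b al ro x*g x)) = (NN x. (SUP n. ennreal (wV b al ro x*indicator (trunc ro n) x*g x)))"
  by (simp only: wV_trunc_SUP[OF ro(2) g(2)])
 also have "... = (SUP n. NN x. ennreal (wV b al ro x*indicator (trunc ro n) x*g x))"
 proof (rule nn_integral_monotone_convergence_SUP)
  show "incseq (\<lambda>n x. ennreal (wV b al ro x*indicator (trunc ro n) x*g x))"
  proof (rule incseq_SucI, rule le_funI, rule ennreal_leI)
   fix n x
   show "wV b al ro x*indicator (trunc ro n) x*g x <= wV b al ro x*indicator (trunc ro (Suc n)) x*g x"
    using trunc_mono[of n "Suc n" ro] g(2)[of x] by (auto simp: indicator_def)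
  qed
 qed measurable
 finally show ?thesis .
qed

text \<open>The cell estimate with th = 1 and y = 0, summed over the cells. The weight uses up the
  share b/N of the total exponent 1, and the hypotheses on \<open>be\<close> say that it lies
  strictly between what the levels 2 and R can pay for with the remaining share.\<close>

lemma potential_bound:
 fixes b be B R :: real
 assumes b: "b > 0" "b < real DIM('a::euclidean_space)" and B: "B \<ge> 1" and R: "R > 2"
  and be: "2*(1 - b/real DIM('a)) < be" "be < R*(1 - b/real DIM('a))"
 shows "\<exists>C>0. \<forall>ro::'a => real. tame B R ro --> (NN x. ennreal (wV b be ro x)) <= ennreal C"
proof -
 define c where "c = 1 - b/real DIM('a)"
 have c: "c > 0" using b by (simp add: c_def)
 \<comment> \<open>Solves R z0 + 2 (c - z0) = be; the two bounds on \<open>be\<close> amount to 0 <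
   z0 < c.\<close>
 define z0 where "z0 = (be - 2*c)/(R - 2)"
 have z0: "z0 > 0" "z0 < c" using be R by (auto simp: z0_def c_def[symmetric] pos_divide_less_eq algebra_simps)
 have "(R - 2)*z0 = be - 2*c" using R by (simp add: z0_def)
 then have s1: "0*0 + R*z0 + 2*(c - z0) = be" by (simp add: algebra_simps)
 have s2: "b/real DIM('a) + 0 + z0 + (c - z0) = 1" by (simp add: c_def)
 have be0: "be > 0" using be(1)[folded c_def] c by linarith
 obtain e Cc where e: "e > 0" and Cc: "Cc > 0" and cb: "\<And>(ro::'a => real) i. tame B R ro ==>
  wt b be i*measure lborel (cell ro i) powr 1 <= Cc*decay e i"
 proof -
  have w0: "0 < c - z0" using z0(2) by simp
  obtain e Cc where e: "e > 0" "Cc > 0" and cb: "\<And>(ro::'a => real) U i. tame B R ro ==> (0 = (0::real) \<and> U = 1 \<or> levelU 0 U ro) ==>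
   wt b be i*measure lborel (cell ro i) powr 1 <= Cc*decay e i*U powr 0"
   using cell_bound[where 'a='a, OF b(1) B R order_refl z0(1) w0 s1 s2] by blast
  show thesis by (rule that[OF e]) (use cb[of _ 1] in simp)
 qed
 define S where "S = (2/(1 - 2 powr (- e)))^2"
 have S: "S \<ge> 0" by (simp add: S_def)
 define C where "C = 2 powr be*(Cc*S) + 1"
 have bd: "(NN x. ennreal (wV b be ro x)) <= ennreal C" if t: "tame B R ro" for ro :: "'a => real"
 proof -
  let ?t = "\<lambda>n. (NN x. ennreal (wV b be ro x*indicator (trunc ro n) x*1))"
  have [measurable]: "ro \<in> borelm" using t by (rule tame_measurable)
  have "(?t n) <= ennreal C" for n
  proof -
   have "(?t n) <= (NN x. (\<Sum>i\<in>KK n. ennreal (wt b be i*2 powr be)*indicator (cell ro i) x))"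
   proof (rule nn_integral_mono, goal_cases)
    case (1 x)
    show ?case
    proof (cases "x \<in> trunc ro n")
     case True
     then obtain i where i: "i \<in> KK n" "x \<in> cell ro i" using trunc_cell by blast
     have "ennreal (wV b be ro x) <= ennreal (wt b be i*2 powr be)*indicator (cell ro i) x"
      using wV_cell[OF i(2)] b be0 i(2) by (simp add: ennreal_leI)
     also have "... <= (\<Sum>i\<in>KK n. ennreal (wt b be i*2 powr be)*indicator (cell ro i) x)"
      using i(1) by (intro member_le_sum) auto
     finally show ?thesis using True by simp
    qed simp
   qed
   also have "... = (\<Sum>i\<in>KK n. ennreal (wt b be i*2 powr be)*emeasure lborel (cell ro i))"
    by (subst nn_integral_sum) (auto simp: nn_integral_cmult_indicator)
   also have "... = (\<Sum>i\<in>KK n. ennreal (wt b be i*2 powr be*measure lborel (cell ro i)))"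
   proof (rule sum.cong[OF refl], goal_cases)
    case (1 i)
    have "emeasure lborel (cell ro i) = ennreal (measure lborel (cell ro i))"
     using cell_measure_le_shell(1)[of ro i] by (intro emeasure_eq_ennreal_measure) auto
    then show ?case
     by (simp add: ennreal_mult)
   qed
   also have "... = ennreal (\<Sum>i\<in>KK n. wt b be i*2 powr be*measure lborel (cell ro i))"
    by (rule sum_ennreal) simp
   also have "... <= ennreal (2 powr be*(Cc*(\<Sum>i\<in>KK n. decay e i)))"
   proof (rule ennreal_leI)
    have "wt b be i*2 powr be*measure lborel (cell ro i) <= 2 powr be*(Cc*decay e i)" for i
     using mult_left_mono[OF cb[OF t, of i], of "2 powr be"] by (simp add: mult_ac)
    then show "(\<Sum>i\<in>KK n. wt b be i*2 powr be*measure lborel (cell ro i)) <= 2 powr be*(Cc*(\<Sum>i\<in>KK n. decay e i))"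
     unfolding sum_distrib_left by (rule sum_mono)
   qed
   also have "... <= ennreal C"
   proof (rule ennreal_leI)
    have "2 powr be*(Cc*(\<Sum>i\<in>KK n. decay e i)) <= 2 powr be*(Cc*S)"
     unfolding S_def by (rule mult_left_mono[OF mult_left_mono[OF decay_sum[OF e]]]) (use Cc in auto)
    then show "2 powr be*(Cc*(\<Sum>i\<in>KK n. decay e i)) <= C" unfolding C_def by linarith
   qed
   finally show ?thesis .
  qed
  moreover have "(NN x. ennreal (wV b be ro x*1)) = (SUP n. NN x. ennreal (wV b be ro x*indicator (trunc ro n) x*1))"
   by (rule nn_integral_wV_trunc) (use t in "auto simp: tame_def")
  ultimately show ?thesis by (simp add: SUP_least)
 qed
 have "C > 0" using Cc S by (auto simp: C_def intro!: add_nonneg_pos mult_nonneg_nonneg)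
 with bd show ?thesis by auto
qed

section \<open>Level sets of sums and Chebyshev's inequality\<close>

lemma tameD:
 assumes "tame B R ro" "s > 0"
 shows "emeasure lborel {x. s <= ro x} < \<infinity>" "measure lborel {x. s <= ro x} <= B * s powr (- R)" "measure lborel {x. s <= ro x} <= B * s powr (- 2)"
 using assms unfolding tame_def by blast+

lemma level_sum:
 fixes ro1 ro2 :: "'a::euclidean_space => real"
 assumes [measurable]: "ro1 \<in> borelm" "ro2 \<in> borelm"
  and f: "emeasure lborel {x. s/2 <= ro1 x} < \<infinity>" "emeasure lborel {x. s/2 <= ro2 x} < \<infinity>"
 shows "emeasure lborel {x. s <= ro1 x + ro2 x} < \<infinity>" 
  "measure lborel {x. s <= ro1 x + ro2 x} <= measure lborel {x. s/2 <= ro1 x} + measure lborel {x. s/2 <= ro2 x}"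
proof -
 have sub: "{x. s <= ro1 x + ro2 x} \<subseteq> {x. s/2 <= ro1 x} \<union> {x. s/2 <= ro2 x}" by auto
 have fm: "{x. s/2 <= ro1 x} \<in> fmeasurable lborel" "{x. s/2 <= ro2 x} \<in> fmeasurable lborel" using f by (auto intro!: fmeasurableI)
 then have u: "{x. s/2 <= ro1 x} \<union> {x. s/2 <= ro2 x} \<in> fmeasurable lborel" by (rule fmeasurable.Un)
 have "{x. s <= ro1 x + ro2 x} \<in> fmeasurable lborel" by (rule fmeasurableI2[OF u sub]) measurable
 then show "emeasure lborel {x. s <= ro1 x + ro2 x} < \<infinity>" by (simp add: fmeasurable_def)
 have "measure lborel {x. s <= ro1 x + ro2 x} <= measure lborel ({x. s/2 <= ro1 x} \<union> {x. s/2 <= ro2 x})"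
  by (rule measure_mono_fmeasurable[OF sub _ u]) measurable
 also have "... <= measure lborel {x. s/2 <= ro1 x} + measure lborel {x. s/2 <= ro2 x}"
  by (rule measure_Un_le) measurable
 finally show "measure lborel {x. s <= ro1 x + ro2 x} <= measure lborel {x. s/2 <= ro1 x} + measure lborel {x. s/2 <= ro2 x}" .
qed

lemma tame_add:
 assumes t: "tame B R ro1" "tame B R ro2" and B: "B \<ge> 0" and R: "R \<ge> 2"
 shows "tame (2*B*2 powr R) R (\<lambda>x. ro1 x + ro2 x)"
 unfolding tame_def
proof (intro conjI allI impI)
 have [measurable]: "ro1 \<in> borelm" "ro2 \<in> borelm" using t by (auto simp: tame_def)
 show "(\<lambda>x. ro1 x + ro2 x) \<in> borelm" by measurable
 fix x show "0 <= ro1 x + ro2 x" using t by (auto simp: tame_def)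
next
 fix s :: real assume s: "0 < s"
 have m: "ro1 \<in> borelm" "ro2 \<in> borelm" using t by (auto simp: tame_def)
 have t1: "emeasure lborel {x. s/2 <= ro1 x} < \<infinity>" "measure lborel {x. s/2 <= ro1 x} <= B*(s/2) powr (- R)" "measure lborel {x. s/2 <= ro1 x} <= B*(s/2) powr (- 2)"
  by (rule tameD[OF t(1) half_gt_zero[OF s]])+
 have t2: "emeasure lborel {x. s/2 <= ro2 x} < \<infinity>" "measure lborel {x. s/2 <= ro2 x} <= B*(s/2) powr (- R)" "measure lborel {x. s/2 <= ro2 x} <= B*(s/2) powr (- 2)"
  by (rule tameD[OF t(2) half_gt_zero[OF s]])+
 note l = level_sum[OF m t1(1) t2(1)]
 show "emeasure lborel {x. s <= ro1 x + ro2 x} < \<infinity>" by (rule l(1))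
 have p: "(s/2) powr (- q) = 2 powr q * s powr (- q)" for q using s by (simp add: powr_divide powr_minus field_simps)
 show "measure lborel {x. s <= ro1 x + ro2 x} <= 2*B*2 powr R * s powr (- R)"
  using l(2) t1(2) t2(2) unfolding p by linarith
 have "measure lborel {x. s <= ro1 x + ro2 x} <= B*(2 powr 2 * s powr (- 2)) + B*(2 powr 2 * s powr (- 2))"
  using l(2) t1(3) t2(3) unfolding p by linarith
 also have "... = 2*B * s powr (- 2)*2 powr 2" by simp
 also have "... <= 2*B * s powr (- 2)*2 powr R" using B R by (intro mult_left_mono powr_mono) auto
 finally show "measure lborel {x. s <= ro1 x + ro2 x} <= 2*B*2 powr R * s powr (- 2)" by (simp add: mult_ac)
qed

lemma levelU_add:
 assumes l: "levelU r U1 ro1" "levelU r U2 ro2" and t: "tame B R ro1" "tame B R ro2"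
 shows "levelU r (2 powr r*(U1 + U2)) (\<lambda>x. ro1 x + ro2 x)"
 unfolding levelU_def
proof (intro conjI allI impI)
 show "0 <= 2 powr r*(U1 + U2)" using l by (simp add: levelU_def)
 fix s :: real assume s: "0 < s"
 have m: "ro1 \<in> borelm" "ro2 \<in> borelm" using t by (auto simp: tame_def)
 have t1: "emeasure lborel {x. s/2 <= ro1 x} < \<infinity>" "emeasure lborel {x. s/2 <= ro2 x} < \<infinity>" by (rule tameD(1)[OF t(1) half_gt_zero[OF s]], rule tameD(1)[OF t(2) half_gt_zero[OF s]])
 have u: "measure lborel {x. s/2 <= ro1 x} <= U1*(s/2) powr (- r)" "measure lborel {x. s/2 <= ro2 x} <= U2*(s/2) powr (- r)"
  using l half_gt_zero[OF s] unfolding levelU_def by blast+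
 have p: "(s/2) powr (- r) = 2 powr r * s powr (- r)" using s by (simp add: powr_divide powr_minus field_simps)
 show "measure lborel {x. s <= ro1 x + ro2 x} <= 2 powr r*(U1 + U2) * s powr (- r)"
  using level_sum(2)[OF m t1] u unfolding p by (simp add: algebra_simps)
qed

lemma chebyshev_L2:
 fixes f :: "'a::euclidean_space => complex"
 assumes f: "f \<in> L2" and s: "s > 0"
 shows "emeasure lborel {x. s <= cmod (f x)} < \<infinity>" "measure lborel {x. s <= cmod (f x)} <= (nrm f)^2 * s powr (- 2)"
proof -
 have [measurable]: "f \<in> borelm" using f by (rule L2_measurable)
 have "ennreal (s^2)*emeasure lborel {x. s <= cmod (f x)} = (NN x. ennreal (s^2)*indicator {x. s <= cmod (f x)} x)"
  by (simp add: nn_integral_cmult_indicator)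
 also have "... <= (NN x. ennreal ((cmod (f x))^2))"
  using s by (intro nn_integral_mono) (auto simp: indicator_def intro!: ennreal_leI power_mono)
 also have "... = ennreal ((nrm f)^2)" by (rule nn_integral_nrm[OF f])
 finally have le: "ennreal (s^2)*emeasure lborel {x. s <= cmod (f x)} <= ennreal ((nrm f)^2)" .
 then have "ennreal (s^2)*emeasure lborel {x. s <= cmod (f x)} < top" using le_less_trans ennreal_less_top by blast
 then show fin: "emeasure lborel {x. s <= cmod (f x)} < \<infinity>" using s by (auto simp: ennreal_mult_less_top)
 then have "emeasure lborel {x. s <= cmod (f x)} = ennreal (measure lborel {x. s <= cmod (f x)})" by (intro emeasure_eq_ennreal_measure) auto
 with le have "ennreal (s^2*measure lborel {x. s <= cmod (f x)}) <= ennreal ((nrm f)^2)" by (simp add: ennreal_mult)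
 then have "s^2*measure lborel {x. s <= cmod (f x)} <= (nrm f)^2" by (subst (asm) ennreal_le_iff) auto
 from mult_right_mono[OF this, of "s powr (- 2)"]
 have "s^2*measure lborel {x. s <= cmod (f x)} * s powr (- 2) <= (nrm f)^2 * s powr (- 2)" by simp
 moreover have "s powr (- 2) = 1/s^2" using s by (simp add: powr_minus_divide powr_realpow[of s 2, simplified])
 ultimately show "measure lborel {x. s <= cmod (f x)} <= (nrm f)^2 * s powr (- 2)" using s by simp
qed

section \<open>A weak Sobolev embedding of H^2\<close>

lemma integrable_bracket_1d:
 fixes a :: real assumes a: "a > 1/2"
 shows "intg (\<lambda>t::real. (1 + t^2) powr (- a))"
proof (rule Bochner_Integration.integrable_bound)
 have t: "intg (\<lambda>s. indicator {1..} s * s powr (- (2*a)))" by (rule tail_powr) (use a in auto)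
 have t': "intg (\<lambda>s. indicator {1..} (- s)*(- s) powr (- (2*a)))" using integrable_lborel_affine[OF t, of "-1" 0] by simp
 have i: "intg (indicat_real {-1..1::real})" by (rule integrable_real_indicator) auto
 show "intg (\<lambda>s. indicat_real {-1..1} s + (indicator {1..} s * s powr (- (2*a)) + indicator {1..} (- s)*(- s) powr (- (2*a))))"
  by (intro Bochner_Integration.integrable_add i t t')
 show "AE s in lborel. norm ((1 + s^2) powr (- a)) <= norm (indicat_real {-1..1} s + (indicator {1..} s * s powr (- (2*a)) + indicator {1..} (- s)*(- s) powr (- (2*a))))"
 proof (rule AE_I2)
  fix s :: real
  show "norm ((1 + s^2) powr (- a)) <= norm (indicat_real {-1..1} s + (indicator {1..} s * s powr (- (2*a)) + indicator {1..} (- s)*(- s) powr (- (2*a))))"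
  proof (cases "s \<in> {-1..1}")
   case True
   have "(1 + s^2) powr (- a) <= 1 powr (- a)" using a by (intro powr_mono2') auto
   then have le: "norm ((1 + s^2) powr (- a)) <= 1" by simp
   define t where "t = indicator {1..} s * s powr (- (2*a)) + indicator {1..} (- s)*(- s) powr (- (2*a))"
   have "0 <= t" by (simp add: t_def)
   then have "1 <= norm (indicat_real {-1..1} s + t)" using True by simp
   with le show ?thesis unfolding t_def by linarith
  next
   case False
   have "(1 + s^2) powr (- a) <= (\<bar>s\<bar> powr 2) powr (- a)"
    using False a by (intro powr_mono2') (auto simp: powr_realpow[of "\<bar>s\<bar>" 2, simplified])
   also have "... = \<bar>s\<bar> powr (2*(- a))" by (rule powr_powr)
   also have "2*(- a) = - (2*a)" by simp
   finally show ?thesis using False by (auto simp: indicator_def abs_if split: if_splits)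
  qed
 qed
qed measurable

text \<open>The bracket is a product of N equal factors with exponent -s/N, and each factor
  increases when |xi|^2 is replaced by the square of a single coordinate. This reduces the claim to
  dimension one.\<close>

lemma integrable_bracket:
 fixes s :: real assumes s: "s > real DIM('a::euclidean_space)/2"
 shows "intg (\<lambda>xi::'a. (1 + (norm xi)^2) powr (- s))"
proof -
 define a where "a = s/real DIM('a)"
 have a: "a > 1/2" using s by (simp add: a_def field_simps)
 have i: "intg (\<lambda>xi::'a. \<Prod>b\<in>Basis. complex_of_real ((1 + (xi \<bullet> b)^2) powr (- a)))"
  by (rule lborel_prod_integral(1)[where f="\<lambda>b t. complex_of_real ((1 + t^2) powr (- a))"])
   (rule integrable_of_real[OF integrable_bracket_1d[OF a]])
 show ?thesis
 proof (rule Bochner_Integration.integrable_bound[OF i])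
  show "AE xi in lborel. norm ((1 + (norm xi)^2) powr (- s)) <= norm (\<Prod>b\<in>(Basis::'a set). complex_of_real ((1 + (xi \<bullet> b)^2) powr (- a)))"
  proof (rule AE_I2, goal_cases)
   case (1 xi)
   have "(1 + (norm xi)^2) powr (- s) = (\<Prod>b\<in>(Basis::'a set). (1 + (norm xi)^2) powr (- a))"
   proof -
    have "(\<Prod>b\<in>(Basis::'a set). (1 + (norm xi)^2) powr (- a)) = ((1 + (norm xi)^2) powr (- a)) powr real DIM('a)"
    proof -
     have "0 < 1 + (norm xi)^2" by (rule add_pos_nonneg) auto
     then have "0 < (1 + (norm xi)^2) powr (- a)" by simp
     from powr_realpow[OF this] show ?thesis by simp
    qed
    also have "... = (1 + (norm xi)^2) powr (- s)" by (simp add: powr_powr a_def)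
    finally show ?thesis ..
   qed
   also have "... <= (\<Prod>b\<in>(Basis::'a set). (1 + (xi \<bullet> b)^2) powr (- a))"
   proof (rule prod_mono, intro conjI)
    fix b :: 'a assume b: "b \<in> Basis"
    have "\<bar>xi \<bullet> b\<bar> <= norm xi" by (rule Basis_le_norm[OF b])
    then have "(xi \<bullet> b)^2 <= (norm xi)^2" by (metis abs_ge_zero power2_abs power_mono)
    then show "(1 + (norm xi)^2) powr (- a) <= (1 + (xi \<bullet> b)^2) powr (- a)" using a by (intro powr_mono2') (auto intro: add_pos_nonneg)
   qed simp
   finally show ?case
    by (simp add: prod_norm[symmetric] norm_of_real abs_prod prod_nonneg)
  qed
 qed measurable
qed

text \<open>For |xi| < r the weight (1 + |xi|^2)^-2 is at most (1 + r^2)^e (1 + |xi|^2)^(-2-e),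
  whose last factor is integrable because 2 + e > N/2; Cauchy-Schwarz then bounds the Fourier
  integral pointwise. The high frequencies are small in L^2 because \<open>w2\<close> is at least 1
  + r^2 there.\<close>

lemma low_freq_bound:
 fixes f :: "'a::euclidean_space => complex" and e :: real
 assumes f: "f \<in> H2" and e: "e > 0" "e > real DIM('a)/2 - 2" and r: "r \<ge> 0"
 defines "J \<equiv> (LINT xi|(lborel::'a measure). (1 + (norm xi)^2) powr (- 2 - e))"
 shows "AE x in lborel. cmod (fmul (\<lambda>xi. indicator (ball 0 r) xi) f x) <= (2*pi) powr (- real DIM('a)/2)*(sqrt J*(1 + r^2) powr (e/2)*h2 f)"
  and "nrm (fmul (\<lambda>xi. indicator (- ball 0 r) xi) f) <= h2 f/(1 + r^2)"
proof -
 have fL: "f \<in> L2" by (rule H2_L2[OF f])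
 note [measurable] = L2_measurable[OF fourier_L2_L2[OF fL]]
 have bm: "bmeas (\<lambda>xi::'a. indicator (ball 0 r) xi)" "bmeas (\<lambda>xi::'a. indicator (- ball 0 r) xi)"
  by (rule bmeasI[of _ 1]; auto simp: indicator_def intro!: borel_measurable_indicator)+
 have wL: "(\<lambda>xi. w2 xi*FT f xi) \<in> L2" using f by (simp add: H2_iff)
 define k where "k xi = complex_of_real (indicator (ball 0 r) xi*inverse (1 + (norm xi)^2))" for xi :: 'a
 have km[measurable]: "k \<in> borelm" 
  unfolding k_def[abs_def] using borel_measurable_indicator[of "ball (0::'a) r" borel] by measurable
 have Ji: "intg (\<lambda>xi::'a. (1 + (norm xi)^2) powr (- 2 - e))"
 proof -
  have eq: "- 2 - e = - (2 + e)" by simp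
  show ?thesis unfolding eq by (rule integrable_bracket) (use e in simp)
 qed
 have J0: "J \<ge> 0" by (simp add: J_def)
 have kb: "(cmod (k xi))^2 <= (1 + r^2) powr e*(1 + (norm xi)^2) powr (- 2 - e)" for xi
 proof (cases "xi \<in> ball 0 r")
  case True
  let ?q = "1 + (norm xi)^2"
  have q: "?q > 0" by (rule add_pos_nonneg) auto
  have "(cmod (k xi))^2 = ?q powr (- 2)" using True q
   by (simp add: k_def norm_of_real power_inverse powr_minus powr_realpow[of _ 2, simplified] norm_inverse del: of_real_add)
  also have "... = ?q powr e*?q powr (- 2 - e)" by (simp add: powr_add[symmetric])
  also have "... <= (1 + r^2) powr e*?q powr (- 2 - e)"
   using True e q by (intro mult_right_mono powr_mono2) (auto intro!: power_mono)
  finally show ?thesis .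
 next
  case False then show ?thesis by (simp add: k_def)
 qed
 have "(NN xi. ennreal ((cmod (k xi))^2)) <= (NN xi. ennreal ((1 + r^2) powr e*(1 + (norm (xi::'a))^2) powr (- 2 - e)))"
  by (intro nn_integral_mono ennreal_leI kb)
 also have "... = ennreal ((1 + r^2) powr e*J)"
  using Ji by (subst nn_integral_eq_integral) (auto simp: J_def)
 also have "(1 + r^2) powr e*J = (sqrt J*(1 + r^2) powr (e/2))^2"
 proof -
  have "((1 + r^2) powr (e/2))^2 = (1 + r^2) powr e" by (simp add: power2_eq_square powr_add[symmetric])
  then show ?thesis using J0 by (simp add: power_mult_distrib)
 qed
 finally have kL: "k \<in> L2" "nrm k <= sqrt J*(1 + r^2) powr (e/2)" using L2I_nn[OF km] J0 by auto
 let ?h = "\<lambda>xi. indicator (ball 0 r) xi*FT f xi"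
 have hk: "?h xi = k xi*(w2 xi*FT f xi)" for xi
 proof -
  have q: "1 + (norm xi)^2 \<noteq> 0" by (metis add_pos_nonneg less_irrefl zero_le_power2 zero_less_one)
  then have "inverse (1 + (norm xi)^2)*(1 + (norm xi)^2) = 1" by simp
  then have "k xi*w2 xi = complex_of_real (indicator (ball 0 r) xi)"
   unfolding k_def w2_def of_real_mult[symmetric] by (simp only: mult.assoc mult_1_right)
  then show ?thesis by (simp add: mult.assoc[symmetric] indicator_def)
 qed
 have hL: "?h \<in> L2" by (rule bmeas_L2[OF bm(1) fourier_L2_L2[OF fL]])
 have hi: "intg ?h" unfolding hk by (rule L2_mult_integrable[OF kL(1) wL])
 have n1h: "n1 ?h <= sqrt J*(1 + r^2) powr (e/2)*h2 f"
 proof -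
  have "n1 ?h <= nrm k*h2 f" unfolding n1_def hk h2_def by (rule L2_CS[OF kL(1) wL])
  also have "... <= sqrt J*(1 + r^2) powr (e/2)*h2 f" by (rule mult_right_mono[OF kL(2)]) simp
  finally show ?thesis .
 qed
 have "AE x in lborel. FT ?h (- x) = ft ?h (- x)" by (rule AE_lborel_minus[OF fourier_L2_integrable[OF hL hi]])
 then show "AE x in lborel. cmod (fmul (\<lambda>xi. indicator (ball 0 r) xi) f x) <= (2*pi) powr (- real DIM('a)/2)*(sqrt J*(1 + r^2) powr (e/2)*h2 f)"
 proof eventually_elim
  case (elim x)
  have "cmod (ft ?h (- x)) <= (2*pi) powr (- real DIM('a)/2)*n1 ?h" unfolding n1_def by (rule ft_bound)
  also have "... <= (2*pi) powr (- real DIM('a)/2)*(sqrt J*(1 + r^2) powr (e/2)*h2 f)" by (rule mult_left_mono[OF n1h]) simp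
  finally show ?case using elim by (simp add: fmul_def)
 qed
 have r1: "1 + r^2 > 0" by (rule add_pos_nonneg) auto
 have "nrm (fmul (\<lambda>xi. indicator (- ball 0 r) xi) f) = nrm (\<lambda>xi. indicator (- ball 0 r) xi*FT f xi)" by (rule nrm_fmul[OF bm(2) fL])
 also have "... <= nrm (\<lambda>xi. complex_of_real (1/(1 + r^2))*(w2 xi*FT f xi))"
 proof (rule L2_dominated(2)[OF L2_cmult[OF wL]])
  show "(\<lambda>xi. indicator (- ball 0 r) xi*FT f xi) \<in> borelm" by (rule L2_measurable[OF bmeas_L2[OF bm(2) fourier_L2_L2[OF fL]]])
  show "AE xi in lborel. cmod (indicator (- ball 0 r) xi*FT f xi) <= cmod (complex_of_real (1/(1 + r^2))*(w2 xi*FT f xi))"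
  proof (rule AE_I2, goal_cases)
   case (1 xi)
   show ?case
   proof (cases "xi \<in> ball 0 r")
    case False
    then have "r <= norm xi" by simp
    then have "1 + r^2 <= 1 + (norm xi)^2" using r by (intro add_left_mono power_mono) auto
    then have "1 <= (1/(1 + r^2))*(1 + (norm xi)^2)" using r1 by (simp add: field_simps)
    then have "1*cmod (FT f xi) <= (1/(1 + r^2))*(1 + (norm xi)^2)*cmod (FT f xi)" by (rule mult_right_mono) simp
    then show ?thesis using False r1 by (simp add: norm_mult cmod_w2 norm_divide del: of_real_add)
   qed simp
  qed
 qed
 also have "... = h2 f/(1 + r^2)" using r1 unfolding nrm_cmult h2_def norm_of_real by simp
 finally show "nrm (fmul (\<lambda>xi. indicator (- ball 0 r) xi) f) <= h2 f/(1 + r^2)" .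
qed

text \<open>For each level s the frequencies are cut so that the low part stays below s/2. Up to a
  null set, the level set of f at s is then contained in that of the high part at s/2, where
  Chebyshev's inequality applies. Small levels are covered by the L^2 bound.\<close>

lemma sobolev_tame:
 fixes R E :: real
 assumes R: "R > 2" and RN: "DIM('a::euclidean_space) <= 4 \<or> R < 2*real DIM('a)/(real DIM('a) - 4)" and E: "E > 0"
 shows "\<exists>B\<ge>1. \<forall>f::'a => complex. f \<in> H2 --> h2 f <= E --> tame B R (\<lambda>x. cmod (f x))"
proof -
 \<comment> \<open>With this value the smallness of the high part improves s^-2 to s^(-2-4/e) =
   s^-R. That R lies below the Sobolev endpoint translates into e > N/2 - 2.\<close>
 define e where "e = 4/(R - 2)"
 have e: "e > 0" using R by (simp add: e_def)
 have "4/e = R - 2" using R by (simp add: e_def)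
 then have Re: "R = 2 + 4/e" by simp
 have eN: "e > real DIM('a)/2 - 2"
 proof (cases "DIM('a) <= 4")
  case True then have "real DIM('a)/2 - 2 <= 0" by simp
  then show ?thesis using e by linarith
 next
  case False
  then have N: "real DIM('a) > 4" by simp
  have "R*(real DIM('a) - 4) < 2*real DIM('a)" using RN False N by (simp add: pos_less_divide_eq)
  then have "(R - 2)*(real DIM('a)/2 - 2) < 4" by (simp add: algebra_simps)
  then show ?thesis using R by (simp add: e_def pos_less_divide_eq mult.commute)
 qed
 define J where "J = (LINT xi|(lborel::'a measure). (1 + (norm xi)^2) powr (- 2 - e))"
 define c where "c = (2*pi) powr (- real DIM('a)/2) * sqrt J*E + 1"
 have c0: "c > 0" unfolding c_def using E by (intro add_nonneg_pos mult_nonneg_nonneg) (auto simp: J_def)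
 define B where "B = 1 + E^2 + E^2*(2*c) powr (R - 2) + 4*E^2*(2*c) powr (4/e)"
 have B1: "B \<ge> 1" unfolding B_def by simp
 have "tame B R (\<lambda>x. cmod (f x))" if f: "f \<in> H2" and fE: "h2 f <= E" for f :: "'a => complex"
  unfolding tame_def
 proof (intro conjI allI impI)
  have fL: "f \<in> L2" by (rule H2_L2[OF f])
  then have [measurable]: "f \<in> borelm" by (rule L2_measurable)
  show "(\<lambda>x. cmod (f x)) \<in> borelm" by measurable
  fix s :: real assume s: "0 < s"
  show "emeasure lborel {x. s <= cmod (f x)} < \<infinity>" by (rule chebyshev_L2[OF fL s])
  have nf: "(nrm f)^2 <= E^2" using nrm_le_h2[OF f] fE by (intro power_mono) auto
  have m2: "measure lborel {x. s <= cmod (f x)} <= E^2 * s powr (- 2)"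
   using chebyshev_L2(2)[OF fL s] mult_right_mono[OF nf, of "s powr (- 2)"] by simp
  have "E^2 * s powr (- 2) <= B * s powr (- 2)" unfolding B_def by (intro mult_right_mono) auto
  with m2 show "measure lborel {x. s <= cmod (f x)} <= B * s powr (- 2)" by linarith
  show "measure lborel {x. s <= cmod (f x)} <= B * s powr (- R)"
  proof (cases "s <= 2*c")
   case True
   have "s powr (- 2) = s powr (R - 2) * s powr (- R)" by (simp add: powr_add[symmetric])
   also have "... <= (2*c) powr (R - 2) * s powr (- R)" using True s R by (intro mult_right_mono powr_mono2) auto
   finally have "E^2 * s powr (- 2) <= E^2*((2*c) powr (R - 2) * s powr (- R))" by (intro mult_left_mono) auto
   also have "... = (E^2*(2*c) powr (R - 2)) * s powr (- R)" by simp
   also have "... <= B * s powr (- R)" unfolding B_def by (intro mult_right_mono) auto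
   finally show ?thesis using m2 by linarith
  next
   case False
   \<comment> \<open>q = 1 + r^2 is chosen so that (1 + r^2)^(e/2) = s/(2c), which bounds the low
     part by s/2.\<close>
   define q where "q = (s/(2*c)) powr (2/e)"
   have sc: "s/(2*c) > 1" using False c0 by simp
   have q1: "q \<ge> 1" unfolding q_def using sc e by (intro ge_one_powr_ge_zero) auto
   define r where "r = sqrt (q - 1)"
   have r: "r \<ge> 0" "1 + r^2 = q" using q1 by (auto simp: r_def)
   note lf = low_freq_bound[OF f e eN r(1), folded J_def, unfolded r(2)]
   have qe: "q powr (e/2) = s/(2*c)" using sc e s c0 by (simp add: q_def powr_powr)
   let ?lo = "fmul (\<lambda>xi::'a. indicator (ball 0 r) xi) f" and ?hi = "fmul (\<lambda>xi::'a. indicator (- ball 0 r) xi) f"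
   have bm: "bmeas (\<lambda>xi::'a. indicator (ball 0 r) xi)" "bmeas (\<lambda>xi::'a. indicator (- ball 0 r) xi)"
    by (rule bmeasI[of _ 1]; auto simp: indicator_def intro!: borel_measurable_indicator)+
   have hiL: "?hi \<in> L2" by (rule fmul_L2[OF bm(2) fL])
   have [measurable]: "?hi \<in> borelm" by (rule L2_measurable[OF hiL])
   have "AE x in lborel. ?hi x = f x - ?lo x"
   proof -
    have "(\<lambda>xi::'a. indicator (- ball 0 r) xi) = (\<lambda>xi. 1 - indicator (ball 0 r) xi :: complex)" by (auto simp: indicator_def fun_eq_iff)
    moreover have "bmeas (\<lambda>xi::'a. 1)" by (rule bmeasI[of _ 1]) auto
    ultimately have "AE x in lborel. ?hi x = fmul (\<lambda>xi. 1) f x - ?lo x"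
     using fmul_diff_fmul[of "\<lambda>xi::'a. 1", OF _ bm(1) fL] by simp
    then show ?thesis using fmul_one[OF fL] by eventually_elim simp
   qed
   then have sub: "AE x in lborel. x \<in> {x. s <= cmod (f x)} --> x \<in> {x. s/2 <= cmod (?hi x)}"
    using lf(1)
   proof eventually_elim
    case (elim x)
    have "cmod (?lo x) <= (2*pi) powr (- real DIM('a)/2)*(sqrt J*(s/(2*c))*h2 f)" using elim(2) by (simp add: qe)
    also have "... <= (2*pi) powr (- real DIM('a)/2)*(sqrt J*(s/(2*c))*E)"
     using fE s c0 by (intro mult_left_mono) (auto simp: J_def)
    also have "... = ((2*pi) powr (- real DIM('a)/2) * sqrt J*E)*(s/(2*c))" by simp
    also have "... <= c*(s/(2*c))" using s c0 by (intro mult_right_mono) (auto simp: c_def)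
    also have "... = s/2" using c0 by simp
    finally have "cmod (?lo x) <= s/2" .
    then show ?case using elim(1) norm_triangle_ineq2[of "f x" "?lo x"] by auto
   qed
   have "measure lborel {x. s <= cmod (f x)} <= measure lborel {x. s/2 <= cmod (?hi x)}"
   proof -
    have "emeasure lborel {x. s <= cmod (f x)} <= emeasure lborel {x. s/2 <= cmod (?hi x)}"
     by (rule emeasure_mono_AE[OF sub]) measurable
    then show ?thesis using chebyshev_L2(1)[OF hiL, of "s/2"] s unfolding measure_def by (intro enn2real_mono) auto
   qed
   also have "... <= (nrm ?hi)^2*(s/2) powr (- 2)" using s by (intro chebyshev_L2 hiL) auto
   also have "... <= (E/q)^2*(s/2) powr (- 2)"
   proof (rule mult_right_mono[OF power_mono])
    show "nrm ?hi <= E/q" using lf(2) divide_right_mono[OF fE, of q] q1 by linarith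
   qed auto
   also have "... = 4*E^2*(q powr (- 2)) * s powr (- 2)"
   proof -
    have "(s/2) powr (- 2) = 4 * s powr (- 2)" using s by (simp add: powr_divide powr_minus field_simps)
    moreover have "q powr (- 2) = 1/q^2" using q1 by (simp add: powr_minus_divide powr_realpow[of q 2, simplified])
    ultimately show ?thesis by (simp add: power_divide)
   qed
   also have "q powr (- 2) = (2*c) powr (4/e) * s powr (- (4/e))"
    using s c0 e by (simp add: q_def powr_powr powr_divide powr_minus field_simps)
   also have "4*E^2*((2*c) powr (4/e) * s powr (- (4/e))) * s powr (- 2) = (4*E^2*(2*c) powr (4/e)) * s powr (- R)"
    unfolding Re by (simp add: powr_add[symmetric] mult.assoc minus_diff_commute)
   also have "... <= B * s powr (- R)" unfolding B_def by (intro mult_right_mono) auto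
   finally show ?thesis .
  qed
 qed auto
 with B1 show ?thesis by auto
qed

section \<open>The Schur test and the free estimate\<close>

definition L2cont :: "(real => 'a::euclidean_space => complex) => bool" where
 "L2cont d \<longleftrightarrow> (\<forall>t. d t \<in> L2) \<and> (\<forall>t s. s ----> t --> (\<lambda>n. nrm (\<lambda>x. d (s n) x - d t x)) ----> 0)"

lemma L2cont_L2: "L2cont d ==> d t \<in> L2" by (simp add: L2cont_def)

lemma L2cont_AE_subseq:
 assumes "L2cont d" "s ----> t"
 shows "\<exists>r::nat=>nat. strict_mono r \<and> (AE x in lborel. (\<lambda>n. d (s (r n)) x) ----> d t x)"
 using L2_AE_subseq[of "\<lambda>n. d (s n)" "d t"] assms by (auto simp: L2cont_def)

text \<open>Only the continuity of each curve in L^2 is given, with no joint measurability in t and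
  x. The sublevel sets of the integral are closed: along a convergent sequence of times, three
  nested subsequences make the three curves converge almost everywhere, and Fatou's lemma together
  with the lower semicontinuity of the integrand controls the limit.\<close>

lemma lsc_integral_measurable:
 fixes d1 d2 d3 :: "real => 'a::euclidean_space => complex" and \<Phi> :: "'a => complex => complex => complex => ennreal"
 assumes d: "L2cont d1" "L2cont d2" "L2cont d3"
  and m: "\<And>t. (\<lambda>x. \<Phi> x (d1 t x) (d2 t x) (d3 t x)) \<in> borelm"
  and lsc: "\<And>x z1 z2 z3 w1 w2 w3. z1 ----> w1 ==> z2 ----> w2 ==> z3 ----> w3 ==> \<Phi> x w1 w2 w3 <= liminf (\<lambda>n. \<Phi> x (z1 n) (z2 n) (z3 n))"
 shows "(\<lambda>t. NN x. \<Phi> x (d1 t x) (d2 t x) (d3 t x)) \<in> borelm"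
proof (rule borel_measurableI_le, goal_cases)
 case (1 c)
 let ?g = "\<lambda>t. NN x. \<Phi> x (d1 t x) (d2 t x) (d3 t x)"
 have "closed {t. ?g t <= c}"
  unfolding closed_sequential_limits
 proof (intro allI impI, elim conjE)
  fix s t assume s: "\<forall>n. s n \<in> {t. ?g t <= c}" and st: "s ----> t"
  obtain r1 :: "nat => nat" where r1: "strict_mono r1" "AE x in lborel. (\<lambda>n. d1 (s (r1 n)) x) ----> d1 t x"
   using L2cont_AE_subseq[OF d(1) st] by blast
  have st1: "(\<lambda>n. s (r1 n)) ----> t" using LIMSEQ_subseq_LIMSEQ[OF st r1(1)] by (simp add: o_def)
  obtain r2 :: "nat => nat" where r2: "strict_mono r2" "AE x in lborel. (\<lambda>n. d2 (s (r1 (r2 n))) x) ----> d2 t x"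
   using L2cont_AE_subseq[OF d(2) st1] by blast
  have st2: "(\<lambda>n. s (r1 (r2 n))) ----> t" using LIMSEQ_subseq_LIMSEQ[OF st1 r2(1)] by (simp add: o_def)
  obtain r3 :: "nat => nat" where r3: "strict_mono r3" "AE x in lborel. (\<lambda>n. d3 (s (r1 (r2 (r3 n)))) x) ----> d3 t x"
   using L2cont_AE_subseq[OF d(3) st2] by blast
  define q where "q n = s (r1 (r2 (r3 n)))" for n
  have "AE x in lborel. \<Phi> x (d1 t x) (d2 t x) (d3 t x) <= liminf (\<lambda>n. \<Phi> x (d1 (q n) x) (d2 (q n) x) (d3 (q n) x))"
   using r1(2) r2(2) r3(2)
  proof eventually_elim
   case (elim x)
   have a: "(\<lambda>n. d1 (q n) x) ----> d1 t x"
    using LIMSEQ_subseq_LIMSEQ[OF LIMSEQ_subseq_LIMSEQ[OF elim(1) r2(1)] r3(1)] by (simp add: o_def q_def)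
   have b: "(\<lambda>n. d2 (q n) x) ----> d2 t x"
    using LIMSEQ_subseq_LIMSEQ[OF elim(2) r3(1)] by (simp add: o_def q_def)
   show ?case by (rule lsc[OF a b elim(3)[folded q_def]])
  qed
  then have "?g t <= (NN x. liminf (\<lambda>n. \<Phi> x (d1 (q n) x) (d2 (q n) x) (d3 (q n) x)))" by (rule nn_integral_mono_AE)
  also have "... <= liminf (\<lambda>n. ?g (q n))" by (rule nn_integral_liminf) (use m in simp)
  also have "... <= liminf (\<lambda>n::nat. c)" by (rule Liminf_mono) (use s in "simp add: q_def")
  finally show "t \<in> {t. ?g t <= c}" by (simp add: Liminf_const)
 qed
 then show ?case by simp
qed

text \<open>The Schur test for the kernel a(t) kap(|t - s|) a(s). Cauchy-Schwarz in s groups a(s)^2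
  with one copy of the kernel, which costs eps; after exchanging the integrals a(t)^2 meets the
  other copy and costs eps again.\<close>

lemma schur2:
 fixes kap a y :: "real => real"
 assumes [measurable]: "kap \<in> borelm" "a \<in> borelm" "y \<in> borelm"
  and nn: "\<And>t. 0 <= kap t" "\<And>t. 0 <= a t" "\<And>t. 0 <= y t"
  and sch: "\<And>t. (NN s. ennreal (kap \<bar>t - s\<bar>*(a s)^2)) <= ennreal eps"
 shows "(NN t. (ennreal (a t)*(NN s. ennreal (kap \<bar>t - s\<bar>*a s*y s)))^2) <= (ennreal eps)^2*(NN t. ennreal ((y t)^2))"
proof -
 let ?R = "\<lambda>t s. ennreal (kap \<bar>s - t\<bar>*(a t)^2)*ennreal ((y s)^2)"
 let ?Q = "\<lambda>t. (NN s. ennreal (kap \<bar>t - s\<bar>*(y s)^2))"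
 let ?P = "\<lambda>t. (NN s. ennreal (kap \<bar>t - s\<bar>*a s*y s))"
 have cs: "(?P t)^2 <= ennreal eps*(?Q t)" for t
 proof -
  have e: "ennreal (kap \<bar>t - s\<bar>*a s*y s) = ennreal (sqrt (kap \<bar>t - s\<bar>)*a s)*ennreal (sqrt (kap \<bar>t - s\<bar>)*y s)" for s
   using nn by (simp add: ennreal_mult[symmetric] mult_ac)
  have "(NN s. ennreal (sqrt (kap \<bar>t - s\<bar>)*a s)*ennreal (sqrt (kap \<bar>t - s\<bar>)*y s))^2 \<le>
   (NN s. (ennreal (sqrt (kap \<bar>t - s\<bar>)*a s))^2)*(NN s. (ennreal (sqrt (kap \<bar>t - s\<bar>)*y s))^2)"
   by (rule Cauchy_Schwarz_nn_integral) measurable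
  also have "... = (NN s. ennreal (kap \<bar>t - s\<bar>*(a s)^2))*(?Q t)"
   using nn by (simp add: ennreal_power power_mult_distrib)
  also have "... <= ennreal eps*(?Q t)" by (intro mult_right_mono sch) simp
  finally show ?thesis unfolding e .
 qed
 have "(NN t. (ennreal (a t)*(?P t))^2) <= (NN t. ennreal eps*(NN s. ?R t s))"
 proof (rule nn_integral_mono, goal_cases)
  case (1 t)
  have "(ennreal (a t)*(?P t))^2 <= (ennreal (a t))^2*(ennreal eps*(?Q t))"
   unfolding power_mult_distrib by (intro mult_left_mono cs) simp
  also have "... = ennreal eps*(ennreal ((a t)^2)*(?Q t))"
   using nn by (simp add: ennreal_power mult_ac)
  also have "ennreal ((a t)^2)*(?Q t) = (NN s. ?R t s)"
   using nn by (subst nn_integral_cmult[symmetric]) (auto simp: ennreal_mult[symmetric] abs_minus_commute mult_ac)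
  finally show ?case .
 qed
 also have "... = ennreal eps*(NN t. NN s. ?R t s)"
  by (rule nn_integral_cmult) measurable
 also have "(NN t. NN s. ?R t s) = (NN s. NN t. ?R t s)"
  by (rule lborel_pair.Fubini') measurable
 also have "... = (NN s. (NN t. ennreal (kap \<bar>s - t\<bar>*(a t)^2))*ennreal ((y s)^2))"
  by (intro nn_integral_cong nn_integral_multc) measurable
 also have "... <= (NN s. ennreal eps*ennreal ((y s)^2))"
  by (intro nn_integral_mono mult_right_mono sch) simp
 also have "... = ennreal eps*(NN s. ennreal ((y s)^2))" by (rule nn_integral_cmult) measurable
 finally show ?thesis by (simp add: power2_eq_square mult.assoc mult_left_mono)
qed

lemma ennreal_square_le_imp_le:
 fixes x y :: ennreal
 assumes "x*x <= y*y" shows "x <= y"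
proof (rule ccontr)
 assume "\<not> x <= y"
 then have yx: "y < x" by simp
 then have "y < top" by (rule less_le_trans) simp
 then have "y*y < top" by (simp add: ennreal_mult_less_top)
 then have "x < top" using assms by (cases x; cases y) (auto simp: ennreal_mult_eq_top_iff top_unique)
 then show False using assms yx
  by (cases x; cases y) (auto simp: ennreal_mult[symmetric] ennreal_less_iff not_le[symmetric] dest: power2_le_imp_le[unfolded power2_eq_square])
qed

lemma ennreal_mult_self_le:
 assumes "ennreal r*ennreal r <= X*ennreal r" shows "ennreal r <= X"
 using assms by (cases X; cases "r <= 0") (auto simp: ennreal_mult[symmetric] ennreal_neg top_unique mult_le_cancel_right)

text \<open>Cauchy-Schwarz in t against \<open>schur2\<close> bounds the square of the form, and the
  root is taken at the end.\<close>

lemma schur1: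
 fixes kap a z :: "real => real"
 assumes [measurable]: "kap \<in> borelm" "a \<in> borelm" "z \<in> borelm"
  and nn: "\<And>t. 0 <= kap t" "\<And>t. 0 <= a t" "\<And>t. 0 <= z t"
  and sch: "\<And>t. (NN s. ennreal (kap \<bar>t - s\<bar>*(a s)^2)) <= ennreal eps"
 shows "(NN t. NN s. ennreal (kap \<bar>t - s\<bar>*a s*a t*(z s*z t))) <= ennreal eps*(NN t. ennreal ((z t)^2))"
proof -
 let ?P = "\<lambda>t. ennreal (a t)*(NN s. ennreal (kap \<bar>t - s\<bar>*a s*z s))"
 let ?Z = "NN t. ennreal ((z t)^2)"
 have p: "?P t*ennreal (z t) = ennreal (a t*z t)*(NN s. ennreal (kap \<bar>t - s\<bar>*a s*z s))" for t
  using nn by (simp add: ennreal_mult mult_ac)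
 have "(NN s. ennreal (kap \<bar>t - s\<bar>*a s*a t*(z s*z t))) = ?P t*ennreal (z t)" for t
  unfolding p using nn by (subst nn_integral_cmult[symmetric]) (auto simp: ennreal_mult[symmetric] mult_ac)
 then have e: "(NN t. NN s. ennreal (kap \<bar>t - s\<bar>*a s*a t*(z s*z t))) = (NN t. ?P t*ennreal (z t))" by simp
 have "(NN t. ?P t*ennreal (z t))^2 <= (NN t. (?P t)^2)*(NN t. (ennreal (z t))^2)"
  by (rule Cauchy_Schwarz_nn_integral) measurable
 also have "... <= ((ennreal eps)^2*?Z)*?Z"
  using schur2[OF assms] nn by (intro mult_mono) (simp_all add: ennreal_power)
 finally show ?thesis unfolding e by - (rule ennreal_square_le_imp_le, simp add: power2_eq_square mult_ac)
qed

text \<open>Two curves are carried along because the potential of an increment u(t + h) - u(t) is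
  built from |u(t)| + |u(t + h)|. The kernel estimate enters as the assumption \<open>kb\<close>
  with its time dependence factored into a(s) a(t), and \<open>sg\<close> is the direction of
  time.\<close>

locale smoothing =
 fixes sg b al :: real and u1 u2 :: "real => 'a::euclidean_space => complex" and a kap :: "real => real"
 assumes sg: "\<bar>sg\<bar> = 1" and b: "0 <= b" and al: "0 < al" and u1: "L2cont u1" and u2: "L2cont u2"
  and a_meas [measurable]: "a \<in> borelm" and a_nonneg: "\<And>t. 0 <= a t"
  and kap_meas [measurable]: "kap \<in> borelm" and kap_nonneg: "\<And>t. 0 <= kap t"
  and kb: "\<And>eta tau s t n m f g. eta > 0 ==> tau \<noteq> 0 ==> f \<in> L2 ==> g \<in> L2 ==>
   cmod (ip (fmul (sm eta tau) (cut b al (nsum (u1 s) (u2 s)) n f))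
       (cut b al (nsum (u1 t) (u2 t)) m g))
   <= kap \<bar>tau\<bar>*a s*a t*(nrm f*nrm g)"
begin

definition rho :: "real => 'a => real" where "rho t x = cmod (u1 t x) + cmod (u2 t x)"
definition V :: "real => 'a => real" where "V t = wV b al (rho t)"
definition sV :: "nat => real => 'a => real" where "sV n t x = sqrt (V t x)*indicator (trunc (rho t) n) x"
definition Vn :: "nat => real => 'a => real" where "Vn n t x = V t x*indicator (trunc (rho t) n) x"
definition S :: "real => ('a => complex) => 'a => complex" where "S t = propagator (sg*t)"
definition W :: "real => ('a => complex) => ennreal" where "W t f = (NN x. ennreal (V t x*(cmod (f x))^2))"
definition Wn :: "nat => real => ('a => complex) => ennreal" where "Wn n t f = (NN x. ennreal (Vn n t x*(cmod (f x))^2))"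

lemma rho_measurable [measurable]: "rho t \<in> borelm"
 using L2_measurable[OF L2cont_L2[OF u1, of t]] L2_measurable[OF L2cont_L2[OF u2, of t]] unfolding rho_def[abs_def] by measurable

lemma rho_nonneg: "0 <= rho t x" by (simp add: rho_def)

lemma V_nonneg [simp]: "0 <= V t x" by (simp add: V_def)
lemma Vn_nonneg [simp]: "0 <= Vn n t x" by (simp add: Vn_def)
lemma sV_nonneg [simp]: "0 <= sV n t x" by (simp add: sV_def)

lemma V_measurable [measurable]: "V t \<in> borelm" unfolding V_def by measurable
lemma sV_measurable [measurable]: "sV n t \<in> borelm" unfolding sV_def[abs_def] by measurable
lemma Vn_measurable [measurable]: "Vn n t \<in> borelm" unfolding Vn_def[abs_def] by measurable

lemma sV_sq: "(sV n t x)^2 = Vn n t x" by (auto simp: sV_def Vn_def indicator_def)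

lemma kernel:
 assumes "eta > 0" "tau \<noteq> 0" "f \<in> L2" "g \<in> L2"
 shows "cmod (ip (fmul (sm eta tau) (\<lambda>x. of_real (sV n s x)*f x)) (\<lambda>x. of_real (sV m t x)*g x)) <= kap \<bar>tau\<bar>*a s*a t*(nrm f*nrm g)"
 using kb[OF assms, of s n t m] by (simp only: sV_def V_def rho_def[abs_def])

lemma Vn_bound: "Vn n t x <= 2 powr (real n*(b + al))"
proof (cases "x \<in> trunc (rho t) n")
 case True
 then have x: "2 powr (- real n) < norm x" "rho t x < 2 powr real n" by (auto simp: trunc_def)
 have "norm x powr (- b) <= (2 powr (- real n)) powr (- b)" using x b by (intro powr_mono2') auto
 moreover have "rho t x powr al <= (2 powr real n) powr al" using x al rho_nonneg by (intro powr_mono2) auto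
 ultimately have "norm x powr (- b)*rho t x powr al <= (2 powr (- real n)) powr (- b)*(2 powr real n) powr al" by (intro mult_mono) auto
 also have "... = 2 powr (real n*(b + al))" by (simp add: powr_powr powr_add[symmetric] algebra_simps)
 finally show ?thesis using True by (simp add: Vn_def V_def wV_def)
qed (simp add: Vn_def)

lemma sV_bound: "sV n t x <= sqrt (2 powr (real n*(b + al)))"
 using Vn_bound[of n t x] by (intro real_le_rsqrt) (simp add: sV_sq)

lemma sV_L2: assumes "f \<in> L2" shows "(\<lambda>x. of_real (sV n t x)*f x) \<in> L2"
 by (rule L2_bounded_mult(1)[OF assms, where B="sqrt (2 powr (real n*(b + al)))"]) (auto simp: sV_bound)

lemma Vn_L2: assumes "f \<in> L2" shows "(\<lambda>x. of_real (Vn n t x)*f x) \<in> L2" "nrm (\<lambda>x. of_real (Vn n t x)*f x) <= 2 powr (real n*(b + al))*nrm f"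
proof -
 have m: "(\<lambda>x. complex_of_real (Vn n t x)) \<in> borelm" by measurable
 have bd: "cmod (complex_of_real (Vn n t x)) <= 2 powr (real n*(b + al))" for x by (simp add: Vn_bound)
 show "(\<lambda>x. of_real (Vn n t x)*f x) \<in> L2" "nrm (\<lambda>x. of_real (Vn n t x)*f x) <= 2 powr (real n*(b + al))*nrm f"
  using L2_bounded_mult[OF assms m bd] by auto
qed

lemma Wn_eq: assumes "f \<in> L2" shows "Wn n t f = ennreal ((nrm (\<lambda>x. of_real (sV n t x)*f x))^2)"
 unfolding nn_integral_nrm[OF sV_L2[OF assms], symmetric] Wn_def
 by (simp add: norm_mult power_mult_distrib sV_sq)

lemma W_SUP: assumes "f \<in> L2" shows "W t f = (SUP n. Wn n t f)"
 unfolding W_def Wn_def V_def Vn_def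
 by (rule nn_integral_wV_trunc) (use L2_measurable[OF assms] rho_nonneg in auto)

lemma Wn_le_W: "Wn n t f <= W t f"
 unfolding W_def Wn_def Vn_def by (intro nn_integral_mono ennreal_leI) (auto simp: indicator_def)

lemma Wn_mono: "Wn n t f <= Wn (Suc n) t f"
 unfolding Wn_def Vn_def using trunc_mono[of n "Suc n" "rho t"] by (intro nn_integral_mono ennreal_leI) (auto simp: indicator_def)

lemma S_L2: "f \<in> L2 ==> S t f \<in> L2" unfolding S_def by (rule propagator_L2)
lemma nrm_S: "f \<in> L2 ==> nrm (S t f) = nrm f" unfolding S_def by (rule nrm_propagator)
lemma ip_S: "f \<in> L2 ==> g \<in> L2 ==> ip (S t f) g = ip f (S (- t) g)" unfolding S_def by (simp add: ip_propagator)
lemma S_S: "f \<in> L2 ==> S s (S t f) = S (s + t) f" unfolding S_def by (simp add: propagator_propagator distrib_left)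

lemma L2cont_S: assumes "f \<in> L2" shows "L2cont (\<lambda>t. S t f)"
 unfolding L2cont_def S_def
proof (intro conjI allI impI propagator_L2 assms)
 fix t and s :: "nat => real" assume "s ----> t"
 then show "(\<lambda>n. nrm (\<lambda>x. propagator (sg * s n) f x - propagator (sg*t) f x)) ----> 0"
  by (intro propagator_tendsto assms tendsto_intros)
qed

text \<open>When |u1| + |u2| lies in the open interval of the truncation the integrand is continuous
  in the values of the curves; otherwise it is 0. So it is lower semicontinuous.\<close>

lemma Wn_measurable:
 assumes d: "L2cont d" shows "(\<lambda>t. Wn n t (d t)) \<in> borelm"
proof -
 define \<Phi> where "\<Phi> x z1 z2 z3 = ennreal (norm x powr (- b)*(cmod z1 + cmod z2) powr al*indicator {x::'a. 2 powr (- real n) < norm x \<and> norm x < 2 powr real n} x*indicator {2 powr (- real n)<..<2 powr real n} (cmod z1 + cmod z2)*(cmod z3)^2)" for x :: 'a and z1 z2 z3 :: complex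
 have eq: "ennreal (Vn n t x*(cmod (d t x))^2) = \<Phi> x (u1 t x) (u2 t x) (d t x)" for t x
  by (auto simp: Vn_def V_def wV_def \<Phi>_def rho_def trunc_def indicator_def)
 show ?thesis unfolding Wn_def eq
 proof (rule lsc_integral_measurable[OF u1 u2 d])
  show "(\<lambda>x. \<Phi> x (u1 t x) (u2 t x) (d t x)) \<in> borelm" for t
   unfolding eq[symmetric] using L2_measurable[OF L2cont_L2[OF d, of t]] by measurable
  fix x :: 'a and z1 z2 z3 :: "nat => complex" and w1 w2 w3 assume z: "z1 ----> w1" "z2 ----> w2" "z3 ----> w3"
  have rl: "(\<lambda>k. cmod (z1 k) + cmod (z2 k)) ----> cmod w1 + cmod w2" by (intro tendsto_intros z)
  show "\<Phi> x w1 w2 w3 <= liminf (\<lambda>k. \<Phi> x (z1 k) (z2 k) (z3 k))"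
  proof (cases "cmod w1 + cmod w2 \<in> {2 powr (- real n)<..<2 powr real n}")
   case True
   have ev: "\<forall>\<^sub>F k in sequentially. cmod (z1 k) + cmod (z2 k) \<in> {2 powr (- real n)<..<2 powr real n}"
    using topological_tendstoD[OF rl _ True] by simp
   let ?c = "indicat_real {x::'a. 2 powr (- real n) < norm x \<and> norm x < 2 powr real n} x"
   have "cmod w1 + cmod w2 > 0" using True less_trans[OF powr_gt_zero[THEN iffD2, of 2 "- real n"]] by simp
   then have "(\<lambda>k. ennreal (norm x powr (- b)*(cmod (z1 k) + cmod (z2 k)) powr al*?c*(cmod (z3 k))^2)) ----> ennreal (norm x powr (- b)*(cmod w1 + cmod w2) powr al*?c*(cmod w3)^2)"
    by (intro tendsto_ennrealI tendsto_mult tendsto_powr rl tendsto_const tendsto_power tendsto_norm z) auto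
   moreover have "ennreal (norm x powr (- b)*(cmod w1 + cmod w2) powr al*?c*(cmod w3)^2) = \<Phi> x w1 w2 w3" using True by (simp add: \<Phi>_def)
   moreover have "\<forall>\<^sub>F k in sequentially. ennreal (norm x powr (- b)*(cmod (z1 k) + cmod (z2 k)) powr al*?c*(cmod (z3 k))^2) = \<Phi> x (z1 k) (z2 k) (z3 k)"
    using ev by eventually_elim (simp add: \<Phi>_def)
   ultimately have "(\<lambda>k. \<Phi> x (z1 k) (z2 k) (z3 k)) ----> \<Phi> x w1 w2 w3" by (simp add: tendsto_cong)
   from lim_imp_Liminf[OF _ this] show ?thesis by simp
  next
   case False then show ?thesis by (simp add: \<Phi>_def)
  qed
 qed
qed

lemma W_measurable:
 assumes d: "L2cont d" shows "(\<lambda>t. W t (d t)) \<in> borelm"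
 unfolding W_SUP[OF L2cont_L2[OF d]] by (intro borel_measurable_SUP Wn_measurable d) auto

end

context smoothing
begin

text \<open>The damping is removed by letting it tend to 0; the bound \<open>kb\<close> does not see
  it.\<close>

lemma kernel0:
 assumes "tau \<noteq> 0" "f \<in> L2" "g \<in> L2"
 shows "cmod (ip (propagator tau (\<lambda>x. of_real (sV n s x)*f x)) (\<lambda>x. of_real (sV m t x)*g x)) <= kap \<bar>tau\<bar>*a s*a t*(nrm f*nrm g)"
proof -
 let ?f = "\<lambda>x. of_real (sV n s x)*f x" and ?g = "\<lambda>x. of_real (sV m t x)*g x"
 note L = sV_L2[OF assms(2)] sV_L2[OF assms(3)]
 let ?m = "\<lambda>k::nat. sm (inverse (real (Suc k))) tau :: 'a => complex"
 have "(\<lambda>k. nrm (\<lambda>x. fmul (?m k) ?f x - fmul (\<lambda>xi. cis (tau*norm xi ^ 4)) ?f x)) ----> 0"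
 proof (rule fmul_tendsto[where B=1])
  show "cmod (?m k xi) <= 1" for k xi by (rule cmod_sm_le) simp
  show "(\<lambda>k. ?m k xi) ----> cis (tau*norm xi ^ 4)" for xi
  proof -
   have "(\<lambda>k. exp (- (of_real (inverse (real (Suc k))) - \<i> * of_real tau) * of_real (norm xi ^ 4))) ----> exp (- (of_real 0 - \<i> * of_real tau) * of_real (norm xi ^ 4))"
    by (intro tendsto_intros LIMSEQ_inverse_real_of_nat)
   then show ?thesis by (simp add: sm_def cis_conv_exp mult.assoc)
  qed
 qed (auto simp: L)
 then have "(\<lambda>k. ip (fmul (?m k) ?f) ?g) ----> ip (propagator tau ?f) ?g"
  unfolding propagator_eq nrm_minus_commute[where f="fmul (?m _) ?f"]
  by (intro ip_tendsto fmul_L2 L) (auto intro!: bmeasI[where B=1] cmod_sm_le)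
 from tendsto_norm[OF this] show ?thesis
  by (rule tendsto_upperbound) (auto intro!: always_eventually kernel assms)
qed

definition zz :: "nat => ('a => complex) => real => real" where
 "zz n f t = nrm (\<lambda>x. of_real (sV n t x)*S t f x)"

lemma zz_nonneg [simp]: "0 <= zz n f t" by (simp add: zz_def)

lemma Wn_zz: "f \<in> L2 ==> Wn n t (S t f) = ennreal ((zz n f t)^2)"
 unfolding zz_def by (rule Wn_eq[OF S_L2])

lemma zz_measurable: assumes "f \<in> L2" shows "zz n f \<in> borelm"
proof -
 have "zz n f = (\<lambda>t. sqrt (enn2real (Wn n t (S t f))))" by (rule ext) (simp add: Wn_zz[OF assms])
 moreover have "(\<lambda>t. Wn n t (S t f)) \<in> borelm" by (rule Wn_measurable[OF L2cont_S[OF assms]])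
 ultimately show ?thesis by simp
qed

lemma zz_le: assumes "f \<in> L2" shows "zz n f t <= sqrt (2 powr (real n*(b + al)))*nrm f"
proof -
 have "nrm (\<lambda>x. of_real (sV n t x)*S t f x) <= sqrt (2 powr (real n*(b + al)))*nrm (S t f)"
  by (rule L2_bounded_mult(2)[OF S_L2[OF assms]]) (auto simp: sV_bound)
 then show ?thesis by (simp add: zz_def nrm_S assms)
qed

definition rr :: "nat => ('a => complex) => ('a => complex) => real => real" where
 "rr n f g t = Re (ip (\<lambda>x. of_real (sV n t x)*S t f x) (\<lambda>x. of_real (sV n t x)*S t g x))"

lemma zz_polar:
 assumes f: "f \<in> L2" and g: "g \<in> L2"
 shows "(zz n (\<lambda>x. f x + of_real c*g x) t)^2 = (zz n f t)^2 + 2*c*rr n f g t + c^2*(zz n g t)^2"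
proof -
 have cg: "(\<lambda>x. of_real c*g x) \<in> L2" using L2_cmult g by blast
 have AE: "AE x in lborel. S t (\<lambda>x. f x + of_real c*g x) x = S t f x + of_real c*S t g x"
  using propagator_add[OF f cg, of "sg*t"] propagator_cmult[OF g, of "sg*t" "of_real c"] unfolding S_def by eventually_elim simp
 let ?F = "\<lambda>x. of_real (sV n t x)*S t f x" and ?G = "\<lambda>x. of_real (sV n t x)*S t g x"
 note L = sV_L2[OF S_L2[OF f], of n t t] sV_L2[OF S_L2[OF g], of n t t]
 have "zz n (\<lambda>x. f x + of_real c*g x) t = nrm (\<lambda>x. ?F x + of_real c*?G x)"
  unfolding zz_def
 proof (rule nrm_cong_AE)
  show "AE x in lborel. of_real (sV n t x)*S t (\<lambda>x. f x + of_real c*g x) x = ?F x + of_real c*?G x"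
   using AE by eventually_elim (simp add: algebra_simps)
  show "(\<lambda>x. of_real (sV n t x)*S t (\<lambda>x. f x + of_real c*g x) x) \<in> borelm"
   using L2_measurable[OF S_L2[OF L2_add[OF f cg]], of t] by measurable
  show "(\<lambda>x. ?F x + of_real c*?G x) \<in> borelm"
   using L2_measurable[OF L(1)] L2_measurable[OF L(2)] by measurable
 qed
 then have "(zz n (\<lambda>x. f x + of_real c*g x) t)^2 = (nrm ?F)^2 + (nrm (\<lambda>x. of_real c*?G x))^2 + 2*Re (ip ?F (\<lambda>x. of_real c*?G x))"
  using nrm_add_sq[OF L(1) L2_cmult[OF L(2), of "of_real c"]] by simp
 then show ?thesis by (simp add: nrm_cmult ip_cmult_right rr_def zz_def power_mult_distrib)
qed

lemma rr_measurable: assumes f: "f \<in> L2" and g: "g \<in> L2" shows "rr n f g \<in> borelm"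
proof -
 have "rr n f g = (\<lambda>t. ((zz n (\<lambda>x. f x + of_real 1*g x) t)^2 - (zz n f t)\<^sup>2 - (zz n g t)\<^sup>2)/2)"
  by (rule ext) (use zz_polar[OF f g, of n 1] in simp)
 moreover have "(\<lambda>x. f x + of_real 1*g x) \<in> L2" using L2_add[OF f g] by simp
 ultimately show ?thesis using zz_measurable f g by simp
qed

lemma rr_le: assumes f: "f \<in> L2" and g: "g \<in> L2" shows "\<bar>rr n f g t\<bar> <= zz n f t*zz n g t"
 unfolding rr_def zz_def using ip_CS[OF sV_L2[OF S_L2[OF f]] sV_L2[OF S_L2[OF g]]] abs_Re_le_cmod order_trans by blast

text \<open>The vectors \<open>gs n f s\<close> represent the form: \<open>rr n f g s = Re (ip (gs n f s) g)\<close>.\<close>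

definition gs :: "nat => ('a => complex) => real => 'a => complex" where
 "gs n f s = S (- s) (\<lambda>x. of_real (sV n s x)*(of_real (sV n s x)*S s f x))"

lemma ip_sV: "ip (\<lambda>x. of_real (sV n t x)*f x) g = ip f (\<lambda>x. of_real (sV n t x)*g x)"
 unfolding ip_def by (rule Bochner_Integration.integral_cong) (auto simp: mult_ac)

text \<open>Evolving \<open>gs n f s\<close> to time t leaves a single propagator over t - s between
  two weights, which is what the kernel estimate bounds. The estimate says nothing at s = t, which
  is a null set of times.\<close>

lemma gs_props:
 assumes f: "f \<in> L2"
 shows "gs n f s \<in> L2" "nrm (gs n f s) <= 2 powr (real n*(b + al))*nrm f" "ip f (gs n f s) = of_real ((zz n f s)^2)"
  "s \<noteq> t ==> \<bar>rr n f (gs n f s) t\<bar> <= kap \<bar>t - s\<bar>*a s*a t*(zz n f s*zz n f t)"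
proof -
 have L1: "(\<lambda>x. of_real (sV n r x)*S r f x) \<in> L2" for r by (rule sV_L2[OF S_L2[OF f]])
 have L2': "(\<lambda>x. of_real (sV n r x)*(of_real (sV n r x)*S r f x)) \<in> L2" for r by (rule sV_L2[OF L1])
 show L: "gs n f s \<in> L2" unfolding gs_def by (rule S_L2[OF L2'])
 have "(\<lambda>x. of_real (sV n s x)*(of_real (sV n s x)*S s f x)) = (\<lambda>x. complex_of_real (Vn n s x)*S s f x)"
  by (rule ext) (simp add: sV_sq[symmetric] power2_eq_square)
 then show "nrm (gs n f s) <= 2 powr (real n*(b + al))*nrm f"
  unfolding gs_def nrm_S[OF L2'] using Vn_L2(2)[OF S_L2[OF f], of n s s] by (simp add: nrm_S f)
 have "ip f (gs n f s) = ip (S s f) (\<lambda>x. of_real (sV n s x)*(of_real (sV n s x)*S s f x))"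
  unfolding gs_def using ip_S[OF f L2', of s] by simp
 also have "... = ip (\<lambda>x. of_real (sV n s x)*S s f x) (\<lambda>x. of_real (sV n s x)*S s f x)" by (rule ip_sV[symmetric])
 finally show "ip f (gs n f s) = of_real ((zz n f s)^2)" by (simp add: ip_self zz_def)
 assume st: "s \<noteq> t"
 let ?p = "\<lambda>r x. of_real (sV n r x)*S r f x"
 have "rr n f (gs n f s) t = Re (ip (S t (gs n f s)) (\<lambda>x. of_real (sV n t x)*?p t x))"
 proof -
  have "ip (\<lambda>x. of_real (sV n t x)*S t f x) (\<lambda>x. of_real (sV n t x)*S t (gs n f s) x) = ip (\<lambda>x. of_real (sV n t x)*?p t x) (S t (gs n f s))"
   by (rule ip_sV[symmetric])
  also have "... = cnj (ip (S t (gs n f s)) (\<lambda>x. of_real (sV n t x)*?p t x))" by (rule ip_cnj)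
  finally show ?thesis by (simp add: rr_def)
 qed
 moreover have "S t (gs n f s) = propagator (sg*(t - s)) (\<lambda>x. of_real (sV n s x)*?p s x)"
  unfolding gs_def using S_S[OF L2', of t "- s" s] by (simp add: S_def)
 moreover have "cmod (ip (propagator (sg*(t - s)) (\<lambda>x. of_real (sV n s x)*?p s x)) (\<lambda>x. of_real (sV n t x)*?p t x)) <= kap \<bar>sg*(t - s)\<bar>*a s*a t*(nrm (?p s)*nrm (?p t))"
  by (rule kernel0[OF _ L1 L1]) (use st sg in auto)
 ultimately show "\<bar>rr n f (gs n f s) t\<bar> <= kap \<bar>t - s\<bar>*a s*a t*(zz n f s*zz n f t)"
  using order_trans[OF abs_Re_le_cmod] sg by (simp add: abs_mult zz_def)
qed

end

lemma discriminant_le: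
 fixes P B Q :: real
 assumes P: "0 <= P" and Q: "0 <= Q" and nn: "\<And>c. 0 <= P + 2*c*B + c^2*Q" shows "B^2 <= P*Q"
proof (cases "Q = 0")
 case True
 have "B = 0"
 proof (rule ccontr)
  assume "B \<noteq> 0"
  then have "P + 2*(- (P + 1)/(2*B))*B = - 1" by (simp add: field_simps)
  then show False using nn[of "- (P + 1)/(2*B)"] True by simp
 qed
 then show ?thesis using P Q by simp
next
 case False
 have "P + 2*(- B/Q)*B + (- B/Q)^2*Q = P - B\<^sup>2/Q" using False by (simp add: field_simps power2_eq_square)
 then have "B^2/Q <= P" using nn[of "- B/Q"] by simp
 then show ?thesis using False Q by (simp add: field_simps)
qed

lemma integrable_interval_bounded:
 fixes h :: "real => real"
 assumes [measurable]: "h \<in> borelm" and h: "\<And>t. \<bar>h t\<bar> <= B"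
 shows "intg (\<lambda>t. indicator {t1..t2} t*h t)"
proof (rule Bochner_Integration.integrable_bound)
 show "intg (\<lambda>t. indicator {t1..t2} t*B)"
  by (intro integrable_mult_left integrable_real_indicator) (auto simp: emeasure_lborel_Icc_eq)
 show "(\<lambda>t. indicator {t1..t2} t*h t) \<in> borel_measurable lborel" by measurable
 show "AE t in lborel. norm (indicator {t1..t2} t*h t) <= norm (indicator {t1..t2} t*B)"
  using h order_trans[OF h abs_ge_self] by (auto simp: indicator_def)
qed

locale smoothing_tail = smoothing +
 fixes J :: "real set" and eps :: real
 assumes J [measurable]: "J \<in> sets borel" and eps: "0 <= eps" and tail: "\<And>t. (NN s. ennreal (kap \<bar>t - s\<bar>*(indicator J s*a s)^2)) <= ennreal eps"
begin

text \<open>M is the best constant for the form \<open>Z\<close>, finite because of the truncation n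
  and the bounded time interval. As P f = M |f|^2 - Z f is non-negative, Cauchy-Schwarz for this
  form shows that a near-maximizer f almost satisfies the eigenvalue equation M Re <f, g> =
  \<open>Rr f g\<close> for every g. Taking g = \<open>gs n f s\<close>, integrating over s and
  applying the Schur bound gives M Z f <= eps Z f up to a vanishing error, whence M <= eps.\<close>

lemma free_estimate_n:
 assumes f0: "f0 \<in> L2" and t02: "{t0..t2} \<subseteq> J"
 shows "(NN t. indicator {t0..t2} t*Wn n t (S t f0)) <= ennreal (eps*(nrm f0)^2)"
proof -
 let ?J = "indicat_real {t0..t2}"
 define K where "K = 2 powr (real n*(b + al))"
 have K0: "K \<ge> 0" by (simp add: K_def)
 have Ji: "intg ?J" by (intro integrable_real_indicator) (auto simp: emeasure_lborel_Icc_eq)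
 define l where "l = (LBINT t. ?J t*1)"
 have l0: "l \<ge> 0" by (simp add: l_def)
 define Z where "Z f = (LBINT t. ?J t*(zz n f t)^2)" for f
 define Rr where "Rr f g = (LBINT t. ?J t*rr n f g t)" for f g
 have zzb: "(zz n f t)^2 <= K*(nrm f)^2" if f: "f \<in> L2" for f t
  using power_mono[OF zz_le[OF f, of n t] zz_nonneg, of 2] by (simp add: power_mult_distrib K_def)
 have Zi: "intg (\<lambda>t. ?J t*(zz n f t)^2)" if f: "f \<in> L2" for f
  by (rule integrable_interval_bounded[where B="K*(nrm f)^2"]) (use zzb[OF f] zz_measurable[OF f] in auto)
 have rrb: "\<bar>rr n f g t\<bar> <= (sqrt K*nrm f)*(sqrt K*nrm g)" if f: "f \<in> L2" and g: "g \<in> L2" for f g t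
  using order_trans[OF rr_le[OF f g, of n t] mult_mono[OF zz_le[OF f] zz_le[OF g]]] K0 by (simp add: K_def)
 have Ri: "intg (\<lambda>t. ?J t*rr n f g t)" if f: "f \<in> L2" and g: "g \<in> L2" for f g
  by (rule integrable_interval_bounded[OF rr_measurable[OF f g] rrb[OF f g]])
 have Z0: "0 <= Z f" for f unfolding Z_def by (intro Bochner_Integration.integral_nonneg) auto
 have Zb: "Z f <= l*K*(nrm f)^2" if f: "f \<in> L2" for f
 proof -
  have "Z f <= (LBINT t. ?J t*1*(K*(nrm f)^2))" unfolding Z_def
  proof (rule Bochner_Integration.integral_mono[OF Zi[OF f]])
   show "intg (\<lambda>t. ?J t*1*(K*(nrm f)^2))" by (intro integrable_mult_left) (simp only: mult_1_right Ji)
  qed (use zzb[OF f] in "auto simp: indicator_def")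
  also have "... = l*K*(nrm f)^2" by (simp add: l_def)
  finally show ?thesis .
 qed
 have Zpol: "Z (\<lambda>x. f x + of_real c*g x) = Z f + 2*c*Rr f g + c^2*Z g" if f: "f \<in> L2" and g: "g \<in> L2" for f g c
 proof -
  have "Z (\<lambda>x. f x + of_real c*g x) = (LBINT t. ?J t*(zz n f t)^2 + 2*c*(?J t*rr n f g t) + c^2*(?J t*(zz n g t)^2))"
   unfolding Z_def zz_polar[OF f g] by (simp add: algebra_simps)
  also have "... = Z f + 2*c*Rr f g + c^2*Z g"
   unfolding Z_def Rr_def using Zi[OF f] Zi[OF g] Ri[OF f g] by simp
  finally show ?thesis .
 qed
 have Zc: "Z (\<lambda>x. of_real c*g x) = c^2*Z g" if g: "g \<in> L2" for g c
 proof -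
  have "Z (\<lambda>x. 0) = 0" using Zb[OF L2_zero] Z0[of "\<lambda>x. 0"] by simp
  moreover have "Rr (\<lambda>x. 0) g = 0"
  proof -
   have "rr n (\<lambda>x. 0) g t = 0" for t using rrb[OF L2_zero g, of t] by simp
   then show ?thesis by (simp add: Rr_def)
  qed
  ultimately show ?thesis using Zpol[OF L2_zero g, of c] by simp
 qed
 define M where "M = Sup (Z ` {f \<in> L2. nrm f <= 1})"
 have bdd: "bdd_above (Z ` {f \<in> L2. nrm f <= 1})"
 proof (rule bdd_aboveI2)
  fix f :: "'a => complex" assume "f \<in> {f \<in> L2. nrm f <= 1}"
  then have f: "f \<in> L2" "nrm f <= 1" by auto
  have "(nrm f)^2 <= 1" using f(2) by (simp add: power_le_one)
  from mult_left_mono[OF this, of "l*K"] show "Z f <= l*K" using Zb[OF f(1)] l0 K0 by simp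
 qed
 have ne: "Z ` {f \<in> L2. nrm f <= 1} \<noteq> {}" using L2_zero by fastforce
 have M1: "Z f <= M" if "f \<in> L2" "nrm f <= 1" for f unfolding M_def by (rule cSup_upper[OF _ bdd]) (use that in auto)
 have M0: "0 <= M" using order_trans[OF Z0 M1[OF L2_zero]] by simp
 have M2: "Z f <= M*(nrm f)^2" if f: "f \<in> L2" for f
 proof (cases "nrm f = 0")
  case True then show ?thesis using Zb[OF f] by simp
 next
  case False
  have g: "(\<lambda>x. of_real (1/nrm f)*f x) \<in> L2" by (rule L2_cmult[OF f])
  have "nrm (\<lambda>x. of_real (1/nrm f)*f x) <= 1" unfolding nrm_cmult using False by (simp add: norm_divide)
  from M1[OF g this] have "(1/nrm f)^2*Z f <= M" unfolding Zc[OF f] .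
  then show ?thesis using False by (simp add: field_simps)
 qed
 define P where "P f = M*(nrm f)^2 - Z f" for f
 have P0: "0 <= P f" if "f \<in> L2" for f using M2[OF that] by (simp add: P_def)
 \<comment> \<open>Cauchy-Schwarz for the non-negative form \<open>P\<close>, read off from the
   discriminant of c -> P (f + c g).\<close>
 have disc: "(M*Re (ip f g) - Rr f g)^2 <= P f*P g" if f: "f \<in> L2" and g: "g \<in> L2" for f g
 proof (rule discriminant_le[OF P0[OF f] P0[OF g]], goal_cases)
  case (1 c)
  have cg: "(\<lambda>x. of_real c*g x) \<in> L2" by (rule L2_cmult[OF g])
  have "0 <= P (\<lambda>x. f x + of_real c*g x)" by (rule P0[OF L2_add[OF f cg]])
  also have "... = P f + 2*c*(M*Re (ip f g) - Rr f g) + c^2*P g"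
   unfolding P_def Zpol[OF f g] nrm_add_sq[OF f cg] by (simp add: nrm_cmult ip_cmult_right power_mult_distrib algebra_simps)
  finally show ?case .
 qed
 have key: "M*Z f <= eps*Z f + l*(K * sqrt (dl*M))" if f: "f \<in> L2" "nrm f <= 1" and dl: "0 <= dl" "P f <= dl" for f dl
 proof -
  have zm [measurable]: "zz n f \<in> borelm" by (rule zz_measurable[OF f(1)])
  let ?k = "\<lambda>t s. ennreal (kap \<bar>t - s\<bar>*(indicator J s*a s)*(indicator J t*a t)*((?J s*zz n f s)*(?J t*zz n f t)))"
  \<comment> \<open>The inequality is obtained at each time s separately, so that only scalar
    functions are integrated. Its last term measures how far f is from being a maximizer.\<close>
  have pt: "ennreal (M*(?J s*(zz n f s)^2)) <= (NN t. ?k s t) + ennreal (K * sqrt (dl*M))*ennreal (?J s*1)" for s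
  proof (cases "s \<in> {t0..t2}")
   case True
   note g = gs_props[OF f(1), of n s]
   have Pg: "P (gs n f s) <= M*K^2"
   proof -
    have "nrm (gs n f s) <= K" using order_trans[OF g(2)[folded K_def] mult_left_mono[OF f(2) K0]] by simp
    then have "(nrm (gs n f s))^2 <= K^2" by (intro power_mono) auto
    then show ?thesis using M0 Z0[of "gs n f s"] mult_left_mono[of "(nrm (gs n f s))^2" "K^2" M] by (simp add: P_def)
   qed
   have "(M*(zz n f s)^2 - Rr f (gs n f s))^2 <= P f*P (gs n f s)" using disc[OF f(1) g(1)] g(3) by simp
   also have "... <= dl*(M*K^2)" by (rule mult_mono[OF dl(2) Pg dl(1) P0[OF g(1)]])
   finally have "\<bar>M*(zz n f s)^2 - Rr f (gs n f s)\<bar> <= sqrt (dl*(M*K^2))" by (rule real_le_rsqrt[of "\<bar>_\<bar>", simplified])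
   also have "... = K * sqrt (dl*M)" using K0 by (simp add: real_sqrt_mult)
   finally have 1: "M*(zz n f s)^2 <= \<bar>Rr f (gs n f s)\<bar> + K * sqrt (dl*M)" by linarith
   have 2: "ennreal \<bar>Rr f (gs n f s)\<bar> <= (NN t. ?k s t)"
   proof -
    have "ennreal (norm (Rr f (gs n f s))) <= (NN t. ennreal (norm (?J t*rr n f (gs n f s) t)))"
     unfolding Rr_def by (rule integral_norm_bound_ennreal[OF Ri[OF f(1) g(1)]])
    also have "... <= (NN t. ?k s t)"
    proof (rule nn_integral_mono_AE)
     show "AE t in lborel. ennreal (norm (?J t*rr n f (gs n f s) t)) <= ?k s t"
      using AE_lborel_singleton[of s]
     proof eventually_elim
      case (elim t)
      then have "\<bar>rr n f (gs n f s) t\<bar> <= kap \<bar>t - s\<bar>*a s*a t*(zz n f s*zz n f t)" using gs_props(4)[OF f(1), where s=s and t=t and n=n] by blast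
      then show ?case using True t02 by (auto intro!: ennreal_leI simp: indicator_def abs_minus_commute mult_ac)
     qed
    qed
    finally show ?thesis by simp
   qed
   have "ennreal (M*(zz n f s)^2) <= ennreal (\<bar>Rr f (gs n f s)\<bar> + K * sqrt (dl*M))" by (rule ennreal_leI[OF 1])
   also have "... = ennreal \<bar>Rr f (gs n f s)\<bar> + ennreal (K * sqrt (dl*M))" using K0 M0 dl(1) by (intro ennreal_plus) auto
   also have "... <= (NN t. ?k s t) + ennreal (K * sqrt (dl*M))" by (rule add_right_mono[OF 2])
   finally show ?thesis using True by simp
  qed simp
  have Zn: "(NN s. ennreal (?J s*(zz n f s)^2)) = ennreal (Z f)"
   unfolding Z_def by (rule nn_integral_eq_integral[OF Zi[OF f(1)]]) simp
  have ln: "(NN s. ennreal (?J s*1)) = ennreal l"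
   unfolding l_def by (rule nn_integral_eq_integral) (auto intro!: Ji)
  have "ennreal (M*Z f) = (NN s. ennreal (M*(?J s*(zz n f s)^2)))"
  proof -
   have "(NN s. ennreal (M*(?J s*(zz n f s)^2))) = (NN s. ennreal M*ennreal (?J s*(zz n f s)^2))"
    using M0 by (intro nn_integral_cong ennreal_mult) auto
   also have "... = ennreal M*ennreal (Z f)" unfolding Zn[symmetric] by (rule nn_integral_cmult) measurable
   finally show ?thesis using M0 Z0[of f] by (simp add: ennreal_mult)
  qed
  also have "... <= (NN s. (NN t. ?k s t) + ennreal (K * sqrt (dl*M))*ennreal (?J s*1))"
   by (rule nn_integral_mono) (rule pt)
  also have "... = (NN s. NN t. ?k s t) + (NN s. ennreal (K * sqrt (dl*M))*ennreal (?J s*1))"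
   by (rule nn_integral_add) measurable
  also have "(NN s. ennreal (K * sqrt (dl*M))*ennreal (?J s*1)) = ennreal (K * sqrt (dl*M))*ennreal l"
   unfolding ln[symmetric] by (rule nn_integral_cmult) measurable
  finally have 1: "ennreal (M*Z f) <= (NN s. NN t. ?k s t) + ennreal (K * sqrt (dl*M))*ennreal l" .
  have "(NN s. NN t. ?k s t) <= ennreal eps*(NN t. ennreal ((?J t*zz n f t)^2))"
  proof (rule schur1)
   show "(\<lambda>s. indicator J s*a s) \<in> borelm" by measurable
   show "(\<lambda>t. ?J t*zz n f t) \<in> borelm" by measurable
  qed (auto intro: tail simp: kap_nonneg a_nonneg)
  also have "(NN t. ennreal ((?J t*zz n f t)^2)) = ennreal (Z f)"
   unfolding Zn[symmetric] by (intro nn_integral_cong) (auto simp: indicator_def)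
  finally have "ennreal (M*Z f) <= ennreal eps*ennreal (Z f) + ennreal (K * sqrt (dl*M))*ennreal l"
   using order_trans[OF 1 add_right_mono] by blast
  also have "ennreal eps*ennreal (Z f) + ennreal (K * sqrt (dl*M))*ennreal l = ennreal (eps*Z f + l*(K * sqrt (dl*M)))"
   using eps Z0[of f] K0 M0 dl(1) l0 by (simp add: ennreal_mult mult.commute)
  finally show ?thesis using eps Z0[of f] K0 M0 dl(1) l0 by (subst (asm) ennreal_le_iff) (auto intro!: add_nonneg_nonneg mult_nonneg_nonneg)
 qed
 \<comment> \<open>If M were larger than eps, letting the defect \<open>dl\<close> tend to 0 would
   give (M - eps) M <= 0.\<close>
 have "M <= eps"
 proof (rule ccontr)
  assume "\<not> M <= eps"
  then have Meps: "M > eps" by simp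
  then have Mp: "M > 0" using eps by linarith
  have ineq: "(M - eps)*(M - dl) <= l*(K * sqrt (dl*M))" if dl: "dl > 0" for dl
  proof -
   have "M - dl < Sup (Z ` {f \<in> L2. nrm f <= 1})" using dl by (simp add: M_def)
   then obtain f where f: "f \<in> L2" "nrm f <= 1" "M - dl < Z f" using less_cSup_iff[OF ne bdd] by auto
   have "(nrm f)^2 <= 1" using f(2) by (simp add: power_le_one)
   from mult_left_mono[OF this M0] have "P f <= dl" using f(3) by (simp add: P_def)
   from key[OF f(1,2) less_imp_le[OF dl] this] have "(M - eps)*Z f <= l*(K * sqrt (dl*M))" by (simp add: algebra_simps)
   moreover have "(M - eps)*(M - dl) <= (M - eps)*Z f" using Meps f(3) by (intro mult_left_mono) auto
   ultimately show ?thesis by linarith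
  qed
  have "(\<lambda>k. (M - eps)*(M - inverse (real (Suc k)))) ----> (M - eps)*(M - 0)" by (intro tendsto_intros LIMSEQ_inverse_real_of_nat)
  moreover have "(\<lambda>k. l*(K * sqrt (inverse (real (Suc k))*M))) ----> l*(K * sqrt (0*M))" by (intro tendsto_intros LIMSEQ_inverse_real_of_nat)
  ultimately have "(M - eps)*(M - 0) <= l*(K * sqrt (0*M))"
   by (rule LIMSEQ_le) (auto intro!: exI[of _ 0] ineq)
  moreover have "0 < (M - eps)*(M - 0)" by (rule mult_pos_pos) (use Meps Mp in auto)
  ultimately show False by simp
 qed
 then have "Z f0 <= eps*(nrm f0)^2" using order_trans[OF M2[OF f0] mult_right_mono[of M eps]] by simp
 moreover have "(NN t. indicator {t0..t2} t*Wn n t (S t f0)) = (NN t. ennreal (?J t*(zz n f0 t)^2))"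
  by (intro nn_integral_cong) (auto simp: indicator_def Wn_zz[OF f0])
 moreover have "... = ennreal (Z f0)" unfolding Z_def by (rule nn_integral_eq_integral[OF Zi[OF f0]]) simp
 ultimately show ?thesis by (simp add: ennreal_leI)
qed

lemma free_estimate:
 assumes f: "f \<in> L2" and J': "{t0..t2} \<subseteq> J"
 shows "(NN t. indicator {t0..t2} t*W t (S t f)) <= ennreal (eps*(nrm f)^2)"
proof -
 have m: "(\<lambda>t. Wn n t (S t f)) \<in> borelm" for n by (rule Wn_measurable[OF L2cont_S[OF f]])
 have "(NN t. indicator {t0..t2} t*W t (S t f)) = (NN t. (SUP n. indicator {t0..t2} t*Wn n t (S t f)))"
  by (intro nn_integral_cong) (simp add: W_SUP[OF S_L2[OF f]] SUP_mult_left_ennreal)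
 also have "... = (SUP n. NN t. indicator {t0..t2} t*Wn n t (S t f))"
 proof (rule nn_integral_monotone_convergence_SUP)
  show "incseq (\<lambda>n t. indicator {t0..t2} t*Wn n t (S t f))"
   by (intro incseq_SucI le_funI mult_left_mono Wn_mono) simp
 qed (use m in measurable)
 also have "... <= ennreal (eps*(nrm f)^2)" by (intro SUP_least free_estimate_n f J')
 finally show ?thesis .
qed

end

section \<open>Increments of the Duhamel profile\<close>

text \<open>\<open>d\<close> is the unknown and \<open>G\<close> its forcing, dominated by the
  potential times \<open>d\<close>; this covers both the solution and its time increments. The
  equation \<open>duh\<close> is available for H^2 test functions, and \<open>W_le\<close> makes the
  quantity that is to be absorbed finite on bounded intervals.\<close>

locale duhamel = smoothing_tail +
 fixes d G :: "real => 'a => complex" and Cg Y0 :: real and c :: complex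
 assumes d: "L2cont d"
  and G_meas [measurable]: "\<And>s. G s \<in> borelm"
  and G_le: "\<And>s x. cmod (G s x) <= Cg*(V s x*cmod (d s x))"
  and Cg: "0 <= Cg" and c: "cmod c <= 1"
  and G_int: "\<And>s phi. phi \<in> H2 ==> intg (\<lambda>x. G s x*phi x)"
  and W_le: "\<And>s. W s (d s) <= ennreal Y0"
  and duh: "\<And>phi tau1 tau2. phi \<in> H2 ==> tau1 <= tau2 ==>
   intg (\<lambda>s. indicat_real {tau1..tau2} s *\<^sub>R ip (G s) (S s phi)) \<and>
   ip (S (- tau2) (d tau2)) phi - ip (S (- tau1) (d tau1)) phi = c*(LBINT s. indicat_real {tau1..tau2} s *\<^sub>R ip (G s) (S s phi))"
begin

definition w :: "real => 'a => complex" where "w t = S (- t) (d t)"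
definition y :: "real => real" where "y t = sqrt (enn2real (W t (d t)))"
text \<open>\<open>G\<close> is the square root of the potential times \<open>gam\<close>. Where the
  potential vanishes so does \<open>G\<close>, and division by 0 gives 0.\<close>

definition gam :: "real => 'a => complex" where "gam s x = G s x/of_real (sqrt (V s x))"

lemma d_L2: "d t \<in> L2" by (rule L2cont_L2[OF d])
lemma w_L2: "w t \<in> L2" unfolding w_def by (rule S_L2[OF d_L2])

lemma y_nonneg [simp]: "0 <= y t" by (simp add: y_def)

lemma y_measurable [measurable]: "y \<in> borelm"
 unfolding y_def[abs_def] using W_measurable[OF d] by measurable

lemma y_sq: "ennreal ((y t)^2) = W t (d t)"
proof -
 have "W t (d t) < top" using W_le[of t] by (rule le_less_trans) simp
 then show ?thesis by (simp add: y_def)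
qed

lemma y_sq_le: "(y t)^2 <= max Y0 0"
proof -
 have "ennreal ((y t)^2) <= ennreal (max Y0 0)" unfolding y_sq using W_le[of t] by (rule order_trans) (simp add: ennreal_leI)
 then show ?thesis by (subst (asm) ennreal_le_iff) auto
qed

lemma gam_L2: "gam s \<in> L2" "nrm (gam s) <= Cg*y s"
proof -
 have m: "gam s \<in> borelm" unfolding gam_def[abs_def] by measurable
 have md: "d s \<in> borelm" by (rule L2_measurable[OF d_L2])
 have pt: "(cmod (gam s x))^2 <= Cg^2*(V s x*(cmod (d s x))^2)" for x
 proof (cases "V s x = 0")
  case True then show ?thesis by (simp add: gam_def)
 next
  case False
  then have V: "V s x > 0" using V_nonneg[of s x] by linarith
  have "(cmod (gam s x))^2 = (cmod (G s x))^2/V s x" using V by (simp add: gam_def norm_divide power_divide)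
  also have "... <= (Cg*(V s x*cmod (d s x)))^2/V s x" using V by (intro divide_right_mono power_mono G_le) auto
  also have "... = Cg^2*(V s x*(cmod (d s x))^2)" using V by (simp add: power_mult_distrib power2_eq_square)
  finally show ?thesis .
 qed
 have "(NN x. ennreal ((cmod (gam s x))^2)) <= (NN x. ennreal (Cg^2)*ennreal (V s x*(cmod (d s x))^2))"
  using pt by (intro nn_integral_mono) (simp add: ennreal_mult[symmetric] ennreal_leI)
 also have "... = ennreal (Cg^2)*W s (d s)" unfolding W_def using md by (intro nn_integral_cmult) measurable
 also have "... = ennreal ((Cg*y s)^2)" by (simp add: y_sq[symmetric] ennreal_mult[symmetric] power_mult_distrib)
 finally show "gam s \<in> L2" "nrm (gam s) <= Cg*y s" using L2I_nn[OF m] Cg by auto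
qed

lemma sV_gam: "of_real (sV m s x)*gam s x = G s x*indicator (trunc (rho s) m) x"
proof (cases "V s x = 0")
 case True
 then have "G s x = 0" using G_le[of s x] by simp
 then show ?thesis by (simp add: gam_def)
next
 case False then show ?thesis by (auto simp: gam_def sV_def indicator_def)
qed

lemma ip_G_tendsto:
 assumes phi: "phi \<in> H2"
 shows "(\<lambda>m. ip (\<lambda>x. of_real (sV m s x)*gam s x) phi) ----> ip (G s) phi"
 unfolding ip_def sV_gam
proof (rule integral_dominated_convergence)
 have i: "intg (\<lambda>x. G s x*cnj (phi x))" by (rule G_int[OF H2_cnj[OF phi]])
 then show "intg (\<lambda>x. norm (G s x*cnj (phi x)))" by (rule integrable_norm)
 show "(\<lambda>x. G s x*cnj (phi x)) \<in> borel_measurable lborel" using i by (rule borel_measurable_integrable)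
 have "phi \<in> borelm" by (rule L2_measurable[OF H2_L2[OF phi]])
 moreover have "trunc (rho s) m \<in> sets borel" for m unfolding trunc_def by measurable
 ultimately show "(\<lambda>x. G s x*indicator (trunc (rho s) m) x*cnj (phi x)) \<in> borel_measurable lborel" for m by measurable
 show "AE x in lborel. norm (G s x*indicator (trunc (rho s) m) x*cnj (phi x)) <= norm (G s x*cnj (phi x))" for m
  by (auto simp: indicator_def)
 have "(\<lambda>m. G s x*indicator (trunc (rho s) m) x*cnj (phi x)) ----> G s x*cnj (phi x)" for x
 proof (cases "V s x = 0")
  case True then have "G s x = 0" using G_le[of s x] by simp
  then show ?thesis by simp
 next
  case False
  then have "x \<noteq> 0" "rho s x > 0" using rho_nonneg[of s x] by (auto simp: V_def wV_def order_less_le)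
  then obtain n0 where "\<And>n. n \<ge> n0 ==> x \<in> trunc (rho s) n" using trunc_eventually[of x "rho s"] by blast
  then have "\<forall>\<^sub>F m in sequentially. G s x*indicator (trunc (rho s) m) x*cnj (phi x) = G s x*cnj (phi x)"
   by (auto simp: eventually_sequentially intro!: exI[of _ n0])
  then show ?thesis by (rule tendsto_eventually)
 qed
 then show "AE x in lborel. (\<lambda>m. G s x*indicator (trunc (rho s) m) x*cnj (phi x)) ----> G s x*cnj (phi x)" by simp
qed

text \<open>The potential is split into two square roots, one for \<open>gam\<close> and one for
  \<open>phi\<close>; Cauchy-Schwarz is applied on the truncations, where both products lie in
  L^2.\<close>

lemma ip_G_bound_W:
 assumes phi: "phi \<in> H2" and K: "W s phi <= ennreal (K^2)" "0 <= K"
 shows "cmod (ip (G s) phi) <= Cg*y s*K"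
proof (rule tendsto_upperbound[OF tendsto_norm[OF ip_G_tendsto[OF phi]]])
 show "\<forall>\<^sub>F m in sequentially. cmod (ip (\<lambda>x. of_real (sV m s x)*gam s x) phi) <= Cg*y s*K"
 proof (intro always_eventually allI)
  fix m
  have p: "phi \<in> L2" by (rule H2_L2[OF phi])
  have "ennreal ((nrm (\<lambda>x. of_real (sV m s x)*phi x))^2) <= ennreal (K^2)"
   unfolding Wn_eq[OF p, symmetric] using Wn_le_W K(1) by (rule order_trans)
  then have "(nrm (\<lambda>x. of_real (sV m s x)*phi x))^2 <= K^2" by simp
  then have "nrm (\<lambda>x. of_real (sV m s x)*phi x) <= K" using K(2) by (rule power2_le_imp_le)
  then have "nrm (gam s)*nrm (\<lambda>x. of_real (sV m s x)*phi x) <= Cg*y s*K"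
   using gam_L2(2) Cg by (intro mult_mono) auto
  then show "cmod (ip (\<lambda>x. of_real (sV m s x)*gam s x) phi) <= Cg*y s*K"
   unfolding ip_sV using ip_CS[OF gam_L2(1) sV_L2[OF p], of s m s] by (rule order_trans[rotated])
 qed
qed simp

text \<open>Mollification by the damping of \<open>sm\<close> at time 0. It makes any L^2 function
  admissible as a test function in \<open>duh\<close>.\<close>

definition reg :: "nat => 'a => complex" where "reg k = sm (inverse (real (Suc k))) 0"

lemma reg_bmeas: "bmeas (reg k)" "cmod (reg k xi) <= 1" "bmeas (\<lambda>xi. w2 xi*reg k xi)"
proof -
 let ?e = "inverse (real (Suc k))"
 show 1: "cmod (reg k xi) <= 1" for xi unfolding reg_def by (rule cmod_sm_le) simp
 then show "bmeas (reg k)" by (intro bmeasI[where B=1]) (auto simp: reg_def)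
 show "bmeas (\<lambda>xi. w2 xi*reg k xi)"
 proof (rule bmeasI)
  show "(\<lambda>xi. w2 xi*reg k xi) \<in> borelm" unfolding reg_def by measurable
  fix xi :: 'a
  define r where "r = norm xi"
  have e: "?e > 0" by simp
  have "0 <= (r^2 - 1/2)^2" by simp
  also have "(r^2 - 1/2)^2 = r ^ 4 - r\<^sup>2 + 1/4" by (simp add: power2_diff power_mult[symmetric] power2_eq_square[of "1/2 :: real"])
  finally have "1 + r^2 <= 2 + r ^ 4" by simp
  also have "... <= (2 + real (Suc k))*(1 + ?e*r ^ 4)" by (simp add: field_simps)
  also have "... <= (2 + real (Suc k))*exp (?e*r ^ 4)" by (intro mult_left_mono exp_ge_add_one_self) simp
  finally have "(1 + r^2)*exp (- ?e*r ^ 4) <= 2 + real (Suc k)" by (simp add: exp_minus field_simps)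
  then show "cmod (w2 xi*reg k xi) <= 2 + real (Suc k)" by (simp only: norm_mult cmod_w2 reg_def cmod_sm r_def)
 qed
qed

lemma reg_H2: "f \<in> L2 ==> fmul (reg k) f \<in> H2" by (rule H2_fmul_decay[OF reg_bmeas(1,3)])

lemma reg_L2: "f \<in> L2 ==> fmul (reg k) f \<in> L2" by (rule fmul_L2[OF reg_bmeas(1)])

lemma reg_nrm: "f \<in> L2 ==> nrm (fmul (reg k) f) <= nrm f"
 using nrm_fmul_le[of "reg k" 1 f] reg_bmeas(2) by (simp add: reg_def)

lemma reg_tendsto: assumes f: "f \<in> L2" shows "(\<lambda>k. nrm (\<lambda>x. fmul (reg k) f x - f x)) ----> 0"
proof -
 have "(\<lambda>k. nrm (\<lambda>x. fmul (reg k) f x - fmul (\<lambda>xi. 1) f x)) ----> 0"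
 proof (rule fmul_tendsto[where B=1])
  show "(\<lambda>k. reg k xi) ----> 1" for xi
  proof -
   have "(\<lambda>k. exp (- (of_real (inverse (real (Suc k))) - \<i> * of_real 0) * of_real (norm xi ^ 4))) ----> exp (- (of_real 0 - \<i> * of_real 0) * of_real (norm xi ^ 4))"
    by (intro tendsto_intros LIMSEQ_inverse_real_of_nat)
   then show ?thesis by (simp add: sm_def reg_def)
  qed
 qed (auto simp: f reg_bmeas(2) reg_def cmod_sm_le)
 moreover have "nrm (\<lambda>x. fmul (reg k) f x - fmul (\<lambda>xi. 1) f x) = nrm (\<lambda>x. fmul (reg k) f x - f x)" for k
 proof (rule nrm_cong_AE)
  show "AE x in lborel. fmul (reg k) f x - fmul (\<lambda>xi. 1) f x = fmul (reg k) f x - f x" using fmul_one[OF f] by eventually_elim simp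
  have "bmeas (\<lambda>xi::'a. 1)" by (rule bmeasI[where B=1]) auto
  then show "(\<lambda>x. fmul (reg k) f x - fmul (\<lambda>xi. 1) f x) \<in> borelm" "(\<lambda>x. fmul (reg k) f x - f x) \<in> borelm"
   by (intro L2_measurable L2_diff reg_L2 fmul_L2 f; assumption)+
 qed
 ultimately show ?thesis by simp
qed

lemma S_H2: "f \<in> H2 ==> S t f \<in> H2" unfolding S_def by (rule H2_propagator)

text \<open>The transport from t to s and the mollification combine to the symbol \<open>sm\<close>
  at time sg (s - t). This is the reason for stating the kernel estimate with damping.\<close>

lemma ip_G_bound_kernel:
 assumes h: "h \<in> L2" and st: "s \<noteq> t"
 shows "cmod (ip (G s) (S s (S (- t) (fmul (reg k) (\<lambda>x. of_real (sV n t x)*h x))))) <= Cg*a t*(kap \<bar>t - s\<bar>*a s*y s)*nrm h"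
proof -
 let ?x = "\<lambda>x. of_real (sV n t x)*h x"
 note xL = sV_L2[OF h, of n t]
 let ?phi = "S s (S (- t) (fmul (reg k) ?x))"
 have phi: "?phi \<in> H2" by (intro S_H2 reg_H2 xL)
 have eq: "?phi = fmul (sm (inverse (real (Suc k))) (sg*(s - t))) ?x"
 proof -
  have "?phi = propagator (sg*(s - t)) (fmul (reg k) ?x)" using S_S[OF reg_L2[OF xL], of s "- t"] by (simp add: S_def)
  also have "... = fmul (\<lambda>xi. cis (sg*(s - t)*norm xi ^ 4)*reg k xi) ?x"
   unfolding propagator_eq by (rule fmul_fmul[OF bmeas_prop reg_bmeas(1) xL])
  also have "(\<lambda>xi. cis (sg*(s - t)*norm xi ^ 4)*reg k xi) = sm (inverse (real (Suc k))) (sg*(s - t))"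
   by (rule ext) (simp add: reg_def sm_def cis_conv_exp exp_add[symmetric] algebra_simps)
  finally show ?thesis .
 qed
 show ?thesis
 proof (rule tendsto_upperbound[OF tendsto_norm[OF ip_G_tendsto[OF phi]]])
  show "\<forall>\<^sub>F m in sequentially. cmod (ip (\<lambda>x. of_real (sV m s x)*gam s x) ?phi) <= Cg*a t*(kap \<bar>t - s\<bar>*a s*y s)*nrm h"
  proof (intro always_eventually allI)
   fix m
   have "cmod (ip (\<lambda>x. of_real (sV m s x)*gam s x) ?phi) = cmod (ip ?phi (\<lambda>x. of_real (sV m s x)*gam s x))"
    by (subst ip_cnj) simp
   also have "... <= kap \<bar>sg*(s - t)\<bar>*a t*a s*(nrm h*nrm (gam s))"
    unfolding eq by (rule kernel[OF _ _ h gam_L2(1)]) (use st sg in auto)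
   also have "... <= kap \<bar>sg*(s - t)\<bar>*a t*a s*(nrm h*(Cg*y s))"
    by (rule mult_left_mono[OF mult_left_mono[OF gam_L2(2)]]) (auto simp: kap_nonneg a_nonneg)
   also have "... = Cg*a t*(kap \<bar>t - s\<bar>*a s*y s)*nrm h" using sg by (simp add: abs_mult abs_minus_commute mult_ac)
   finally show "cmod (ip (\<lambda>x. of_real (sV m s x)*gam s x) ?phi) <= Cg*a t*(kap \<bar>t - s\<bar>*a s*y s)*nrm h" .
  qed
 qed simp
qed

section \<open>Bounds on the increment of the profile\<close>

definition dlw :: "real => real => 'a => complex" where "dlw tau1 tau2 x = w tau2 x - w tau1 x"

lemma dlw_L2: "dlw tau1 tau2 \<in> L2" unfolding dlw_def[abs_def] by (intro L2_diff w_L2)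

lemma ip_dlw:
 assumes phi: "phi \<in> H2" and tau: "tau1 <= tau2"
 shows "ennreal (cmod (ip (dlw tau1 tau2) phi)) <= (NN s. indicator {tau1..tau2} s*ennreal (cmod (ip (G s) (S s phi))))"
proof -
 note D = duh[OF phi tau]
 let ?I = "LBINT s. indicat_real {tau1..tau2} s *\<^sub>R ip (G s) (S s phi)"
 have "cmod (ip (dlw tau1 tau2) phi) = cmod (c*?I)"
  unfolding dlw_def[abs_def] using D ip_diff_left[OF w_L2 w_L2 H2_L2[OF phi], of tau2 tau1] by (simp add: w_def)
 also have "... <= 1*cmod ?I" unfolding norm_mult by (rule mult_right_mono[OF c]) simp
 finally have "ennreal (cmod (ip (dlw tau1 tau2) phi)) <= ennreal (cmod ?I)" by (simp add: ennreal_leI)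
 also have "... <= (NN s. ennreal (norm (indicat_real {tau1..tau2} s *\<^sub>R ip (G s) (S s phi))))"
  by (rule integral_norm_bound_ennreal) (use D in blast)
 also have "... = (NN s. indicator {tau1..tau2} s*ennreal (cmod (ip (G s) (S s phi))))"
  by (intro nn_integral_cong) (auto simp: indicator_def)
 finally show ?thesis .
qed

text \<open>Duality at fixed t. With h the truncated root of the potential times the evolved
  increment, the equation is tested with the mollification of the same root times h, transported
  back to time 0. In the limit this yields |h|^2 <= X |h|, and the supremum over n gives the
  bound.\<close>

lemma claimA:
 assumes tau: "tau1 <= tau2"
 shows "W t (S t (dlw tau1 tau2)) <= (ennreal (Cg*a t)*(NN s. ennreal (kap \<bar>t - s\<bar>*a s*(indicator {tau1..tau2} s*y s))))^2"
  (is "_ <= ?X^2")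
 unfolding W_SUP[OF S_L2[OF dlw_L2]]
proof (rule SUP_least)
 fix n
 let ?D = "dlw tau1 tau2"
 define h where "h = (\<lambda>x. of_real (sV n t x)*S t ?D x)"
 have h: "h \<in> L2" unfolding h_def by (rule sV_L2[OF S_L2[OF dlw_L2]])
 let ?x = "\<lambda>x. of_real (sV n t x)*h x"
 note xL = sV_L2[OF h, of n t]
 let ?I = "NN s. ennreal (kap \<bar>t - s\<bar>*a s*(indicator {tau1..tau2} s*y s))"
 let ?phi = "\<lambda>k. S (- t) (fmul (reg k) ?x)"
 have Ca: "0 <= Cg*a t" using Cg a_nonneg by simp
 have bd: "ennreal (cmod (ip ?D (?phi k))) <= ?X*ennreal (nrm h)" for k
 proof -
  have "?phi k \<in> H2" by (intro S_H2 reg_H2 xL)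
  from ip_dlw[OF this tau]
  have "ennreal (cmod (ip ?D (?phi k))) <= (NN s. indicator {tau1..tau2} s*ennreal (cmod (ip (G s) (S s (?phi k)))))" .
  also have "... <= (NN s. ennreal (Cg*a t*nrm h)*ennreal (kap \<bar>t - s\<bar>*a s*(indicator {tau1..tau2} s*y s)))"
  proof (rule nn_integral_mono_AE)
   show "AE s in lborel. indicator {tau1..tau2} s*ennreal (cmod (ip (G s) (S s (?phi k)))) <= ennreal (Cg*a t*nrm h)*ennreal (kap \<bar>t - s\<bar>*a s*(indicator {tau1..tau2} s*y s))"
    using AE_lborel_singleton[of t]
   proof eventually_elim
    case (elim s)
    have "ennreal (cmod (ip (G s) (S s (?phi k)))) <= ennreal (Cg*a t*(kap \<bar>t - s\<bar>*a s*y s)*nrm h)"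
     by (rule ennreal_leI[OF ip_G_bound_kernel[OF h elim]])
    also have "... = ennreal (Cg*a t*nrm h)*ennreal (kap \<bar>t - s\<bar>*a s*y s)"
     using Ca by (subst ennreal_mult[symmetric]) (auto intro!: mult_nonneg_nonneg arg_cong[where f=ennreal] simp: mult_ac kap_nonneg a_nonneg Cg)
    finally show ?case by (auto simp: indicator_def)
   qed
  qed
  also have "... = ennreal (Cg*a t*nrm h)*?I" by (rule nn_integral_cmult) measurable
  also have "... = ?X*ennreal (nrm h)" unfolding ennreal_mult[OF Ca nrm_nonneg] by (simp only: mult_ac)
  finally show ?thesis .
 qed
 have "(\<lambda>k. ip (S t ?D) (fmul (reg k) ?x)) ----> ip (S t ?D) ?x"
  using reg_tendsto[OF xL] by (intro ip_tendsto S_L2 dlw_L2 reg_L2 xL) (simp_all add: nrm_minus_commute[of ?x])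
 moreover have "ip (S t ?D) (fmul (reg k) ?x) = ip ?D (?phi k)" for k by (rule ip_S[OF dlw_L2 reg_L2[OF xL]])
 moreover have "ip (S t ?D) ?x = of_real ((nrm h)^2)" unfolding ip_sV[symmetric] h_def[symmetric] by (rule ip_self)
 ultimately have "(\<lambda>k. ip ?D (?phi k)) ----> of_real ((nrm h)^2)" by simp
 then have "(\<lambda>k. ennreal (cmod (ip ?D (?phi k)))) ----> ennreal (cmod (of_real ((nrm h)^2)))" by (intro tendsto_ennrealI tendsto_norm)
 then have "ennreal (cmod (of_real ((nrm h)^2))) <= ?X*ennreal (nrm h)"
  by (rule tendsto_upperbound) (auto intro!: always_eventually bd)
 then have "ennreal (nrm h)*ennreal (nrm h) <= ?X*ennreal (nrm h)" by (simp add: ennreal_mult[symmetric] power2_eq_square norm_mult)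
 then have "ennreal (nrm h) <= ?X" by (rule ennreal_mult_self_le)
 then have "(ennreal (nrm h))^2 <= ?X^2" by (rule power_mono) simp
 then show "Wn n t (S t ?D) <= ?X^2" unfolding Wn_eq[OF S_L2[OF dlw_L2]] h_def[symmetric] by (simp add: ennreal_power)
qed

text \<open>Square of the space-time L^2 norm of the root of the potential times \<open>d\<close> on
  the interval.\<close>

definition Y2 :: "real => real => real" where "Y2 tau1 tau2 = (LBINT s. indicator {tau1..tau2} s*(y s)^2)"

lemma y_int: "intg (\<lambda>s. indicator {tau1..tau2} s*(y s)^2)"
 by (rule integrable_interval_bounded[where B="max Y0 0"]) (use y_sq_le in auto)

lemma Y2_nonneg: "0 <= Y2 tau1 tau2" unfolding Y2_def by (intro Bochner_Integration.integral_nonneg) auto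

lemma Y2_nn: "(NN s. indicator {tau1..tau2} s*W s (d s)) = ennreal (Y2 tau1 tau2)"
proof -
 have "(NN s. indicator {tau1..tau2} s*W s (d s)) = (NN s. ennreal (indicator {tau1..tau2} s*(y s)^2))"
  by (intro nn_integral_cong) (auto simp: indicator_def y_sq)
 also have "... = ennreal (Y2 tau1 tau2)" unfolding Y2_def by (rule nn_integral_eq_integral[OF y_int]) auto
 finally show ?thesis .
qed

lemma Y2_le: assumes "tau1 <= tau2" shows "Y2 tau1 tau2 <= (tau2 - tau1)*max Y0 0"
proof -
 have "Y2 tau1 tau2 <= (LBINT s. indicat_real {tau1..tau2} s*max Y0 0)" unfolding Y2_def
 proof (rule Bochner_Integration.integral_mono[OF y_int])
  show "intg (\<lambda>s. indicat_real {tau1..tau2} s*max Y0 0)"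
   by (intro integrable_mult_left integrable_real_indicator) (auto simp: emeasure_lborel_Icc_eq)
 qed (use y_sq_le in "auto simp: indicator_def")
 then show ?thesis using assms by simp
qed

text \<open>The dual of the free estimate: testing the equation with the mollified increment D and
  applying Cauchy-Schwarz in time bounds |D|^2 by Cg sqrt (eps Y2) |D|.\<close>

lemma claimB:
 assumes tau: "tau1 <= tau2" and J': "{tau1..tau2} \<subseteq> J"
 shows "(nrm (dlw tau1 tau2))^2 <= Cg^2*eps*Y2 tau1 tau2"
proof -
 let ?D = "dlw tau1 tau2" and ?Q = "Cg*(sqrt eps * sqrt (Y2 tau1 tau2))"
 have Q0: "0 <= ?Q" using Cg eps Y2_nonneg by simp
 have bd: "cmod (ip ?D (fmul (reg k) ?D)) <= ?Q*nrm ?D" for k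
 proof -
  let ?phi = "fmul (reg k) ?D"
  have phi: "?phi \<in> H2" by (rule reg_H2[OF dlw_L2])
  have phiL: "?phi \<in> L2" by (rule reg_L2[OF dlw_L2])
  \<comment> \<open>The weighted norm of the free evolution may be infinite on a null set of times,
    where \<open>enn2real\<close> returns 0; hence its square is identified only almost
    everywhere.\<close>
  define p where "p s = sqrt (enn2real (indicator {tau1..tau2} s*W s (S s ?phi)))" for s
  have Wm [measurable]: "(\<lambda>s. W s (S s ?phi)) \<in> borelm" by (rule W_measurable[OF L2cont_S[OF phiL]])
  have pm [measurable]: "p \<in> borelm" unfolding p_def[abs_def] by measurable
  have fe: "(NN s. indicator {tau1..tau2} s*W s (S s ?phi)) <= ennreal (eps*(nrm ?D)^2)"
  proof -
   have "(nrm ?phi)^2 <= (nrm ?D)^2" by (intro power_mono reg_nrm dlw_L2) simp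
   from mult_left_mono[OF this eps] show ?thesis by (rule order_trans[OF free_estimate[OF phiL J'] ennreal_leI])
  qed
  then have fin: "AE s in lborel. indicator {tau1..tau2} s*W s (S s ?phi) \<noteq> \<infinity>"
   by (intro nn_integral_PInf_AE) (auto simp: top_unique)
  then have p_sq: "AE s in lborel. ennreal ((p s)^2) = indicator {tau1..tau2} s*W s (S s ?phi)"
   by eventually_elim (simp add: p_def less_top)
  have p_int: "(NN s. ennreal ((p s)^2)) <= ennreal (eps*(nrm ?D)^2)"
   using fe nn_integral_cong_AE[OF p_sq] by simp
  have "ennreal (cmod (ip ?D ?phi)) <= (NN s. indicator {tau1..tau2} s*ennreal (cmod (ip (G s) (S s ?phi))))"
   by (rule ip_dlw[OF phi tau])
  also have "... <= (NN s. ennreal Cg*(ennreal (indicator {tau1..tau2} s*y s)*ennreal (p s)))"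
  proof (rule nn_integral_mono_AE)
   show "AE s in lborel. indicator {tau1..tau2} s*ennreal (cmod (ip (G s) (S s ?phi))) <= ennreal Cg*(ennreal (indicator {tau1..tau2} s*y s)*ennreal (p s))"
    using p_sq
   proof eventually_elim
    case (elim s)
    show ?case
    proof (cases "s \<in> {tau1..tau2}")
     case True
     have p0: "0 <= p s" by (simp add: p_def)
     have "W s (S s ?phi) <= ennreal ((p s)^2)" using elim True by simp
     from ip_G_bound_W[OF S_H2[OF phi] this p0] have "cmod (ip (G s) (S s ?phi)) <= Cg*(y s*p s)" by (simp add: mult.assoc)
     then have "ennreal (cmod (ip (G s) (S s ?phi))) <= ennreal (Cg*(y s*p s))" by (rule ennreal_leI)
     also have "... = ennreal Cg*(ennreal (y s)*ennreal (p s))" using Cg p0 by (simp add: ennreal_mult)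
     finally show ?thesis using True by simp
    qed simp
   qed
  qed
  also have "... = ennreal Cg*(NN s. ennreal (indicator {tau1..tau2} s*y s)*ennreal (p s))"
   by (rule nn_integral_cmult) measurable
  finally have 1: "ennreal (cmod (ip ?D ?phi)) <= ennreal Cg*(NN s. ennreal (indicator {tau1..tau2} s*y s)*ennreal (p s))" .
  have "(NN s. ennreal (indicator {tau1..tau2} s*y s)*ennreal (p s))^2 \<le>
   (NN s. (ennreal (indicator {tau1..tau2} s*y s))^2)*(NN s. (ennreal (p s))^2)"
   by (rule Cauchy_Schwarz_nn_integral) measurable
  also have "(NN s. (ennreal (indicator {tau1..tau2} s*y s))^2) = ennreal (Y2 tau1 tau2)"
   unfolding Y2_nn[symmetric] by (intro nn_integral_cong) (auto simp: indicator_def y_sq[symmetric] ennreal_power)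
  also have "(NN s. (ennreal (p s))^2) = (NN s. ennreal ((p s)^2))"
   by (intro nn_integral_cong) (simp add: ennreal_power p_def)
  also have "ennreal (Y2 tau1 tau2)*(NN s. ennreal ((p s)^2)) <= ennreal (Y2 tau1 tau2)*ennreal (eps*(nrm ?D)^2)"
   by (intro mult_left_mono p_int) simp
  finally have 2: "(NN s. ennreal (indicator {tau1..tau2} s*y s)*ennreal (p s))^2 <= ennreal (Y2 tau1 tau2*(eps*(nrm ?D)^2))"
   using Y2_nonneg eps by (simp add: ennreal_mult)
  have "(ennreal (cmod (ip ?D ?phi)))^2 <= (ennreal Cg)^2*ennreal (Y2 tau1 tau2*(eps*(nrm ?D)^2))"
   using power_mono[OF 1, of 2] mult_left_mono[OF 2, of "(ennreal Cg)^2"] unfolding power_mult_distrib by (meson order_trans zero_le)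
  also have "... = ennreal ((?Q*nrm ?D)^2)"
   using Cg eps Y2_nonneg by (simp add: ennreal_power ennreal_mult[symmetric] power_mult_distrib mult_ac)
  finally have "(cmod (ip ?D ?phi))^2 <= (?Q*nrm ?D)^2" by (simp add: ennreal_power)
  then show ?thesis using mult_nonneg_nonneg[OF Q0 nrm_nonneg] by (rule power2_le_imp_le)
 qed
 have "(\<lambda>k. ip ?D (fmul (reg k) ?D)) ----> ip ?D ?D"
  using reg_tendsto[OF dlw_L2] by (intro ip_tendsto dlw_L2 reg_L2) (simp_all add: nrm_minus_commute[of ?D])
 from tendsto_norm[OF this] have "cmod (ip ?D ?D) <= ?Q*nrm ?D"
  by (rule tendsto_upperbound) (auto intro!: always_eventually bd)
 then have "nrm ?D <= ?Q" by (rule nrm_le_dual[OF dlw_L2 Q0])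
 then have "(nrm ?D)^2 <= ?Q^2" by (rule power_mono) simp
 then show ?thesis using eps Y2_nonneg by (simp add: power_mult_distrib mult_ac)
qed

text \<open>On the interval, d is the free evolution of w(t1) plus that of the increment. In Y2 the
  free estimate bounds the first part, and \<open>claimA\<close> with the Schur test bounds the
  second by Y2/2. Absorbing the latter leaves Y2 <= 4 eps |w(t1)|^2, and \<open>claimB\<close>
  concludes.\<close>

lemma claimC:
 assumes small: "Cg*eps <= 1/2" and tau: "t1 <= t2" and J': "{t1..t2} \<subseteq> J"
 shows "nrm (dlw t1 t2) <= 2*Cg*eps*nrm (w t1)"
proof -
 have Sm [measurable]: "(\<lambda>t. W t (S t (w t1))) \<in> borelm" by (rule W_measurable[OF L2cont_S[OF w_L2]])
 let ?X = "\<lambda>t. ennreal (Cg*a t)*(NN s. ennreal (kap \<bar>t - s\<bar>*a s*(indicator {t1..t2} s*y s)))"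
 have pt: "W t (d t) <= 2*W t (S t (w t1)) + 2*(?X t)^2" if t: "t \<in> {t1..t2}" for t
 proof -
  have AE: "AE x in lborel. d t x = S t (w t1) x + S t (dlw t1 t) x"
  proof -
   have "S t (w t) = propagator 0 (d t)" unfolding w_def using S_S[OF d_L2, of t "- t" t] by (simp add: S_def)
   then have "AE x in lborel. S t (w t) x = d t x" using propagator_0[OF d_L2] by simp
   moreover have "AE x in lborel. S t (dlw t1 t) x = S t (w t) x - S t (w t1) x"
    unfolding S_def dlw_def[abs_def] by (rule propagator_diff[OF w_L2 w_L2])
   ultimately show ?thesis by eventually_elim simp
  qed
  have m: "S t (w t1) \<in> borelm" "S t (dlw t1 t) \<in> borelm"
   by (intro L2_measurable S_L2 w_L2 dlw_L2)+
  have "W t (d t) <= (NN x. 2*ennreal (V t x*(cmod (S t (w t1) x))^2) + 2*ennreal (V t x*(cmod (S t (dlw t1 t) x))^2))"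
   unfolding W_def
  proof (rule nn_integral_mono_AE)
   show "AE x in lborel. ennreal (V t x*(cmod (d t x))^2) <= 2*ennreal (V t x*(cmod (S t (w t1) x))^2) + 2*ennreal (V t x*(cmod (S t (dlw t1 t) x))^2)"
    using AE
   proof eventually_elim
    case (elim x)
    let ?A = "cmod (S t (w t1) x)" and ?B = "cmod (S t (dlw t1 t) x)"
    have "(cmod (d t x))^2 <= (?A + ?B)^2" unfolding elim by (intro power_mono norm_triangle_ineq) simp
    also have "... <= 2*?A^2 + 2*?B^2" using sum_squares_bound[of ?A ?B] by (simp add: power2_sum)
    finally have "V t x*(cmod (d t x))^2 <= V t x*(2*?A^2 + 2*?B^2)" by (intro mult_left_mono) auto
    then have "ennreal (V t x*(cmod (d t x))^2) <= ennreal (2*(V t x*?A^2) + 2*(V t x*?B^2))" by (intro ennreal_leI) (simp add: algebra_simps)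
    also have "... = 2*ennreal (V t x*?A^2) + 2*ennreal (V t x*?B^2)" by (simp add: ennreal_plus ennreal_mult)
    finally show ?case .
   qed
  qed
  also have "... = 2*W t (S t (w t1)) + 2*W t (S t (dlw t1 t))"
   unfolding W_def using m by (simp add: nn_integral_add nn_integral_cmult)
  also have "... <= 2*W t (S t (w t1)) + 2*(?X t)^2"
  proof -
   have "W t (S t (dlw t1 t)) <= (ennreal (Cg*a t)*(NN s. ennreal (kap \<bar>t - s\<bar>*a s*(indicator {t1..t} s*y s))))^2"
    by (rule claimA) (use t in auto)
   also have "... <= (?X t)^2"
   proof (rule power_mono[OF mult_left_mono[OF nn_integral_mono[OF ennreal_leI]]], goal_cases)
    case (1 s) show ?case
     by (rule mult_left_mono[OF mult_right_mono]) (use t in "auto simp: indicator_def kap_nonneg a_nonneg")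
   qed auto
   finally show ?thesis by (intro add_left_mono mult_left_mono) auto
  qed
  finally show ?thesis .
 qed
 let ?J = "indicator J :: real => real"
 let ?X' = "\<lambda>t. ennreal (?J t*a t)*(NN s. ennreal (kap \<bar>t - s\<bar>*(?J s*a s)*(indicator {t1..t2} s*y s)))"
 have XX: "?X t = ennreal Cg*?X' t" if t: "t \<in> {t1..t2}" for t
 proof -
  have "t \<in> J" using t J' by auto
  moreover have "ennreal (kap \<bar>t - s\<bar>*(?J s*a s)*(indicator {t1..t2} s*y s)) = ennreal (kap \<bar>t - s\<bar>*a s*(indicator {t1..t2} s*y s))" for s
   using J' by (auto simp: indicator_def)
  ultimately show ?thesis using Cg a_nonneg by (simp add: ennreal_mult mult.assoc)
 qed
 have X'm [measurable]: "?X' \<in> borelm" by measurable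
 have sch: "(NN t. (?X' t)^2) <= (ennreal eps)^2*ennreal (Y2 t1 t2)"
 proof -
  have "(NN t. (?X' t)^2) <= (ennreal eps)^2*(NN t. ennreal ((indicator {t1..t2} t*y t)^2))"
  proof (rule schur2)
   show "(\<lambda>s. ?J s*a s) \<in> borelm" "(\<lambda>s. indicator {t1..t2} s*y s) \<in> borelm" by measurable
  qed (auto intro: tail simp: kap_nonneg a_nonneg)
  also have "(NN t. ennreal ((indicator {t1..t2} t*y t)^2)) = ennreal (Y2 t1 t2)"
   unfolding Y2_nn[symmetric] by (intro nn_integral_cong) (auto simp: indicator_def y_sq[symmetric])
  finally show ?thesis .
 qed
 have "ennreal (Y2 t1 t2) <= (NN t. 2*(indicator {t1..t2} t*W t (S t (w t1))) + ennreal (2*Cg^2)*(?X' t)^2)"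
  unfolding Y2_nn[symmetric]
 proof (rule nn_integral_mono, goal_cases)
  case (1 t)
  show ?case
  proof (cases "t \<in> {t1..t2}")
   case True
   have "2*(ennreal Cg*?X' t)^2 = ennreal (2*Cg^2)*(?X' t)^2"
    using Cg by (simp only: power_mult_distrib ennreal_power) (simp add: ennreal_mult mult.assoc)
   then show ?thesis using pt[OF True, unfolded XX[OF True] distrib_left] True by simp
  qed simp
 qed
 also have "... = 2*(NN t. indicator {t1..t2} t*W t (S t (w t1))) + ennreal (2*Cg^2)*(NN t. (?X' t)^2)"
 proof -
  have "(NN t. 2*(indicator {t1..t2} t*W t (S t (w t1))) + ennreal (2*Cg^2)*(?X' t)^2) = (NN t. 2*(indicator {t1..t2} t*W t (S t (w t1)))) + (NN t. ennreal (2*Cg^2)*(?X' t)^2)"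
   by (rule nn_integral_add) measurable
  moreover have "(NN t. 2*(indicator {t1..t2} t*W t (S t (w t1)))) = 2*(NN t. indicator {t1..t2} t*W t (S t (w t1)))"
   by (rule nn_integral_cmult) measurable
  moreover have "(NN t. ennreal (2*Cg^2)*(?X' t)^2) = ennreal (2*Cg^2)*(NN t. (?X' t)^2)"
   by (rule nn_integral_cmult) measurable
  ultimately show ?thesis by simp
 qed
 also have "... <= 2*ennreal (eps*(nrm (w t1))^2) + ennreal (2*Cg^2)*((ennreal eps)^2*ennreal (Y2 t1 t2))"
  by (rule add_mono[OF mult_left_mono[OF free_estimate[OF w_L2 J']] mult_left_mono[OF sch]]) auto
 also have "... = ennreal (2*(eps*(nrm (w t1))^2) + 2*Cg^2*(eps^2*Y2 t1 t2))"
  using eps Y2_nonneg by (simp add: ennreal_mult ennreal_plus ennreal_power)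
 finally have "Y2 t1 t2 <= 2*(eps*(nrm (w t1))^2) + 2*Cg^2*(eps^2*Y2 t1 t2)"
  using eps Y2_nonneg by (subst (asm) ennreal_le_iff) auto
 \<comment> \<open>The smallness \<open>Cg*eps <= 1/2\<close> makes this term at most half of the
   finite number \<open>Y2\<close>, which can then be moved to the left.\<close>
 moreover have "2*Cg^2*(eps^2*Y2 t1 t2) <= 1/2*Y2 t1 t2"
 proof -
  have "(Cg*eps)^2 <= (1/2)^2" using small Cg eps by (intro power_mono) auto
  then have "2*(Cg*eps)^2 <= 1/2" by (simp add: power2_eq_square)
  from mult_right_mono[OF this Y2_nonneg[of t1 t2]] show ?thesis by (simp add: power_mult_distrib mult_ac)
 qed
 ultimately have Yb: "Y2 t1 t2 <= 4*(eps*(nrm (w t1))^2)" by linarith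
 have "(nrm (dlw t1 t2))^2 <= Cg^2*eps*Y2 t1 t2" by (rule claimB[OF tau J'])
 also have "... <= Cg^2*eps*(4*(eps*(nrm (w t1))^2))" by (rule mult_left_mono[OF Yb]) (use eps in auto)
 also have "... = (2*Cg*eps*nrm (w t1))^2" by (simp add: power2_eq_square)
 finally show ?thesis by (rule power2_le_imp_le) (use Cg eps in auto)
qed

end

section \<open>Upgrade to second-order Sobolev spaces\<close>

definition hw :: "real => real" where "hw h = indicator {0<..} h*h powr (- 2)"

lemma hw_nonneg [simp]: "0 <= hw h" by (simp add: hw_def)
lemma hw_eq: "0 < h ==> hw h = 1/h^2" by (simp add: hw_def powr_minus powr_numeral divide_inverse)
lemma hw_measurable [measurable]: "hw \<in> borelm" unfolding hw_def[abs_def] by measurable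

lemma cmod_cis_minus_one_sq: "(cmod (cis x - 1))^2 = 2 - 2*cos x"
proof -
 have "(cmod (cis x - 1))^2 = (cos x - 1)^2 + (sin x)^2" by (simp add: cmod_power2)
 also have "... = 2 - 2*cos x" using sin_cos_squared_add[of x] by (simp add: power2_diff)
 finally show ?thesis .
qed

text \<open>The exact value is pi; bounds from both sides suffice below.\<close>

definition hC :: ennreal where "hC = (NN h. ennreal (hw h*(2 - 2*cos h)))"

text \<open>On [pi/2, pi], an interval of length pi/2, the factor 2 - 2 cos h is at least 2 and h^-2
  is at least pi^-2.\<close>

lemma hC_ge: "ennreal (1/pi) <= hC"
proof -
 have "ennreal (1/pi) = (NN h. ennreal (2/pi^2)*indicator {pi/2..pi} h)"
  by (simp add: nn_integral_cmult ennreal_mult[symmetric] power2_eq_square)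
 also have "... <= hC" unfolding hC_def
 proof (rule nn_integral_mono, goal_cases)
  case (1 h)
  show ?case
  proof (cases "h \<in> {pi/2..pi}")
   case True
   then have h: "pi/2 <= h" "h <= pi" by auto
   have h0: "0 < h" using h(1) pi_gt_zero by linarith
   have "cos h <= cos (pi/2)" using h by (intro cos_monotone_0_pi_le) auto
   then have c: "2 <= 2 - 2*cos h" by simp
   have "h^2 <= pi^2" using h0 h by (intro power_mono) auto
   then have "1/pi^2 <= hw h" unfolding hw_eq[OF h0] using h0 by (intro divide_left_mono) auto
   from mult_mono[OF this c] have "2/pi^2 <= hw h*(2 - 2*cos h)" by simp
   then show ?thesis using True by (simp add: ennreal_leI)
  qed simp
 qed
 finally show ?thesis .
qed

text \<open>The integrand is at most 1 for h <= 1 and at most 4 h^-2 beyond, whence 1 + 4.\<close>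

lemma hC_le: "hC <= ennreal 5"
proof -
 have "hC <= (NN h. ennreal (indicator {0..1} h) + ennreal 4*ennreal (indicator {1..} h*h powr (- 2)))"
  unfolding hC_def
 proof (rule nn_integral_mono, goal_cases)
  case (1 h)
  have 1: "2 - 2*cos h <= h^2"
  proof -
   have "2 - 2*cos h = 4*(sin (h/2))^2" using cos_double_sin[of "h/2"] by simp
   also have "... <= 4*(h/2)^2" using abs_sin_x_le_abs_x[of "h/2"] by (simp add: abs_le_square_iff[symmetric])
   finally show ?thesis by (simp add: power_divide)
  qed
  have 2: "2 - 2*cos h <= 4" using cos_ge_minus_one[of h] by linarith
  have 3: "0 <= 2 - 2*cos h" by simp
  show ?case
  proof (cases "h > 0")
   case True
   show ?thesis
   proof (cases "h <= 1")
    case h1: True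
    have "hw h*(2 - 2*cos h) <= h powr (- 2)*h^2" unfolding hw_def using 1 True by (intro mult_mono) auto
    also have "... = 1" using True by (simp add: powr_minus powr_numeral)
    finally have "ennreal (hw h*(2 - 2*cos h)) <= ennreal 1" by (rule ennreal_leI)
    then show ?thesis using True h1 by (intro add_increasing2) auto
   next
    case False
    have "hw h*(2 - 2*cos h) <= hw h*4" using 2 by (intro mult_left_mono) auto
    then have "ennreal (hw h*(2 - 2*cos h)) <= ennreal 4*ennreal (indicator {1..} h*h powr (- 2))"
     using False by (subst ennreal_mult[symmetric]) (auto simp: hw_def intro!: ennreal_leI)
    then show ?thesis by (intro add_increasing) auto
   qed
  qed (simp add: hw_def)
 qed
 also have "... = ennreal 1 + ennreal 4*(NN h. ennreal (indicator {1..} h*h powr (- 2)))"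
  by (subst nn_integral_add) (simp_all add: nn_integral_cmult ennreal_indicator)
 also have "(NN h. ennreal (indicator {1..} h*h powr (- 2))) = ennreal 1"
  using tail_powr[of 2 1] by (subst nn_integral_eq_integral) auto
 finally show ?thesis by (simp add: ennreal_plus[symmetric] ennreal_mult[symmetric] del: ennreal_plus)
qed

text \<open>Substitution of l h for h. The weight h^-2 makes the result linear in l, so l = |xi|^4
  yields |xi|^4, the square of the symbol of the Laplacian.\<close>

lemma hC_scale:
 assumes l: "0 <= l" and sg: "\<bar>sg\<bar> = (1::real)"
 shows "(NN h. ennreal (hw h*(cmod (cis (sg*h*l) - 1))^2)) = ennreal l*hC"
proof -
 have sg': "cos (sg*h*l) = cos (l*h)" for h
  using sg by (cases "sg = 1") (auto simp: abs_if mult.commute split: if_splits)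
 show ?thesis
 proof (cases "l = 0")
  case False
  then have l0: "l > 0" using l by simp
  have hl: "hw (l*h) = hw h/l^2" for h
   using l0 by (auto simp: hw_def indicator_def powr_mult powr_minus powr_numeral zero_less_mult_iff divide_inverse)
  have "hC = ennreal \<bar>l\<bar>*(NN h. ennreal (hw (l*h)*(2 - 2*cos (l*h))))"
   unfolding hC_def using nn_integral_lborel_affine[of "\<lambda>h. ennreal (hw h*(2 - 2*cos h))" l 0] False by simp
  also have "(NN h. ennreal (hw (l*h)*(2 - 2*cos (l*h)))) = (NN h. ennreal (1/l^2)*ennreal (hw h*(2 - 2*cos (l*h))))"
   unfolding hl by (intro nn_integral_cong) (simp add: ennreal_mult[symmetric])
  also have "... = ennreal (1/l^2)*(NN h. ennreal (hw h*(2 - 2*cos (l*h))))"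
   by (rule nn_integral_cmult) measurable
  finally have "ennreal l*hC = ennreal l*(ennreal l*(ennreal (1/l^2)*(NN h. ennreal (hw h*(2 - 2*cos (l*h))))))"
   using l0 by simp
  also have "... = ennreal (l*(l*(1/l^2)))*(NN h. ennreal (hw h*(2 - 2*cos (l*h))))"
   using l0 by (simp only: ennreal_mult l mult_nonneg_nonneg zero_le_divide_1_iff zero_le_power2 mult.assoc)
  also have "l*(l*(1/l^2)) = 1" using False by (simp add: power2_eq_square)
  finally show ?thesis unfolding cmod_cis_minus_one_sq sg' by simp
 qed simp
qed

text \<open>The squared half-derivative in time of the free evolution of f; by \<open>hq_eq\<close>
  it is a multiple of the squared L^2 norm of the Laplacian of f.\<close>

definition hq :: "real => ('a::euclidean_space => complex) => ennreal" where
 "hq sg f = (NN h. ennreal (hw h)*ennreal ((nrm (\<lambda>x. propagator (sg*h) f x - f x))^2))"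

lemma nrm_propagator_minus:
 assumes f: "f \<in> L2"
 shows "ennreal ((nrm (\<lambda>x. propagator t f x - f x))^2) = (NN xi. ennreal ((cmod (cis (t*norm xi ^ 4) - 1))^2*(cmod (FT f xi))^2))"
proof -
 have L: "(\<lambda>x. propagator t f x - f x) \<in> L2" by (intro L2_diff propagator_L2 f)
 have "ennreal ((nrm (\<lambda>x. propagator t f x - f x))^2) = ennreal ((nrm (FT (\<lambda>x. propagator t f x - f x)))^2)"
  by (simp add: nrm_fourier_L2[OF L])
 also have "... = (NN xi. ennreal ((cmod (FT (\<lambda>x. propagator t f x - f x) xi))^2))"
  by (rule nn_integral_nrm[symmetric]) (intro fourier_L2_L2 L)
 also have "... = (NN xi. ennreal ((cmod (cis (t*norm xi ^ 4) - 1))^2*(cmod (FT f xi))^2))"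
 proof (rule nn_integral_cong_AE)
  show "AE xi in lborel. ennreal ((cmod (FT (\<lambda>x. propagator t f x - f x) xi))^2) = ennreal ((cmod (cis (t*norm xi ^ 4) - 1))^2*(cmod (FT f xi))^2)"
   using fourier_L2_diff[OF propagator_L2[OF f] f, of t] fourier_propagator[OF f, of t]
  proof eventually_elim
   case (elim xi)
   have "FT (\<lambda>x. propagator t f x - f x) xi = (cis (t*norm xi ^ 4) - 1)*FT f xi" using elim by (simp add: algebra_simps)
   then show ?case by (simp add: norm_mult power_mult_distrib)
  qed
 qed
 finally show ?thesis .
qed

lemma hq_eq:
 fixes f :: "'a::euclidean_space => complex"
 assumes f: "f \<in> L2" and sg: "\<bar>sg\<bar> = 1"
 shows "hq sg f = hC*(NN xi. ennreal (norm xi ^ 4*(cmod (FT f xi))^2))"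
proof -
 have [measurable]: "FT f \<in> borelm" by (rule L2_measurable[OF fourier_L2_L2[OF f]])
 let ?k = "\<lambda>h (xi::'a). ennreal (hw h*(cmod (cis (sg*h*norm xi ^ 4) - 1))^2)*ennreal ((cmod (FT f xi))^2)"
 have km: "(\<lambda>(h, xi). ?k h xi) \<in> borel_measurable (lborel \<Otimes>\<^sub>M lborel)"
  unfolding cmod_cis_minus_one_sq by measurable
 have "hq sg f = (NN h. NN xi. ?k h xi)"
  unfolding hq_def nrm_propagator_minus[OF f]
 proof (intro nn_integral_cong)
  fix h
  have "ennreal (hw h)*(NN xi. ennreal ((cmod (cis (sg*h*norm xi ^ 4) - 1))^2*(cmod (FT f xi))^2))
   = (NN xi. ennreal (hw h)*ennreal ((cmod (cis (sg*h*norm xi ^ 4) - 1))^2*(cmod (FT f xi))^2))"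
   by (rule nn_integral_cmult[symmetric]) (simp only: cmod_cis_minus_one_sq, measurable)
  also have "... = (NN xi. ?k h xi)" by (intro nn_integral_cong) (simp add: ennreal_mult mult.assoc)
  finally show "ennreal (hw h)*(NN xi. ennreal ((cmod (cis (sg*h*norm xi ^ 4) - 1))^2*(cmod (FT f xi))^2)) = (NN xi. ?k h xi)" .
 qed
 also have "... = (NN xi. NN h. ?k h xi)" by (rule lborel_pair.Fubini'[OF km, symmetric])
 also have "... = (NN xi. hC*ennreal (norm xi ^ 4*(cmod (FT f xi))^2))"
 proof (intro nn_integral_cong)
  fix xi :: 'a
  have "(NN h. ?k h xi) = (NN h. ennreal (hw h*(cmod (cis (sg*h*norm xi ^ 4) - 1))^2))*ennreal ((cmod (FT f xi))^2)"
   by (rule nn_integral_multc) (simp only: cmod_cis_minus_one_sq, measurable)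
  also have "... = hC*ennreal (norm xi ^ 4*(cmod (FT f xi))^2)"
   by (subst hC_scale[OF _ sg]) (auto simp: ennreal_mult mult_ac)
  finally show "(NN h. ?k h xi) = hC*ennreal (norm xi ^ 4*(cmod (FT f xi))^2)" .
 qed
 also have "... = hC*(NN xi. ennreal (norm xi ^ 4*(cmod (FT f xi))^2))" by (rule nn_integral_cmult) measurable
 finally show ?thesis .
qed

lemma h2_sq_nn: "f \<in> H2 ==> ennreal ((h2 f)^2) = (NN xi. ennreal ((1 + (norm xi)^2)^2*(cmod (FT f xi))^2))"
 unfolding h2_def by (subst nn_integral_nrm[symmetric]) (auto simp: H2_iff norm_mult cmod_w2 power_mult_distrib)

lemma hq_le: assumes f: "f \<in> H2" and sg: "\<bar>sg\<bar> = 1" shows "hq sg f <= ennreal (5*(h2 f)^2)"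
proof -
 have "(NN xi. ennreal (norm xi ^ 4*(cmod (FT f xi))^2)) <= ennreal ((h2 f)^2)"
  unfolding h2_sq_nn[OF f]
 proof (intro nn_integral_mono ennreal_leI mult_right_mono)
  fix xi :: 'a
  have "norm xi ^ 4 = ((norm xi)^2)^2" by (simp add: power_mult[symmetric])
  also have "... <= (1 + (norm xi)^2)^2" by (intro power_mono) auto
  finally show "norm xi ^ 4 <= (1 + (norm xi)^2)^2" .
 qed simp
 then have "hq sg f <= ennreal 5*ennreal ((h2 f)^2)" unfolding hq_eq[OF H2_L2[OF f] sg] by (intro mult_mono hC_le) auto
 then show ?thesis by (simp add: ennreal_mult)
qed

lemma h2_le_hq: 
 assumes f: "f \<in> H2" and sg: "\<bar>sg\<bar> = 1" and q: "hq sg f <= ennreal Q" "0 <= Q"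
 shows "(h2 f)^2 <= 2*(nrm f)^2 + 2*pi*Q"
proof -
 note fL = H2_L2[OF f]
 have [measurable]: "FT f \<in> borelm" by (rule L2_measurable[OF fourier_L2_L2[OF fL]])
 let ?I = "NN xi. ennreal (norm xi ^ 4*(cmod (FT f xi))^2)"
 have "ennreal (1/pi)*?I <= ennreal Q" using order_trans[OF mult_right_mono[OF hC_ge] q(1)[unfolded hq_eq[OF fL sg]]] by simp
 from mult_left_mono[OF this, of "ennreal pi"] have I: "?I <= ennreal (pi*Q)"
  using q(2) by (simp add: mult.assoc[symmetric] ennreal_mult[symmetric])
 have "ennreal ((h2 f)^2) <= (NN xi. 2*ennreal ((cmod (FT f xi))^2) + 2*ennreal (norm xi ^ 4*(cmod (FT f xi))^2))"
  unfolding h2_sq_nn[OF f]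
 proof (rule nn_integral_mono, goal_cases)
  case (1 xi)
  let ?F = "(cmod (FT f xi))^2"
  have "(1 + (norm xi)^2)^2 <= 2 + 2*norm xi ^ 4" using sum_squares_bound[of 1 "(norm xi)^2"] by (simp add: power2_sum power_mult[symmetric])
  from mult_right_mono[OF this, of ?F] have "ennreal ((1 + (norm xi)^2)^2*?F) <= ennreal (2*?F + 2*(norm xi ^ 4*?F))"
   by (intro ennreal_leI) (simp add: algebra_simps)
  then show ?case by (simp add: ennreal_mult)
 qed
 also have "... = 2*ennreal ((nrm f)^2) + 2*?I"
  by (subst nn_integral_add) (simp_all add: nn_integral_cmult nn_integral_nrm[OF fourier_L2_L2[OF fL]] nrm_fourier_L2[OF fL])
 also have "... <= 2*ennreal ((nrm f)^2) + 2*ennreal (pi*Q)" by (intro add_left_mono mult_left_mono I) simp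
 also have "... = ennreal (2*(nrm f)^2 + 2*pi*Q)" using q(2) by (simp add: ennreal_mult ennreal_plus mult.assoc)
 finally show ?thesis using q(2) by (subst (asm) ennreal_le_iff) auto
qed

text \<open>The fractional-in-time increments: below \<open>eps\<close> the increment is controlled by the equation,
 above \<open>eps\<close> by the decay of \<open>h powr -2\<close>.\<close>

lemma H2_increment:
 fixes f1 f2 :: "'a::euclidean_space => complex" and p1 p2 :: "real => 'a => complex"
 assumes f: "f1 \<in> H2" "f2 \<in> H2" and sg: "\<bar>sg\<bar> = 1" and E: "h2 f1 <= E" and eps: "0 < eps" "eps <= 1" and gam: "1/2 < gam" and C: "0 <= C"
  and p: "\<And>h. p1 h \<in> L2" "\<And>h. p2 h \<in> L2"
  and d: "nrm (\<lambda>x. f2 x - f1 x) <= eps*E"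
  and hol: "\<And>h. 0 < h ==> h < eps ==> nrm (\<lambda>x. p1 h x - f1 x) <= C*h powr gam" "\<And>h. 0 < h ==> h < eps ==> nrm (\<lambda>x. p2 h x - f2 x) <= C*h powr gam"
  and inc: "\<And>h. 0 < h ==> h < eps ==> nrm (\<lambda>x. (propagator (sg*h) (p2 h) x - f2 x) - (propagator (sg*h) (p1 h) x - f1 x))
   <= eps*nrm (\<lambda>x. propagator (sg*h) (p1 h) x - f1 x)"
 shows "(h2 (\<lambda>x. f2 x - f1 x))^2 <= 2*(eps*E)^2 + 2*pi*(24*eps*E^2 + 12*C^2*(eps powr (2*gam - 1)/(2*gam - 1)))"
proof -
 let ?g = "(eps powr (2*gam - 1)/(2*gam - 1))"
 let ?D = "\<lambda>x. f2 x - f1 x" and ?S = "\<lambda>h. propagator (sg*h) :: ('a => complex) => 'a => complex"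
 have fL: "f1 \<in> L2" "f2 \<in> L2" using f H2_L2 by auto
 have DL: "?D \<in> L2" by (intro L2_diff fL)
 have D2: "?D \<in> H2" by (rule H2_diff(1)[OF f(2) f(1)])
 have E0: "0 <= E" using order_trans[OF h2_nonneg E] .
 let ?P = "\<lambda>h. nrm (\<lambda>x. ?S h f1 x - f1 x)"
 let ?dd = "\<lambda>h. (nrm (\<lambda>x. ?S h ?D x - ?D x))^2"
 \<comment> \<open>\<open>?w1\<close> and \<open>?w2\<close> differ from the free increments of f1
   and f2 by the propagated \<open>?r1\<close> and \<open>?r2\<close>, of norm at most C h^gam. In
   this way \<open>inc\<close> is transferred to the free increment of the difference
   \<open>?D\<close>.\<close>
 have small: "(?dd h) <= 4*eps*(?P h)^2 + 12*C^2*h powr (2*gam)" if h: "0 < h" "h < eps" for h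
 proof -
  let ?w1 = "\<lambda>x. ?S h (p1 h) x - f1 x" and ?w2 = "\<lambda>x. ?S h (p2 h) x - f2 x"
  let ?r1 = "\<lambda>x. p1 h x - f1 x" and ?r2 = "\<lambda>x. p2 h x - f2 x"
  have rL: "?r1 \<in> L2" "?r2 \<in> L2" by (intro L2_diff p fL)+
  have wL: "?w1 \<in> L2" "?w2 \<in> L2" by (intro L2_diff propagator_L2 p fL)+
  have SL: "?S h ?r1 \<in> L2" "?S h ?r2 \<in> L2" "?S h f1 \<in> L2" by (intro propagator_L2 rL fL)+
  let ?c = "h powr gam"
  have nr: "nrm (?S h ?r1) <= C*?c" "nrm (?S h ?r2) <= C*?c" using hol[OF h] by (simp_all add: nrm_propagator rL)
  have w1: "nrm ?w1 <= ?P h + C*?c"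
  proof -
   have ae: "AE x in lborel. ?w1 x = (?S h f1 x - f1 x) + ?S h ?r1 x"
    using propagator_diff[OF p(1) fL(1), of "sg*h" h] by eventually_elim simp
   have L: "(\<lambda>x. ?S h f1 x - f1 x) \<in> L2" by (intro L2_diff SL fL)
   have "nrm ?w1 = nrm (\<lambda>x. (?S h f1 x - f1 x) + ?S h ?r1 x)"
    by (rule nrm_cong_AE[OF ae L2_measurable[OF wL(1)] L2_measurable[OF L2_add[OF L SL(1)]]])
   also have "... <= ?P h + nrm (?S h ?r1)" by (rule nrm_triangle[OF L SL(1)])
   finally show ?thesis using nr by linarith
  qed
  have "nrm (\<lambda>x. ?S h ?D x - ?D x) <= eps*?P h + 3*(C*?c)"
  proof -
   have ae: "AE x in lborel. ?S h ?D x - ?D x = (?w2 x - ?w1 x) - (?S h ?r2 x - ?S h ?r1 x)"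
    using propagator_diff[OF p(1) fL(1), of "sg*h" h] propagator_diff[OF p(2) fL(2), of "sg*h" h] propagator_diff[OF fL(2) fL(1), of "sg*h"]
    by eventually_elim simp
   have L: "(\<lambda>x. ?w2 x - ?w1 x) \<in> L2" "(\<lambda>x. ?S h ?r2 x - ?S h ?r1 x) \<in> L2" by (intro L2_diff wL SL)+
   have L3: "(\<lambda>x. ?S h ?D x - ?D x) \<in> L2" by (intro L2_diff[OF propagator_L2[OF DL] DL])
   have "nrm (\<lambda>x. ?S h ?D x - ?D x) = nrm (\<lambda>x. (?w2 x - ?w1 x) - (?S h ?r2 x - ?S h ?r1 x))"
    by (rule nrm_cong_AE[OF ae L2_measurable[OF L3] L2_measurable[OF L2_diff[OF L]]])
   also have "... <= nrm (\<lambda>x. ?w2 x - ?w1 x) + nrm (\<lambda>x. ?S h ?r2 x - ?S h ?r1 x)" by (rule nrm_diff_le[OF L])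
   also have "nrm (\<lambda>x. ?S h ?r2 x - ?S h ?r1 x) <= nrm (?S h ?r2) + nrm (?S h ?r1)" by (rule nrm_diff_le[OF SL(2,1)])
   also have "nrm (\<lambda>x. ?w2 x - ?w1 x) <= eps*nrm ?w1" by (rule inc[OF h])
   also have "eps*nrm ?w1 <= eps*(?P h + C*?c)" by (rule mult_left_mono[OF w1]) (use eps in simp)
   also have "eps*(?P h + C*?c) <= eps*?P h + 1*(C*?c)" unfolding distrib_left by (intro add_left_mono mult_right_mono eps) (use C in simp)
   finally show ?thesis using nr by linarith
  qed
  then have "(?dd h) <= (eps*?P h + 3*(C*?c))^2" by (rule power_mono) simp
  \<comment> \<open>(A + B)^2 <= 4 A^2 + (4/3) B^2 is equivalent to (3 A - B)^2 >= 0.\<close>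
  also have "... <= 4*(eps*?P h)^2 + 4/3*(3*(C*?c))^2"
  proof -
   have "0 <= (3*(eps*?P h) - (3*(C*?c)))^2" by simp
   then show ?thesis by (simp add: power2_sum power2_diff algebra_simps power2_eq_square)
  qed
  also have "... = 4*(eps^2*(?P h)^2) + 12*C^2*h powr (2*gam)"
   using h by (simp add: power_mult_distrib powr_powr[symmetric] powr_numeral mult.commute[of 2])
  also have "4*(eps^2*(?P h)^2) <= 4*(eps*(?P h)^2)"
   using eps by (intro mult_left_mono mult_right_mono) (auto simp: power2_eq_square mult_left_le)
  finally show ?thesis by simp
 qed
 have big: "(?dd h) <= 4*(eps*E)^2" for h
 proof -
  have "nrm (\<lambda>x. ?S h ?D x - ?D x) <= nrm (?S h ?D) + nrm ?D" by (rule nrm_diff_le[OF propagator_L2[OF DL] DL])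
  also have "nrm (?S h ?D) = nrm ?D" by (rule nrm_propagator[OF DL])
  finally have "nrm (\<lambda>x. ?S h ?D x - ?D x) <= 2*(eps*E)" using d by linarith
  then have "(?dd h) <= (2*(eps*E))^2" by (rule power_mono) simp
  then show ?thesis by (simp add: power_mult_distrib)
 qed
 let ?n = "indicat_real {0..eps}" and ?t = "indicat_real {eps..}"
 let ?c2 = "ennreal (4*(eps*E)^2)"
 let ?c1 = "ennreal (12*C^2)"
 let ?f2 = "\<lambda>h. ennreal (?t h*h powr (- 2))"
 let ?f1 = "\<lambda>h. ennreal (?n h*h powr (- (2 - 2*gam)))"
 let ?f0 = "\<lambda>h. (ennreal (hw h)*ennreal ((?P h)^2))"
 have Pm [measurable]: "(\<lambda>h. ennreal ((?P h)^2)) \<in> borelm"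
 proof -
  have [measurable]: "FT f1 \<in> borelm" by (rule L2_measurable[OF fourier_L2_L2[OF fL(1)]])
  show ?thesis unfolding nrm_propagator_minus[OF fL(1)] cmod_cis_minus_one_sq by measurable
 qed
 have "hq sg ?D <= (NN h. ennreal (4*eps)*(?f0 h) + (?c1*?f1 h + ?c2*?f2 h))"
  unfolding hq_def
 proof (rule nn_integral_mono, goal_cases)
  case (1 h)
  let ?N = "(?dd h)"
  show ?case
  proof (cases "0 < h")
   case h0: True
   show ?thesis
   proof (cases "h < eps")
    case True
    have "hw h*?N <= hw h*(4*eps*(?P h)^2 + 12*C^2*h powr (2*gam))" by (rule mult_left_mono[OF small[OF h0 True]]) simp
    also have "... = 4*eps*(hw h*(?P h)^2) + 12*C^2*(?n h*h powr (- (2 - 2*gam)))"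
     using h0 True by (simp add: hw_def algebra_simps powr_add[symmetric] powr_diff powr_minus divide_inverse)
    finally have "ennreal (hw h*?N) <= ennreal (4*eps*(hw h*(?P h)^2) + 12*C^2*(?n h*h powr (- (2 - 2*gam))))" by (rule ennreal_leI)
    also have "... = ennreal (4*eps)*(?f0 h) + ?c1*?f1 h"
     using eps by (subst ennreal_plus) (auto simp: ennreal_mult[symmetric])
    finally have "ennreal (hw h)*ennreal ?N <= ennreal (4*eps)*(?f0 h) + ?c1*?f1 h"
     by (simp add: ennreal_mult)
    then show ?thesis by (rule order_trans) (simp add: add.assoc[symmetric])
   next
    case False
    have "hw h*?N <= hw h*(4*(eps*E)^2)" by (rule mult_left_mono[OF big]) simp
    also have "... = 4*(eps*E)^2*(?t h*h powr (- 2))" using h0 False by (simp add: hw_def)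
    finally have "ennreal (hw h*?N) <= ennreal (4*(eps*E)^2*(?t h*h powr (- 2)))" by (rule ennreal_leI)
    then have "ennreal (hw h)*ennreal ?N <= ?c2*?f2 h" by (simp only: ennreal_mult[symmetric] hw_nonneg zero_le_power2 mult_nonneg_nonneg indicator_pos_le powr_ge_zero zero_le_numeral)
    then show ?thesis by (rule order_trans) (simp add: add.assoc[symmetric])
   qed
  qed (simp add: hw_def)
 qed
 also have "... = (NN h. ennreal (4*eps)*(?f0 h)) + (NN h. ?c1*?f1 h + ?c2*?f2 h)"
  by (rule nn_integral_add) measurable
 also have "(NN h. ennreal (4*eps)*(?f0 h)) = ennreal (4*eps)*hq sg f1"
  unfolding hq_def by (rule nn_integral_cmult) measurable
 also have "(NN h. ?c1*?f1 h + ?c2*?f2 h)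
  = ?c1*(NN h. ?f1 h) + ?c2*(NN h. ?f2 h)"
  by (subst nn_integral_add) (simp_all add: nn_integral_cmult)
 also have "(NN h. ?f1 h) = ennreal ?g"
  using near_powr[of "2 - 2*gam" eps] gam eps by (subst nn_integral_eq_integral) (auto simp: algebra_simps)
 also have "(NN h. ?f2 h) = ennreal (1/eps)"
  using tail_powr[of 2 eps] eps by (subst nn_integral_eq_integral) (auto simp: powr_minus divide_inverse)
 finally have "hq sg ?D <= ennreal (4*eps)*hq sg f1 + (?c1*ennreal ?g + ?c2*ennreal (1/eps))" .
 also have "... <= ennreal (4*eps)*ennreal (5*E^2) + (?c1*ennreal ?g + ?c2*ennreal (1/eps))"
 proof (rule add_right_mono[OF mult_left_mono])
  have "5*(h2 f1)^2 <= 5*E^2" using power_mono[OF E h2_nonneg, of 2] by simp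
  then show "hq sg f1 <= ennreal (5*E^2)" by (rule order_trans[OF hq_le[OF f(1) sg] ennreal_leI])
 qed simp
 also have "... = ennreal (4*eps*(5*E^2) + (12*C^2*?g + 4*(eps*E)^2*(1/eps)))"
  using eps gam by (simp add: ennreal_mult[symmetric] ennreal_plus[symmetric] del: ennreal_plus)
 \<comment> \<open>The share 20 eps E^2 comes from the free increments of f1, and 4 eps E^2 from h
   >= eps, where h^-2 integrates to 1/eps.\<close>
 also have "4*eps*(5*E^2) + (12*C^2*?g + 4*(eps*E)^2*(1/eps)) = 24*eps*E^2 + 12*C^2*?g"
  using eps by (simp add: power_mult_distrib power2_eq_square)
 finally have "hq sg ?D <= ennreal (24*eps*E^2 + 12*C^2*?g)" .
 moreover have "0 <= 24*eps*E^2 + 12*C^2*?g" using eps gam by (intro add_nonneg_nonneg mult_nonneg_nonneg divide_nonneg_nonneg) auto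
 ultimately have "(h2 ?D)^2 <= 2*(nrm ?D)^2 + 2*pi*(24*eps*E^2 + 12*C^2*?g)"
  by (rule h2_le_hq[OF D2 sg])
 moreover have "(nrm ?D)^2 <= (eps*E)^2" by (intro power_mono d) simp
 ultimately show ?thesis by linarith
qed

text \<open>By the mean value theorem the left side is al xi^(al-1) (x - z) z for some xi between z
  and x. For al < 1 the power is singular at 0, and the factor z <= xi compensates it.\<close>

lemma powr_mult_diff_le:
 fixes x z al :: real
 assumes z: "0 <= z" "z <= x" and al: "0 < al"
 shows "(x powr al - z powr al)*z <= al*x powr al*(x - z)"
proof (cases "z = 0 \<or> z = x")
 case True then show ?thesis using z al by auto
next
 case False
 then have z0: "0 < z" and zx: "z < x" using z by auto
 have "\<exists>xi. z < xi \<and> xi < x \<and> x powr al - z powr al = (x - z)*(al*xi powr (al - 1))"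
 proof (rule MVT2[OF zx])
  fix xi assume "z <= xi" "xi <= x"
  then show "((\<lambda>x. x powr al) has_real_derivative al*xi powr (al - 1)) (at xi)"
   using z0 by (auto intro!: derivative_eq_intros)
 qed
 then obtain xi where xi: "z < xi" "xi < x" and e: "x powr al - z powr al = (x - z)*(al*xi powr (al - 1))" by blast
 have "xi powr (al - 1)*z <= xi powr (al - 1)*xi" using xi by (intro mult_left_mono) auto
 also have "... = xi powr al" using xi z0 powr_add[of xi "al - 1" 1] by simp
 also have "... <= x powr al" using xi z0 al by (intro powr_mono2) auto
 finally have "(al*(x - z))*(xi powr (al - 1)*z) <= (al*(x - z))*x powr al" using zx al by (intro mult_left_mono) auto
 then show ?thesis unfolding e by (simp add: mult_ac)
qed

text \<open>With |q| <= |p| the difference splits into |p|^al (p - q) and (|p|^al - |q|^al) q, and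
  the mean value bound covers the second term. The factor (|p| + |q|)^al on the right is the density
  part of the potential of a pair of curves.\<close>

lemma nonlinearity_Lipschitz:
 fixes p q :: complex
 assumes al: "0 < al"
 shows "cmod (of_real (cmod p powr al)*p - of_real (cmod q powr al)*q) <= (1 + al)*((cmod p + cmod q) powr al*cmod (p - q))"
proof -
 have *: "cmod (of_real (cmod p powr al)*p - of_real (cmod q powr al)*q) <= (1 + al)*((cmod p + cmod q) powr al*cmod (p - q))"
  if pq: "cmod q <= cmod p" for p q :: complex
 proof -
  let ?P = "cmod p powr al" and ?Q = "cmod q powr al"
  have QP: "?Q <= ?P" using pq al by (intro powr_mono2) auto
  have "of_real ?P*p - of_real ?Q*q = of_real ?P*(p - q) + of_real (?P - ?Q)*q" by (simp add: algebra_simps)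
  also have "cmod ... <= cmod (of_real ?P*(p - q)) + cmod (of_real (?P - ?Q)*q)" by (rule norm_triangle_ineq)
  also have "... = ?P*cmod (p - q) + (?P - ?Q)*cmod q" unfolding norm_mult norm_of_real using QP by simp
  also have "(?P - ?Q)*cmod q <= al*?P*(cmod p - cmod q)" by (rule powr_mult_diff_le[OF _ pq al]) simp
  also have "al*?P*(cmod p - cmod q) <= al*?P*cmod (p - q)" using al by (intro mult_left_mono norm_triangle_ineq2) auto
  finally have "cmod (of_real ?P*p - of_real ?Q*q) <= (1 + al)*(?P*cmod (p - q))" by (simp add: algebra_simps)
  also have "... <= (1 + al)*((cmod p + cmod q) powr al*cmod (p - q))"
   using al by (intro mult_left_mono mult_right_mono powr_mono2) auto
  finally show ?thesis .
 qed
 show ?thesis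
 proof (cases "cmod q <= cmod p")
  case False
  then show ?thesis using *[of p q] by (simp add: norm_minus_commute add.commute)
 qed (rule *)
qed

section \<open>Continuity in time and limits in H^2\<close>

lemma L2cont_shift: "L2cont u ==> L2cont (\<lambda>t. u (t + h))"
 unfolding L2cont_def
proof (elim conjE, intro conjI allI impI)
 fix t and s :: "nat => real"
 assume u: "\<forall>t s. s ----> t --> (\<lambda>n. nrm (\<lambda>x. u (s n) x - u t x)) ----> 0" and s: "s ----> t"
 have "(\<lambda>n. s n + h) ----> t + h" by (intro tendsto_intros s)
 with u show "(\<lambda>n. nrm (\<lambda>x. u (s n + h) x - u (t + h) x)) ----> 0" by blast
qed blast

lemma L2cont_diff:
 assumes u: "L2cont u" and v: "L2cont v" shows "L2cont (\<lambda>t x. u t x - v t x)"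
 unfolding L2cont_def
proof (intro conjI allI impI L2_diff L2cont_L2[OF u] L2cont_L2[OF v])
 fix t and s :: "nat => real" assume s: "s ----> t"
 have l: "(\<lambda>n. nrm (\<lambda>x. u (s n) x - u t x) + nrm (\<lambda>x. v (s n) x - v t x)) ----> 0 + 0"
  using u v s unfolding L2cont_def by (intro tendsto_add) blast+
 show "(\<lambda>n. nrm (\<lambda>x. (u (s n) x - v (s n) x) - (u t x - v t x))) ----> 0"
 proof (rule tendsto_sandwich[OF _ _ tendsto_const])
  show "(\<lambda>n. nrm (\<lambda>x. u (s n) x - u t x) + nrm (\<lambda>x. v (s n) x - v t x)) ----> 0" using l by simp
  show "\<forall>\<^sub>F n in sequentially. nrm (\<lambda>x. (u (s n) x - v (s n) x) - (u t x - v t x)) <= nrm (\<lambda>x. u (s n) x - u t x) + nrm (\<lambda>x. v (s n) x - v t x)"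
  proof (intro always_eventually allI)
   fix n
   have "(\<lambda>x. (u (s n) x - v (s n) x) - (u t x - v t x)) = (\<lambda>x. (u (s n) x - u t x) - (v (s n) x - v t x))" by (rule ext) simp
   then show "nrm (\<lambda>x. (u (s n) x - v (s n) x) - (u t x - v t x)) <= nrm (\<lambda>x. u (s n) x - u t x) + nrm (\<lambda>x. v (s n) x - v t x)"
    by (simp only:) (intro nrm_diff_le L2_diff L2cont_L2[OF u] L2cont_L2[OF v])
  qed
 qed simp
qed

text \<open>The Fourier transform followed by multiplication by \<open>w2\<close> is an isometry
  into L^2, where the limit is taken; division by \<open>w2\<close> brings the limit back to
  H^2.\<close>

lemma H2_complete_at_top:
 fixes v :: "real => 'a::euclidean_space => complex"
 assumes v: "\<And>t. v t \<in> H2" and C: "\<And>e. e > 0 ==> \<exists>T. \<forall>t1\<ge>T. \<forall>t2\<ge>t1. h2 (\<lambda>x. v t2 x - v t1 x) < e"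
 shows "\<exists>phi\<in>H2. ((\<lambda>t. h2 (\<lambda>x. v t x - phi x)) \<longlongrightarrow> 0) at_top"
proof -
 define g where "g t = (\<lambda>xi. w2 xi*FT (v t) xi)" for t
 have gL: "g t \<in> L2" for t using v[of t] unfolding g_def by (simp add: H2_iff)
 have hg: "h2 (\<lambda>x. v t x - v s x) = nrm (\<lambda>xi. g t xi - g s xi)" for t s
  unfolding g_def by (rule H2_diff(2)[OF v v])
 have C': "\<exists>T. \<forall>t1\<ge>T. \<forall>t2\<ge>T. nrm (\<lambda>xi. g t2 xi - g t1 xi) < e" if e: "e > 0" for e
 proof -
  obtain T where T: "\<And>t1 t2. t1 \<ge> T ==> t2 \<ge> t1 ==> h2 (\<lambda>x. v t2 x - v t1 x) < e" using C[OF e] by blast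
  have "nrm (\<lambda>xi. g t2 xi - g t1 xi) < e" if "t1 \<ge> T" "t2 \<ge> T" for t1 t2
   using T[of t1 t2] T[of t2 t1] that nrm_minus_commute[of "g t2" "g t1"] unfolding hg by (cases "t1 <= t2") auto
  then show ?thesis by blast
 qed
 have "\<exists>G\<in>L2. (\<lambda>n. nrm (\<lambda>xi. g (real n) xi - G xi)) ----> 0"
 proof (rule L2_complete[OF gL])
  fix e :: real assume "e > 0"
  from C'[OF this] obtain T where T: "\<And>t1 t2. t1 \<ge> T ==> t2 \<ge> T ==> nrm (\<lambda>xi. g t2 xi - g t1 xi) < e" by blast
  show "\<exists>M. \<forall>m\<ge>M. \<forall>n\<ge>M. nrm (\<lambda>xi. g (real m) xi - g (real n) xi) < e"
   by (rule exI[of _ "nat \<lceil>T\<rceil>"]) (auto intro!: T simp: nat_le_iff ceiling_le_iff)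
 qed
 then obtain G where G: "G \<in> L2" "(\<lambda>n. nrm (\<lambda>xi. g (real n) xi - G xi)) ----> 0" by blast
 have Gt: "((\<lambda>t. nrm (\<lambda>xi. g t xi - G xi)) \<longlongrightarrow> 0) at_top"
 proof (rule tendstoI)
  fix e :: real assume e: "e > 0"
  then obtain T where T: "\<And>t1 t2. t1 \<ge> T ==> t2 \<ge> T ==> nrm (\<lambda>xi. g t2 xi - g t1 xi) < e/2" using C'[of "e/2"] by auto
  have "\<forall>\<^sub>F n in sequentially. nrm (\<lambda>xi. g (real n) xi - G xi) < e/2" using order_tendstoD(2)[OF G(2), of "e/2"] e by simp
  moreover have "\<forall>\<^sub>F n in sequentially. real n \<ge> T" by (rule eventually_sequentiallyI[of "nat \<lceil>T\<rceil>"]) (simp add: nat_le_iff ceiling_le_iff)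
  ultimately have "\<forall>\<^sub>F n in sequentially. nrm (\<lambda>xi. g (real n) xi - G xi) < e/2 \<and> real n \<ge> T" by (rule eventually_conj)
  then obtain n where n: "nrm (\<lambda>xi. g (real n) xi - G xi) < e/2" "real n \<ge> T" using eventually_happens[of _ sequentially] by auto
  show "\<forall>\<^sub>F t in at_top. dist (nrm (\<lambda>xi. g t xi - G xi)) 0 < e"
   unfolding eventually_at_top_linorder
  proof (intro exI[of _ T] allI impI)
   fix t assume "t \<ge> T"
   then have "nrm (\<lambda>xi. g t xi - g (real n) xi) < e/2" by (rule T[OF n(2)])
   then show "dist (nrm (\<lambda>xi. g t xi - G xi)) 0 < e" using nrm_triangle_diff[OF gL[of t] gL[of "real n"] G(1)] n(1) by simp
  qed
 qed
 have [measurable]: "G \<in> borelm" by (rule L2_measurable[OF G(1)])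
 have w2p: "w2 xi \<noteq> 0" for xi :: 'a 
 proof
  assume "w2 xi = 0"
  then have "1 + (norm xi)^2 = 0" unfolding cmod_w2[symmetric] by simp
  then show False using zero_le_power2[of "norm xi"] by linarith
 qed
 define g0 where "g0 xi = G xi/w2 xi" for xi
 have g0: "g0 \<in> L2"
 proof (rule L2_dominated(1)[OF G(1)])
  show "g0 \<in> borelm" unfolding g0_def[abs_def] by measurable
  show "AE xi in lborel. cmod (g0 xi) <= cmod (G xi)"
  proof (rule AE_I2)
   fix xi :: 'a
   have "cmod (G xi)*1 <= cmod (G xi)*(1 + (norm xi)^2)" by (intro mult_left_mono) auto
   moreover have "0 < 1 + (norm xi)^2" by (intro add_pos_nonneg) auto
   ultimately show "cmod (g0 xi) <= cmod (G xi)" by (simp add: g0_def norm_divide cmod_w2 pos_divide_le_eq)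
  qed
 qed
 define phi where "phi x = FT g0 (- x)" for x
 have phiL: "phi \<in> L2" unfolding phi_def by (intro L2_reflect fourier_L2_L2 g0)
 have Fphi: "AE xi in lborel. FT phi xi = g0 xi"
  using fourier_L2_reflect[OF fourier_L2_L2[OF g0]] AE_lborel_minus[OF fourier_L2_inversion[OF g0]] unfolding phi_def[abs_def] by eventually_elim simp
 have ae: "AE xi in lborel. w2 xi*FT phi xi = G xi" using Fphi by eventually_elim (simp add: g0_def w2p)
 have phiH: "phi \<in> H2" by (rule H2_fourierI(1)[OF phiL G(1) ae])
 have "h2 (\<lambda>x. v t x - phi x) = nrm (\<lambda>xi. g t xi - G xi)" for t
  unfolding H2_diff(2)[OF v phiH] g_def[symmetric]
 proof (rule nrm_cong_AE)
  show "AE xi in lborel. w2 xi*FT (v t) xi - w2 xi*FT phi xi = g t xi - G xi" using ae by eventually_elim (simp add: g_def)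
  have m: "FT phi \<in> borelm" "FT (v t) \<in> borelm"
   by (intro L2_measurable fourier_L2_L2 phiL H2_L2[OF v])+
  then show "(\<lambda>xi. w2 xi*FT (v t) xi - w2 xi*FT phi xi) \<in> borelm" by measurable
  show "(\<lambda>xi. g t xi - G xi) \<in> borelm" by (intro L2_measurable L2_diff gL G)
 qed
 then have "((\<lambda>t. h2 (\<lambda>x. v t x - phi x)) \<longlongrightarrow> 0) at_top" using Gt by (simp only:)
 then show ?thesis using phiH by blast
qed

text \<open>Two kernel bounds are assumed. \<open>kb\<close> carries the time weights A(s) and A(s +
  h), with constants uniform in h >= 0, and \<open>tail\<close> makes the weighted kernel small at
  late times. \<open>kb1\<close> has no time weight and a power singularity of order below 1; it
  serves for short times. \<open>pot\<close> bounds the weighted integral of the density with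
  exponent al + 2.\<close>

locale scat =
 fixes sg b al E Y0 sg1 C1 :: real and u :: "real => 'a::euclidean_space => complex" and kap A :: "real => real" and c :: complex
 assumes sg: "\<bar>sg\<bar> = 1" and b: "0 <= b" and al: "0 < al" and c: "cmod c <= 1"
  and u_H2: "\<And>t. u t \<in> H2" and u_le: "\<And>t. h2 (u t) <= E" and u_cont: "L2cont u"
  and F_int: "\<And>s phi. phi \<in> H2 ==> intg (\<lambda>x. inls_nonlinearity b al (u s) x*phi x)"
  and duh: "\<And>phi tau1 tau2. phi \<in> H2 ==> tau1 <= tau2 ==>
   intg (\<lambda>s. indicat_real {tau1..tau2} s *\<^sub>R ip (inls_nonlinearity b al (u s)) (propagator (sg * s) phi)) \<and>
   ip (propagator (sg*- tau2) (u tau2)) phi - ip (propagator (sg*- tau1) (u tau1)) phi =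
    c*(LBINT s. indicat_real {tau1..tau2} s *\<^sub>R ip (inls_nonlinearity b al (u s)) (propagator (sg * s) phi))"
  and A_meas [measurable]: "A \<in> borelm" and A_nonneg: "\<And>t. 0 <= A t"
  and kap_meas [measurable]: "kap \<in> borelm" and kap_nonneg: "\<And>t. 0 <= kap t"
  and kb: "\<And>h eta tau s t n m f g. 0 <= h ==> eta > 0 ==> tau \<noteq> 0 ==> f \<in> L2 ==> g \<in> L2 ==>
   cmod (ip (fmul (sm eta tau) (cut b al (nsum (u s) (u (s + h))) n f))
       (cut b al (nsum (u t) (u (t + h))) m g))
   <= kap \<bar>tau\<bar> * sqrt (A s + A (s + h)) * sqrt (A t + A (t + h))*(nrm f*nrm g)"
  and tail: "\<And>eps. 0 < eps ==> \<exists>T. \<forall>t. (NN s. ennreal (kap \<bar>t - s\<bar>*(indicator {T..} s*A s))) <= ennreal eps"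
  and kb1: "\<And>eta tau s t n m f g. eta > 0 ==> tau \<noteq> 0 ==> f \<in> L2 ==> g \<in> L2 ==>
   cmod (ip (fmul (sm eta tau) (cut b al (nsum (u s) (u (s + 0))) n f))
       (cut b al (nsum (u t) (u (t + 0))) m g))
   <= C1*\<bar>tau\<bar> powr (- sg1)*1*1*(nrm f*nrm g)"
  and sg1: "0 <= sg1" "sg1 < 1" and C1: "0 <= C1"
  and pot: "\<And>h t. 0 <= h ==> (NN x. ennreal (wV b (al + 2) (nsum (u t) (u (t + h))) x)) <= ennreal Y0"
begin

section \<open>The solution and its increments as instances of the profile estimate\<close>

definition F :: "real => 'a => complex" where "F t = inls_nonlinearity b al (u t)"
definition SS :: "real => ('a => complex) => 'a => complex" where "SS t = propagator (sg*t)"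
definition v :: "real => 'a => complex" where "v t = SS (- t) (u t)"

lemma u_L2: "u t \<in> L2" by (rule L2cont_L2[OF u_cont])
lemma v_L2: "v t \<in> L2" unfolding v_def SS_def by (rule propagator_L2[OF u_L2])
lemma v_H2: "v t \<in> H2" unfolding v_def SS_def by (rule H2_propagator(1)[OF u_H2])
lemma v_le: "h2 (v t) <= E" unfolding v_def SS_def H2_propagator(2)[OF u_H2] by (rule u_le)

lemma u_meas [measurable]: "u t \<in> borelm" by (rule L2_measurable[OF u_L2])
lemma F_meas [measurable]: "F t \<in> borelm"
 unfolding F_def inls_nonlinearity_def[abs_def] by measurable

lemma smoothing_inst: assumes h: "0 <= h" shows "smoothing sg b al u (\<lambda>t. u (t + h)) (\<lambda>t. sqrt (A t + A (t + h))) kap"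
proof unfold_locales
 show "(\<lambda>t. sqrt (A t + A (t + h))) \<in> borelm" by measurable
 show "0 <= sqrt (A t + A (t + h))" for t using A_nonneg[of t] A_nonneg[of "t + h"] by simp
qed (fact sg b al u_cont L2cont_shift[OF u_cont] kap_meas kap_nonneg | rule kb[OF h]; assumption)+

text \<open>The squared weight for the shift h is A(s) + A(s + h). If s >= T then s + h >= T because
  h >= 0, so the tail beyond T controls both parts. This doubles eps, and T does not depend on
  h.\<close>

lemma tail_inst:
 assumes h: "0 <= h" and eps: "0 <= eps" and T: "\<And>t. (NN s. ennreal (kap \<bar>t - s\<bar>*(indicator {T..} s*A s))) <= ennreal eps"
 shows "smoothing_tail sg b al u (\<lambda>t. u (t + h)) (\<lambda>t. sqrt (A t + A (t + h))) kap {T..} (eps + eps)"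
proof (rule smoothing_tail.intro[OF smoothing_inst[OF h] smoothing_tail_axioms.intro])
 show "{T..} \<in> sets borel" by simp
 show "0 <= eps + eps" using eps by simp
 fix t
 have "(NN s. ennreal (kap \<bar>t - s\<bar>*(indicator {T..} s * sqrt (A s + A (s + h)))^2))
  = (NN s. ennreal (kap \<bar>t - s\<bar>*(indicator {T..} s*A s)) + ennreal (kap \<bar>t - s\<bar>*(indicator {T..} s*A (s + h))))"
 proof (rule nn_integral_cong, goal_cases)
  case (1 s)
  show ?case
   using A_nonneg[of s] A_nonneg[of "s + h"] kap_nonneg[of "\<bar>t - s\<bar>"]
   by (subst ennreal_plus[symmetric]) (auto simp: indicator_def power_mult_distrib distrib_left)
 qed
 also have "... = (NN s. ennreal (kap \<bar>t - s\<bar>*(indicator {T..} s*A s))) + (NN s. ennreal (kap \<bar>t - s\<bar>*(indicator {T..} s*A (s + h))))"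
  by (rule nn_integral_add) measurable
 also have "... <= ennreal eps + ennreal eps"
 proof (rule add_mono[OF T])
  have "(NN s. ennreal (kap \<bar>t - s\<bar>*(indicator {T..} s*A (s + h)))) <= (NN s. ennreal (kap \<bar>(t + h) - (h + s)\<bar>*(indicator {T..} (h + s)*A (h + s))))"
  proof (intro nn_integral_mono ennreal_leI)
   fix s show "kap \<bar>t - s\<bar>*(indicator {T..} s*A (s + h)) <= kap \<bar>(t + h) - (h + s)\<bar>*(indicator {T..} (h + s)*A (h + s))"
    using h A_nonneg kap_nonneg by (auto simp: indicator_def add.commute)
  qed
  also have "... = (NN s. ennreal (kap \<bar>(t + h) - s\<bar>*(indicator {T..} s*A s)))"
   using nn_integral_lborel_affine[of "\<lambda>s. ennreal (kap \<bar>(t + h) - s\<bar>*(indicator {T..} s*A s))" 1 h] by simp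
  also have "... <= ennreal eps" by (rule T)
  finally show "(NN s. ennreal (kap \<bar>t - s\<bar>*(indicator {T..} s*A (s + h)))) <= ennreal eps" .
 qed
 also have "... = ennreal (eps + eps)" by (rule ennreal_plus[symmetric, OF eps eps])
 finally show "(NN s. ennreal (kap \<bar>t - s\<bar>*(indicator {T..} s * sqrt (A s + A (s + h)))^2)) <= ennreal (eps + eps)" .
qed

definition dh :: "real => real => 'a => complex" where "dh h t x = u (t + h) x - u t x"
definition Gh :: "real => real => 'a => complex" where "Gh h t x = F (t + h) x - F t x"

lemma dh_L2: "dh h t \<in> L2" unfolding dh_def[abs_def] by (intro L2_diff u_L2)

lemma F_pair: "phi \<in> H2 ==> intg (\<lambda>x. F t x*phi x)" unfolding F_def by (rule F_int)

lemma duh_u: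
 assumes "phi \<in> H2" "tau1 <= tau2"
 shows "intg (\<lambda>s. indicat_real {tau1..tau2} s *\<^sub>R ip (F s) (SS s phi))"
  "ip (SS (- tau2) (u tau2)) phi - ip (SS (- tau1) (u tau1)) phi = c*(LBINT s. indicat_real {tau1..tau2} s *\<^sub>R ip (F s) (SS s phi))"
 using duh[OF assms] unfolding F_def SS_def by auto

text \<open>The equation between tau1 + h and tau2 + h, tested with S(-h) phi, is the equation for
  the shifted solution tested with phi; the unshifted equation is subtracted from it.\<close>

lemma duh_h:
 assumes phi: "phi \<in> H2" and tau: "tau1 <= tau2"
 shows "intg (\<lambda>s. indicat_real {tau1..tau2} s *\<^sub>R ip (Gh h s) (SS s phi))"
  "ip (SS (- tau2) (dh h tau2)) phi - ip (SS (- tau1) (dh h tau1)) phi = c*(LBINT s. indicat_real {tau1..tau2} s *\<^sub>R ip (Gh h s) (SS s phi))"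
proof -
 let ?\<psi> = "SS (- h) phi"
 have phiL: "phi \<in> L2" by (rule H2_L2[OF phi])
 have \<psi>: "?\<psi> \<in> H2" unfolding SS_def by (rule H2_propagator(1)[OF phi])
 have SSphi: "SS s phi \<in> H2" for s unfolding SS_def by (rule H2_propagator(1)[OF phi])
 have comp: "SS (s + h) ?\<psi> = SS s phi" for s
  unfolding SS_def propagator_propagator[OF phiL] by (simp add: distrib_left)
 note D1 = duh_u[OF phi tau]
 have "tau1 + h <= tau2 + h" using tau by simp
 note D2 = duh_u[OF \<psi> this]
 have ind: "indicat_real {tau1 + h..tau2 + h} (s + h) = indicat_real {tau1..tau2} s" for s by (auto simp: indicator_def)
 have i2: "intg (\<lambda>s. indicat_real {tau1..tau2} s *\<^sub>R ip (F (s + h)) (SS s phi))"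
  using lborel_integrable_real_affine[OF D2(1), of 1 h] by (simp add: ind comp add.commute[of h])
 have e2: "(LBINT s. indicat_real {tau1 + h..tau2 + h} s *\<^sub>R ip (F s) (SS s ?\<psi>)) = (LBINT s. indicat_real {tau1..tau2} s *\<^sub>R ip (F (s + h)) (SS s phi))"
  using lborel_integral_real_affine[of 1 "\<lambda>s. indicat_real {tau1 + h..tau2 + h} s *\<^sub>R ip (F s) (SS s ?\<psi>)" h] by (simp add: ind comp add.commute[of h])
 have ipG: "ip (Gh h s) (SS s phi) = ip (F (s + h)) (SS s phi) - ip (F s) (SS s phi)" for s
 proof -
  have "intg (\<lambda>x. F r x*cnj (SS s phi x))" for r by (rule F_pair[OF H2_cnj[OF SSphi]])
  then show ?thesis unfolding ip_def Gh_def left_diff_distrib by (intro Bochner_Integration.integral_diff)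
 qed
 have eqG: "(\<lambda>s. indicat_real {tau1..tau2} s *\<^sub>R ip (Gh h s) (SS s phi)) = (\<lambda>s. indicat_real {tau1..tau2} s *\<^sub>R ip (F (s + h)) (SS s phi) - indicat_real {tau1..tau2} s *\<^sub>R ip (F s) (SS s phi))"
  unfolding ipG by (simp add: scaleR_diff_right)
 show "intg (\<lambda>s. indicat_real {tau1..tau2} s *\<^sub>R ip (Gh h s) (SS s phi))"
  unfolding eqG by (rule Bochner_Integration.integrable_diff[OF i2 D1(1)])
 have sp: "ip (SS (- tau) (dh h tau)) phi = ip (SS (- (tau + h)) (u (tau + h))) ?\<psi> - ip (SS (- tau) (u tau)) phi" for tau
 proof -
  have "ip (SS (- tau) (dh h tau)) phi = ip (dh h tau) (SS tau phi)" unfolding SS_def using ip_propagator[OF dh_L2 phiL] by simp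
  also have "... = ip (u (tau + h)) (SS tau phi) - ip (u tau) (SS tau phi)"
   unfolding dh_def[abs_def] by (rule ip_diff_left[OF u_L2 u_L2 H2_L2[OF SSphi]])
  also have "ip (u tau) (SS tau phi) = ip (SS (- tau) (u tau)) phi" unfolding SS_def using ip_propagator[OF u_L2 phiL] by simp
  also have "ip (u (tau + h)) (SS tau phi) = ip (SS (- (tau + h)) (u (tau + h))) ?\<psi>"
  proof -
   have "- (sg*- (tau + h)) = sg*(tau + h)" by (simp add: algebra_simps)
   then have "ip (SS (- (tau + h)) (u (tau + h))) ?\<psi> = ip (u (tau + h)) (SS (tau + h) ?\<psi>)"
    using ip_propagator[OF u_L2[of "tau + h"] H2_L2[OF \<psi>], of "sg*- (tau + h)"] unfolding SS_def by (simp only:)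
   then show ?thesis unfolding comp ..
  qed
  finally show ?thesis .
 qed
 show "ip (SS (- tau2) (dh h tau2)) phi - ip (SS (- tau1) (dh h tau1)) phi = c*(LBINT s. indicat_real {tau1..tau2} s *\<^sub>R ip (Gh h s) (SS s phi))"
  unfolding eqG Bochner_Integration.integral_diff[OF i2 D1(1)] sp right_diff_distrib D1(2)[symmetric] e2[symmetric] D2(2)[symmetric] by simp
qed

lemma W_bound:
 assumes h: "0 <= h" and d: "\<And>x. cmod (d x) <= cmod (u s x) + cmod (u (s + h) x)"
 shows "(NN x. ennreal (wV b al (nsum (u s) (u (s + h))) x*(cmod (d x))^2)) <= ennreal Y0"
proof (rule order_trans[OF nn_integral_mono pot[OF h, of s]], rule ennreal_leI, goal_cases)
 case (1 x)
 let ?r = "cmod (u s x) + cmod (u (s + h) x)"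
 have r0: "0 <= ?r" by simp
 have "?r powr al*(cmod (d x))^2 <= ?r powr al*?r^2" by (intro mult_left_mono power_mono d) auto
 also have "... = ?r powr (al + 2)" using r0 by (cases "?r = 0") (simp_all add: powr_add powr_numeral)
 finally show ?case
  unfolding wV_def mult.assoc by (rule mult_left_mono) simp
qed

text \<open>The solution itself is treated with the pair of curves for h = 0, which explains the
  shift by 0 in the potential.\<close>

lemma F_le: "cmod (F s x) <= 1*(wV b al (nsum (u s) (u (s + 0))) x*cmod (u s x))"
proof -
 have "cmod (F s x) = norm x powr (- b)*cmod (u s x) powr al*cmod (u s x)" by (simp add: F_def inls_nonlinearity_def norm_mult)
 also have "... <= norm x powr (- b)*(cmod (u s x) + cmod (u (s + 0) x)) powr al*cmod (u s x)"
  using al by (intro mult_right_mono mult_left_mono powr_mono2) auto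
 finally show ?thesis by (simp add: wV_def)
qed

lemma Gh_le: "cmod (Gh h s x) <= (1 + al)*(wV b al (nsum (u s) (u (s + h))) x*cmod (dh h s x))"
proof -
 let ?p = "u (s + h) x" and ?q = "u s x"
 have "Gh h s x = of_real (norm x powr (- b))*(of_real (cmod ?p powr al)*?p - of_real (cmod ?q powr al)*?q)"
  by (simp add: Gh_def F_def inls_nonlinearity_def algebra_simps)
 then have "cmod (Gh h s x) = norm x powr (- b)*cmod (of_real (cmod ?p powr al)*?p - of_real (cmod ?q powr al)*?q)"
  by (simp add: norm_mult)
 also have "... <= norm x powr (- b)*((1 + al)*((cmod ?p + cmod ?q) powr al*cmod (?p - ?q)))"
  by (rule mult_left_mono[OF nonlinearity_Lipschitz[OF al]]) simp
 finally show ?thesis by (simp add: wV_def dh_def add.commute mult_ac)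
qed

lemma small_u:
 assumes eps: "0 <= eps" "eps + eps <= 1/2" and T: "\<And>t. (NN s. ennreal (kap \<bar>t - s\<bar>*(indicator {T..} s*A s))) <= ennreal eps"
  and t: "T <= t1" "t1 <= t2"
 shows "nrm (\<lambda>x. v t2 x - v t1 x) <= 4*eps*nrm (v t1)"
proof -
 interpret T: smoothing_tail sg b al u "\<lambda>t. u (t + 0)" "\<lambda>t. sqrt (A t + A (t + 0))" kap "{T..}" "eps + eps"
  by (rule tail_inst[OF _ eps(1) T]) simp
 have S: "T.S t = SS t" for t by (simp add: T.S_def SS_def)
 have V: "T.V s = wV b al (nsum (u s) (u (s + 0)))" for s unfolding T.V_def T.rho_def[abs_def] ..
 interpret D: duhamel sg b al u "\<lambda>t. u (t + 0)" "\<lambda>t. sqrt (A t + A (t + 0))" kap "{T..}" "eps + eps" u F 1 Y0 c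
 proof (unfold_locales, goal_cases)
  case 1 show ?case by (rule u_cont)
 next case (2 s) show ?case by (rule F_meas)
 next case (3 s x) show ?case unfolding V by (rule F_le)
 next case 4 show ?case by simp
 next case 5 show ?case by (rule c)
 next case (6 s phi) then show ?case using F_pair by blast
 next case (7 s) show ?case unfolding T.W_def V by (rule W_bound) auto
 next case (8 phi tau1 tau2) then show ?case unfolding S using duh_u by blast
 qed
 have "nrm (D.dlw t1 t2) <= 2*1*(eps + eps)*nrm (D.w t1)" by (rule D.claimC) (use eps t in auto)
 then show ?thesis unfolding D.dlw_def[abs_def] D.w_def S v_def by simp
qed

lemma small_h:
 assumes h: "0 <= h" and eps: "0 <= eps" "(1 + al)*(eps + eps) <= 1/2" and T: "\<And>t. (NN s. ennreal (kap \<bar>t - s\<bar>*(indicator {T..} s*A s))) <= ennreal eps"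
  and t: "T <= t1" "t1 <= t2"
 shows "nrm (\<lambda>x. SS (- t2) (dh h t2) x - SS (- t1) (dh h t1) x) <= 4*(1 + al)*eps*nrm (SS (- t1) (dh h t1))"
proof -
 interpret T: smoothing_tail sg b al u "\<lambda>t. u (t + h)" "\<lambda>t. sqrt (A t + A (t + h))" kap "{T..}" "eps + eps"
  by (rule tail_inst[OF h eps(1) T])
 have S: "T.S t = SS t" for t by (simp add: T.S_def SS_def)
 have V: "T.V s = wV b al (nsum (u s) (u (s + h)))" for s unfolding T.V_def T.rho_def[abs_def] ..
 interpret D: duhamel sg b al u "\<lambda>t. u (t + h)" "\<lambda>t. sqrt (A t + A (t + h))" kap "{T..}" "eps + eps" "dh h" "Gh h" "1 + al" Y0 c
 proof (unfold_locales, goal_cases)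
  case 1 show ?case unfolding dh_def[abs_def] by (rule L2cont_diff[OF L2cont_shift[OF u_cont] u_cont])
 next case (2 s) show ?case unfolding Gh_def[abs_def] by measurable
 next case (3 s x) show ?case unfolding V by (rule Gh_le)
 next case 4 show ?case using al by simp
 next case 5 show ?case by (rule c)
 next case (6 s phi) 
  have "intg (\<lambda>x. F (s + h) x*phi x - F s x*phi x)" by (intro Bochner_Integration.integrable_diff F_pair 6)
  then show ?case by (simp add: Gh_def left_diff_distrib)
 next case (7 s) show ?case unfolding T.W_def V by (rule W_bound[OF h]) (simp add: dh_def norm_triangle_ineq4[THEN order_trans] add.commute)
 next case (8 phi tau1 tau2) then show ?case unfolding S using duh_h by blast
 qed
 have "nrm (D.dlw t1 t2) <= 2*(1 + al)*(eps + eps)*nrm (D.w t1)" by (rule D.claimC) (use eps t in auto)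
 then show ?thesis unfolding D.dlw_def[abs_def] D.w_def S by (simp add: algebra_simps)
qed

section \<open>Hoelder continuity of the profile and its convergence in H^2\<close>

definition CH :: real where "CH = sqrt (C1*(2/(1 - sg1) + 1)*max Y0 0)"

lemma CH_nonneg: "0 <= CH" using C1 sg1 by (simp add: CH_def)

text \<open>On an interval of length h the kernel |tau|^-sg1 has row integrals of order h^(1 - sg1),
  and Y2 is at most h times the bound Y0. In \<open>claimB\<close> the two multiply to the square of
  h^(1 - sg1/2), whose exponent exceeds 1/2 because sg1 < 1.\<close>

lemma holder:
 assumes h: "0 < h"
 shows "nrm (\<lambda>x. v (t + h) x - v t x) <= CH*h powr (1 - sg1/2)"
proof -
 let ?J = "{t..t + h}"
 define e where "e = C1*(2/(1 - sg1) + 1)*h powr (1 - sg1)"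
 have e0: "0 <= e" unfolding e_def using C1 sg1 by (intro mult_nonneg_nonneg) auto
 interpret P: smoothing sg b al u "\<lambda>t. u (t + 0)" "\<lambda>_. 1" "\<lambda>tau. C1*tau powr (- sg1)"
  by unfold_locales (fact sg b al u_cont L2cont_shift[OF u_cont] | rule kb1; assumption | simp add: C1)+
 interpret T: smoothing_tail sg b al u "\<lambda>t. u (t + 0)" "\<lambda>_. 1" "\<lambda>tau. C1*tau powr (- sg1)" ?J e
 proof unfold_locales
  fix t'
  let ?n = "\<lambda>s. indicat_real {0..h} s * s powr (- sg1)"
  have n: "(NN s. ennreal (?n s)) = ennreal (h powr (1 - sg1)/(1 - sg1))"
   using near_powr[of sg1 h] sg1 h by (subst nn_integral_eq_integral) auto
  \<comment> \<open>Within distance h of t' the integral of the singularity is used; farther away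
    the kernel is at most h^-sg1, over an interval of length h.\<close>
  have pt: "\<bar>t' - s\<bar> powr (- sg1)*indicat_real ?J s <= (?n (t' - s) + ?n (s - t')) + indicat_real ?J s*h powr (- sg1)" for s
  proof (cases "\<bar>t' - s\<bar> <= h")
   case True
   have "\<bar>t' - s\<bar> powr (- sg1)*indicat_real ?J s <= \<bar>t' - s\<bar> powr (- sg1)" by (simp add: indicator_def)
   also have "... <= ?n (t' - s) + ?n (s - t')" using True by (cases "s <= t'") (simp_all add: indicator_def)
   finally show ?thesis by (simp add: add_increasing2)
  next
   case False
   then have "\<bar>t' - s\<bar> powr (- sg1) <= h powr (- sg1)" using h sg1 by (intro powr_mono2') auto
   then have "indicat_real ?J s*\<bar>t' - s\<bar> powr (- sg1) <= indicat_real ?J s*h powr (- sg1)" by (rule mult_left_mono) simp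
   moreover have "0 <= ?n (t' - s) + ?n (s - t')" by simp
   ultimately show ?thesis unfolding mult.commute[of "\<bar>t' - s\<bar> powr (- sg1)"] by linarith
  qed
  have "(NN s. ennreal (C1*\<bar>t' - s\<bar> powr (- sg1)*(indicat_real ?J s*1)^2))
   <= (NN s. ennreal C1*((ennreal (?n (t' - s)) + ennreal (?n (s - t'))) + ennreal (indicat_real ?J s*h powr (- sg1))))"
  proof (rule nn_integral_mono, goal_cases)
   case (1 s)
   have "ennreal (C1*\<bar>t' - s\<bar> powr (- sg1)*(indicat_real ?J s*1)^2) = ennreal (C1*(\<bar>t' - s\<bar> powr (- sg1)*indicat_real ?J s))"
    by (simp add: indicator_def)
   also have "... <= ennreal (C1*((?n (t' - s) + ?n (s - t')) + indicat_real ?J s*h powr (- sg1)))" by (intro ennreal_leI mult_left_mono pt C1)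
   also have "... = ennreal C1*((ennreal (?n (t' - s)) + ennreal (?n (s - t'))) + ennreal (indicat_real ?J s*h powr (- sg1)))"
    using C1 by (simp add: ennreal_mult ennreal_plus)
   finally show ?case .
  qed
  also have "... = ennreal C1*(((NN s. ennreal (?n (t' - s))) + (NN s. ennreal (?n (s - t')))) + (NN s. ennreal (indicat_real ?J s*h powr (- sg1))))"
   by (subst nn_integral_cmult, measurable, subst nn_integral_add, measurable, subst nn_integral_add, measurable)
  also have "(NN s. ennreal (?n (t' - s))) = ennreal (h powr (1 - sg1)/(1 - sg1))"
   using nn_integral_lborel_affine[of "\<lambda>s. ennreal (?n s)" "- 1" t'] n by simp
  also have "(NN s. ennreal (?n (s - t'))) = ennreal (h powr (1 - sg1)/(1 - sg1))"
   using nn_integral_lborel_affine[of "\<lambda>s. ennreal (?n s)" 1 "- t'"] n by simp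
  also have "(NN s. ennreal (indicat_real ?J s*h powr (- sg1))) = ennreal (h*h powr (- sg1))"
  proof -
   have "(NN s. ennreal (indicat_real ?J s*h powr (- sg1))) = (NN s. ennreal (h powr (- sg1))*indicator ?J s)"
    by (intro nn_integral_cong) (simp add: indicator_def)
   then show ?thesis using h by (simp add: nn_integral_cmult ennreal_mult[symmetric] mult.commute)
  qed
  also have "h*h powr (- sg1) = h powr (1 - sg1)" using h powr_add[of h 1 "- sg1"] by simp
  also have "ennreal C1*((ennreal (h powr (1 - sg1)/(1 - sg1)) + ennreal (h powr (1 - sg1)/(1 - sg1))) + ennreal (h powr (1 - sg1))) = ennreal e"
  proof -
   define p where "p = h powr (1 - sg1)/(1 - sg1)"
   have p0: "0 <= p" using sg1 by (simp add: p_def)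
   have "e = C1*((p + p) + h powr (1 - sg1))" by (simp add: e_def p_def distrib_left distrib_right mult_ac)
   then show ?thesis unfolding p_def[symmetric] using p0 C1 by (simp only: ennreal_plus ennreal_mult add_nonneg_nonneg powr_ge_zero)
  qed
  finally show "(NN s. ennreal (C1*\<bar>t' - s\<bar> powr (- sg1)*(indicat_real ?J s*1)^2)) <= ennreal e" .
 qed (auto simp: e0)
 have S: "P.S t = SS t" for t by (simp add: P.S_def SS_def)
 have V: "P.V s = wV b al (nsum (u s) (u (s + 0)))" for s unfolding P.V_def P.rho_def[abs_def] ..
 interpret D: duhamel sg b al u "\<lambda>t. u (t + 0)" "\<lambda>_. 1" "\<lambda>tau. C1*tau powr (- sg1)" ?J e u F 1 Y0 c
 proof (unfold_locales, goal_cases)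
  case 1 show ?case by (rule u_cont)
 next case (2 s) show ?case by (rule F_meas)
 next case (3 s x) show ?case unfolding V by (rule F_le)
 next case 4 show ?case by simp
 next case 5 show ?case by (rule c)
 next case (6 s phi) then show ?case using F_pair by blast
 next case (7 s) show ?case unfolding P.W_def V by (rule W_bound) auto
 next case (8 phi tau1 tau2) then show ?case unfolding S using duh_u by blast
 qed
 have "(nrm (D.dlw t (t + h)))^2 <= 1^2*e*D.Y2 t (t + h)" by (rule D.claimB) (use h in auto)
 also have "... <= 1^2*e*((t + h - t)*max Y0 0)" by (rule mult_left_mono[OF D.Y2_le]) (use h e0 in auto)
 also have "... = (C1*(2/(1 - sg1) + 1)*max Y0 0)*(h powr (1 - sg1)*h)" by (simp add: e_def mult_ac)
 also have "h powr (1 - sg1)*h = (h powr (1 - sg1/2))^2"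
  using h powr_add[of h "1 - sg1" 1] by (simp add: power2_eq_square powr_add[symmetric])
 also have "(C1*(2/(1 - sg1) + 1)*max Y0 0) = CH^2" using C1 sg1 by (simp add: CH_def)
 finally have "(nrm (D.dlw t (t + h)))^2 <= (CH*h powr (1 - sg1/2))^2" by (simp add: power_mult_distrib)
 then have "nrm (D.dlw t (t + h)) <= CH*h powr (1 - sg1/2)" by (rule power2_le_imp_le) (simp add: CH_nonneg)
 then show ?thesis unfolding D.dlw_def[abs_def] D.w_def S v_def .
qed

theorem scatters: "\<exists>phi\<in>H2. ((\<lambda>t. h2 (\<lambda>x. u t x - propagator (sg*t) phi x)) \<longlongrightarrow> 0) at_top"
proof -
 define gam where "gam = 1 - sg1/2"
 have gam: "1/2 < gam" using sg1 by (simp add: gam_def)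
 have E0: "0 <= E" using order_trans[OF h2_nonneg u_le] by blast
 \<comment> \<open>\<open>B eps\<close> is the right side of \<open>H2_increment\<close>; it
   vanishes with eps since 2 gam - 1 = 1 - sg1 is positive.\<close>
 define B where "B eps = 2*(eps*E)^2 + 2*pi*(24*eps*E^2 + 12*CH^2*(eps powr (2*gam - 1)/(2*gam - 1)))" for eps
 have B0: "(\<lambda>k. B (inverse (real (Suc k)))) ----> 0"
 proof -
  have i: "(\<lambda>k. inverse (real (Suc k))) ----> 0" by (rule LIMSEQ_inverse_real_of_nat)
  have "(\<lambda>k. inverse (real (Suc k)) powr (2*gam - 1)) ----> 0 powr (2*gam - 1)"
   by (rule tendsto_powr2[OF i tendsto_const]) (use gam in "auto intro!: always_eventually")
  then have p: "(\<lambda>k. inverse (real (Suc k)) powr (2*gam - 1)) ----> 0" by simp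
  have "(\<lambda>k. B (inverse (real (Suc k)))) ----> 2*(0*E)^2 + 2*pi*(24*0*E^2 + 12*CH^2*(0/(2*gam - 1)))"
   unfolding B_def by (intro tendsto_intros i p) (use gam in auto)
  then show ?thesis by simp
 qed
 have cauchy: "\<exists>T. \<forall>t1\<ge>T. \<forall>t2\<ge>t1. h2 (\<lambda>x. v t2 x - v t1 x) < e" if e: "e > 0" for e
 proof -
  have "\<forall>\<^sub>F k in sequentially. B (inverse (real (Suc k))) < e^2" using order_tendstoD(2)[OF B0, of "e^2"] e by simp
  then obtain k where k: "B (inverse (real (Suc k))) < e^2" using eventually_happens[of _ sequentially] by auto
  define eps where "eps = inverse (real (Suc k))"
  have eps: "0 < eps" "eps <= 1" by (auto simp: eps_def inverse_le_1_iff)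
  \<comment> \<open>The tail is taken so small that both L^2 estimates, with their factors 4 and 4
    (1 + al), give at most eps.\<close>
  define dl where "dl = eps/(4*(1 + al))"
  have dl: "0 < dl" using eps al by (simp add: dl_def)
  have dl1: "4*(1 + al)*dl = eps" using al by (simp add: dl_def)
  have dl2: "(1 + al)*(dl + dl) <= 1/2" using dl1 eps by (simp add: algebra_simps)
  have "4*1*dl <= 4*(1 + al)*dl" using al dl by (intro mult_right_mono) auto
  then have dl3: "4*dl <= eps" "dl + dl <= 1/2" using dl1 eps by auto
  obtain T where T: "\<And>t. (NN s. ennreal (kap \<bar>t - s\<bar>*(indicator {T..} s*A s))) <= ennreal dl" using tail[OF dl] by blast
  have "h2 (\<lambda>x. v t2 x - v t1 x) < e" if t: "T <= t1" "t1 <= t2" for t1 t2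
  proof -
   have vE: "nrm (v t1) <= E" using nrm_le_h2[OF v_H2] v_le order_trans by blast
   have R1: "nrm (\<lambda>x. v t2 x - v t1 x) <= eps*E"
    using small_u[OF less_imp_le[OF dl] dl3(2) T t] mult_mono[OF dl3(1) vE] eps by (meson less_imp_le nrm_nonneg order_trans)
   \<comment> \<open>The increment of u in the interaction picture: S(h) v(t + h) and v(t) are u(t +
     h) and u(t), both transported by S(-t).\<close>
   have sp: "AE x in lborel. propagator (sg*h) (v (t + h)) x - v t x = SS (- t) (dh h t) x" for t h
   proof -
    have "propagator (sg*h) (v (t + h)) = SS (- t) (u (t + h))"
     unfolding v_def SS_def propagator_propagator[OF u_L2] by (simp add: algebra_simps)
    then have e: "propagator (sg*h) (v (t + h)) x - v t x = SS (- t) (u (t + h)) x - SS (- t) (u t) x" for x by (simp add: v_def)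
    have "AE x in lborel. SS (- t) (dh h t) x = SS (- t) (u (t + h)) x - SS (- t) (u t) x"
     unfolding SS_def dh_def[abs_def] by (rule propagator_diff[OF u_L2 u_L2])
    then show ?thesis unfolding e by eventually_elim simp
   qed
   have wL: "(\<lambda>x. propagator (sg*h) (v (t + h)) x - v t x) \<in> L2" for t h by (intro L2_diff propagator_L2 v_L2)
   have sL: "SS (- t) (dh h t) \<in> L2" for t h unfolding SS_def by (intro propagator_L2 dh_L2)
   have R2: "nrm (\<lambda>x. (propagator (sg*h) (v (t2 + h)) x - v t2 x) - (propagator (sg*h) (v (t1 + h)) x - v t1 x))
    <= eps*nrm (\<lambda>x. propagator (sg*h) (v (t1 + h)) x - v t1 x)" if h: "0 < h" for h
   proof -
    have "nrm (\<lambda>x. (propagator (sg*h) (v (t2 + h)) x - v t2 x) - (propagator (sg*h) (v (t1 + h)) x - v t1 x)) = nrm (\<lambda>x. SS (- t2) (dh h t2) x - SS (- t1) (dh h t1) x)"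
    proof (rule nrm_cong_AE)
     show "AE x in lborel. (propagator (sg*h) (v (t2 + h)) x - v t2 x) - (propagator (sg*h) (v (t1 + h)) x - v t1 x) = SS (- t2) (dh h t2) x - SS (- t1) (dh h t1) x"
      using sp[of h t2] sp[of h t1] by eventually_elim simp
    qed (intro L2_measurable L2_diff[OF wL wL] L2_diff[OF sL sL])+
    also have "... <= 4*(1 + al)*dl*nrm (SS (- t1) (dh h t1))" by (rule small_h[OF _ less_imp_le[OF dl] dl2 T t]) (use h in simp)
    also have "nrm (SS (- t1) (dh h t1)) = nrm (\<lambda>x. propagator (sg*h) (v (t1 + h)) x - v t1 x)"
     by (rule nrm_cong_AE[OF _ L2_measurable[OF sL] L2_measurable[OF wL]]) (use sp[of h t1] in eventually_elim, simp)
    finally show ?thesis unfolding dl1 .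
   qed
   have "(h2 (\<lambda>x. v t2 x - v t1 x))^2 <= B eps"
    unfolding B_def
    by (rule H2_increment[OF v_H2 v_H2 sg v_le eps gam CH_nonneg, where ?p1.0="\<lambda>h. v (t1 + h)" and ?p2.0="\<lambda>h. v (t2 + h)"])
     (auto intro: v_L2 R1 R2 holder[folded gam_def])
   then have "(h2 (\<lambda>x. v t2 x - v t1 x))^2 < e^2" using k unfolding eps_def by linarith
   then show ?thesis using e by (simp add: power_less_imp_less_base)
  qed
  then show ?thesis by blast
 qed
 obtain phi where phi: "phi \<in> H2" "((\<lambda>t. h2 (\<lambda>x. v t x - phi x)) \<longlongrightarrow> 0) at_top" using H2_complete_at_top[OF v_H2 cauchy] by blast
 have "h2 (\<lambda>x. u t x - propagator (sg*t) phi x) = h2 (\<lambda>x. v t x - phi x)" for t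
 proof -
  have D: "(\<lambda>x. v t x - phi x) \<in> H2" by (rule H2_diff(1)[OF v_H2 phi(1)])
  have L: "(\<lambda>x. u t x - propagator (sg*t) phi x) \<in> L2" by (intro L2_diff u_L2 propagator_L2 H2_L2 phi)
  have e1: "propagator (sg*t) (v t) = propagator 0 (u t)" unfolding v_def SS_def propagator_propagator[OF u_L2] by simp
  have "AE x in lborel. propagator (sg*t) (\<lambda>x. v t x - phi x) x = u t x - propagator (sg*t) phi x"
   using propagator_diff[OF v_L2 H2_L2[OF phi(1)], of "sg*t" t] propagator_0[OF u_L2, of t] by eventually_elim (simp add: e1)
  from H2_cong(2)[OF H2_propagator(1)[OF D] L this] show ?thesis by (simp add: H2_propagator(2)[OF D])
 qed
 then have "((\<lambda>t. h2 (\<lambda>x. u t x - propagator (sg*t) phi x)) \<longlongrightarrow> 0) at_top" using phi(2) by (simp only:)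
 then show ?thesis using phi(1) by blast
qed

end

section \<open>From the weak Duhamel formula to the equation for the profile\<close>

lemma oriented_primitive:
 fixes g H :: "real => complex"
 assumes gi: "\<And>r. interval_lebesgue_integrable lborel (ereal 0) (ereal r) g"
  and H: "\<And>r. H r = H0 + k*(LBINT s=ereal 0..ereal r. g s)" and ab: "a <= b"
 shows "intg (\<lambda>s. indicat_real {a..b} s *\<^sub>R g s)"
  "H b - H a = k*(LBINT s. indicat_real {a..b} s *\<^sub>R g s)"
proof -
 define n where "n = max \<bar>a\<bar> \<bar>b\<bar> + 1"
 have n: "n > 0" "- n < a" "b < n" by (auto simp: n_def)
 \<comment> \<open>The hypothesis covers the open intervals on either side of 0. The point 0 itself
   is a null set, so together they give integrability on a neighbourhood of [a, b].\<close>
 have 1: "set_integrable lborel {0<..<n} g" using gi[of n] n by (simp add: interval_lebesgue_integrable_def)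
 have 2: "set_integrable lborel {- n<..<0} g" using gi[of "- n"] n by (simp add: interval_lebesgue_integrable_def)
 have 3: "set_integrable lborel ({- n<..<0} \<union> {0<..<n}) g" by (rule set_integrable_Un[OF 2 1]) auto
 have 4: "set_integrable lborel {- n<..<n} g"
  using 3 by (subst set_integrable_discrete_difference[where X="{0}" and B="{- n<..<0} \<union> {0<..<n}"]) auto
 have 5: "set_integrable lborel {a..b} g" by (rule set_integrable_subset[OF 4]) (use n in auto)
 then show "intg (\<lambda>s. indicat_real {a..b} s *\<^sub>R g s)" by (simp add: set_integrable_def)
 have i: "interval_lebesgue_integrable lborel (min (ereal 0) (min (ereal a) (ereal b))) (max (ereal 0) (max (ereal a) (ereal b))) g"
 proof -
  have "min (ereal 0) (min (ereal a) (ereal b)) = ereal (min 0 (min a b))" "max (ereal 0) (max (ereal a) (ereal b)) = ereal (max 0 (max a b))"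
   by (simp_all add: min_def max_def)
  moreover have "set_integrable lborel {min 0 (min a b)<..<max 0 (max a b)} g" by (rule set_integrable_subset[OF 4]) (use n ab in auto)
  ultimately show ?thesis by (simp only: interval_lebesgue_integrable_def einterval_eq) (auto simp: min_def max_def)
 qed
 have "H b - H a = k*((LBINT s=ereal 0..ereal b. g s) - (LBINT s=ereal 0..ereal a. g s))" unfolding H by (simp add: algebra_simps)
 also have "(LBINT s=ereal 0..ereal b. g s) - (LBINT s=ereal 0..ereal a. g s) = (LBINT s=ereal a..ereal b. g s)"
  using interval_integral_sum[OF i] by (simp add: algebra_simps)
 also have "... = (LBINT s. indicat_real {a..b} s *\<^sub>R g s)"
  unfolding interval_integral_Icc[OF ab] set_lebesgue_integral_def ..
 finally show "H b - H a = k*(LBINT s. indicat_real {a..b} s *\<^sub>R g s)" .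
qed

lemma solution_L2cont:
 assumes sol: "global_H2_solution lam b al u0 u"
 shows "L2cont (\<lambda>t. u (sg*t))"
 unfolding L2cont_def
proof (intro conjI allI impI)
 have uH: "u t \<in> H2" for t using sol by (simp add: global_H2_solution_def)
 show "u (sg*t) \<in> L2" for t by (rule H2_L2[OF uH])
 fix t and s :: "nat => real" assume s: "s ----> t"
 let ?f = "\<lambda>r. H2_norm (\<lambda>x. u r x - u (sg*t) x)"
 have DH: "(\<lambda>x. u r x - u (sg*t) x) \<in> H2" for r by (rule H2_diff(1)[OF uH uH])
 have z: "?f (sg*t) = 0" unfolding H2_norm_eq[OF DH] H2_diff(2)[OF uH uH] by simp
 with sol have "isCont ?f (sg*t)" by (simp add: global_H2_solution_def isCont_def)
 then have "(\<lambda>n. ?f (sg * s n)) ----> ?f (sg*t)" by (rule isCont_tendsto_compose) (intro tendsto_intros s)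
 then have "(\<lambda>n. ennreal (h2 (\<lambda>x. u (sg * s n) x - u (sg*t) x))) ----> ennreal 0"
  unfolding z unfolding H2_norm_eq[OF DH] by (simp only: ennreal_0)
 then have l: "(\<lambda>n. h2 (\<lambda>x. u (sg * s n) x - u (sg*t) x)) ----> 0" by (subst (asm) tendsto_ennreal_iff) auto
 show "(\<lambda>n. nrm (\<lambda>x. u (sg * s n) x - u (sg*t) x)) ----> 0"
  by (rule tendsto_sandwich[OF _ _ tendsto_const l]) (auto intro!: always_eventually nrm_le_h2 DH)
qed

text \<open>The formula at time r is tested with the conjugate of the propagated function S(r) phi.
  The bilinear pairing becomes the inner product, the transport by r cancels so that the integrand
  no longer depends on r, and the term of u0 becomes constant. Differences in r then give the
  equation between two times.\<close>

lemma solution_duhamel: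
 fixes u :: "real => 'a::euclidean_space => complex"
 assumes sol: "global_H2_solution lam b al u0 u" and u0: "u0 \<in> H2" and sg: "sg = 1 \<or> sg = - 1" and phi: "phi \<in> H2" and tau: "tau1 <= tau2"
 shows "intg (\<lambda>s. indicat_real {tau1..tau2} s *\<^sub>R ip (inls_nonlinearity b al (u (sg * s))) (propagator (sg * s) phi))"
  "ip (propagator (sg*- tau2) (u (sg*tau2))) phi - ip (propagator (sg*- tau1) (u (sg*tau1))) phi =
    (\<i> * of_real lam * of_real sg)*(LBINT s. indicat_real {tau1..tau2} s *\<^sub>R ip (inls_nonlinearity b al (u (sg * s))) (propagator (sg * s) phi))"
proof -
 let ?F = "\<lambda>t. inls_nonlinearity b al (u t)"
 define g where "g s = ip (?F s) (propagator s phi)" for s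
 define H where "H r = ip (propagator (- r) (u r)) phi" for r
 have uH: "u t \<in> H2" for t using sol by (simp add: global_H2_solution_def)
 have um [measurable]: "u t \<in> borelm" for t by (rule L2_measurable[OF H2_L2[OF uH]])
 have Fm: "?F t \<in> borelm" for t unfolding inls_nonlinearity_def[abs_def] by measurable
 have phiL: "phi \<in> L2" by (rule H2_L2[OF phi])
 have cphi: "(\<lambda>x. cnj (phi x)) \<in> L2" by (rule L2_cnj[OF phiL])
 have ds: "dual_propagator (r - s) (pairing (?F s)) (\<lambda>x. cnj (propagator r phi x)) = g s" for r s
 proof -
  let ?\<psi> = "\<lambda>x. cnj (propagator r phi x)"
  have \<psi>: "?\<psi> \<in> L2" by (intro L2_cnj propagator_L2 phiL)
  have "propagator (r - s) ?\<psi> = propagator (r - s) (propagator (- r) (\<lambda>x. cnj (phi x)))"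
   by (rule propagator_cong[OF \<psi> propagator_L2[OF cphi] propagator_cnj[OF phiL]])
  also have "... = propagator (- s) (\<lambda>x. cnj (phi x))" unfolding propagator_propagator[OF cphi] by simp
  finally have e: "propagator (r - s) ?\<psi> = propagator (- s) (\<lambda>x. cnj (phi x))" .
  show ?thesis unfolding dual_propagator_def pairing_def g_def ip_def e
  proof (rule integral_cong_AE)
   show "AE x in lborel. ?F s x*propagator (- s) (\<lambda>x. cnj (phi x)) x = ?F s x*cnj (propagator s phi x)"
    using propagator_cnj[OF phiL, of s] by eventually_elim simp
   have "propagator (- s) (\<lambda>x. cnj (phi x)) \<in> borelm" "propagator s phi \<in> borelm"
    by (intro L2_measurable propagator_L2 cphi phiL)+
   then show "(\<lambda>x. ?F s x*propagator (- s) (\<lambda>x. cnj (phi x)) x) \<in> borel_measurable lborel" "(\<lambda>x. ?F s x*cnj (propagator s phi x)) \<in> borel_measurable lborel"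
    using Fm[of s] by measurable
  qed
 qed
 have pf: "pairing f (\<lambda>x. cnj (h x)) = ip f h" for f h :: "'a => complex" unfolding pairing_def ip_def ..
 have base: "interval_lebesgue_integrable lborel (ereal 0) (ereal r) g \<and> H r = ip u0 phi + \<i> * of_real lam*(LBINT s=ereal 0..ereal r. g s)" for r
 proof -
  have "(\<lambda>x. cnj (propagator r phi x)) \<in> H2" by (intro H2_cnj H2_propagator phi)
  then have "interval_lebesgue_integrable lborel (ereal 0) (ereal r) g \<and>
   ip (u r) (propagator r phi) = ip (propagator r u0) (propagator r phi) + \<i> * of_real lam*(LBINT s=ereal 0..ereal r. g s)"
   using sol unfolding global_H2_solution_def pf[symmetric] ds[symmetric, of _ r] by blast
  moreover have "ip (u r) (propagator r phi) = H r" unfolding H_def using ip_propagator[OF H2_L2[OF uH[of r]] phiL, of "- r"] by simp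
  moreover have "ip (propagator r u0) (propagator r phi) = ip u0 phi"
  proof -
   have "ip (propagator r u0) (propagator r phi) = ip u0 (propagator 0 phi)"
    using ip_propagator[OF H2_L2[OF u0] propagator_L2[OF phiL], of r r] by (simp add: propagator_propagator[OF phiL])
   also have "... = ip u0 phi"
    by (rule ip_cong_AE[OF _ propagator_0[OF phiL]]) (auto intro!: L2_measurable H2_L2 u0 phi propagator_L2 phiL)
   finally show ?thesis .
  qed
  ultimately show ?thesis by simp
 qed
 note P = oriented_primitive[of g H "ip u0 phi" "\<i> * of_real lam", OF conjunct1[OF base] conjunct2[OF base]]
 have "intg (\<lambda>s. indicat_real {tau1..tau2} s *\<^sub>R g (sg * s)) \<and> H (sg*tau2) - H (sg*tau1) = (\<i> * of_real lam * of_real sg)*(LBINT s. indicat_real {tau1..tau2} s *\<^sub>R g (sg * s))"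
  using sg
 proof
  assume "sg = 1" then show ?thesis using P[OF tau] by simp
 next
  \<comment> \<open>The reflection of time exchanges the endpoints, which accounts for the factor
    \<open>sg\<close> in front of the integral.\<close>
  assume s: "sg = - 1"
  have tau': "- tau2 <= - tau1" using tau by simp
  have ind: "indicat_real {- tau2..- tau1} (- s) = indicat_real {tau1..tau2} s" for s by (auto simp: indicator_def)
  have "intg (\<lambda>s. indicat_real {tau1..tau2} s *\<^sub>R g (- s))"
   using lborel_integrable_real_affine[OF P(1)[OF tau'], of "- 1" 0] by (simp add: ind)
  moreover have "(LBINT s. indicat_real {- tau2..- tau1} s *\<^sub>R g s) = (LBINT s. indicat_real {tau1..tau2} s *\<^sub>R g (- s))"
   using lborel_integral_real_affine[of "- 1" "\<lambda>s. indicat_real {- tau2..- tau1} s *\<^sub>R g s" 0] by (simp add: ind)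
  ultimately show ?thesis using P(2)[OF tau'] s by (simp add: algebra_simps)
 qed
 then show "intg (\<lambda>s. indicat_real {tau1..tau2} s *\<^sub>R ip (inls_nonlinearity b al (u (sg * s))) (propagator (sg * s) phi))"
  "ip (propagator (sg*- tau2) (u (sg*tau2))) phi - ip (propagator (sg*- tau1) (u (sg*tau1))) phi =
    (\<i> * of_real lam * of_real sg)*(LBINT s. indicat_real {tau1..tau2} s *\<^sub>R ip (inls_nonlinearity b al (u (sg * s))) (propagator (sg * s) phi))"
  by (simp_all add: g_def H_def)
qed

lemma scatters_H2I:
 fixes u :: "real => 'a::euclidean_space => complex"
 assumes u: "\<And>t. u t \<in> H2"
  and s: "\<And>sg. sg = 1 \<or> sg = - 1 ==> \<exists>phi\<in>H2. ((\<lambda>t. h2 (\<lambda>x. u (sg*t) x - propagator (sg*t) phi x)) \<longlongrightarrow> 0) at_top"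
 shows "scatters_H2 u"
proof -
 have e: "H2_norm (\<lambda>x. u t x - propagator t phi x) = ennreal (h2 (\<lambda>x. u t x - propagator t phi x))" if "phi \<in> H2" for t and phi :: "'a => complex"
  by (intro H2_norm_eq H2_diff(1) u H2_propagator that)
 obtain p where p: "p \<in> H2" "((\<lambda>t. h2 (\<lambda>x. u (1*t) x - propagator (1*t) p x)) \<longlongrightarrow> 0) at_top" using s[of 1] by auto
 obtain m where m: "m \<in> H2" "((\<lambda>t. h2 (\<lambda>x. u (- 1*t) x - propagator (- 1*t) m x)) \<longlongrightarrow> 0) at_top" using s[of "- 1"] by auto
 have "((\<lambda>t. H2_norm (\<lambda>x. u t x - propagator t p x)) \<longlongrightarrow> 0) at_top"
  unfolding e[OF p(1)] using tendsto_ennrealI[OF p(2)] by simp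
 moreover have "((\<lambda>t. H2_norm (\<lambda>x. u t x - propagator t m x)) \<longlongrightarrow> 0) at_bot"
  unfolding e[OF m(1)] filterlim_at_bot_mirror using tendsto_ennrealI[OF m(2)] by simp
 ultimately show ?thesis unfolding scatters_H2_def using p(1) m(1) by blast
qed

section \<open>Exponents\<close>

text \<open>Here ro stands for 1/R. At the reciprocal of the Sobolev endpoint both inequalities hold
  strictly, by the upper bound on al if N >= 5 and by the bounds on b otherwise, so they persist
  slightly above it. The first makes the potential integrable with exponent al + 2; the second gives
  a kernel singularity of order below 1 without recourse to the level r0.\<close>

lemma exponents_R:
 fixes N :: nat and b al x :: real
 assumes N: "3 <= N" and b: "0 < b" "b < real N/2" "b < 4" and al: "0 < al" and al4: "5 <= N ==> al < (8 - 2*b)/(real N - 4)"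
  and x: "max 0 ((real N - 4)/(2*real N)) < x"
 shows "\<exists>ro. max 0 ((real N - 4)/(2*real N)) < ro \<and> ro < x \<and> (al + 2)*ro + b/real N < 1 \<and> al*ro + b/real N < 4/real N"
proof -
 let ?L = "max 0 ((real N - 4)/(2*real N))"
 have Np: "0 < real N" using N by simp
 have 1: "(al + 2)*?L + b/real N < 1 \<and> al*?L + b/real N < 4/real N"
 proof (cases "5 <= N")
  case True
  then have p: "0 < real N - 4" by simp
  have a: "al*(real N - 4) < 8 - 2*b" using al4[OF True] p by (simp add: field_simps)
  have L: "?L = (real N - 4)/(2*real N)" using p by simp
  have "(al + 2)*((real N - 4)/(2*real N)) + b/real N = ((al + 2)*(real N - 4) + 2*b)/(2*real N)" by (simp add: add_divide_distrib)
  also have "... < 1" using a Np by (simp add: pos_divide_less_eq algebra_simps)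
  finally have 1: "(al + 2)*((real N - 4)/(2*real N)) + b/real N < 1" .
  have "al*((real N - 4)/(2*real N)) + b/real N = (al*(real N - 4) + 2*b)/(2*real N)" by (simp add: add_divide_distrib)
  also have "... < 8/(2*real N)" using a Np by (intro divide_strict_right_mono) auto
  finally show ?thesis unfolding L using 1 by simp
 next
  case False
  then have "real N <= 4" by simp
  then have L: "?L = 0" using Np by (simp add: divide_nonpos_pos)
  show ?thesis unfolding L using b Np by (simp add: field_simps)
 qed
 define L where "L = ?L"
 have "L < (1 - b/real N)/(al + 2)" using 1 al unfolding L_def[symmetric] by (simp add: pos_less_divide_eq mult.commute)
 moreover have "L < (4 - b)/(real N*al)"
 proof -
  have "real N*(al*L + b/real N) < real N*(4/real N)" using 1 Np unfolding L_def[symmetric] by (intro mult_strict_left_mono) auto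
  then have "L*(real N*al) < 4 - b" using Np by (simp add: distrib_left mult_ac)
  then show ?thesis using Np al by (simp add: pos_less_divide_eq)
 qed
 ultimately have "?L < min x (min ((1 - b/real N)/(al + 2)) ((4 - b)/(real N*al)))" using x by (simp add: L_def)
 from dense[OF this] obtain ro where r: "?L < ro" "ro < x" "ro < (1 - b/real N)/(al + 2)" "ro < (4 - b)/(real N*al)" by auto
 have "(al + 2)*ro + b/real N < 1" using r(3) al by (simp add: pos_less_divide_eq mult.commute)
 moreover have "al*ro + b/real N < 4/real N"
 proof -
  have "ro*(real N*al) < 4 - b" using r(4) al Np by (simp add: pos_less_divide_eq)
  then have "(al*ro*real N + b)/real N < 4/real N" using Np by (intro divide_strict_right_mono) (auto simp: mult_ac)
  then show ?thesis using Np by (simp add: add_divide_distrib)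
 qed
 ultimately show ?thesis using r by blast
qed

text \<open>At \<open>y = al / r0\<close> the kernel has exactly the critical decay.  Moving a little of \<open>y\<close> to \<open>z\<close>
 (respectively \<open>w\<close>) makes it integrable at \<open>0\<close> (respectively at \<open>\<infinity>\<close>).\<close>

lemma kernel_exponents:
 fixes N b al r0 q0 R :: real
 assumes N: "0 < N" and b: "0 < b" and al: "0 < al" and r0: "2 < r0" "r0 < R" and q0: "0 < q0"
  and th0: "al/r0 + b/N < 1" and scal: "4/q0 + N/r0 = (4 - b)/al" and sc: "0 < N/2 - (4 - b)/al"
 shows "\<exists>y zn wn zf wf. 0 < y \<and> y < 1 \<and> 0 < zn \<and> 0 < wn \<and> 0 < zf \<and> 0 < wf \<and>
  r0*y + R*zn + 2*wn = al \<and> r0*y + R*zf + 2*wf = al \<and>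
  b/N + y + zn + wn <= 1 \<and> b/N + y + zf + wf <= 1 \<and>
  r0*y/q0 + N*(b/N + y + zn + wn)/4 < 1 \<and> 1 < r0*y/q0 + N*(b/N + y + zf + wf)/4"
proof -
 define s where "s = N/2 - (4 - b)/al"
 have s: "0 < s" using sc by (simp add: s_def)
 have R: "2 < R" using r0 by simp
 \<comment> \<open>The amount taken away from al/r0: at most half of it, and small enough to keep
   the total exponents at most 1.\<close>
 define dl where "dl = min (al/(2*r0)) ((1 - (al/r0 + b/N))/r0)"
 have dl: "0 < dl" "dl <= al/(2*r0)" "dl*r0 <= 1 - (al/r0 + b/N)"
 proof -
  have "dl <= (1 - (al/r0 + b/N))/r0" by (simp add: dl_def)
  then show "dl*r0 <= 1 - (al/r0 + b/N)" using r0 by (simp add: pos_le_divide_eq)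
 qed (use al r0 th0 in "auto simp: dl_def")
 define y where "y = al/r0 - dl"
 have y0: "0 < y" using dl(2) al r0 divide_strict_left_mono[of r0 "2*r0" al] by (simp add: y_def)
 have y1: "y < 1" unfolding y_def using th0 dl(1) divide_pos_pos[OF b N] by linarith
 have r0y: "r0*y = al - r0*dl" using r0 by (simp add: y_def algebra_simps)
 \<comment> \<open>If all of r0 dl went to the level R, the added exponents would sum to (r0/R) dl,
   less than the dl removed. The share \<open>e\<close> given to the level 2 raises the factor to
   the midpoint of r0/R and 1.\<close>
 define e where "e = (R - r0)/(2*(R - 2))"
 have e: "0 < e" "2*e < r0"
 proof -
  show "0 < e" using r0 R by (simp add: e_def)
  have "2*e <= 1" using r0 R by (simp add: e_def field_simps)
  then show "2*e < r0" using r0 by simp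
 qed
 define wn where "wn = e*dl"
 define zn where "zn = (r0 - 2*e)*dl/R"
 \<comment> \<open>If all of r0 dl went to the level 2, the added exponents would sum to (r0/2) dl.
   The share \<open>f\<close> given to the level R must not use up the gain, which is proportional
   to s.\<close>
 define f where "f = min (r0 * s/(N*(R - 2))) (r0/(2*R))"
 have f: "0 < f" "f*(N*(R - 2)) <= r0 * s" "R*f < r0"
 proof -
  show "0 < f" using r0 R s N by (auto simp: f_def)
  have "f <= r0 * s/(N*(R - 2))" by (simp add: f_def)
  then show "f*(N*(R - 2)) <= r0 * s" using N R by (simp add: pos_le_divide_eq)
  have "f <= r0/(2*R)" by (simp add: f_def)
  then have "f*(2*R) <= r0" using R by (simp add: pos_le_divide_eq)
  then have "2*(R*f) <= r0" by (simp add: mult_ac)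
  moreover have "0 < R*f" using \<open>0 < f\<close> R by simp
  ultimately show "R*f < r0" by linarith
 qed
 define zf where "zf = f*dl"
 define wf where "wf = (r0 - R*f)*dl/2"
 have pos: "0 < zn" "0 < wn" "0 < zf" "0 < wf" using e f dl R by (auto simp: zn_def wn_def zf_def wf_def)
 have Rzn: "R*zn = (r0 - 2*e)*dl" using R by (simp add: zn_def)
 have sumn: "r0*y + R*zn + 2*wn = al" unfolding r0y Rzn by (simp add: wn_def algebra_simps)
 have wf2: "2*wf = (r0 - R*f)*dl" by (simp add: wf_def)
 have sumf: "r0*y + R*zf + 2*wf = al" unfolding r0y wf2 by (simp add: zf_def algebra_simps)
 have zwn: "zn + wn = dl*((R + r0)/(2*R))"
 proof -
  have "zn + wn = dl*((r0 + e*(R - 2))/R)" using R by (simp add: zn_def wn_def field_simps)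
  also have "e*(R - 2) = (R - r0)/2" using R by (simp add: e_def field_simps)
  also have "(r0 + (R - r0)/2)/R = (R + r0)/(2*R)" by (simp add: field_simps)
  finally show ?thesis .
 qed
 have zwn1: "zn + wn < dl"
 proof -
  have "(R + r0)/(2*R) < 1" using r0 R by simp
  then have "dl*((R + r0)/(2*R)) < dl*1" using dl(1) by (rule mult_strict_left_mono)
  then show ?thesis unfolding zwn by simp
 qed
 have zwf: "zf + wf = dl*(r0/2 - f*(R - 2)/2)" by (simp add: zf_def wf_def field_simps)
 \<comment> \<open>Scaling: before the transfer, the order of the kernel and the reciprocal of the
   time exponent of the weight add up to exactly 1.\<close>
 have crit: "al/q0 + N*(b/N + al/r0)/4 = 1"
 proof -
  have "al*(4/q0 + N/r0) = 4 - b" unfolding scal using al by simp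
  then have "4*(al/q0) + N*(al/r0) = 4 - b" by (simp add: algebra_simps)
  moreover have e: "N*(b/N + al/r0) = b + N*(al/r0)" using N by (simp add: distrib_left)
  moreover have "P + (b + Q)/4 = 1" if "4*P + Q = 4 - b" for P Q :: real using that by (simp add: field_simps)
  ultimately show ?thesis unfolding e by blast
 qed
 have A: "r0*y/q0 + N*(b/N + y + t)/4 = 1 - r0*dl/q0 + N*(t - dl)/4" for t
 proof -
  have "N*(b/N + y + t) = N*(b/N + al/r0) + N*(t - dl)" unfolding y_def distrib_left[symmetric] by simp
  moreover have "a - d + X/4 = 1 - d + Y/4" if "X = Z + Y" "a + Z/4 = 1" for a d X Y Z :: real using that by linarith
  ultimately show ?thesis unfolding r0y diff_divide_distrib using crit by blast
 qed
 have near: "r0*y/q0 + N*(b/N + y + (zn + wn))/4 < 1"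
 proof -
  have "N*(zn + wn - dl) < 0" using N zwn1 by (simp add: mult_pos_neg)
  moreover have "0 < r0*dl/q0" using r0 dl q0 by simp
  ultimately show ?thesis unfolding A by linarith
 qed
 \<comment> \<open>The transfer changes the critical sum by dl (2 r0 s - f N (R - 2))/8. Here s is
   the critical regularity, and its positivity makes the change a gain.\<close>
 have far: "1 < r0*y/q0 + N*(b/N + y + (zf + wf))/4"
 proof -
  have q: "r0/q0 = r0*(N/2 - s)/4 - N/4"
  proof -
   have "4/q0 = N/2 - s - N/r0" using scal by (simp add: s_def)
   then have "r0*(4/q0) = r0*(N/2 - s) - N" using r0 by (simp add: right_diff_distrib)
   moreover have "r0*(4/q0) = 4*(r0/q0)" by simp
   moreover have "P = Q/4 - N/4" if "X = Q - N" "X = 4*P" for P Q X :: real using that by linarith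
   ultimately show ?thesis by blast
  qed
  have "- (r0*dl/q0) + N*(zf + wf - dl)/4 = dl*(- (r0/q0) + N*(r0/2 - f*(R - 2)/2 - 1)/4)"
   unfolding zwf by (simp add: algebra_simps)
  also have "- (r0/q0) + N*(r0/2 - f*(R - 2)/2 - 1)/4 = (2*(r0 * s) - f*(N*(R - 2)))/8"
   unfolding q by (simp add: field_simps)
  finally have "- (r0*dl/q0) + N*(zf + wf - dl)/4 = dl*((2*(r0 * s) - f*(N*(R - 2)))/8)" .
  moreover have "0 < 2*(r0 * s) - f*(N*(R - 2))" using f(2) mult_pos_pos[of r0 s] r0 s by linarith
  ultimately have "0 < - (r0*dl/q0) + N*(zf + wf - dl)/4" using dl(1) by (simp only:) (intro mult_pos_pos divide_pos_pos; simp)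
  then show ?thesis unfolding A by linarith
 qed
 have thf: "b/N + y + zf + wf <= 1"
 proof -
  have "0 <= f*(R - 2)" using f(1) R by simp
  then have "r0/2 - f*(R - 2)/2 <= r0" using r0 by linarith
  then have "zf + wf <= dl*r0" unfolding zwf using dl(1) by (intro mult_left_mono) auto
  then show ?thesis using dl by (simp add: y_def)
 qed
 have thn: "b/N + y + zn + wn <= 1" using zwn1 th0 by (simp add: y_def)
 show ?thesis
  by (rule exI[of _ y], rule exI[of _ zn], rule exI[of _ wn], rule exI[of _ zf], rule exI[of _ wf])
   (use y0 y1 pos sumn sumf thn thf near far in "simp add: add.assoc")
qed

section \<open>Smallness of the weighted kernel at late times\<close>

lemma mult_le_powr_sum:
 fixes x z mu p :: real
 assumes x: "0 <= x" and z: "0 <= z" and mu: "0 < mu" "mu < 1" and p: "p = 1/(1 - mu)"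
 shows "x*z <= x powr p + z powr (1/mu)"
proof (cases "x = 0 \<or> z = 0")
 case False
 then have x0: "0 < x" and z0: "0 < z" using x z by auto
 have 1: "x*z = (x powr p) powr (1 - mu)*(z powr (1/mu)) powr mu" using x0 z0 mu by (simp add: powr_powr p)
 let ?m = "max (x powr p) (z powr (1/mu))"
 have "(x powr p) powr (1 - mu)*(z powr (1/mu)) powr mu <= ?m powr (1 - mu)*?m powr mu"
  using mu by (intro mult_mono powr_mono2) auto
 also have "... = ?m"
 proof -
  have "0 < ?m" using x0 by (simp add: less_max_iff_disj)
  then show ?thesis unfolding powr_add[symmetric] by simp
 qed
 also have "... <= x powr p + z powr (1/mu)" by simp
 finally show ?thesis unfolding 1 .
qed auto

text \<open>Young's inequality in the role of Hoelder's. The kernel to the conjugate power p is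
  integrable, at 0 by \<open>n\<close> and at infinity by \<open>f\<close>, and A^(1/mu) is
  integrable by assumption. A small factor l makes the kernel part eps/2, and a large T does the
  same for the part of A; both are uniform in t.\<close>

lemma time_tail:
 fixes A :: "real => real" and C sgn sgf mu :: real
 assumes [measurable]: "A \<in> borelm" and A: "\<And>t. 0 <= A t" and C: "0 <= C"
  and mu: "0 < mu" and n: "mu + sgn < 1" and f: "1 < mu + sgf" and sgn: "0 <= sgn"
  and fin: "(NN t. ennreal (A t powr (1/mu))) < \<infinity>" and eps: "0 < eps"
 shows "\<exists>T. \<forall>t. (NN s. ennreal (C*(if \<bar>t - s\<bar> <= 1 then \<bar>t - s\<bar> powr (- sgn) else \<bar>t - s\<bar> powr (- sgf))*(indicator {T..} s*A s))) <= ennreal eps"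
proof -
 define p where "p = 1/(1 - mu)"
 have mu1: "mu < 1" using n sgn by linarith
 have p: "0 < p" "sgn*p < 1" "1 < sgf*p" using n f mu1 by (auto simp: p_def pos_divide_less_eq pos_less_divide_eq)
 let ?k = "\<lambda>r::real. if \<bar>r\<bar> <= 1 then \<bar>r\<bar> powr (- sgn) else \<bar>r\<bar> powr (- sgf)"
 let ?u2 = "1/(sgf*p - 1)"
 let ?u1 = "1/(1 - sgn*p)"
 let ?kp = "\<lambda>t s. ennreal (?k (t - s) powr p)"
 let ?a = "\<lambda>r. indicat_real {0..1} r*r powr (- (sgn*p))" and ?b = "\<lambda>r. indicat_real {1..} r*r powr (- (sgf*p))"
 define K where "K = 2*(?u1) + 2*(?u2)"
 have K: "0 < K" using p by (auto simp: K_def intro!: add_pos_pos)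
 have na: "(NN r. ennreal (?a r)) = ennreal (?u1)"
  using near_powr[of "sgn*p" 1] p by (subst nn_integral_eq_integral) auto
 have nb: "(NN r. ennreal (?b r)) = ennreal (?u2)"
  using tail_powr[of "sgf*p" 1] p by (subst nn_integral_eq_integral) auto
 have kp: "(NN s. ?kp t s) <= ennreal K" for t
 proof -
  have "(NN s. ?kp t s) <= (NN s. (ennreal (?a (t - s)) + ennreal (?a (s - t))) + (ennreal (?b (t - s)) + ennreal (?b (s - t))))"
  proof (rule nn_integral_mono, goal_cases)
   case (1 s)
   have "?k (t - s) powr p <= (?a (t - s) + ?a (s - t)) + (?b (t - s) + ?b (s - t))"
    by (cases "s <= t") (auto simp: indicator_def powr_powr)
   then have "?kp t s <= ennreal ((?a (t - s) + ?a (s - t)) + (?b (t - s) + ?b (s - t)))" by (rule ennreal_leI)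
   also have "... = (ennreal (?a (t - s)) + ennreal (?a (s - t))) + (ennreal (?b (t - s)) + ennreal (?b (s - t)))"
    by (simp add: ennreal_plus)
   finally show ?case .
  qed
  also have "... = ((NN s. ennreal (?a (t - s))) + (NN s. ennreal (?a (s - t)))) + ((NN s. ennreal (?b (t - s))) + (NN s. ennreal (?b (s - t))))"
   by (subst nn_integral_add, measurable, subst nn_integral_add, measurable, subst nn_integral_add, measurable)
  also have "(NN s. ennreal (?a (t - s))) = ennreal (?u1)"
   using nn_integral_lborel_affine[of "\<lambda>s. ennreal (?a s)" "- 1" t] na by simp
  also have "(NN s. ennreal (?a (s - t))) = ennreal (?u1)"
   using nn_integral_lborel_affine[of "\<lambda>s. ennreal (?a s)" 1 "- t"] na by simp
  also have "(NN s. ennreal (?b (t - s))) = ennreal (?u2)"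
   using nn_integral_lborel_affine[of "\<lambda>s. ennreal (?b s)" "- 1" t] nb by simp
  also have "(NN s. ennreal (?b (s - t))) = ennreal (?u2)"
   using nn_integral_lborel_affine[of "\<lambda>s. ennreal (?b s)" 1 "- t"] nb by simp
  also have "ennreal (?u1) + ennreal (?u1) + (ennreal (?u2) + ennreal (?u2)) = ennreal K"
  proof -
   define x where "x = ?u1"
   define z where "z = ?u2"
   have "0 <= x" "0 <= z" using p by (auto simp: x_def z_def)
   then have "ennreal x + ennreal x + (ennreal z + ennreal z) = ennreal ((x + x) + (z + z))" by (simp only: ennreal_plus add_nonneg_nonneg)
   then show ?thesis by (simp only: K_def x_def[symmetric] z_def[symmetric] mult_2)
  qed
  finally show ?thesis .
 qed
 \<comment> \<open>The two factors are weighted by l and 1/l; the kernel part then contributes at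
   most l^p K = eps/2.\<close>
 define l where "l = (eps/(2*K)) powr (1/p)"
 have l: "0 < l" "l powr p*K = eps/2" using eps K p by (auto simp: l_def powr_powr)
 define M where "M = (C/l) powr (1/mu)"
 have M: "0 <= M" by (simp add: M_def)
 have Ai: "intg (\<lambda>t. A t powr (1/mu))" using fin by (intro integrableI_nonneg) auto
 have "(\<lambda>n::nat. LBINT s. indicator {real n..} s*A s powr (1/mu)) ----> (LBINT s::real. (0::real))"
 proof (rule integral_dominated_convergence[where w="\<lambda>t. A t powr (1/mu)"])
  have "(\<lambda>n. indicator {real n..} s*A s powr (1/mu)) ----> 0" for s
  proof (rule tendsto_eventually)
   show "\<forall>\<^sub>F n in sequentially. indicator {real n..} s*A s powr (1/mu) = 0"
    by (rule eventually_sequentiallyI[of "nat \<lceil>s\<rceil> + 1"]) (auto simp: indicator_def, linarith)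
  qed
  then show "AE s in lborel. (\<lambda>n. indicator {real n..} s*A s powr (1/mu)) ----> 0" by simp
 qed (use Ai in "auto simp: indicator_def")
 then have "(\<lambda>n::nat. M*(LBINT s. indicator {real n..} s*A s powr (1/mu))) ----> M*0" by (intro tendsto_intros) simp
 then have "\<forall>\<^sub>F n::nat in sequentially. M*(LBINT s. indicator {real n..} s*A s powr (1/mu)) < eps/2"
  by (rule order_tendstoD) (use eps in simp)
 then obtain T :: nat where T: "M*(LBINT s. indicator {real T..} s*A s powr (1/mu)) < eps/2" using eventually_happens[of _ sequentially] by auto
 let ?iA = "\<lambda>s. (indicator {real T..} s*A s powr (1/mu))"
 have i2: "intg (\<lambda>s. indicator {real T..} s*A s powr (1/mu))"
  by (rule Bochner_Integration.integrable_bound[OF Ai]) (auto simp: indicator_def)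
 have "(NN s. ennreal (C*?k (t - s)*(indicator {real T..} s*A s))) <= ennreal eps" for t
 proof -
  have "(NN s. ennreal (C*?k (t - s)*(indicator {real T..} s*A s))) <= (NN s. ennreal (l powr p)*?kp t s + ennreal M*ennreal (?iA s))"
  proof (rule nn_integral_mono, goal_cases)
   case (1 s)
   let ?q = "?k (t - s)" and ?i = "indicat_real {real T..} s"
   have q0: "0 <= ?q" by simp
   have "C*?q*(?i*A s) = (l*?q)*(C/l*(?i*A s))" using l(1) by simp
   also have "... <= (l*?q) powr p + (C/l*(?i*A s)) powr (1/mu)"
    by (rule mult_le_powr_sum[OF _ _ mu mu1 p_def]) (use l(1) q0 C A[of s] in auto)
   also have "... = l powr p*?q powr p + M*(?i*A s powr (1/mu))"
   proof -
    have "(C/l*A s) powr (1/mu) = (C/l) powr (1/mu)*A s powr (1/mu)" by (rule powr_mult)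
    moreover have "(l*?q) powr p = l powr p*?q powr p" by (rule powr_mult)
    ultimately show ?thesis by (auto simp: M_def indicator_def)
   qed
   finally have "ennreal (C*?q*(?i*A s)) <= ennreal (l powr p*?q powr p + M*(?i*A s powr (1/mu)))" by (rule ennreal_leI)
   also have "... = ennreal (l powr p)*ennreal (?q powr p) + ennreal M*ennreal (?i*A s powr (1/mu))"
    using M by (subst ennreal_plus) (auto simp: ennreal_mult simp del: powr_gt_zero)
   finally show ?case .
  qed
  also have "... = (NN s. ennreal (l powr p)*?kp t s) + (NN s. ennreal M*ennreal (?iA s))"
   by (rule nn_integral_add) measurable
  also have "(NN s. ennreal (l powr p)*?kp t s) = ennreal (l powr p)*(NN s. ?kp t s)"
   by (rule nn_integral_cmult) measurable
  also have "(NN s. ennreal M*ennreal (?iA s)) = ennreal M*(NN s. ennreal (?iA s))"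
   by (rule nn_integral_cmult) measurable
  also have "(NN s. ennreal (?iA s)) = ennreal (LBINT s. indicator {real T..} s*A s powr (1/mu))"
   by (rule nn_integral_eq_integral[OF i2]) auto
  also have "ennreal (l powr p)*(NN s. ?kp t s) + ennreal M*ennreal (LBINT s. indicator {real T..} s*A s powr (1/mu)) <= ennreal (l powr p)*ennreal K + ennreal M*ennreal (LBINT s. indicator {real T..} s*A s powr (1/mu))"
   by (rule add_right_mono[OF mult_left_mono[OF kp]]) simp
  also have "... = ennreal (l powr p*K + M*(LBINT s. indicator {real T..} s*A s powr (1/mu)))"
   using K M by (subst ennreal_plus) (auto simp: ennreal_mult intro!: mult_nonneg_nonneg Bochner_Integration.integral_nonneg)
  also have "... <= ennreal eps" using T l(2) by (intro ennreal_leI) linarith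
  finally show ?thesis .
 qed
 then show ?thesis by (intro exI[of _ "real T"]) auto
qed

section \<open>The mixed norm as a time-dependent weight\<close>

lemma powr_subadditive:
 fixes a c y :: real
 assumes "0 <= a" "0 <= c" "0 < y" "y <= 1"
 shows "(a + c) powr y <= a powr y + c powr y"
proof (cases "a + c = 0")
 case False
 then have s: "0 < a + c" using assms by simp
 have *: "z/(a + c)*(a + c) powr y <= z powr y" if z: "0 <= z" "z <= a + c" for z
 proof -
  have "(z/(a + c)) powr 1 <= (z/(a + c)) powr y" using assms z s by (intro powr_mono') auto
  then have "z/(a + c)*(a + c) powr y <= (z/(a + c)) powr y*(a + c) powr y" using z s by (intro mult_right_mono) auto
  also have "... = z powr y" using z s by (subst powr_mult[symmetric]) auto
  finally show ?thesis .
 qed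
 have "(a + c) powr y = a/(a + c)*(a + c) powr y + c/(a + c)*(a + c) powr y"
  using s by (simp add: distrib_right[symmetric] add_divide_distrib[symmetric])
 then show ?thesis using *[of a] *[of c] assms by simp
qed (use assms in simp)

definition pint :: "real => ('a::euclidean_space => complex) => ennreal" where
 "pint r f = (NN x. ennreal (cmod (f x) powr r))"

text \<open>The integral may be infinite at some times, where \<open>enn2real\<close> alone would
  return 0. The truncation at B loses nothing for a tame function, whose level sets already obey the
  bound with B.\<close>

definition ptrunc :: "real => real => ('a::euclidean_space => complex) => real" where
 "ptrunc B r f = enn2real (min (ennreal B) (pint r f))"

lemma ptrunc_nonneg [simp]: "0 <= ptrunc B r f" by (simp add: ptrunc_def)

lemma ptrunc_measurable:
 assumes u: "L2cont u" and r: "0 < r" shows "(\<lambda>t. ptrunc B r (u t)) \<in> borelm"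
proof -
 have "(\<lambda>t. NN x. ennreal (cmod (u t x) powr r)) \<in> borelm"
 proof (rule lsc_integral_measurable[OF u u u, where \<Phi>="\<lambda>x z1 z2 z3. ennreal (cmod z1 powr r)"])
  show "(\<lambda>x. ennreal (cmod (u t x) powr r)) \<in> borelm" for t
   using L2_measurable[OF L2cont_L2[OF u, of t]] by measurable
  fix z1 :: "nat => complex" and w1 assume z: "z1 ----> w1"
  have "(\<lambda>n. ennreal (cmod (z1 n) powr r)) ----> ennreal (cmod w1 powr r)"
   by (rule tendsto_ennrealI[OF tendsto_powr2[OF tendsto_norm[OF z] tendsto_const]]) (use r in "auto intro!: always_eventually")
  from lim_imp_Liminf[OF _ this] show "ennreal (cmod w1 powr r) <= liminf (\<lambda>n. ennreal (cmod (z1 n) powr r))" by simp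
 qed
 then show ?thesis unfolding ptrunc_def pint_def by measurable
qed

text \<open>Both members of the minimum bound s^r times the measure of the level set: the integral
  by Chebyshev's inequality, and B by the level 2 if s <= 1 and by the level R if s > 1, since 2 <=
  r <= R.\<close>

lemma levelU_ptrunc:
 assumes t: "tame B R (\<lambda>x. cmod (f x))" and B: "0 <= B" and r: "2 <= r" "r <= R"
 shows "levelU r (ptrunc B r f) (\<lambda>x. cmod (f x))"
 unfolding levelU_def
proof (intro conjI allI impI ptrunc_nonneg)
 fix s :: real assume s: "0 < s"
 have [measurable]: "(\<lambda>x. cmod (f x)) \<in> borelm" by (rule tame_measurable[OF t])
 let ?S = "{x. s <= cmod (f x)}"
 have Sm: "?S \<in> sets lborel" by measurable
 note T = tameD[OF t s]
 have em: "emeasure lborel ?S = ennreal (measure lborel ?S)" using T(1) by (intro emeasure_eq_ennreal_measure) auto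
 have 1: "measure lborel ?S * s powr r <= B"
 proof (cases "s <= 1")
  case True
  have "measure lborel ?S * s powr r <= B * s powr (- 2) * s powr r" by (rule mult_right_mono[OF T(3)]) simp
  also have "... = B * s powr (r - 2)" using s by (simp add: powr_add[symmetric] mult.assoc)
  also have "... <= B*1" using True s r B by (intro mult_left_mono powr_le1) auto
  finally show ?thesis by simp
 next
  case False
  have "measure lborel ?S * s powr r <= B * s powr (- R) * s powr r" by (rule mult_right_mono[OF T(2)]) simp
  also have "... = B * s powr (r - R)" using s by (simp add: powr_add[symmetric] mult.assoc)
  also have "... <= B * s powr 0" using False r B by (intro mult_left_mono powr_mono) auto
  finally show ?thesis using s by simp
 qed
 have 2: "ennreal (measure lborel ?S * s powr r) <= pint r f"
 proof -
  have "ennreal (measure lborel ?S * s powr r) = (NN x. ennreal (s powr r)*indicator ?S x)"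
   by (subst nn_integral_cmult_indicator[OF Sm]) (simp add: em ennreal_mult mult.commute)
  also have "... <= pint r f" unfolding pint_def
  proof (rule nn_integral_mono, goal_cases)
   case (1 x) show ?case
    using s r by (auto simp: indicator_def intro!: ennreal_leI powr_mono2)
  qed
  finally show ?thesis .
 qed
 have "ennreal (measure lborel ?S * s powr r) <= min (ennreal B) (pint r f)" using 1 2 by (simp add: ennreal_leI)
 then have "enn2real (ennreal (measure lborel ?S * s powr r)) <= ptrunc B r f"
  unfolding ptrunc_def by (rule enn2real_mono) (simp add: min.strict_coboundedI1)
 then have "measure lborel ?S * s powr r <= ptrunc B r f" by (simp add: enn2real_ennreal)
 then show "measure lborel ?S <= ptrunc B r f * s powr (- r)" using s by (simp add: powr_minus field_simps)
qed

lemma mixed_norm_finite: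
 fixes u :: "real => 'a::euclidean_space => complex"
 assumes m: "mixed_norm (ereal q) (ereal r) u < \<infinity>" and q: "0 < q" and r: "0 < r"
 shows "(NN t. ennreal (ptrunc B r (u t) powr (q/r))) < \<infinity>"
proof -
 have Lp: "Lp_norm (ereal r) f = ennreal_powr (pint r f) (1/r)" for f :: "'a => complex"
  by (simp add: Lp_norm_def eLp_norm_def ennreal_powr_def pint_def)
 have "ennreal_powr (NN t. ennreal_powr (Lp_norm (ereal r) (u t)) q) (1/q) < \<infinity>"
  using m by (simp add: mixed_norm_def eLp_norm_def)
 then have fin: "(NN t. ennreal_powr (Lp_norm (ereal r) (u t)) q) < \<infinity>"
  by (auto simp: ennreal_powr_def top.not_eq_extremum split: if_splits)
 have "ennreal (ptrunc B r f powr (q/r)) <= ennreal_powr (Lp_norm (ereal r) f) q" for f :: "'a => complex"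
 proof (cases "pint r f = \<infinity>")
  case False
  then have fin: "pint r f < top" by (simp add: top.not_eq_extremum)
  have "ptrunc B r f <= enn2real (pint r f)" unfolding ptrunc_def by (rule enn2real_mono[OF min.cobounded2 fin])
  then have "ptrunc B r f powr (q/r) <= enn2real (pint r f) powr (q/r)" using q r by (intro powr_mono2) auto
  also have "... = (enn2real (pint r f) powr (1/r)) powr q" by (simp add: powr_powr)
  finally show ?thesis using False unfolding Lp by (simp add: ennreal_powr_def ennreal_leI)
 qed (simp add: Lp ennreal_powr_def)
 then have "(NN t. ennreal (ptrunc B r (u t) powr (q/r))) <= (NN t. ennreal_powr (Lp_norm (ereal r) (u t)) q)"
  by (intro nn_integral_mono)
 then show ?thesis using fin by (rule le_less_trans)
qed

text \<open>The common core of both alternatives: one mixed norm with the scaling of s_c suffices if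
  r0 lies strictly between 2 and the Sobolev endpoint. The condition \<open>th0\<close> keeps the
  interpolation exponents of the kernel at most 1.\<close>

theorem mixed_norm_scatters:
 fixes u :: "real => 'a::euclidean_space => complex" and b al q0 r0 E lam :: real
 defines "N \<equiv> real DIM('a)"
 assumes N3: "3 <= DIM('a)" and b: "0 < b" "b < N/2" "b < 4" and al: "(8 - 2*b)/N < al" and al4: "5 <= DIM('a) ==> al < (8 - 2*b)/(N - 4)"
  and r0: "2 < r0" "max 0 ((N - 4)/(2*N)) < 1/r0" and q0: "0 < q0" and scal: "4/q0 + N/r0 = (4 - b)/al" and th0: "al/r0 + b/N < 1"
  and lam: "lam \<in> {1, - 1}" and u0: "u0 \<in> H2" and sol: "global_H2_solution lam b al u0 u" and E: "0 < E" "\<And>t. h2 (u t) <= E"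
  and fin: "mixed_norm (ereal q0) (ereal r0) u < \<infinity>"
 shows "scatters_H2 u"
proof -
 have Np: "0 < N" using N3 by (simp add: N_def)
 have al0: "0 < al" using order.strict_trans[OF divide_pos_pos[of "8 - 2*b" N] al] b(3) Np by simp
 have uH: "u t \<in> H2" for t using sol by (simp add: global_H2_solution_def)
 obtain ro where ro: "max 0 ((N - 4)/(2*N)) < ro" "ro < 1/r0" "(al + 2)*ro + b/N < 1" "al*ro + b/N < 4/N"
  using exponents_R[OF N3, of b al "1/r0", folded N_def, OF b al0 al4 r0(2)] by blast
 have ro0: "0 < ro" using ro(1) by simp
 define R where "R = 1/ro"
 have rR: "r0 < R" using ro(2) ro0 r0(1) by (simp add: R_def field_simps)
 have R2: "2 < R" using rR r0 by simp
 have RN: "DIM('a) <= 4 \<or> R < 2*real DIM('a)/(real DIM('a) - 4)"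
 proof (cases "DIM('a) <= 4")
  case False
  then have p: "0 < N - 4" by (simp add: N_def)
  have "(N - 4)/(2*N) < ro" using ro(1) by simp
  then have "N - 4 < ro*(2*N)" using Np by (simp add: pos_divide_less_eq)
  then have "R*(N - 4) < 2*N" using ro0 by (simp add: R_def field_simps)
  then show ?thesis using p by (simp add: N_def[symmetric] pos_less_divide_eq)
 qed simp
 have sc: "0 < N/2 - (4 - b)/al"
 proof -
  have "8 - 2*b < al*N" using al Np by (simp add: pos_divide_less_eq)
  then show ?thesis using al0 by (simp add: field_simps)
 qed
 obtain y zn wn zf wf where y: "0 < y" "y < 1" and pos: "0 < zn" "0 < wn" "0 < zf" "0 < wf"
  and sumn: "r0*y + R*zn + 2*wn = al" and sumf: "r0*y + R*zf + 2*wf = al"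
  and thn: "b/N + y + zn + wn <= 1" and thf: "b/N + y + zf + wf <= 1"
  and near: "r0*y/q0 + N*(b/N + y + zn + wn)/4 < 1" and far: "1 < r0*y/q0 + N*(b/N + y + zf + wf)/4"
  using kernel_exponents[OF Np b(1) al0 r0(1) rR q0 th0 scal sc] by blast
 obtain B0 where B0: "1 <= B0" and tm: "\<And>f::'a => complex. f \<in> H2 ==> h2 f <= E ==> tame B0 R (\<lambda>x. cmod (f x))"
  using sobolev_tame[OF R2 RN E(1)] by blast
 \<comment> \<open>The densities are sums of two moduli, for which \<open>tame_add\<close> gives
   this constant.\<close>
 define B where "B = 2*B0*2 powr R"
 have B1: "1 <= B"
 proof -
  have "(1::real) <= 2 powr R" using R2 by (intro ge_one_powr_ge_zero) auto
  then have "1*1 <= B0*2 powr R" using B0 by (intro mult_mono) auto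
  then show ?thesis by (simp add: B_def)
 qed
 let ?thn = "b/N + y + zn + wn" and ?thf = "b/N + y + zf + wf"
 define sgn where "sgn = N*?thn/4"
 define sgf where "sgf = N*?thf/4"
 \<comment> \<open>The conclusion of \<open>kernel_bound\<close>, needed for three choices of
   exponents: for short and for long time differences, and without the level r0.\<close>
 define Kb where "Kb C th yy \<longleftrightarrow> (\<forall>(eta::real) (tau::real) (ro1::'a => real) (ro2::'a => real) U1 U2 n1 n2 (f::'a => complex) (g::'a => complex). eta > 0 --> tau \<noteq> 0 --> tame B R ro1 --> tame B R ro2 -->
  (yy = 0 \<and> U1 = 1 \<or> levelU r0 U1 ro1) --> (yy = 0 \<and> U2 = 1 \<or> levelU r0 U2 ro2) --> f \<in> L2 --> g \<in> L2 -->
  cmod (ip (fmul (sm eta tau) (cut b al ro1 n1 f))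
       (cut b al ro2 n2 g))
   <= C*\<bar>tau\<bar> powr (- N*th/4)*(U1 powr (yy/2)*U2 powr (yy/2))*(nrm f*nrm g))"
  for C th yy
 have "\<exists>C>0. Kb C ?thn y" unfolding Kb_def
  by (rule kernel_bound[OF N3 b(1) al0 B1 R2 less_imp_le[OF y(1)] pos(1,2) sumn, folded N_def, OF refl thn])
 then obtain Cn where Cn: "0 < Cn" "Kb Cn ?thn y" by blast
 have "\<exists>C>0. Kb C ?thf y" unfolding Kb_def
  by (rule kernel_bound[OF N3 b(1) al0 B1 R2 less_imp_le[OF y(1)] pos(3,4) sumf, folded N_def, OF refl thf])
 then obtain Cf where Cf: "0 < Cf" "Kb Cf ?thf y" by blast
 \<comment> \<open>Exponents with y = 0 for the kernel without time weight: the slack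
   \<open>g1\<close> in the conditions on ro pays for the small share \<open>w1\<close> at the level
   2 while N th/4 stays below 1.\<close>
 define g1 where "g1 = min 1 (4/N) - (b/N + al*ro)"
 have "0 <= 2*ro" using ro0 by simp
 then have "al*ro + b/N < 1" using ro(3) unfolding distrib_right by linarith
 then have g1: "0 < g1" using ro(4) by (simp add: g1_def)
 define w1 where "w1 = min (al/4) (g1/2)"
 define z1 where "z1 = (al - 2*w1)*ro"
 have w1: "0 < w1" "w1 <= al/4" "w1 < g1" using g1 al0 by (auto simp: w1_def)
 have z1: "0 < z1" using w1 al0 ro0 by (simp add: z1_def)
 have s1: "r0*0 + R*z1 + 2*w1 = al" using ro0 by (simp add: z1_def R_def)
 let ?th1 = "b/N + 0 + z1 + w1"
 have th1: "?th1 < min 1 (4/N)"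
 proof -
  have "0 < w1*ro" using w1(1) ro0 by simp
  then have "?th1 < b/N + al*ro + g1" using w1(3) by (simp add: z1_def left_diff_distrib)
  then show ?thesis by (simp add: g1_def)
 qed
 define sg1 where "sg1 = N*?th1/4"
 have sg1: "0 <= sg1" "sg1 < 1"
 proof -
  show "0 <= sg1" unfolding sg1_def using Np b z1 w1 by (intro divide_nonneg_nonneg mult_nonneg_nonneg add_nonneg_nonneg) auto
  have "N*?th1 < N*(4/N)" using th1 Np by (intro mult_strict_left_mono) auto
  then show "sg1 < 1" using Np by (simp add: sg1_def)
 qed
 have th1': "?th1 <= 1" using th1 by simp
 have "\<exists>C>0. Kb C ?th1 0" unfolding Kb_def
  by (rule kernel_bound[OF N3 b(1) al0 B1 R2 order_refl z1 w1(1) s1, folded N_def, OF refl th1'])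
 then obtain C1 where C1: "0 < C1" "Kb C1 ?th1 0" by blast
 have bD: "b < real DIM('a)" using b(2) Np by (simp add: N_def)
 have be: "2*(1 - b/real DIM('a)) < al + 2" "al + 2 < R*(1 - b/real DIM('a))"
 proof -
  show "2*(1 - b/real DIM('a)) < al + 2" using al0 divide_pos_pos[OF b(1) Np] by (simp add: N_def)
  show "al + 2 < R*(1 - b/real DIM('a))" using ro(3) ro0 by (simp add: R_def N_def[symmetric] field_simps)
 qed
 obtain Y0 where Y0: "\<And>ro::'a => real. tame B R ro ==> (NN x. ennreal (wV b (al + 2) ro x)) <= ennreal Y0"
  using potential_bound[OF b(1) bD B1 R2 be] by blast
 define C2 where "C2 = (Cn + Cf)*2 powr (r0*y)"
 have C2: "0 <= C2" using Cn Cf by (simp add: C2_def)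
 \<comment> \<open>The near exponents serve for |tau| <= 1 and the far ones beyond.
   \<open>C2\<close> covers both constants and the factor that \<open>levelU_add\<close>
   produces.\<close>
 define kap where "kap tau = C2*(if \<bar>tau\<bar> <= 1 then \<bar>tau\<bar> powr (- sgn) else \<bar>tau\<bar> powr (- sgf))" for tau
 show ?thesis
 proof (rule scatters_H2I[OF uH])
  fix sg :: real assume sg: "sg = 1 \<or> sg = - 1"
  have uc: "L2cont (\<lambda>t. u (sg*t))" by (rule solution_L2cont[OF sol])
  define U where "U t = ptrunc B0 r0 (u (sg*t))" for t
  define A where "A t = U t powr y" for t
  have U0: "0 <= U t" for t by (simp add: U_def)
  have Um [measurable]: "U \<in> borelm" unfolding U_def[abs_def] by (rule ptrunc_measurable[OF uc]) (use r0 in simp)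
  have Am: "A \<in> borelm" unfolding A_def[abs_def] by measurable
  have A0: "0 <= A t" for t by (simp add: A_def)
  have tu: "tame B0 R (\<lambda>x. cmod (u t x))" for t by (rule tm[OF uH E(2)])
  have B00: "0 <= B0" using B0 by simp
  have lu: "levelU r0 (U t) (\<lambda>x. cmod (u (sg*t) x))" for t
   unfolding U_def by (rule levelU_ptrunc[OF tu B00]) (use r0 rR in auto)
  let ?r = "\<lambda>h s x. cmod (u (sg * s) x) + cmod (u (sg*(s + h)) x)"
  have tr: "tame B R (?r h s)" for h s unfolding B_def by (rule tame_add[OF tu tu B00]) (use R2 in simp)
  have lr: "levelU r0 (2 powr r0*(U s + U (s + h))) (?r h s)" for h s by (rule levelU_add[OF lu lu tu tu])
  \<comment> \<open>Since y < 1, the power y is subadditive, which separates the contributions of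
    the times s and s + h.\<close>
  have sq: "(2 powr r0*(U s + U (s + h))) powr (y/2) <= 2 powr (r0*y/2) * sqrt (A s + A (s + h))" for s h
  proof -
   have "(U s + U (s + h)) powr y <= A s + A (s + h)" unfolding A_def by (rule powr_subadditive) (use U0 y in auto)
   then have "sqrt ((U s + U (s + h)) powr y) <= sqrt (A s + A (s + h))" by simp
   moreover have "sqrt ((U s + U (s + h)) powr y) = (U s + U (s + h)) powr (y/2)" by (simp add: powr_half_sqrt[symmetric] powr_powr)
   ultimately show ?thesis using U0[of s] U0[of "s + h"] by (simp add: powr_mult powr_powr mult_left_mono)
  qed
  have kbg: "cmod (ip (fmul (sm eta tau) (cut b al (?r h s) n f))
       (cut b al (?r h t) m g))
   <= C2*\<bar>tau\<bar> powr (- N*th/4) * sqrt (A s + A (s + h)) * sqrt (A t + A (t + h))*(nrm f*nrm g)"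
   if K: "Kb C th y" "0 <= C" "C <= Cn + Cf" and h: "0 < eta" "tau \<noteq> 0" "f \<in> L2" "g \<in> L2" for C th h eta tau s t n m f g
  proof -
   let ?X = "\<lambda>s. (2 powr r0*(U s + U (s + h))) powr (y/2)"
   let ?T = "\<bar>tau\<bar> powr (- N*th/4)" and ?p = "2 powr (r0*y/2)"
   have "cmod (ip (fmul (sm eta tau) (cut b al (?r h s) n f))
       (cut b al (?r h t) m g)) <= C*?T*(?X s*?X t)*(nrm f*nrm g)"
    using K(1)[unfolded Kb_def, rule_format, OF h(1,2) tr tr disjI2[OF lr] disjI2[OF lr] h(3,4)] .
   also have "... <= (Cn + Cf)*?T*((?p * sqrt (A s + A (s + h)))*(?p * sqrt (A t + A (t + h))))*(nrm f*nrm g)"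
   proof (rule mult_right_mono[OF mult_mono[OF mult_right_mono[OF K(3)] mult_mono[OF sq sq]]])
    show "0 <= (Cn + Cf)*?T" using Cn Cf by simp
    show "0 <= ?p * sqrt (A s + A (s + h))" using A0[of s] A0[of "s + h"] by simp
   qed auto
   also have "... = ((Cn + Cf)*(?p*?p))*?T * sqrt (A s + A (s + h)) * sqrt (A t + A (t + h))*(nrm f*nrm g)" by (simp only: mult_ac)
   also have "?p*?p = 2 powr (r0*y)" by (simp add: powr_add[symmetric])
   finally show ?thesis by (simp only: C2_def)
  qed
  have sgn0: "0 <= sgn" unfolding sgn_def using Np b y pos by (intro divide_nonneg_nonneg mult_nonneg_nonneg add_nonneg_nonneg) auto
  have mu: "0 < r0*y/q0" using r0 y q0 by simp
  have Afin: "(NN t. ennreal (A t powr (1/(r0*y/q0)))) < \<infinity>"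
  proof -
   \<comment> \<open>With mu = r0 y/q0 the power 1/mu of A = U^y is U^(q0/r0), whose time integral
     the mixed norm controls.\<close>
   have p: "y*(1/(r0*y/q0)) = q0/r0" using y r0 q0 by simp
   have m: "(\<lambda>t. ennreal (ptrunc B0 r0 (u t) powr (q0/r0))) \<in> borelm"
    using ptrunc_measurable[OF solution_L2cont[OF sol, of 1], of r0 B0] r0 by simp
   have "(NN t. ennreal (A t powr (1/(r0*y/q0)))) = (NN t. ennreal (ptrunc B0 r0 (u (sg*t)) powr (q0/r0)))"
    unfolding A_def U_def powr_powr p ..
   also have "... = (NN t. ennreal (ptrunc B0 r0 (u t) powr (q0/r0)))"
    using sg nn_integral_lborel_affine[OF m, of sg 0] by auto
   also have "... < \<infinity>" by (rule mixed_norm_finite[OF fin q0]) (use r0 in simp)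
   finally show ?thesis .
  qed
  interpret scat sg b al E Y0 sg1 C1 "\<lambda>t. u (sg*t)" kap A "\<i> * of_real lam * of_real sg"
  proof (unfold_locales, goal_cases)
   case 1 show ?case using sg by auto
  next case 2 show ?case using b by simp
  next case 3 show ?case by (rule al0)
  next case 4 show ?case using lam sg by (auto simp: norm_mult)
  next case (5 t) show ?case by (rule uH)
  next case (6 t) show ?case by (rule E(2))
  next case 7 show ?case by (rule uc)
  next case (8 s phi) then show ?case using sol unfolding global_H2_solution_def by blast
  next case (9 phi tau1 tau2)
   show ?case using solution_duhamel[OF sol u0 sg 9] by blast
  next case 10 show ?case by (rule Am)
  next case (11 t) show ?case by (rule A0)
  next case 12 show ?case unfolding kap_def[abs_def] by measurable
  next case (13 t) show ?case using C2 by (simp add: kap_def)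
  next case (14 h eta tau s t n m f g)
   show ?case
   proof (cases "\<bar>tau\<bar> <= 1")
    case True
    have "Cn <= Cn + Cf" using Cf by simp
    from kbg[OF Cn(2) less_imp_le[OF Cn(1)] this 14(2-5), where h=h and s=s and n=n and t=t and m=m] show ?thesis using True by (simp add: kap_def sgn_def)
   next
    case False
    have "Cf <= Cn + Cf" using Cn by simp
    from kbg[OF Cf(2) less_imp_le[OF Cf(1)] this 14(2-5), where h=h and s=s and n=n and t=t and m=m] show ?thesis using False by (simp add: kap_def sgf_def)
   qed
  next case (15 eps)
   have "r0*y/q0 + sgn < 1" "1 < r0*y/q0 + sgf" using near far by (auto simp: sgn_def sgf_def)
   from time_tail[OF Am A0 C2 mu this sgn0 Afin 15] show ?case unfolding kap_def abs_idempotent .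
  next case (16 eta tau s t n m f g)
   have one: "(0::real) = 0 \<and> (1::real) = 1 \<or> levelU r0 1 ro" for ro :: "'a => real" by simp
   have "cmod (ip (fmul (sm eta tau) (cut b al (?r 0 s) n f))
       (cut b al (?r 0 t) m g))
    <= C1*\<bar>tau\<bar> powr (- N*?th1/4)*(1 powr (0/2)*1 powr (0/2))*(nrm f*nrm g)"
    by (rule C1(2)[unfolded Kb_def, rule_format, OF 16(1,2) tr tr one one 16(3,4)])
   then show ?case by (simp add: sg1_def)
  next case 17 show ?case by (rule sg1)
  next case 18 show ?case by (rule sg1)
  next case 19 show ?case using C1 by simp
  next case (20 h t) show ?case by (rule Y0[OF tr])
  qed
  show "\<exists>phi\<in>H2. ((\<lambda>t. h2 (\<lambda>x. u (sg*t) x - propagator (sg*t) phi x)) \<longlongrightarrow> 0) at_top" by (rule scatters)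
 qed
qed

theorem proposition1p4:
  fixes b \<alpha> :: real
  shows "\<exists>\<delta>>0. \<forall>\<theta> \<epsilon>. 0 < \<theta> \<and> \<theta> < \<delta> \<and> 0 < \<epsilon> \<and> \<epsilon> < \<delta> \<longrightarrow>
    (\<forall>lam::real. \<forall>u0 :: real ^ 'n \<Rightarrow> complex. \<forall>u :: real \<Rightarrow> real ^ 'n \<Rightarrow> complex. \<forall>\<eta>::real.
       lam \<in> {1, -1} \<longrightarrow>
       u0 \<in> H2 \<longrightarrow>
       global_H2_solution lam b \<alpha> u0 u \<longrightarrow>
       \<eta> > 0 \<longrightarrow>
       (SUP t. H2_norm (u t)) \<le> ennreal \<eta> \<longrightarrow>
       (CARD('n) \<ge> 3 \<and> 0 < b \<and> b < min (real CARD('n) / 2) 4 \<and>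
          (8 - 2 * b) / real CARD('n) < \<alpha> \<and>
          (if CARD('n) = 5 then \<alpha> < 7 - 2 * b else ereal \<alpha> < four_star CARD('n) b) \<and>
          B_norm (s_crit CARD('n) b \<alpha>) u < \<infinity>)
       \<or>
       (CARD('n) = 5 \<and> 0 < b \<and> b \<le> 3 / 2 \<and>
          (8 - 2 * b) / 5 < \<alpha> \<and> \<alpha> < 8 - 2 * b \<and>
          mixed_norm (ereal (a_star CARD('n) b \<alpha> \<theta> \<epsilon>)) (ereal (r_star CARD('n) b \<alpha> \<theta> \<epsilon>)) u < \<infinity>) \<longrightarrow>
       scatters_H2 u)"
proof -
 \<comment> \<open>In the second alternative this keeps 2 \<theta> (4 - b) + 2 \<epsilon> \<alpha>
   below \<alpha> (8 - 2 b - \<alpha>), which places the reciprocal of r* above 1/10, that of the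
   Sobolev endpoint for N = 5.\<close>
 define \<delta> where "\<delta> = (if 0 < \<alpha>*(8 - 2*b - \<alpha>) \<and> 0 < \<alpha> then min 1 (\<alpha>*(8 - 2*b - \<alpha>)/(8 + 2*\<alpha>)) else 1)"
 have \<delta>0: "0 < \<delta>" by (auto simp: \<delta>_def)
 define N where "N = real CARD('n)"
 have main: "scatters_H2 u"
  if \<theta>: "0 < \<theta>" "\<theta> < \<delta>" "0 < \<epsilon>" "\<epsilon> < \<delta>" and lam: "lam \<in> {1, -1}" and u0: "u0 \<in> H2" and sol: "global_H2_solution lam b \<alpha> u0 u"
   and \<eta>: "0 < \<eta>" "(SUP t. H2_norm (u t)) <= ennreal \<eta>"
   and cases: "(CARD('n) \<ge> 3 \<and> 0 < b \<and> b < min (real CARD('n)/2) 4 \<and>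
     (8 - 2*b)/real CARD('n) < \<alpha> \<and>
     (if CARD('n) = 5 then \<alpha> < 7 - 2*b else ereal \<alpha> < four_star CARD('n) b) \<and>
     B_norm (s_crit CARD('n) b \<alpha>) u < \<infinity>)
   \<or>
   (CARD('n) = 5 \<and> 0 < b \<and> b <= 3/2 \<and>
     (8 - 2*b)/5 < \<alpha> \<and> \<alpha> < 8 - 2*b \<and>
     mixed_norm (ereal (a_star CARD('n) b \<alpha> \<theta> \<epsilon>)) (ereal (r_star CARD('n) b \<alpha> \<theta> \<epsilon>)) u < \<infinity>)"
  for \<theta> \<epsilon> lam \<eta> :: real and u0 :: "real ^ 'n => complex" and u :: "real => real ^ 'n => complex"
 proof -
  have uH: "u t \<in> H2" for t using sol by (simp add: global_H2_solution_def)
  have uE: "h2 (u t) <= \<eta>" for t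
  proof -
   have "H2_norm (u t) <= ennreal \<eta>" by (rule order_trans[OF SUP_upper \<eta>(2)]) simp
   then show ?thesis using \<eta>(1) by (simp add: H2_norm_eq[OF uH])
  qed
  have D: "DIM(real ^ 'n) = CARD('n)" by simp
  note scat = mixed_norm_scatters[where 'a="real ^ 'n" and u=u, unfolded D, folded N_def, OF _ _ _ _ _ _ _ _ _ _ _ lam u0 sol \<eta>(1) uE]
  show ?thesis using cases
  proof (elim disjE conjE)
   assume N3: "3 <= CARD('n)" and b: "0 < b" "b < min (real CARD('n)/2) 4" and \<alpha>: "(8 - 2*b)/real CARD('n) < \<alpha>"
    and \<alpha>4': "if CARD('n) = 5 then \<alpha> < 7 - 2*b else ereal \<alpha> < four_star CARD('n) b" and fin: "B_norm (s_crit CARD('n) b \<alpha>) u < \<infinity>"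
   have Np: "0 < N" using N3 by (simp add: N_def)
   have b': "b < N/2" "b < 4" using b by (auto simp: N_def)
   have \<alpha>N: "(8 - 2*b)/N < \<alpha>" using \<alpha> by (simp add: N_def)
   have \<alpha>0: "0 < \<alpha>" using order.strict_trans[OF divide_pos_pos[of "8 - 2*b" N] \<alpha>N] b' Np by simp
   have \<alpha>4: "\<alpha> < (8 - 2*b)/(N - 4)" if N5: "5 <= CARD('n)"
    using \<alpha>4' N5 by (auto simp: four_star_def N_def split: if_splits)
   \<comment> \<open>\<open>?L\<close> is the reciprocal of the Sobolev endpoint, and 1/r0 is chosen
     between it and three upper bounds: (4 - b)/(N \<alpha>) is the reciprocal of the left end of
     the admissible range, (1 - b/N)/\<alpha> comes from the condition on \<alpha>/r0 + b/N, and 1/2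
     from r0 > 2.\<close>
   let ?L = "max 0 ((N - 4)/(2*N))"
   have L: "?L < (4 - b)/(N*\<alpha>)" "?L < (1 - b/N)/\<alpha>" "?L < 1/2"
   proof -
    have 1: "?L*(N*\<alpha>) < 4 - b"
    proof (cases "5 <= CARD('n)")
     case True
     then have p: "0 < N - 4" by (simp add: N_def)
     then have "?L = (N - 4)/(2*N)" using Np by simp
     then have "?L*(N*\<alpha>) = \<alpha>*(N - 4)/2" using Np by simp
     moreover have "\<alpha>*(N - 4) < 8 - 2*b" using \<alpha>4[OF True] p by (simp add: pos_less_divide_eq)
     ultimately show ?thesis by linarith
    next
     case False
     then have "N - 4 <= 0" by (simp add: N_def)
     then have "?L = 0" using Np by (simp add: divide_nonpos_pos)
     then show ?thesis using b' by simp
    qed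
    then show "?L < (4 - b)/(N*\<alpha>)" using Np \<alpha>0 by (simp only: pos_less_divide_eq mult_pos_pos)
    have "?L*\<alpha> < 1 - b/N"
    proof (cases "5 <= CARD('n)")
     case True
     then have "4 - b <= N - b" by (simp add: N_def)
     with 1 have "N*(?L*\<alpha>) < N - b" by (simp only: mult_ac)
     then have "N*(?L*\<alpha>) < N*(1 - b/N)" using Np by (simp add: right_diff_distrib)
     then show ?thesis using Np by (simp only: mult_less_cancel_left_pos)
    next
     case False
     then have "N - 4 <= 0" by (simp add: N_def)
     then have "?L = 0" using Np by (simp add: divide_nonpos_pos)
     then show ?thesis using b' b Np by (simp add: pos_divide_less_eq)
    qed
    then show "?L < (1 - b/N)/\<alpha>" using \<alpha>0 by (simp only: pos_less_divide_eq)
    have "(N - 4)/(2*N) < 1/2" using Np by (simp add: pos_divide_less_eq)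
    then show "?L < 1/2" unfolding max_less_iff_conj by (intro conjI) auto
   qed
   then have "?L < min ((4 - b)/(N*\<alpha>)) (min ((1 - b/N)/\<alpha>) (1/2))" by simp
   from dense[OF this] obtain x where x: "?L < x" "x < (4 - b)/(N*\<alpha>)" "x < (1 - b/N)/\<alpha>" "x < 1/2" by auto
   have x0: "0 < x" using x(1) by simp
   define r0 where "r0 = 1/x"
   \<comment> \<open>The value of 4/q0 for the admissible pair with this r0; it is positive because
     r0 lies strictly above the left end of the range, so q0 is finite.\<close>
   define k where "k = (4 - b)/\<alpha> - N/r0"
   have k: "0 < k"
   proof -
    have "x*(N*\<alpha>) < 4 - b" using x(2) Np \<alpha>0 by (simp add: pos_less_divide_eq)
    then have "N*x < (4 - b)/\<alpha>" using \<alpha>0 by (simp add: pos_less_divide_eq mult_ac)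
    then show ?thesis by (simp add: k_def r0_def)
   qed
   define q0 where "q0 = 4/k"
   have q0: "0 < q0" "4/q0 = k" using k by (auto simp: q0_def)
   have r2: "2 < r0" using x(4) x0 by (simp add: r0_def field_simps)
   have sc: "s_crit CARD('n) b \<alpha> = N/2 - (4 - b)/\<alpha>" by (simp add: s_crit_def N_def)
   have "(ereal q0, r0) \<in> biharmonic_admissible DIM(real ^ 'n) (s_crit CARD('n) b \<alpha>)"
   proof -
    have "4/ereal q0 = ereal (4/q0)" using q0(1) by simp
    moreover have "4/q0 = N/2 - N/r0 - (N/2 - (4 - b)/\<alpha>)" using q0(2) by (simp add: k_def)
    moreover have "2*N/(N - 2*(N/2 - (4 - b)/\<alpha>)) <= r0"
    proof -
     have "2*N/(N - 2*(N/2 - (4 - b)/\<alpha>)) = 2*N/(2*((4 - b)/\<alpha>))" by simp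
     also have "... = N*\<alpha>/(4 - b)" by (simp only: mult_divide_mult_cancel_left_if) simp
     also have "... <= 1/x"
     proof -
      have "x*(N*\<alpha>) <= 4 - b" using x(2) Np \<alpha>0 by (simp add: pos_less_divide_eq)
      then show ?thesis using x0 b' by (simp add: field_simps)
     qed
     finally show ?thesis by (simp add: r0_def)
    qed
    moreover have "r0 < 2*N/(N - 4)" if "5 <= CARD('n)"
    proof -
     have p: "0 < N - 4" using that by (simp add: N_def)
     have "(N - 4)/(2*N) < x" using x(1) by simp
     then have "N - 4 < x*(2*N)" using Np by (simp add: pos_divide_less_eq)
     then have "r0*(N - 4) < 2*N" using x0 by (simp add: r0_def field_simps)
     then show ?thesis using p by (simp add: pos_less_divide_eq)
    qed
    ultimately show ?thesis unfolding sc biharmonic_admissible_def D N_def[symmetric] using q0(1) r2 by auto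
   qed
   then have "mixed_norm (ereal q0) (ereal r0) u <= B_norm (s_crit CARD('n) b \<alpha>) u"
    unfolding B_norm_def using SUP_upper[of "(ereal q0, r0)" _ "\<lambda>(q, r). mixed_norm q (ereal r) u"] by simp
   then have fin': "mixed_norm (ereal q0) (ereal r0) u < \<infinity>" using fin by (rule le_less_trans)
   have "\<alpha>/r0 + b/N < 1"
   proof -
    have "x*\<alpha> < 1 - b/N" using x(3) \<alpha>0 by (simp add: pos_less_divide_eq)
    then show ?thesis by (simp add: r0_def mult.commute)
   qed
   moreover have "4/q0 + N/r0 = (4 - b)/\<alpha>" unfolding q0(2) by (simp add: k_def)
   moreover have "?L < 1/r0" using x(1) by (simp add: r0_def)
   ultimately show ?thesis by (intro scat[where ?r0.0=r0 and ?q0.0=q0] N3 b b' \<alpha>N \<alpha>4 r2 q0(1) fin')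
  next
   assume N5: "CARD('n) = 5" and b: "0 < b" "b <= 3/2" and \<alpha>: "(8 - 2*b)/5 < \<alpha>" "\<alpha> < 8 - 2*b"
    and fin: "mixed_norm (ereal (a_star CARD('n) b \<alpha> \<theta> \<epsilon>)) (ereal (r_star CARD('n) b \<alpha> \<theta> \<epsilon>)) u < \<infinity>"
   have N: "N = 5" using N5 by (simp add: N_def)
   have \<alpha>0: "0 < \<alpha>" using \<alpha>(1) b by (simp add: pos_divide_less_eq)
   define P where "P = \<alpha> + 1 - \<theta>"
   define a where "a = 8 - 2*b - \<alpha> + 2*\<epsilon>*\<alpha>"
   define e where "e = \<alpha>*(9 - 2*b) - 2*\<theta>*(4 - b) - 2*\<epsilon>*\<alpha>"
   have p: "0 < \<alpha>*(8 - 2*b - \<alpha>)" using \<alpha>0 \<alpha>(2) by simp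
   have \<delta>1: "\<delta> <= 1" "\<delta> <= \<alpha>*(8 - 2*b - \<alpha>)/(8 + 2*\<alpha>)" using p \<alpha>0 by (auto simp: \<delta>_def)
   have P: "0 < P" using \<theta>(2) \<delta>1(1) \<alpha>0 by (simp add: P_def)
   have a: "0 < a" using \<alpha>(2) \<theta>(3) \<alpha>0 by (simp add: a_def add_pos_pos)
   have small: "2*\<theta>*(4 - b) + 2*\<epsilon>*\<alpha> < \<alpha>*(8 - 2*b - \<alpha>)"
   proof -
    have "2*\<theta>*(4 - b) <= 2*\<theta>*4" using b \<theta>(1) by (intro mult_left_mono) auto
    also have "... <= 8*\<delta>" using \<theta>(2) by simp
    finally have 1: "2*\<theta>*(4 - b) <= 8*\<delta>" .
    have "2*\<epsilon>*\<alpha> < 2*\<delta>*\<alpha>" using \<theta>(4) \<alpha>0 by simp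
    moreover have "8*\<delta> + 2*\<delta>*\<alpha> <= \<alpha>*(8 - 2*b - \<alpha>)" using \<delta>1(2) \<alpha>0 by (simp add: pos_le_divide_eq algebra_simps)
    ultimately show ?thesis using 1 by linarith
   qed
   have e1: "\<alpha>*(\<alpha> + 1) < e" using small by (simp add: e_def algebra_simps)
   have e0: "0 < e" using e1 mult_pos_pos[of \<alpha> "\<alpha> + 1"] \<alpha>0 by linarith
   define q0 where "q0 = 8*\<alpha>*P/a"
   define r0 where "r0 = 10*\<alpha>*P/e"
   have aq: "a_star CARD('n) b \<alpha> \<theta> \<epsilon> = q0" by (simp add: a_star_def q0_def P_def a_def N5)
   have rr: "r_star CARD('n) b \<alpha> \<theta> \<epsilon> = r0" by (simp add: r_star_def r0_def P_def e_def N5)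
   have q0: "0 < q0" using \<alpha>0 P a by (simp add: q0_def)
   have r0: "0 < r0" using \<alpha>0 P e0 by (simp add: r0_def)
   have iq: "4/q0 = a/(2*\<alpha>*P)" using \<alpha>0 P a by (simp add: q0_def)
   have ir: "1/r0 = e/(10*\<alpha>*P)" by (simp add: r0_def)
   have scal: "4/q0 + N/r0 = (4 - b)/\<alpha>"
   proof -
    have "N/r0 = e/(2*\<alpha>*P)" using ir by (simp add: N r0_def)
    then have "4/q0 + N/r0 = (a + e)/(2*\<alpha>*P)" unfolding iq by (simp add: add_divide_distrib)
    also have "a + e = (8 - 2*b)*P" by (simp add: a_def e_def P_def algebra_simps)
    also have "(8 - 2*b)*P/(2*\<alpha>*P) = (8 - 2*b)/(2*\<alpha>)" using P by simp
    also have "... = (4 - b)/\<alpha>" using \<alpha>0 by (simp add: field_simps)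
    finally show ?thesis .
   qed
   \<comment> \<open>r* lies below the Sobolev endpoint 2N/(N - 4) = 10; this is the place where the
     smallness of \<theta> and \<epsilon> enters.\<close>
   have x1: "1/10 < 1/r0"
   proof -
    have "\<alpha>*P <= \<alpha>*(\<alpha> + 1)" using \<alpha>0 \<theta>(1) by (intro mult_left_mono) (auto simp: P_def)
    then have "\<alpha>*P < e" using e1 by linarith
    then show ?thesis unfolding ir using \<alpha>0 P by (simp add: pos_less_divide_eq)
   qed
   have x2: "5/r0 < (4 - b)/\<alpha>" using scal q0 divide_pos_pos[of 4 q0] unfolding N by linarith
   have r2: "2 < r0"
   proof -
    have "(4 - b)/\<alpha> < 5/2" using \<alpha>(1) \<alpha>0 by (simp add: pos_divide_less_eq field_simps)
    then have "5/r0 < 5/2" using x2 by linarith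
    then show ?thesis using r0 by (simp add: field_simps)
   qed
   have \<theta>0: "\<alpha>/r0 + b/N < 1"
   proof -
    have "\<alpha>*(5/r0) < 4 - b" using x2 \<alpha>0 by (simp add: pos_less_divide_eq mult.commute)
    moreover have "\<alpha>*(5/r0) = 5*(\<alpha>/r0)" by simp
    ultimately show ?thesis unfolding N by linarith
   qed
   have L: "max 0 ((N - 4)/(2*N)) < 1/r0" using x1 r0 by (simp add: N)
   show ?thesis
    by (rule scat[where ?r0.0=r0 and ?q0.0=q0]) (use N5 b \<alpha> L q0 r2 scal \<theta>0 fin[unfolded aq rr] in "simp_all add: N")
  qed
 qed
 show ?thesis by (rule exI[of _ \<delta>], intro conjI \<delta>0 allI impI, rule main) auto
qed

end
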